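(* Let $V,g,U,H,\alpha,T,L$, the eigenvalues $\mu_1\le\dots\le\mu_n$ of $g^{-1}H$, and the Dolbeault Laplacian $\Box$ be as described in the context. Assume that $\mu_1,\dots,\mu_n$ are linearly independent over $\mathbf{Q}$ (in particular none of them vanishes), and let $p\in\{0,\dots,n\}$ be the number of strictly negative $\mu_i$. Then the spectrum of $\Box$ (on the forms of type $(0,k)$, $0\le k\le n$, with values in $L$) is $$\mathrm{Spec}\,\Box=\left\{2\pi\sum_{i=1}^n n_i|\mu_i| \;:\; n_i\in\mathbf{N}\text{ for all } i\right\},$$ and, for $\lambda=2\pi\sum_{i=1}^n n_i|\mu_i|$ with $n_i\in\mathbf{N}$, the eigenspace $E_\lambda^k$ of $\Box$ for the eigenvalue $\lambda$ on forms of type $(0,k)$ has dimension $$\dim E_\lambda^k=|\chi(L)|\,\binom{\#\{i : n_i\neq0\}}{k-\#\{i\le p : n_i=0\}},$$ where the binomial coefficient $\binom{a}{b}$ is taken to be zero if $b<0$ or $b>a$.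
   Context: $\mathbf{N}=\{0,1,2,\dots\}$. $V$ is a complex vector space of complex dimension $n$ with a positive definite hermitian form $g$, $U\subset V$ is a lattice (discrete subgroup of rank $2n$), and $H$ is a hermitian form on $V$ such that $E=\operatorname{Im}H$ takes integer values on $U\times U$. Hermitian forms are $\mathbf{C}$-linear in the first variable and antilinear in the second. $\alpha:U\to\mathbf{U}(1)$ satisfies $\alpha(u_1+u_2)=\alpha(u_1)\alpha(u_2)\exp(i\pi E(u_1,u_2))$. $T=V/U$ is the complex torus with the translation-invariant Kähler metric induced by $g$ (underlying Riemannian metric $\operatorname{Re}g$), and $L=L(H,\alpha)$ is the holomorphic line bundle on $T$ obtained as the quotient of $\mathbf{C}\times V$ by the action of $U$ $$\Phi_u(\lambda,z)=\left(\lambda\,\alpha(u)\exp\left[\pi H(z,u)+\tfrac{\pi}{2}H(u,u)\right],\,z+u\right),$$ with hermitian metric given over $z$ by $h(\lambda_1,\lambda_2)=\lambda_1\overline{\lambda_2}\exp[-\pi H(z,z)]$. The endomorphism $g^{-1}H$ of $V$ is defined by $H(z_1,z_2)=g([g^{-1}H]z_1,z_2)$; it is $g$-self-adjoint, and $\mu_1\le\dots\le\mu_n$ are its (real) eigenvalues listed with multiplicity, diagonalized in a $g$-orthonormal basis $(e_i)$ with corresponding complex coordinates $(z_i)$. $\Box=\overline\partial_L\overline\partial_L^*+\overline\partial_L^*\overline\partial_L$ is the Dolbeault Laplacian acting on smooth forms of type $(0,k)$ with values in $L$, where $\overline\partial_L^*$ is the formal adjoint of $\overline\partial_L$ for the $L^2$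 products defined by $g$ and $h$. The normalization is such that $\Box$ is half the nonnegative Riemannian Laplacian when $H=0$ (so $d\overline z_i$ has squared norm $2$). Explicitly, in the trivialization over $V$ above, $$\Box=-2\sum_{i}\frac{\partial^2}{\partial z_i\partial\overline z_i}+2\pi\sum_i\mu_i\overline z_i\frac{\partial}{\partial\overline z_i}+2\pi\sum_i\mu_i\,d\overline z_i\wedge\iota_{\partial/\partial\overline z_i},$$ where the first two terms act on the coefficients of forms in the basis of products of the $d\overline z_i$. $\chi(L)=\sum_{k=0}^n(-1)^k\dim H^k(T,L)$ is the Euler characteristic of $L$. *)

theory Defs
  imports "HOL-Analysis.Analysis" "HOL-Library.Function_Algebras"
begin

section \<open>Finite-dimensional complex vector spaces\<close>

text \<open>The inner product that comes with \<^class>\<open>euclidean_space\<close> is an arbitrary auxiliary one: it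
  is not required to be related to multiplication by \<open>\<i>\<close>, and it only serves to give
  access to the (canonical) topology and, up to a constant factor, the Lebesgue measure.\<close>

class complex_euclidean_space = euclidean_space +
  fixes scaleC :: "complex \<Rightarrow> 'a \<Rightarrow> 'a"  (infixr "*\<^sub>C" 75)
  assumes scaleC_add_right: "a *\<^sub>C (x + y) = a *\<^sub>C x + a *\<^sub>C y"
    and scaleC_add_left: "(a + b) *\<^sub>C x = a *\<^sub>C x + b *\<^sub>C x"
    and scaleC_scaleC: "a *\<^sub>C (b *\<^sub>C x) = (a * b) *\<^sub>C x"
    and scaleC_of_real: "complex_of_real r *\<^sub>C x = r *\<^sub>R x"

global_interpretation complex_space:
  vector_space "scaleC :: complex \<Rightarrow> 'a \<Rightarrow> 'a::complex_euclidean_space"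
  using scaleC_of_real[of 1] by unfold_locales (simp_all add: scaleC_add_right scaleC_add_left scaleC_scaleC)

instantiation complex :: complex_euclidean_space
begin
definition scaleC_complex :: "complex \<Rightarrow> complex \<Rightarrow> complex" where "scaleC_complex a x = a * x"
instance by standard (simp_all add: scaleC_complex_def algebra_simps scaleR_conv_of_real)
end

instantiation vec :: (complex_euclidean_space, finite) complex_euclidean_space
begin
definition scaleC_vec :: "complex \<Rightarrow> 'a ^ 'b \<Rightarrow> 'a ^ 'b" where "scaleC_vec a x = (\<chi> i. a *\<^sub>C (x $ i))"
instance
  by standard
    (simp_all add: scaleC_vec_def vec_eq_iff scaleC_add_right scaleC_add_left scaleC_scaleC scaleC_of_real)
end


section \<open>The data: hermitian forms, lattices, semicharacters\<close>

text \<open>The first two clauses and symmetry give antilinearity in the second variable.\<close>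

definition hermitian_form :: "('v::complex_euclidean_space \<Rightarrow> 'v \<Rightarrow> complex) \<Rightarrow> bool" where
  "hermitian_form H \<longleftrightarrow>
     (\<forall>x y z. H (x + y) z = H x z + H y z) \<and>
     (\<forall>c x z. H (c *\<^sub>C x) z = c * H x z) \<and>
     (\<forall>x y. H y x = cnj (H x y))"

definition positive_definite :: "('v::complex_euclidean_space \<Rightarrow> 'v \<Rightarrow> complex) \<Rightarrow> bool" where
  "positive_definite g \<longleftrightarrow> (\<forall>z. z \<noteq> 0 \<longrightarrow> Re (g z z) > 0)"

abbreviation int_scale :: "int \<Rightarrow> 'v::real_vector \<Rightarrow> 'v" where
  "int_scale k x \<equiv> of_int k *\<^sub>R x"

text \<open>A discrete subgroup which is free of rank \<open>2 n\<close>.\<close>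

definition is_lattice :: "nat \<Rightarrow> 'v::complex_euclidean_space set \<Rightarrow> bool" where
  "is_lattice n U \<longleftrightarrow> discrete U \<and>
     (\<exists>B. finite B \<and> card B = 2 * n \<and> module.independent int_scale B \<and> module.span int_scale B = U)"

definition semicharacter ::
  "'v::complex_euclidean_space set \<Rightarrow> ('v \<Rightarrow> 'v \<Rightarrow> complex) \<Rightarrow> ('v \<Rightarrow> complex) \<Rightarrow> bool" where
  "semicharacter U H \<alpha> \<longleftrightarrow>
     (\<forall>u\<in>U. norm (\<alpha> u) = 1) \<and>
     (\<forall>u\<in>U. \<forall>v\<in>U. \<alpha> (u + v) = \<alpha> u * \<alpha> v * exp (\<i> * of_real pi * of_real (Im (H u v))))"

text \<open>The endomorphism \<open>g\<^sup>-\<^sup>1 H\<close>.\<close>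

definition g_inv_H ::
  "('v::complex_euclidean_space \<Rightarrow> 'v \<Rightarrow> complex) \<Rightarrow> ('v \<Rightarrow> 'v \<Rightarrow> complex) \<Rightarrow> 'v \<Rightarrow> 'v" where
  "g_inv_H g H z1 = (THE w. \<forall>z2. H z1 z2 = g w z2)"

definition orthonormal_system ::
  "('v::complex_euclidean_space \<Rightarrow> 'v \<Rightarrow> complex) \<Rightarrow> nat \<Rightarrow> (nat \<Rightarrow> 'v) \<Rightarrow> bool" where
  "orthonormal_system g n e \<longleftrightarrow> (\<forall>i\<in>{1..n}. \<forall>j\<in>{1..n}. g (e i) (e j) = (if i = j then 1 else 0))"


section \<open>Smooth functions and differential forms\<close>

primrec times_differentiable :: "nat \<Rightarrow> ('v::real_normed_vector \<Rightarrow> complex) \<Rightarrow> bool" where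
  "times_differentiable 0 f \<longleftrightarrow> continuous_on UNIV f"
| "times_differentiable (Suc m) f \<longleftrightarrow>
     (\<forall>x. f differentiable (at x)) \<and>
     (\<forall>v. times_differentiable m (\<lambda>x. frechet_derivative f (at x) v))"

definition smooth_function :: "('v::real_normed_vector \<Rightarrow> complex) \<Rightarrow> bool" where
  "smooth_function f \<longleftrightarrow> (\<forall>m. times_differentiable m f)"

text \<open>A differential form of type \<open>(0,*)\<close> with values in \<open>L\<close> is represented on \<open>V\<close>, in the
  trivialization of the pull-back of \<open>L\<close>, as \<open>\<Sum>\<^sub>J \<psi>\<^sub>J dzbar\<^sub>J\<close>, where \<open>J\<close> runs over the subsets of
  \<open>{1..n}\<close> and \<open>dzbar\<^sub>J = dzbar\<^sub>j\<^sub>1 \<and> \<dots> \<and> dzbar\<^sub>j\<^sub>k\<close> for \<open>J = {j\<^sub>1 < \<dots> < j\<^sub>k}\<close>;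
  the value \<open>\<psi> z J\<close> is the coefficient \<open>\<psi>\<^sub>J(z)\<close> (zero for all other \<open>J\<close>). As the forms \<open>dzbar\<^sub>J\<close> are
  translation invariant, invariance under the action of \<open>U\<close> on \<open>\<complex> \<times> V\<close> is the
  quasi-periodicity of every coefficient.\<close>

type_synonym 'v form = "'v \<Rightarrow> nat set \<Rightarrow> complex"

definition automorphy_factor ::
  "('v \<Rightarrow> 'v \<Rightarrow> complex) \<Rightarrow> ('v \<Rightarrow> complex) \<Rightarrow> 'v \<Rightarrow> 'v \<Rightarrow> complex" where
  "automorphy_factor H \<alpha> u z = \<alpha> u * exp (of_real pi * H z u + of_real pi / 2 * H u u)"

definition L_forms ::
  "nat \<Rightarrow> 'v::complex_euclidean_space set \<Rightarrow> ('v \<Rightarrow> 'v \<Rightarrow> complex) \<Rightarrow> ('v \<Rightarrow> complex) \<Rightarrow> 'v form set" where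
  "L_forms n U H \<alpha> = {\<psi>.
     (\<forall>J. smooth_function (\<lambda>z. \<psi> z J)) \<and>
     (\<forall>z J. \<not> J \<subseteq> {1..n} \<longrightarrow> \<psi> z J = 0) \<and>
     (\<forall>u\<in>U. \<forall>z J. \<psi> (z + u) J = automorphy_factor H \<alpha> u z * \<psi> z J)}"

definition L_forms_deg ::
  "nat \<Rightarrow> 'v::complex_euclidean_space set \<Rightarrow> ('v \<Rightarrow> 'v \<Rightarrow> complex) \<Rightarrow> ('v \<Rightarrow> complex) \<Rightarrow> nat \<Rightarrow> 'v form set" where
  "L_forms_deg n U H \<alpha> k = {\<psi> \<in> L_forms n U H \<alpha>. \<forall>z J. card J \<noteq> k \<longrightarrow> \<psi> z J = 0}"

definition form_scale :: "complex \<Rightarrow> 'v form \<Rightarrow> 'v form" where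
  "form_scale c \<psi> = (\<lambda>z J. c * \<psi> z J)"

global_interpretation form: vector_space "form_scale :: complex \<Rightarrow> 'v form \<Rightarrow> 'v form"
  by unfold_locales (simp_all add: form_scale_def fun_eq_iff algebra_simps)


section \<open>The Dolbeault operator, its formal adjoint and the Laplacian\<close>

text \<open>With \<open>z = x + \<i> y\<close> along \<open>e\<close>, the operator \<open>\<partial>/\<partial>zbar\<close> is \<open>(\<partial>/\<partial>x + \<i> \<partial>/\<partial>y) / 2\<close>.\<close>

definition deriv_zbar :: "'v::complex_euclidean_space \<Rightarrow> ('v \<Rightarrow> complex) \<Rightarrow> 'v \<Rightarrow> complex" where
  "deriv_zbar e f z =
     (frechet_derivative f (at z) e + \<i> * frechet_derivative f (at z) (\<i> *\<^sub>C e)) / 2"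

text \<open>This is \<open>\<Sum>\<^sub>i dzbar\<^sub>i \<and> \<partial>/\<partial>zbar\<^sub>i\<close>; the sign comes from moving \<open>dzbar\<^sub>i\<close> to its place. The trivialization
  of \<open>L\<close> over \<open>V\<close> is holomorphic, so there is no zeroth order term.\<close>

definition dbar :: "nat \<Rightarrow> (nat \<Rightarrow> 'v::complex_euclidean_space) \<Rightarrow> 'v form \<Rightarrow> 'v form" where
  "dbar n e \<psi> = (\<lambda>z J.
     if J \<subseteq> {1..n}
     then \<Sum>i\<in>J. (-1) ^ card {j\<in>J. j < i} * deriv_zbar (e i) (\<lambda>w. \<psi> w (J - {i})) z
     else 0)"

text \<open>The pointwise product uses \<open>h(\<lambda>\<^sub>1,\<lambda>\<^sub>2) = \<lambda>\<^sub>1 cnj \<lambda>\<^sub>2 exp(-\<pi> H(z,z))\<close>, and the \<open>dzbar\<^sub>i\<close> are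
  orthogonal of squared norm \<open>2\<close>.\<close>

definition form_inner ::
  "nat \<Rightarrow> ('v \<Rightarrow> 'v \<Rightarrow> complex) \<Rightarrow> 'v form \<Rightarrow> 'v form \<Rightarrow> 'v \<Rightarrow> complex" where
  "form_inner n H \<phi> \<psi> z =
     (\<Sum>J\<in>Pow {1..n}. 2 ^ card J * \<phi> z J * cnj (\<psi> z J)) * exp (- of_real pi * H z z)"

definition fundamental_domain :: "'v::euclidean_space set \<Rightarrow> 'v set \<Rightarrow> bool" where
  "fundamental_domain U F \<longleftrightarrow> F \<in> sets borel \<and> bounded F \<and> (\<forall>z. \<exists>!u. u \<in> U \<and> z - u \<in> F)"

text \<open>A unit cube for the Riemannian metric \<open>Re g\<close>, when \<open>e\<close> is \<open>g\<close>-orthonormal; it normalizes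
  the Lebesgue measure to the Riemannian volume.\<close>

definition unit_cube :: "nat \<Rightarrow> (nat \<Rightarrow> 'v::complex_euclidean_space) \<Rightarrow> 'v set" where
  "unit_cube n e = {(\<Sum>i=1..n. Complex (s i) (t i) *\<^sub>C e i) | s t.
     \<forall>i\<in>{1..n}. 0 \<le> s i \<and> s i \<le> 1 \<and> 0 \<le> t i \<and> t i \<le> 1}"

text \<open>For periodic \<open>f\<close> this is the integral over \<open>V/U\<close>; it does not depend on the fundamental domain.\<close>

definition torus_integral ::
  "nat \<Rightarrow> (nat \<Rightarrow> 'v::complex_euclidean_space) \<Rightarrow> 'v set \<Rightarrow> ('v \<Rightarrow> complex) \<Rightarrow> complex" where
  "torus_integral n e U f =
     (let F = (SOME F. fundamental_domain U F)
      in set_lebesgue_integral lborel F f / of_real (measure lborel (unit_cube n e)))"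

definition L2_product ::
  "nat \<Rightarrow> (nat \<Rightarrow> 'v::complex_euclidean_space) \<Rightarrow> 'v set \<Rightarrow> ('v \<Rightarrow> 'v \<Rightarrow> complex) \<Rightarrow> 'v form \<Rightarrow> 'v form \<Rightarrow> complex" where
  "L2_product n e U H \<phi> \<psi> = torus_integral n e U (form_inner n H \<phi> \<psi>)"

definition dbar_adjoint ::
  "nat \<Rightarrow> (nat \<Rightarrow> 'v::complex_euclidean_space) \<Rightarrow> 'v set \<Rightarrow> ('v \<Rightarrow> 'v \<Rightarrow> complex) \<Rightarrow> ('v \<Rightarrow> complex) \<Rightarrow>
    'v form \<Rightarrow> 'v form" where
  "dbar_adjoint n e U H \<alpha> \<psi> =
     (THE \<eta>. \<eta> \<in> L_forms n U H \<alpha> \<and>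
        (\<forall>\<phi>\<in>L_forms n U H \<alpha>. L2_product n e U H (dbar n e \<phi>) \<psi> = L2_product n e U H \<phi> \<eta>))"

definition dolbeault_laplacian ::
  "nat \<Rightarrow> (nat \<Rightarrow> 'v::complex_euclidean_space) \<Rightarrow> 'v set \<Rightarrow> ('v \<Rightarrow> 'v \<Rightarrow> complex) \<Rightarrow> ('v \<Rightarrow> complex) \<Rightarrow>
    'v form \<Rightarrow> 'v form" where
  "dolbeault_laplacian n e U H \<alpha> \<psi> =
     dbar n e (dbar_adjoint n e U H \<alpha> \<psi>) + dbar_adjoint n e U H \<alpha> (dbar n e \<psi>)"

text \<open>The spectrum of the Laplacian as an endomorphism of the space of all smooth forms
  of type \<open>(0,k)\<close>, \<open>0 \<le> k \<le> n\<close>. As the Laplacian is elliptic on a compact manifold, this is the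
  same as the \<open>L\<^sup>2\<close> spectrum.\<close>

definition laplacian_spectrum ::
  "nat \<Rightarrow> (nat \<Rightarrow> 'v::complex_euclidean_space) \<Rightarrow> 'v set \<Rightarrow> ('v \<Rightarrow> 'v \<Rightarrow> complex) \<Rightarrow> ('v \<Rightarrow> complex) \<Rightarrow>
    complex set" where
  "laplacian_spectrum n e U H \<alpha> =
     {ev. \<not> bij_betw (\<lambda>\<psi>. dolbeault_laplacian n e U H \<alpha> \<psi> - form_scale ev \<psi>)
            (L_forms n U H \<alpha>) (L_forms n U H \<alpha>)}"

definition laplacian_eigenspace ::
  "nat \<Rightarrow> (nat \<Rightarrow> 'v::complex_euclidean_space) \<Rightarrow> 'v set \<Rightarrow> ('v \<Rightarrow> 'v \<Rightarrow> complex) \<Rightarrow> ('v \<Rightarrow> complex) \<Rightarrow>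
    complex \<Rightarrow> nat \<Rightarrow> 'v form set" where
  "laplacian_eigenspace n e U H \<alpha> ev k =
     {\<psi> \<in> L_forms_deg n U H \<alpha> k. dolbeault_laplacian n e U H \<alpha> \<psi> = form_scale ev \<psi>}"

text \<open>Unlike \<open>form.dim S = d\<close>, this includes that \<open>S\<close> is a finite-dimensional subspace.\<close>

definition has_dimension :: "'v form set \<Rightarrow> nat \<Rightarrow> bool" where
  "has_dimension S d \<longleftrightarrow> (\<exists>B. finite B \<and> card B = d \<and> form.independent B \<and> form.span B = S)"


section \<open>Cohomology and Euler characteristic\<close>

text \<open>The cohomology \<open>H\<^sup>k(T,L)\<close> is Dolbeault cohomology.\<close>

definition dbar_cocycles ::
  "nat \<Rightarrow> (nat \<Rightarrow> 'v::complex_euclidean_space) \<Rightarrow> 'v set \<Rightarrow> ('v \<Rightarrow> 'v \<Rightarrow> complex) \<Rightarrow> ('v \<Rightarrow> complex) \<Rightarrow>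
    nat \<Rightarrow> 'v form set" where
  "dbar_cocycles n e U H \<alpha> k = {\<psi> \<in> L_forms_deg n U H \<alpha> k. dbar n e \<psi> = 0}"

definition dbar_coboundaries ::
  "nat \<Rightarrow> (nat \<Rightarrow> 'v::complex_euclidean_space) \<Rightarrow> 'v set \<Rightarrow> ('v \<Rightarrow> 'v \<Rightarrow> complex) \<Rightarrow> ('v \<Rightarrow> complex) \<Rightarrow>
    nat \<Rightarrow> 'v form set" where
  "dbar_coboundaries n e U H \<alpha> k =
     (if k = 0 then {0} else dbar n e ` L_forms_deg n U H \<alpha> (k - 1))"

text \<open>The classes of the elements of \<open>B\<close> form a basis of \<open>W / W'\<close>.\<close>

definition quotient_basis :: "'v form set \<Rightarrow> 'v form set \<Rightarrow> 'v form set \<Rightarrow> bool" where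
  "quotient_basis W W' B \<longleftrightarrow> B \<subseteq> W \<and>
     (\<forall>w\<in>W. \<exists>!c. (\<forall>b. b \<notin> B \<longrightarrow> c b = 0) \<and> w - (\<Sum>b\<in>B. form_scale (c b) b) \<in> W')"

definition cohomology_dim ::
  "nat \<Rightarrow> (nat \<Rightarrow> 'v::complex_euclidean_space) \<Rightarrow> 'v set \<Rightarrow> ('v \<Rightarrow> 'v \<Rightarrow> complex) \<Rightarrow> ('v \<Rightarrow> complex) \<Rightarrow>
    nat \<Rightarrow> nat" where
  "cohomology_dim n e U H \<alpha> k =
     (THE d. \<exists>B. finite B \<and> card B = d \<and>
        quotient_basis (dbar_cocycles n e U H \<alpha> k) (dbar_coboundaries n e U H \<alpha> k) B)"

definition euler_characteristic ::
  "nat \<Rightarrow> (nat \<Rightarrow> 'v::complex_euclidean_space) \<Rightarrow> 'v set \<Rightarrow> ('v \<Rightarrow> 'v \<Rightarrow> complex) \<Rightarrow> ('v \<Rightarrow> complex) \<Rightarrow>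
    int" where
  "euler_characteristic n e U H \<alpha> = (\<Sum>k\<le>n. (-1) ^ k * int (cohomology_dim n e U H \<alpha> k))"

end

theory Submission
  imports Defs "HOL-Complex_Analysis.Cauchy_Integral_Formula"
begin

text \<open>Multiplication by \<open>exp (- \<pi> H(z,z) / 2)\<close> turns sections of \<open>L\<close> into functions with unitary multipliers, and
  the operators \<open>\<partial>/\<partial>zbar\<^sub>i\<close> and their adjoints into annihilation and creation operators \<open>b\<^sub>i\<close>, \<open>b\<^sub>i\<^sup>*\<close> with
  \<open>[b\<^sub>i, b\<^sub>j\<^sup>*] = \<delta>\<^sub>i\<^sub>j \<pi> |\<mu>\<^sub>i|\<close>, the two roles being exchanged when \<open>\<mu>\<^sub>i < 0\<close>. On the coefficient of \<open>dzbar\<^sub>J\<close>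
  the Laplacian is twice \<open>\<Sum>\<^sub>i b\<^sub>i\<^sup>* b\<^sub>i\<close> plus a constant depending on \<open>J\<close>. The resolvent of \<open>\<Sum>\<^sub>i b\<^sub>i\<^sup>* b\<^sub>i\<close> on the
  negative half plane comes from Mehler's explicit heat kernel, so no elliptic regularity is needed; the commutation
  relations extend the resolvent to the complement of \<open>{\<Sum>\<^sub>i m\<^sub>i \<pi> |\<mu>\<^sub>i|}\<close> and identify each eigenspace with the
  space of ground states \<open>\<Inter>\<^sub>i ker b\<^sub>i\<close>, whose finite positive dimension \<open>d\<close> never has to be computed. Rational
  independence makes the \<open>m\<^sub>i\<close> unique, and the same description for the eigenvalue \<open>0\<close>, by Hodge theory, gives
  cohomology of dimension \<open>d\<close> in degree \<open>p\<close> only, so \<open>d = |\<chi>(L)|\<close>.\<close>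

section \<open>Smooth functions and directional derivatives\<close>

text \<open>All forms stay smooth and no Hilbert space is completed, so neither compactness nor a
  spectral theorem supplies eigenvalues; the point is to solve \<open>(A - c) u = f\<close> inside
  the smooth quasi-periodic functions. Averages of magnetic translates serve as integral operators:
  such translations respect the multipliers of the lattice, and derivatives of an average can be
  moved to the kernel, which smooths, or to the function, which reaches \<open>t = 0\<close>.
  Neither theta functions nor Riemann-Roch enter. Finiteness of the space of ground states is
  Cauchy's estimate plus a fine net of points. Its positivity is by contradiction: without ground
  states the large time limit of the heat kernel annihilates every smooth quasi-periodic function, a
  power series passes this on to narrower and narrower Gaussians, and no smooth quasi-periodic
  function except zero is left; but smoothing a discontinuous one yields a nonzero example. The
  factor \<open>2\<close> in the Laplacian is the squared norm of \<open>dzbar\<close>.\<close>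

definition dird :: "'v::real_normed_vector \<Rightarrow> ('v \<Rightarrow> complex) \<Rightarrow> 'v \<Rightarrow> complex" where
  "dird v f z = frechet_derivative f (at z) v"

lemma times_differentiable_Suc_dird:
  "times_differentiable (Suc m) f \<longleftrightarrow> (\<forall>x. f differentiable (at x)) \<and> (\<forall>v. times_differentiable m (dird v f))"
  unfolding times_differentiable.simps dird_def[abs_def] by (rule refl)

lemma dird_eqI: "(f has_derivative f') (at z) \<Longrightarrow> dird v f z = f' v"
  unfolding dird_def by (metis frechet_derivative_at)

lemma differentiable_has_derivative_dird:
  assumes "f differentiable (at z)"
  shows "(f has_derivative (\<lambda>v. dird v f z)) (at z)"
  using assms unfolding dird_def frechet_derivative_works by simp

lemma times_differentiable_SucD: "times_differentiable (Suc m) f \<Longrightarrow> times_differentiable m f"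
proof (induction m arbitrary: f)
  case 0
  then show ?case
    by (auto simp: times_differentiable_Suc_dird continuous_on_eq_continuous_at differentiable_imp_continuous_within)
next
  case (Suc m)
  then show ?case by (metis times_differentiable_Suc_dird)
qed

lemma dird_const: "dird v (\<lambda>z. c) = (\<lambda>z. 0)"
  by (rule ext, rule dird_eqI[THEN trans], rule has_derivative_const) simp

lemma dird_add:
  assumes "\<And>z. f differentiable (at z)" "\<And>z. g differentiable (at z)"
  shows "dird v (\<lambda>z. f z + g z) = (\<lambda>z. dird v f z + dird v g z)"
proof
  fix z show "dird v (\<lambda>z. f z + g z) z = dird v f z + dird v g z"
    by (rule dird_eqI[OF has_derivative_add[OF differentiable_has_derivative_dird differentiable_has_derivative_dird], OF assms])
qed

lemma dird_mult:
  assumes "\<And>z. f differentiable (at z)" "\<And>z. g differentiable (at z)"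
  shows "dird v (\<lambda>z. f z * g z) = (\<lambda>z. f z * dird v g z + dird v f z * g z)"
proof
  fix z show "dird v (\<lambda>z. f z * g z) z = f z * dird v g z + dird v f z * g z"
    by (rule dird_eqI[OF has_derivative_mult[OF differentiable_has_derivative_dird differentiable_has_derivative_dird], OF assms])
qed

lemma dird_bounded_linear_comp:
  assumes "bounded_linear L" "\<And>z. f differentiable (at z)"
  shows "dird v (\<lambda>z. L (f z)) = (\<lambda>z. L (dird v f z))"
proof
  fix z show "dird v (\<lambda>z. L (f z)) z = L (dird v f z)"
    by (rule dird_eqI[OF bounded_linear.has_derivative[OF assms(1) differentiable_has_derivative_dird[OF assms(2)]]])
qed

lemma dird_affine_comp:
  assumes "bounded_linear L" "\<And>z. f differentiable (at z)"
  shows "dird v (\<lambda>z. f (L z + c)) = (\<lambda>z. dird (L v) f (L z + c))"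
proof
  fix z
  have "((\<lambda>z. L z + c) has_derivative L) (at z)"
    by (auto intro!: derivative_eq_intros bounded_linear.has_derivative[OF assms(1)])
  then have "(f \<circ> (\<lambda>z. L z + c) has_derivative (\<lambda>v. dird v f (L z + c)) \<circ> L) (at z)"
    using differentiable_has_derivative_dird[OF assms(2), of "L z + c"]
    by (intro diff_chain_at) (auto simp: o_def)
  then show "dird v (\<lambda>z. f (L z + c)) z = dird (L v) f (L z + c)"
    by (intro dird_eqI[THEN trans]) (auto simp: o_def)
qed

lemma differentiable_affine_comp:
  assumes "bounded_linear L" "\<And>z. f differentiable (at z)"
  shows "(\<lambda>z. f (L z + c)) differentiable (at z)"
proof -
  have "((\<lambda>z. L z + c) has_derivative L) (at z)"
    by (auto intro!: derivative_eq_intros bounded_linear.has_derivative[OF assms(1)])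
  then have "(f \<circ> (\<lambda>z. L z + c)) differentiable (at z)"
    using assms(2) by (intro differentiable_chain_at) (auto simp: differentiable_def)
  then show ?thesis by (simp add: o_def)
qed

lemma times_differentiable_const: "times_differentiable m (\<lambda>z. c)"
  by (induction m arbitrary: c) (auto simp: times_differentiable_Suc_dird dird_const simp del: times_differentiable.simps(2))

lemma times_differentiable_add:
  "times_differentiable m f \<Longrightarrow> times_differentiable m g \<Longrightarrow> times_differentiable m (\<lambda>z. f z + g z)"
proof (induction m arbitrary: f g)
  case 0 then show ?case by (auto intro: continuous_intros)
next
  case (Suc m) then show ?case
    by (auto simp: times_differentiable_Suc_dird dird_add simp del: times_differentiable.simps(2))
qed

lemma times_differentiable_mult:
  "times_differentiable m f \<Longrightarrow> times_differentiable m g \<Longrightarrow> times_differentiable m (\<lambda>z. f z * g z)"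
proof (induction m arbitrary: f g)
  case 0 then show ?case by (auto intro: continuous_intros)
next
  case (Suc m)
  have "times_differentiable m f" "times_differentiable m g"
    using Suc.prems by (auto intro: times_differentiable_SucD simp del: times_differentiable.simps)
  then show ?case using Suc
    by (auto simp: times_differentiable_Suc_dird dird_mult intro!: times_differentiable_add simp del: times_differentiable.simps(2))
qed

lemma times_differentiable_bounded_linear_comp:
  "bounded_linear L \<Longrightarrow> times_differentiable m f \<Longrightarrow> times_differentiable m (\<lambda>z. L (f z))"
proof (induction m arbitrary: f)
  case 0 then show ?case
    by (auto intro: bounded_linear.continuous_on)
next
  case (Suc m)
  have "(\<lambda>z. L (f z)) differentiable (at x)" for x
    using Suc.prems bounded_linear.has_derivative[OF Suc.prems(1)]
    unfolding times_differentiable_Suc_dird differentiable_def by blast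
  then show ?case using Suc
    by (auto simp: times_differentiable_Suc_dird dird_bounded_linear_comp simp del: times_differentiable.simps(2))
qed

lemma times_differentiable_affine_comp:
  "bounded_linear L \<Longrightarrow> times_differentiable m f \<Longrightarrow> times_differentiable m (\<lambda>z. f (L z + c))"
proof (induction m arbitrary: f)
  case 0
  have "continuous_on UNIV (f \<circ> (\<lambda>z. L z + c))" using 0
    by (intro continuous_on_compose continuous_intros bounded_linear.continuous_on[OF 0(1)])
       (auto intro: continuous_on_subset)
  then show ?case by (simp add: o_def)
next
  case (Suc m)
  then show ?case
    by (auto simp: times_differentiable_Suc_dird dird_affine_comp differentiable_affine_comp simp del: times_differentiable.simps(2))
qed

lemma smooth_function_unfold:
  "smooth_function f \<longleftrightarrow> (\<forall>z. f differentiable (at z)) \<and> (\<forall>v. smooth_function (dird v f))"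
proof -
  have "smooth_function f \<longleftrightarrow> (\<forall>m. times_differentiable (Suc m) f)"
    unfolding smooth_function_def by (metis times_differentiable_SucD)
  then show ?thesis unfolding times_differentiable_Suc_dird smooth_function_def by blast
qed

lemma smooth_function_differentiable: "smooth_function f \<Longrightarrow> f differentiable (at z)"
  by (metis smooth_function_unfold)
lemma smooth_function_dird: "smooth_function f \<Longrightarrow> smooth_function (dird v f)"
  by (metis smooth_function_unfold)
lemma smooth_function_continuous: "smooth_function f \<Longrightarrow> continuous_on S f"
  using smooth_function_def[of f] times_differentiable.simps(1)[of f] continuous_on_subset by blast
lemma smooth_function_const: "smooth_function (\<lambda>z. c)"
  by (simp add: smooth_function_def times_differentiable_const)
lemma smooth_function_add: "smooth_function f \<Longrightarrow> smooth_function g \<Longrightarrow> smooth_function (\<lambda>z. f z + g z)"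
  by (simp add: smooth_function_def times_differentiable_add)
lemma smooth_function_mult: "smooth_function f \<Longrightarrow> smooth_function g \<Longrightarrow> smooth_function (\<lambda>z. f z * g z)"
  by (simp add: smooth_function_def times_differentiable_mult)
lemma smooth_function_cmult: "smooth_function f \<Longrightarrow> smooth_function (\<lambda>z. c * f z)"
  by (intro smooth_function_mult smooth_function_const)
lemma smooth_function_sum: "(\<And>i. i \<in> I \<Longrightarrow> smooth_function (f i)) \<Longrightarrow> smooth_function (\<lambda>z. \<Sum>i\<in>I. f i z)"
  by (induction I rule: infinite_finite_induct) (auto intro: smooth_function_const smooth_function_add)
lemma smooth_function_bounded_linear_comp: "bounded_linear L \<Longrightarrow> smooth_function f \<Longrightarrow> smooth_function (\<lambda>z. L (f z))"
  by (simp add: smooth_function_def times_differentiable_bounded_linear_comp)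
lemma smooth_function_cnj: "smooth_function f \<Longrightarrow> smooth_function (\<lambda>z. cnj (f z))"
  by (rule smooth_function_bounded_linear_comp[OF bounded_linear_cnj])
lemma smooth_function_affine_comp: "bounded_linear L \<Longrightarrow> smooth_function f \<Longrightarrow> smooth_function (\<lambda>z. f (L z + c))"
  by (simp add: smooth_function_def times_differentiable_affine_comp)
lemma smooth_function_translate: "smooth_function f \<Longrightarrow> smooth_function (\<lambda>z. f (z + c))"
  using smooth_function_affine_comp[OF bounded_linear_ident] .

lemma dird_bounded_linear: "bounded_linear L \<Longrightarrow> dird v L = (\<lambda>z. L v)"
  by (rule ext, rule dird_eqI) (rule bounded_linear_imp_has_derivative)

lemma smooth_function_bounded_linear: "bounded_linear L \<Longrightarrow> smooth_function L"
  by (subst smooth_function_unfold)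
     (auto simp: dird_bounded_linear smooth_function_const bounded_linear_imp_differentiable)

text \<open>Differentiation reproduces the exponential with the factor \<open>dird v q z\<close>, so
  the induction on the order asks only that \<open>q\<close> be differentiable to every
  order.\<close>

lemma smooth_function_exp:
  assumes "smooth_function q"
  shows "smooth_function (\<lambda>z. exp (q z))"
proof -
  have 1: "((\<lambda>z. exp (q z)) has_derivative (\<lambda>v. dird v q z * exp (q z))) (at z)" for z
    using has_derivative_compose[OF differentiable_has_derivative_dird[OF smooth_function_differentiable[OF assms]] DERIV_exp[unfolded has_field_derivative_def], of z]
    by (simp add: mult.commute)
  have diff: "(\<lambda>z. exp (q z)) differentiable (at z)" for z using 1 unfolding differentiable_def by blast
  have d: "dird v (\<lambda>z. exp (q z)) = (\<lambda>z. dird v q z * exp (q z))" for v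
    by (rule ext, rule dird_eqI[OF 1])
  have "times_differentiable m (\<lambda>z. exp (q z))" for m
  proof (induction m)
    case 0
    show ?case by (auto intro!: continuous_on_exp smooth_function_continuous[OF assms])
  next
    case (Suc m)
    then show ?case unfolding times_differentiable_Suc_dird d
      using diff assms smooth_function_dird[OF assms] by (auto simp: smooth_function_def intro!: times_differentiable_mult simp del: times_differentiable.simps)
  qed
  then show ?thesis by (simp add: smooth_function_def)
qed

lemma dird_linear_combination:
  assumes "f differentiable (at z)"
  shows "dird (v + w) f z = dird v f z + dird w f z" "dird (c *\<^sub>R v) f z = c *\<^sub>R dird v f z"
    "dird (-v) f z = - dird v f z"
  using linear_add[OF has_derivative_linear[OF differentiable_has_derivative_dird[OF assms]]]
    linear_scale[OF has_derivative_linear[OF differentiable_has_derivative_dird[OF assms]]]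
    linear_neg[OF has_derivative_linear[OF differentiable_has_derivative_dird[OF assms]]]
  by auto

lemma dird_has_vector_derivative:
  assumes "\<And>z. f differentiable (at z)"
  shows "((\<lambda>t. f (z + t *\<^sub>R v)) has_vector_derivative dird v f (z + t *\<^sub>R v)) (at t)"
proof -
  have "((\<lambda>t. z + t *\<^sub>R v) has_derivative (\<lambda>s. s *\<^sub>R v)) (at t)"
    by (auto intro!: derivative_eq_intros)
  from has_derivative_compose[OF this differentiable_has_derivative_dird[OF assms]]
  show ?thesis
    unfolding has_vector_derivative_def by (simp add: dird_linear_combination[OF assms])
qed

text \<open>Schwarz's argument: by two mean value theorems the second difference over a small
  parallelogram is \<open>h * h\<close> times either mixed derivative at a nearby point. Different
  values at \<open>z\<close> would be separated by continuity.\<close>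

lemma real_mixed_derivative_commute:
  fixes f fv fw fvw fwv :: "'v::real_normed_vector \<Rightarrow> real"
  assumes v: "\<And>z t. ((\<lambda>t. f (z + t *\<^sub>R v)) has_real_derivative fv (z + t *\<^sub>R v)) (at t)"
    and w: "\<And>z t. ((\<lambda>t. f (z + t *\<^sub>R w)) has_real_derivative fw (z + t *\<^sub>R w)) (at t)"
    and vw: "\<And>z t. ((\<lambda>t. fv (z + t *\<^sub>R w)) has_real_derivative fvw (z + t *\<^sub>R w)) (at t)"
    and wv: "\<And>z t. ((\<lambda>t. fw (z + t *\<^sub>R v)) has_real_derivative fwv (z + t *\<^sub>R v)) (at t)"
    and c: "isCont fvw z" "isCont fwv z"
  shows "fvw z = fwv z"
proof (rule ccontr)
  assume neq: "fvw z \<noteq> fwv z"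
  define e where "e = \<bar>fvw z - fwv z\<bar> / 2"
  have e: "e > 0" using neq by (simp add: e_def)
  \<comment> \<open>General in the two directions, so that the same second difference, symmetric in
    \<open>v\<close> and \<open>w\<close>, can be evaluated in both orders.\<close>
  have gen: "\<exists>s t. 0 < s \<and> s < h \<and> 0 < t \<and> t < h \<and>
      f (z + h *\<^sub>R w + h *\<^sub>R v) - f (z + h *\<^sub>R w) - (f (z + h *\<^sub>R v) - f z) = h * (h * gvw (z + s *\<^sub>R v + t *\<^sub>R w))"
    if h: "h > 0" and v: "\<And>z t. ((\<lambda>t. f (z + t *\<^sub>R v)) has_real_derivative gv (z + t *\<^sub>R v)) (at t)"
      and vw: "\<And>z t. ((\<lambda>t. gv (z + t *\<^sub>R w)) has_real_derivative gvw (z + t *\<^sub>R w)) (at t)" for h gv gvw v w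
  proof -
    have "\<exists>s>0. s < h \<and> (f (z + h *\<^sub>R w + h *\<^sub>R v) - f (z + h *\<^sub>R v)) - (f (z + h *\<^sub>R w + 0 *\<^sub>R v) - f (z + 0 *\<^sub>R v)) = (h - 0) * (gv (z + h *\<^sub>R w + s *\<^sub>R v) - gv (z + s *\<^sub>R v))"
      by (rule MVT2[where f = "\<lambda>t. f (z + h *\<^sub>R w + t *\<^sub>R v) - f (z + t *\<^sub>R v)" and f'="\<lambda>s. gv (z + h *\<^sub>R w + s *\<^sub>R v) - gv (z + s *\<^sub>R v)" and a = 0 and b = h])
         (use h in \<open>auto intro!: DERIV_diff v\<close>)
    then obtain s where s: "0 < s" "s < h" and 1: "f (z + h *\<^sub>R w + h *\<^sub>R v) - f (z + h *\<^sub>R v) - (f (z + h *\<^sub>R w) - f z) = h * (gv (z + s *\<^sub>R v + h *\<^sub>R w) - gv (z + s *\<^sub>R v))"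
      by (auto simp: algebra_simps)
    have "\<exists>t>0. t < h \<and> gv (z + s *\<^sub>R v + h *\<^sub>R w) - gv (z + s *\<^sub>R v + 0 *\<^sub>R w) = (h - 0) * gvw (z + s *\<^sub>R v + t *\<^sub>R w)"
      by (rule MVT2) (use h in \<open>auto intro!: vw\<close>)
    then obtain t where t: "0 < t" "t < h" "gv (z + s *\<^sub>R v + h *\<^sub>R w) - gv (z + s *\<^sub>R v) = h * gvw (z + s *\<^sub>R v + t *\<^sub>R w)"
      by auto
    show ?thesis using s t(1,2) 1 unfolding t(3) by (intro exI[of _ s] exI[of _ t]) linarith
  qed
  obtain d1 where d1: "d1 > 0" "\<And>y. dist y z < d1 \<Longrightarrow> dist (fvw y) (fvw z) < e"
    using c(1) e by (metis continuous_at_eps_delta)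
  obtain d2 where d2: "d2 > 0" "\<And>y. dist y z < d2 \<Longrightarrow> dist (fwv y) (fwv z) < e"
    using c(2) e by (metis continuous_at_eps_delta)
  \<comment> \<open>The parallelogram then lies within both radii of continuity; the summand
    \<open>1\<close> keeps the denominator positive when \<open>v\<close> and \<open>w\<close>
    vanish.\<close>
  define h where "h = min d1 d2 / (norm v + norm w + 1)"
  have h: "h > 0" using d1 d2 by (auto simp: h_def intro!: divide_pos_pos add_nonneg_pos)
  have close: "dist (z + s *\<^sub>R v + t *\<^sub>R w) z < min d1 d2" "dist (z + s *\<^sub>R w + t *\<^sub>R v) z < min d1 d2" if "0 < s" "s < h" "0 < t" "t < h" for s t
  proof -
    have "s * norm v \<le> h * norm v" "t * norm w \<le> h * norm w" "s * norm w \<le> h * norm w" "t * norm v \<le> h * norm v"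
      using that by (auto intro!: mult_right_mono)
    moreover have "h * (norm v + norm w + 1) = min d1 d2" unfolding h_def
      by (simp add: add_nonneg_pos less_imp_neq[symmetric])
    moreover have "dist (z + s *\<^sub>R v + t *\<^sub>R w) z \<le> s * norm v + t * norm w" "dist (z + s *\<^sub>R w + t *\<^sub>R v) z \<le> s * norm w + t * norm v"
      using norm_triangle_ineq[of "s *\<^sub>R v" "t *\<^sub>R w"] norm_triangle_ineq[of "s *\<^sub>R w" "t *\<^sub>R v"] that by (auto simp: dist_norm)
    ultimately show "dist (z + s *\<^sub>R v + t *\<^sub>R w) z < min d1 d2" "dist (z + s *\<^sub>R w + t *\<^sub>R v) z < min d1 d2"
      using h by (auto simp: algebra_simps)
  qed
  obtain s t where st: "0 < s" "s < h" "0 < t" "t < h"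
    "f (z + h *\<^sub>R w + h *\<^sub>R v) - f (z + h *\<^sub>R w) - (f (z + h *\<^sub>R v) - f z) = h * (h * fvw (z + s *\<^sub>R v + t *\<^sub>R w))"
    using gen[OF h v vw] by auto
  obtain s' t' where st': "0 < s'" "s' < h" "0 < t'" "t' < h"
    "f (z + h *\<^sub>R v + h *\<^sub>R w) - f (z + h *\<^sub>R v) - (f (z + h *\<^sub>R w) - f z) = h * (h * fwv (z + s' *\<^sub>R w + t' *\<^sub>R v))"
    using gen[OF h w wv] by auto
  have "h * (h * fvw (z + s *\<^sub>R v + t *\<^sub>R w)) = h * (h * fwv (z + s' *\<^sub>R w + t' *\<^sub>R v))"
    using st(5) st'(5) by (simp add: algebra_simps)
  then have "fvw (z + s *\<^sub>R v + t *\<^sub>R w) = fwv (z + s' *\<^sub>R w + t' *\<^sub>R v)" using h by auto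
  moreover have "dist (fvw (z + s *\<^sub>R v + t *\<^sub>R w)) (fvw z) < e" "dist (fwv (z + s' *\<^sub>R w + t' *\<^sub>R v)) (fwv z) < e"
    using close(1)[OF st(1-4)] close(2)[OF st'(1-4)] d1 d2 by auto
  ultimately show False unfolding e_def dist_real_def by (auto simp: abs_if field_simps split: if_splits)
qed

text \<open>The mean value theorem is real, hence the passage to real and imaginary parts.\<close>

lemma dird_commute:
  fixes f :: "'v::real_normed_vector \<Rightarrow> complex"
  assumes "smooth_function f"
  shows "dird v (dird w f) = dird w (dird v f)"
proof
  fix z :: "'v"
  note sm = assms smooth_function_dird[OF assms] smooth_function_dird[OF smooth_function_dird[OF assms]]
  have hv: "((\<lambda>t. g (z + t *\<^sub>R v)) has_vector_derivative dird v g (z + t *\<^sub>R v)) (at t)" if "smooth_function g" for g v t z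
    by (rule dird_has_vector_derivative) (rule smooth_function_differentiable[OF that])
  have Re: "((\<lambda>t. Re (g (z + t *\<^sub>R v))) has_real_derivative Re (dird v g (z + t *\<^sub>R v))) (at t)"
    and Im: "((\<lambda>t. Im (g (z + t *\<^sub>R v))) has_real_derivative Im (dird v g (z + t *\<^sub>R v))) (at t)" if "smooth_function g" for g v t z
    using bounded_linear.has_vector_derivative[OF bounded_linear_Re hv[OF that]]
      bounded_linear.has_vector_derivative[OF bounded_linear_Im hv[OF that]]
    by (auto simp: has_real_derivative_iff_has_vector_derivative)
  have cont: "isCont g z" if "smooth_function g" for g
    using smooth_function_continuous[OF that, of UNIV] by (simp add: continuous_on_eq_continuous_at)
  have "Re (dird v (dird w f) z) = Re (dird w (dird v f) z)"
    by (rule real_mixed_derivative_commute[where v=w and w=v and f = "\<lambda>z. Re (f z)" and fv = "\<lambda>z. Re (dird w f z)" and fw = "\<lambda>z. Re (dird v f z)" and fvw="\<lambda>z. Re (dird v (dird w f) z)" and fwv="\<lambda>z. Re (dird w (dird v f) z)"])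
       (intro Re sm isCont_Re cont)+
  moreover have "Im (dird v (dird w f) z) = Im (dird w (dird v f) z)"
    by (rule real_mixed_derivative_commute[where v=w and w=v and f = "\<lambda>z. Im (f z)" and fv = "\<lambda>z. Im (dird w f z)" and fw = "\<lambda>z. Im (dird v f z)" and fvw="\<lambda>z. Im (dird v (dird w f) z)" and fwv="\<lambda>z. Im (dird w (dird v f) z)"])
       (intro Im sm isCont_Im cont)+
  ultimately show "dird v (dird w f) z = dird w (dird v f) z" by (rule complex_eqI)
qed

section \<open>Ladder operators\<close>

definition fscale :: "complex \<Rightarrow> ('x \<Rightarrow> complex) \<Rightarrow> 'x \<Rightarrow> complex" where
  "fscale c f = (\<lambda>x. c * f x)"

global_interpretation fun_space: vector_space "fscale :: complex \<Rightarrow> ('x \<Rightarrow> complex) \<Rightarrow> 'x \<Rightarrow> complex"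
  by unfold_locales (simp_all add: fscale_def fun_eq_iff algebra_simps)

lemma sum_fun_apply: "(\<Sum>i\<in>I. f i) x = (\<Sum>i\<in>I. f i x)"
  by (induction I rule: infinite_finite_induct) auto

text \<open>Canonical commutation relations on a space of functions. All analysis is concentrated in
  \<open>resolvent\<close>; the rest is algebra and positivity. The structure is used twice, for
  quasi-periodic functions with unitary multipliers and, after conjugation by the gauge factor, for
  sections of the line bundle.\<close>

locale ladder =
  fixes S :: "('x \<Rightarrow> complex) set" and b bs :: "nat \<Rightarrow> ('x \<Rightarrow> complex) \<Rightarrow> 'x \<Rightarrow> complex"
    and \<nu> :: "nat \<Rightarrow> real" and I :: "nat set" and ip :: "('x \<Rightarrow> complex) \<Rightarrow> ('x \<Rightarrow> complex) \<Rightarrow> complex"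
  assumes fin [simp]: "finite I" and sub: "fun_space.subspace S"
    and b_in: "i \<in> I \<Longrightarrow> f \<in> S \<Longrightarrow> b i f \<in> S"
    and bs_in: "i \<in> I \<Longrightarrow> f \<in> S \<Longrightarrow> bs i f \<in> S"
    and b_add: "i \<in> I \<Longrightarrow> f \<in> S \<Longrightarrow> g \<in> S \<Longrightarrow> b i (f + g) = b i f + b i g"
    and bs_add: "i \<in> I \<Longrightarrow> f \<in> S \<Longrightarrow> g \<in> S \<Longrightarrow> bs i (f + g) = bs i f + bs i g"
    and b_scale: "i \<in> I \<Longrightarrow> f \<in> S \<Longrightarrow> b i (fscale c f) = fscale c (b i f)"
    and bs_scale: "i \<in> I \<Longrightarrow> f \<in> S \<Longrightarrow> bs i (fscale c f) = fscale c (bs i f)"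
    and b_bs: "i \<in> I \<Longrightarrow> j \<in> I \<Longrightarrow> f \<in> S \<Longrightarrow>
      b i (bs j f) = bs j (b i f) + (if i = j then fscale (of_real (\<nu> i)) f else 0)"
    and b_b: "i \<in> I \<Longrightarrow> j \<in> I \<Longrightarrow> f \<in> S \<Longrightarrow> b i (b j f) = b j (b i f)"
    and bs_bs: "i \<in> I \<Longrightarrow> j \<in> I \<Longrightarrow> f \<in> S \<Longrightarrow> bs i (bs j f) = bs j (bs i f)"
    and \<nu>_pos: "i \<in> I \<Longrightarrow> \<nu> i > 0"
    and ip_add: "f \<in> S \<Longrightarrow> g \<in> S \<Longrightarrow> h \<in> S \<Longrightarrow> ip (f + g) h = ip f h + ip g h"
    and ip_scale: "f \<in> S \<Longrightarrow> g \<in> S \<Longrightarrow> ip (fscale c f) g = c * ip f g"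
    and ip_cnj: "f \<in> S \<Longrightarrow> g \<in> S \<Longrightarrow> ip g f = cnj (ip f g)"
    and ip_pos: "f \<in> S \<Longrightarrow> f \<noteq> 0 \<Longrightarrow> Re (ip f f) > 0"
    and ip_b: "i \<in> I \<Longrightarrow> f \<in> S \<Longrightarrow> g \<in> S \<Longrightarrow> ip (b i f) g = ip f (bs i g)"
    and resolvent: "Re c < 0 \<Longrightarrow> f \<in> S \<Longrightarrow> \<exists>u\<in>S. (\<Sum>i\<in>I. bs i (b i u)) - fscale c u = f"
begin

lemma S_closed [simp, intro]:
  "0 \<in> S" "f \<in> S \<Longrightarrow> g \<in> S \<Longrightarrow> f + g \<in> S" "f \<in> S \<Longrightarrow> g \<in> S \<Longrightarrow> f - g \<in> S" "f \<in> S \<Longrightarrow> fscale c f \<in> S"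
  "(\<And>i. i \<in> J \<Longrightarrow> F i \<in> S) \<Longrightarrow> (\<Sum>i\<in>J. F i) \<in> S"
  using sub by (auto intro: fun_space.subspace_0 fun_space.subspace_add fun_space.subspace_diff fun_space.subspace_scale fun_space.subspace_sum)

lemma zero [simp]:
  assumes "i \<in> I" shows "b i 0 = 0" "bs i 0 = 0" "b i (\<lambda>x. 0) = (\<lambda>x. 0)" "bs i (\<lambda>x. 0) = (\<lambda>x. 0)"
  using b_scale[OF assms S_closed(1), of 0] bs_scale[OF assms S_closed(1), of 0] by (auto simp: zero_fun_def)

lemma b_sum: "i \<in> I \<Longrightarrow> (\<And>j. j \<in> J \<Longrightarrow> F j \<in> S) \<Longrightarrow> b i (\<Sum>j\<in>J. F j) = (\<Sum>j\<in>J. b i (F j))"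
  by (induction J rule: infinite_finite_induct) (auto simp: b_add)
lemma bs_sum: "i \<in> I \<Longrightarrow> (\<And>j. j \<in> J \<Longrightarrow> F j \<in> S) \<Longrightarrow> bs i (\<Sum>j\<in>J. F j) = (\<Sum>j\<in>J. bs i (F j))"
  by (induction J rule: infinite_finite_induct) (auto simp: bs_add)
lemma bs_diff: "i \<in> I \<Longrightarrow> f \<in> S \<Longrightarrow> g \<in> S \<Longrightarrow> bs i (f - g) = bs i f - bs i g"
  using bs_add[of i "f - g" g] by (simp add: algebra_simps)

definition A :: "('x \<Rightarrow> complex) \<Rightarrow> 'x \<Rightarrow> complex" where
  "A f = (\<Sum>i\<in>I. bs i (b i f))"

lemma A_in [simp]: "f \<in> S \<Longrightarrow> A f \<in> S"
  unfolding A_def by (intro S_closed bs_in b_in)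
lemma A_add: "f \<in> S \<Longrightarrow> g \<in> S \<Longrightarrow> A (f + g) = A f + A g"
  unfolding A_def sum.distrib[symmetric] by (rule sum.cong) (auto simp: b_add bs_add b_in)
lemma A_scale: "f \<in> S \<Longrightarrow> A (fscale c f) = fscale c (A f)"
  unfolding A_def fun_space.scale_sum_right by (rule sum.cong) (auto simp: b_scale bs_scale b_in)
lemma A_zero [simp]: "A 0 = 0" by (simp add: A_def)
lemma A_diff: "f \<in> S \<Longrightarrow> g \<in> S \<Longrightarrow> A (f - g) = A f - A g"
  using A_add[of "f - g" g] by (simp add: algebra_simps)
lemma A_sum: "(\<And>j. j \<in> J \<Longrightarrow> F j \<in> S) \<Longrightarrow> A (\<Sum>j\<in>J. F j) = (\<Sum>j\<in>J. A (F j))"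
  by (induction J rule: infinite_finite_induct) (auto simp: A_add)

lemma number_bs:
  assumes "i \<in> I" "j \<in> I" "f \<in> S"
  shows "bs i (b i (bs j f)) = bs j (bs i (b i f)) + (if i = j then fscale (of_real (\<nu> j)) (bs j f) else 0)"
  using assms by (simp add: b_bs bs_add bs_scale bs_bs b_in bs_in)

lemma number_b:
  assumes "i \<in> I" "j \<in> I" "f \<in> S"
  shows "bs i (b i (b j f)) = b j (bs i (b i f)) - (if i = j then fscale (of_real (\<nu> j)) (b j f) else 0)"
  using assms by (simp add: b_bs[of j i] b_b[of i j] b_in bs_in)

lemma A_bs: "j \<in> I \<Longrightarrow> f \<in> S \<Longrightarrow> A (bs j f) = bs j (A f) + fscale (of_real (\<nu> j)) (bs j f)"
  unfolding A_def by (simp add: number_bs bs_sum sum.distrib bs_in b_in sum.delta)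

lemma A_b: "j \<in> I \<Longrightarrow> f \<in> S \<Longrightarrow> A (b j f) = b j (A f) - fscale (of_real (\<nu> j)) (b j f)"
  unfolding A_def by (simp add: number_b b_sum sum_subtractf bs_in b_in sum.delta)

definition Ker :: "complex \<Rightarrow> ('x \<Rightarrow> complex) set" where
  "Ker c = {f \<in> S. A f = fscale c f}"

lemma Ker_subspace: "fun_space.subspace (Ker c)"
  unfolding fun_space.subspace_def Ker_def
  by (auto simp: A_add A_scale fun_space.scale_right_distrib mult.commute)

lemma bs_Ker: "j \<in> I \<Longrightarrow> f \<in> Ker (c - of_real (\<nu> j)) \<Longrightarrow> bs j f \<in> Ker c"
  unfolding Ker_def by (auto simp: A_bs bs_in bs_scale fun_space.scale_left_distrib[symmetric])
lemma b_Ker: "j \<in> I \<Longrightarrow> f \<in> Ker c \<Longrightarrow> b j f \<in> Ker (c - of_real (\<nu> j))"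
  unfolding Ker_def by (auto simp: A_b b_in b_scale fun_space.scale_left_diff_distrib[symmetric])

lemma resolvent_A: "Re c < 0 \<Longrightarrow> f \<in> S \<Longrightarrow> \<exists>u\<in>S. A u - fscale c u = f"
  unfolding A_def by (rule resolvent)

text \<open>The uniform gap guarantees that finitely many lowering steps make the spectral parameter
  negative.\<close>

lemma \<nu>_lower_bound: "\<exists>\<nu>0>0. \<forall>i\<in>I. \<nu>0 \<le> \<nu> i"
proof (cases "I = {}")
  case True then show ?thesis by (auto intro: exI[of _ 1])
next
  case False
  then have "Min (\<nu> ` I) \<in> \<nu> ` I" by (intro Min_in) auto
  then show ?thesis using \<nu>_pos by (intro exI[of _ "Min (\<nu> ` I)"]) auto
qed

text \<open>Raising intertwines \<open>A - (c - \<nu> j)\<close> with \<open>A - c\<close>, so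
  solutions at the lower parameter are carried to solutions at \<open>c\<close>.\<close>

lemma bs_range:
  assumes "j \<in> I" "w \<in> S"
  shows "bs j (A w - fscale (c - of_real (\<nu> j)) w) = A (bs j w) - fscale c (bs j w)"
  using assms by (simp add: bs_diff bs_scale A_bs fun_space.scale_left_diff_distrib)

text \<open>Induction on the number of lowering steps after which the spectral parameter is negative: \<open>b j\<close>
  shifts \<open>c\<close> to \<open>c - \<nu> j\<close>, and the sum of \<open>bs j\<close> applied to the solutions below solves the equation for \<open>c\<close>.\<close>

theorem Ker_range_decomposition:
  assumes "f \<in> S"
  shows "\<exists>k\<in>Ker c. \<exists>u\<in>S. f = k + (A u - fscale c u)"
proof -
  obtain \<nu>0 where \<nu>0: "\<nu>0 > 0" "\<And>i. i \<in> I \<Longrightarrow> \<nu>0 \<le> \<nu> i" using \<nu>_lower_bound by auto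
  have main: "Re c < real N * \<nu>0 \<Longrightarrow> f \<in> S \<Longrightarrow> \<exists>k\<in>Ker c. \<exists>u\<in>S. f = k + (A u - fscale c u)" for N c f
  proof (induction N arbitrary: c f)
    case 0
    then obtain u where "u \<in> S" "A u - fscale c u = f" using resolvent_A[of c f] by auto
    then show ?case by (intro bexI[of _ 0] bexI[of _ u]) (auto simp: Ker_def)
  next
    case (Suc N)
    show ?case
    proof (cases "c = 0")
      case True
      \<comment> \<open>At \<open>c = 0\<close> the concluding division by \<open>c\<close> is
        impossible. Instead the resolvent at \<open>- \<nu> j\<close> is applied twice: the first
        solutions \<open>w j\<close> produce \<open>u\<close> with \<open>A u = A f\<close>, so that
        \<open>f - u\<close> lies in the kernel, and the second solutions \<open>x j\<close> show
        that \<open>u\<close> itself is in the range of \<open>A\<close>.\<close>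
      have resolvent_neg: "\<exists>u. u \<in> S \<and> A u - fscale (- of_real (\<nu> j)) u = g" if "j \<in> I" "g \<in> S" for j g
        using resolvent_A[of "- of_real (\<nu> j)" g] \<nu>_pos[OF that(1)] that(2) by auto
      have "\<forall>j\<in>I. \<exists>w. w \<in> S \<and> A w - fscale (- of_real (\<nu> j)) w = b j f"
        using resolvent_neg Suc.prems(2) b_in by blast
      then obtain w where w: "\<And>j. j \<in> I \<Longrightarrow> w j \<in> S" "\<And>j. j \<in> I \<Longrightarrow> A (w j) - fscale (- of_real (\<nu> j)) (w j) = b j f"
        by metis
      have "\<forall>j\<in>I. \<exists>x. x \<in> S \<and> A x - fscale (- of_real (\<nu> j)) x = w j"
        using resolvent_neg w(1) by blast
      then obtain x where x: "\<And>j. j \<in> I \<Longrightarrow> x j \<in> S" "\<And>j. j \<in> I \<Longrightarrow> A (x j) - fscale (- of_real (\<nu> j)) (x j) = w j"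
        by metis
      define u where "u = (\<Sum>j\<in>I. bs j (w j))"
      have u: "u \<in> S" unfolding u_def using w bs_in by auto
      have "A u = (\<Sum>j\<in>I. A (bs j (w j)))" unfolding u_def by (rule A_sum) (use w bs_in in auto)
      also have "\<dots> = (\<Sum>j\<in>I. bs j (b j f))"
        using bs_range[of _ _ 0] w by (intro sum.cong) (auto simp flip: w(2))
      finally have Au: "A u = A f" by (simp add: A_def)
      have "u = (\<Sum>j\<in>I. A (bs j (x j)))" unfolding u_def
        using bs_range[of _ _ 0] x(1) by (intro sum.cong) (auto simp flip: x(2))
      also have "\<dots> = A (\<Sum>j\<in>I. bs j (x j))" by (rule A_sum[symmetric]) (use x bs_in in auto)
      finally have "u = A (\<Sum>j\<in>I. bs j (x j))" .
      then show ?thesis using True Suc.prems u Au x bs_in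
        by (intro bexI[of _ "f - u"] bexI[of _ "\<Sum>j\<in>I. bs j (x j)"]) (auto simp: Ker_def A_diff)
    next
      case False
      have "\<forall>j\<in>I. \<exists>h w. h \<in> Ker (c - of_real (\<nu> j)) \<and> w \<in> S \<and> b j f = h + (A w - fscale (c - of_real (\<nu> j)) w)"
      proof
        fix j assume j: "j \<in> I"
        have "Re (c - of_real (\<nu> j)) < real N * \<nu>0" using Suc.prems(1) \<nu>0(2)[OF j] by (simp add: algebra_simps)
        from Suc.IH[OF this b_in[OF j Suc.prems(2)]] show "\<exists>h w. h \<in> Ker (c - of_real (\<nu> j)) \<and> w \<in> S \<and> b j f = h + (A w - fscale (c - of_real (\<nu> j)) w)"
          by blast
      qed
      then obtain h w where hw: "\<And>j. j \<in> I \<Longrightarrow> h j \<in> Ker (c - of_real (\<nu> j))" "\<And>j. j \<in> I \<Longrightarrow> w j \<in> S"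
        "\<And>j. j \<in> I \<Longrightarrow> b j f = h j + (A (w j) - fscale (c - of_real (\<nu> j)) (w j))" by metis
      have hS: "h j \<in> S" if "j \<in> I" for j using hw(1)[OF that] by (simp add: Ker_def)
      define k where "k = (\<Sum>j\<in>I. bs j (h j))"
      define u where "u = (\<Sum>j\<in>I. bs j (w j))"
      have k: "k \<in> Ker c" unfolding k_def by (intro fun_space.subspace_sum[OF Ker_subspace] bs_Ker hw)
      have u: "u \<in> S" unfolding u_def using hw bs_in by auto
      have "A f = (\<Sum>j\<in>I. bs j (h j) + (A (bs j (w j)) - fscale c (bs j (w j))))"
        unfolding A_def[of f] using hw hS by (intro sum.cong) (auto simp: bs_add bs_range)
      also have "\<dots> = k + (A u - fscale c u)"
        unfolding k_def u_def using hw bs_in by (subst A_sum) (auto simp: sum.distrib sum_subtractf fun_space.scale_sum_right)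
      finally have *: "A f = k + (A u - fscale c u)" .
      \<comment> \<open>The equation reached so far is about \<open>A f\<close>. Passing from
        \<open>u\<close> to \<open>u - f\<close> trades \<open>A f\<close> for
        \<open>fscale c f\<close>, which can be divided by \<open>c\<close>.\<close>
      define v where "v = u - f"
      have v: "v \<in> S" using u Suc.prems by (simp add: v_def)
      have "fscale c f = k + (A v - fscale c v)"
        unfolding v_def using * u Suc.prems by (simp add: A_diff fun_space.scale_right_diff_distrib algebra_simps)
      then have "fscale (1 / c) (fscale c f) = fscale (1 / c) (k + (A v - fscale c v))" by simp
      then have "f = fscale (1 / c) k + (A (fscale (1 / c) v) - fscale c (fscale (1 / c) v))"
        using False v by (simp add: A_scale fun_space.scale_right_diff_distrib fun_space.scale_right_distrib mult.commute)
      then show ?thesis using k v fun_space.subspace_scale[OF Ker_subspace k]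
        by (intro bexI[of _ "fscale (1 / c) k"] bexI[of _ "fscale (1 / c) v"]) auto
    qed
  qed
  obtain N where "Re c / \<nu>0 < real N" using reals_Archimedean2 by blast
  then show ?thesis using main[of c N f] assms \<nu>0 by (simp add: field_simps)
qed

lemma ip_bs: "i \<in> I \<Longrightarrow> f \<in> S \<Longrightarrow> g \<in> S \<Longrightarrow> ip (bs i f) g = ip f (b i g)"
  using ip_b[of i g f] ip_cnj[of g "bs i f"] ip_cnj[of "b i g" f] by (auto simp: b_in bs_in)

lemma ip_nonneg: "f \<in> S \<Longrightarrow> Re (ip f f) \<ge> 0"
  using ip_pos[of f] ip_scale[of 0 0 0] by (cases "f = 0") (auto simp: less_imp_le)

lemma ip_real: "f \<in> S \<Longrightarrow> Im (ip f f) = 0"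
  using arg_cong[OF ip_cnj[of f f], of Im] by simp

lemma ip_sum: "g \<in> S \<Longrightarrow> (\<And>j. j \<in> J \<Longrightarrow> F j \<in> S) \<Longrightarrow> ip (\<Sum>j\<in>J. F j) g = (\<Sum>j\<in>J. ip (F j) g)"
  using ip_scale[of 0 g 0] by (induction J rule: infinite_finite_induct) (auto simp: ip_add)

lemma ip_A: "f \<in> S \<Longrightarrow> ip (A f) f = (\<Sum>i\<in>I. ip (b i f) (b i f))"
  unfolding A_def by (simp add: ip_sum bs_in b_in ip_bs)

text \<open>Pairing \<open>A f\<close> with \<open>f\<close> makes \<open>c\<close> times a positive
  number equal to a sum of squared norms.\<close>

lemma Ker_eigenvalue:
  assumes "f \<in> Ker c" "f \<noteq> 0"
  shows "Im c = 0" "Re c \<ge> 0"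
proof -
  have f: "f \<in> S" "A f = fscale c f" using assms by (auto simp: Ker_def)
  have eq: "c * ip f f = (\<Sum>i\<in>I. ip (b i f) (b i f))" using ip_A[OF f(1)] f by (simp add: ip_scale)
  have "Re c * Re (ip f f) = (\<Sum>i\<in>I. Re (ip (b i f) (b i f)))"
    using arg_cong[OF eq, of Re] ip_real[OF f(1)] by simp
  also have "\<dots> \<ge> 0" using f by (intro sum_nonneg ip_nonneg b_in)
  finally show "Re c \<ge> 0" using ip_pos[OF f(1) assms(2)] by (simp add: zero_le_mult_iff)
  have "Im c * Re (ip f f) = (\<Sum>i\<in>I. Im (ip (b i f) (b i f)))"
    using arg_cong[OF eq, of Im] ip_real[OF f(1)] by simp
  also have "\<dots> = 0" using f by (intro sum.neutral) (auto intro: ip_real b_in)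
  finally show "Im c = 0" using ip_pos[OF f(1) assms(2)] by simp
qed

text \<open>For eigenvalue zero the sum of squares in \<open>ip_A\<close> vanishes, hence every
  summand does. Elements of \<open>Ker 0\<close> are the ground states.\<close>

lemma Ker_zero_iff: "f \<in> Ker 0 \<longleftrightarrow> f \<in> S \<and> (\<forall>i\<in>I. b i f = 0)"
proof (safe)
  assume "f \<in> Ker 0"
  then have f: "f \<in> S" "A f = 0" by (auto simp: Ker_def)
  show "f \<in> S" by fact
  fix i assume i: "i \<in> I"
  have "(\<Sum>i\<in>I. Re (ip (b i f) (b i f))) = Re (ip (A f) f)" using ip_A[OF f(1)] by simp
  also have "\<dots> = 0" using f ip_scale[of 0 f 0] by simp
  finally have "Re (ip (b i f) (b i f)) = 0"
    using i f by (subst (asm) sum_nonneg_eq_0_iff) (auto intro: ip_nonneg b_in)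
  then show "b i f = 0" using ip_pos[OF b_in[OF i f(1)]] by auto
qed (auto simp: Ker_def A_def)

definition level :: "(nat \<Rightarrow> nat) \<Rightarrow> real" where "level m = (\<Sum>i\<in>I. real (m i) * \<nu> i)"

lemma level_upd: "j \<in> I \<Longrightarrow> level (m(j := Suc (m j))) = level m + \<nu> j"
proof -
  assume j: "j \<in> I"
  have "level (m(j := Suc (m j))) = (\<Sum>i\<in>I. real (m i) * \<nu> i + (if i = j then \<nu> i else 0))"
    unfolding level_def by (rule sum.cong) (auto simp: algebra_simps)
  then show ?thesis using j by (simp add: sum.distrib level_def)
qed

end

text \<open>The form in which rational independence of the eigenvalues is used: the total energy
  determines the number of quanta in every mode.\<close>

locale independent_ladder = ladder +
  assumes level_inj: "level m = level m' \<Longrightarrow> i \<in> I \<Longrightarrow> m i = m' i"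
begin

text \<open>Lowering reduces to smaller eigenvalues. Every nonzero \<open>b j f\<close> is by
  induction a joint eigenvector of all number operators, and \<open>f\<close> is recovered as
  \<open>1 / c\<close> times the sum of the \<open>bs j (b j f)\<close>. These summands have the
  same occupation numbers because their levels agree.\<close>

lemma Ker_eigen_exists:
  assumes "f \<in> Ker c" "f \<noteq> 0"
  shows "\<exists>m. c = of_real (level m) \<and> (\<forall>i\<in>I. bs i (b i f) = fscale (of_real (real (m i) * \<nu> i)) f)"
proof -
  obtain \<nu>0 where \<nu>0: "\<nu>0 > 0" "\<And>i. i \<in> I \<Longrightarrow> \<nu>0 \<le> \<nu> i" using \<nu>_lower_bound by auto
  have main: "Re c < real N * \<nu>0 \<Longrightarrow> f \<in> Ker c \<Longrightarrow> f \<noteq> 0 \<Longrightarrow>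
     \<exists>m. c = of_real (level m) \<and> (\<forall>i\<in>I. bs i (b i f) = fscale (of_real (real (m i) * \<nu> i)) f)" for N c f
  proof (induction N arbitrary: c f)
    case 0
    from Ker_eigenvalue(2)[OF 0(2,3)] 0(1) show ?case by simp
  next
    case (Suc N)
    have f: "f \<in> S" "A f = fscale c f" using Suc.prems by (auto simp: Ker_def)
    show ?case
    proof (cases "c = 0")
      case True
      then have "\<forall>i\<in>I. b i f = 0" using Suc.prems Ker_zero_iff by auto
      then show ?thesis using True by (intro exI[of _ "\<lambda>_. 0"]) (auto simp: level_def)
    next
      case False
      have IH: "\<exists>m. c - of_real (\<nu> j) = of_real (level m) \<and> (\<forall>i\<in>I. bs i (b i (b j f)) = fscale (of_real (real (m i) * \<nu> i)) (b j f))"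
        if "j \<in> I" "b j f \<noteq> 0" for j
        using Suc.prems(1) \<nu>0(2)[OF that(1)] that by (intro Suc.IH b_Ker Suc.prems) (auto simp: algebra_simps)
      have "\<exists>j\<in>I. b j f \<noteq> 0"
      proof (rule ccontr)
        assume "\<not> ?thesis"
        then have "A f = 0" by (simp add: A_def)
        then show False using f False Suc.prems(3) by auto
      qed
      then obtain j0 where j0: "j0 \<in> I" "b j0 f \<noteq> 0" by auto
      from IH[OF j0] obtain m0 where m0: "c - of_real (\<nu> j0) = of_real (level m0)" by auto
      define m where "m = m0(j0 := Suc (m0 j0))"
      have c: "c = of_real (level m)" using m0 j0 by (simp add: m_def level_upd algebra_simps)
      have num: "bs i (b i (bs j (b j f))) = fscale (of_real (real (m i) * \<nu> i)) (bs j (b j f))" if i: "i \<in> I" and j: "j \<in> I" for i j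
      proof (cases "b j f = 0")
        case True then show ?thesis using i j by simp
      next
        case False
        from IH[OF j False] obtain m' where m': "c - of_real (\<nu> j) = of_real (level m')"
           "bs i (b i (b j f)) = fscale (of_real (real (m' i) * \<nu> i)) (b j f)" using i by auto
        \<comment> \<open>The occupation numbers found after lowering in direction \<open>j\<close>
          might depend on \<open>j\<close>; equality of levels excludes this.\<close>
        have "complex_of_real (level m) = of_real (level (m'(j := Suc (m' j))))"
          using m'(1) c j by (simp add: level_upd algebra_simps)
        then have "m i = (m'(j := Suc (m' j))) i" using level_inj[OF _ i] of_real_eq_iff by blast
        then show ?thesis using i j f m'(2)
          by (auto simp: number_bs b_in bs_in bs_scale fun_space.scale_left_distrib distrib_right)
      qed
      have "fscale (1 / c) (A f) = f" using False by (simp add: f(2))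
      then have feq: "f = fscale (1 / c) (\<Sum>j\<in>I. bs j (b j f))"
        unfolding A_def by (rule sym)
      have "bs i (b i f) = fscale (of_real (real (m i) * \<nu> i)) f" if i: "i \<in> I" for i
      proof -
        have "bs i (b i f) = bs i (b i (fscale (1 / c) (\<Sum>j\<in>I. bs j (b j f))))" using feq by (rule arg_cong)
        also have "\<dots> = fscale (1 / c) (\<Sum>j\<in>I. bs i (b i (bs j (b j f))))"
          using i f by (simp add: b_scale bs_scale b_sum bs_sum b_in bs_in)
        also have "\<dots> = fscale (1 / c) (\<Sum>j\<in>I. fscale (of_real (real (m i) * \<nu> i)) (bs j (b j f)))"
          using num i by simp
        also have "\<dots> = fscale (of_real (real (m i) * \<nu> i)) (fscale (1 / c) (\<Sum>j\<in>I. bs j (b j f)))"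
          by (simp add: fun_space.scale_sum_right mult.commute)
        also have "\<dots> = fscale (of_real (real (m i) * \<nu> i)) f" using feq by (rule arg_cong[OF sym])
        finally show ?thesis .
      qed
      then show ?thesis using c by blast
    qed
  qed
  obtain N where "Re c / \<nu>0 < real N" using reals_Archimedean2 by blast
  then show ?thesis using main[of c N f] assms \<nu>0 by (simp add: field_simps)
qed

lemma Ker_number:
  assumes "f \<in> Ker (of_real (level m))" "i \<in> I"
  shows "bs i (b i f) = fscale (of_real (real (m i) * \<nu> i)) f"
proof (cases "f = 0")
  case True then show ?thesis using assms by simp
next
  case False
  from Ker_eigen_exists[OF assms(1) False] obtain m' where m': "complex_of_real (level m) = of_real (level m')"
    "bs i (b i f) = fscale (of_real (real (m' i) * \<nu> i)) f" using assms(2) by auto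
  then have "m i = m' i" using level_inj[OF _ assms(2)] of_real_eq_iff by blast
  then show ?thesis using m' by simp
qed

text \<open>Quanta are added one at a time, by induction on their total number. On the lower level
  \<open>b j\<close> after \<open>bs j\<close> is multiplication by the nonzero number
  \<open>m j * \<nu> j\<close>, and \<open>Ker_number\<close> gives the inverse from the other side.
  All eigenspaces of \<open>A\<close> are thus copies of the space of ground states.\<close>

lemma Ker_iso:
  "\<exists>T. bij_betw T (Ker 0) (Ker (of_real (level m))) \<and>
     (\<forall>f\<in>Ker 0. \<forall>g\<in>Ker 0. T (f + g) = T f + T g) \<and> (\<forall>c. \<forall>f\<in>Ker 0. T (fscale c f) = fscale c (T f))"
proof (induction "\<Sum>i\<in>I. m i" arbitrary: m)
  case 0
  then have "level m = 0" by (simp add: level_def)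
  then show ?case by (intro exI[of _ "\<lambda>f. f"]) (auto simp: bij_betw_def)
next
  case (Suc N)
  then have "\<exists>j\<in>I. m j \<noteq> 0" by (metis Zero_not_Suc sum.neutral)
  then obtain j where j: "j \<in> I" "m j \<noteq> 0" by auto
  define m' where "m' = m(j := m j - 1)"
  have m: "m = m'(j := Suc (m' j))" using j by (auto simp: m'_def)
  have lev: "level m = level m' + \<nu> j" using level_upd[OF j(1), of m'] m by simp
  have "(\<Sum>i\<in>I. m i) = (\<Sum>i\<in>I. m' i + (if i = j then 1 else 0))"
    using j by (intro sum.cong) (auto simp: m'_def)
  then have "N = (\<Sum>i\<in>I. m' i)" using Suc.hyps(2) j by (simp add: sum.distrib)
  from Suc.hyps(1)[OF this] obtain T where T: "bij_betw T (Ker 0) (Ker (of_real (level m')))"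
     "\<And>f g. f\<in>Ker 0 \<Longrightarrow> g\<in>Ker 0 \<Longrightarrow> T (f + g) = T f + T g" "\<And>f c. f\<in>Ker 0 \<Longrightarrow> T (fscale c f) = fscale c (T f)" by auto
  have inS: "f \<in> Ker c \<Longrightarrow> f \<in> S" for f c by (simp add: Ker_def)
  have 1: "b j (bs j f) = fscale (of_real (real (m j) * \<nu> j)) f" if "f \<in> Ker (of_real (level m'))" for f
  proof -
    have "complex_of_real (real (m j) * \<nu> j) = of_real (real (m' j) * \<nu> j) + of_real (\<nu> j)"
      using j by (simp add: m'_def of_nat_diff algebra_simps)
    then show ?thesis
      using b_bs[OF j(1) j(1) inS[OF that]] Ker_number[OF that j(1)] by (simp add: fun_space.scale_left_distrib)
  qed
  have nz: "complex_of_real (real (m j) * \<nu> j) \<noteq> 0" using j \<nu>_pos[OF j(1)] by simp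
  have "inj_on (bs j) (Ker (of_real (level m')))"
    using 1 nz by (intro inj_onI) (metis fun_space.scale_left_imp_eq)
  moreover have "bs j ` Ker (of_real (level m')) = Ker (of_real (level m))"
  proof safe
    fix f assume "f \<in> Ker (of_real (level m'))"
    then show "bs j f \<in> Ker (of_real (level m))" using bs_Ker[OF j(1), of f "of_real (level m)"] lev by simp
  next
    fix f assume f: "f \<in> Ker (of_real (level m))"
    have "b j f \<in> Ker (of_real (level m'))" using b_Ker[OF j(1) f] lev by simp
    then have "fscale (1 / of_real (real (m j) * \<nu> j)) (b j f) \<in> Ker (of_real (level m'))"
      by (rule fun_space.subspace_scale[OF Ker_subspace])
    moreover have "f = bs j (fscale (1 / of_real (real (m j) * \<nu> j)) (b j f))"
      using Ker_number[OF f j(1)] nz inS[OF f] by (simp add: bs_scale j b_in)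
    ultimately show "f \<in> bs j ` Ker (of_real (level m'))" by blast
  qed
  ultimately have "bij_betw (bs j) (Ker (of_real (level m'))) (Ker (of_real (level m)))" by (simp add: bij_betw_def)
  then have "bij_betw (bs j \<circ> T) (Ker 0) (Ker (of_real (level m)))" using T(1) bij_betw_trans by blast
  moreover have "T f \<in> S" if "f \<in> Ker 0" for f using that T(1) inS by (auto simp: bij_betw_def)
  ultimately show ?case using T j
    by (intro exI[of _ "bs j \<circ> T"]) (auto simp: bs_add bs_scale)
qed

end

section \<open>Integration\<close>

text \<open>The filter is tested on sequences; measurability and domination hold only eventually, so
  the sequence is shifted by \<open>N\<close> before dominated convergence is applied.\<close>

lemma tendsto_integral_dominated:
  fixes f :: "'a::metric_space \<Rightarrow> 'x \<Rightarrow> 'b::{banach, second_countable_topology}"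
  assumes "eventually (\<lambda>z. f z \<in> borel_measurable M) (at a within T)" "g \<in> borel_measurable M" "integrable M w"
    and lim: "\<And>x. x \<in> space M \<Longrightarrow> ((\<lambda>z. f z x) \<longlongrightarrow> g x) (at a within T)"
    and bound: "eventually (\<lambda>z. \<forall>x\<in>space M. norm (f z x) \<le> w x) (at a within T)"
  shows "((\<lambda>z. \<integral>x. f z x \<partial>M) \<longlongrightarrow> (\<integral>x. g x \<partial>M)) (at a within T)"
  unfolding tendsto_at_iff_sequentially comp_def
proof (intro allI impI)
  fix X :: "nat \<Rightarrow> 'a" assume X: "\<forall>i. X i \<in> T - {a}" "X \<longlonglongrightarrow> a"
  have fl: "filterlim X (at a within T) sequentially"
    unfolding filterlim_at using X by (auto intro: always_eventually)
  from eventually_compose_filterlim[OF eventually_conj[OF assms(1) bound] fl] obtain N where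
    N: "\<And>i. i \<ge> N \<Longrightarrow> f (X i) \<in> borel_measurable M" "\<And>i x. i \<ge> N \<Longrightarrow> x \<in> space M \<Longrightarrow> norm (f (X i) x) \<le> w x"
    unfolding eventually_sequentially by auto
  show "(\<lambda>i. \<integral>x. f (X i) x \<partial>M) \<longlonglongrightarrow> (\<integral>x. g x \<partial>M)"
  proof (rule LIMSEQ_offset[where k=N], rule integral_dominated_convergence[where w=w])
    show "AE x in M. (\<lambda>i. f (X (i + N)) x) \<longlonglongrightarrow> g x"
      using filterlim_compose[OF lim fl] by (intro AE_I2 LIMSEQ_ignore_initial_segment)
  qed (use N assms in auto)
qed

lemma continuous_on_integral_dominated:
  fixes f :: "'a::metric_space \<Rightarrow> 'x \<Rightarrow> 'b::{banach, second_countable_topology}"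
  assumes "\<And>z. z \<in> T \<Longrightarrow> f z \<in> borel_measurable M" "integrable M w"
    and "\<And>x. x \<in> space M \<Longrightarrow> continuous_on T (\<lambda>z. f z x)"
    and "\<And>z x. z \<in> T \<Longrightarrow> x \<in> space M \<Longrightarrow> norm (f z x) \<le> w x"
  shows "continuous_on T (\<lambda>z. \<integral>x. f z x \<partial>M)"
  unfolding continuous_on_def
proof
  fix a assume a: "a \<in> T"
  show "((\<lambda>z. \<integral>x. f z x \<partial>M) \<longlongrightarrow> (\<integral>x. f a x \<partial>M)) (at a within T)"
    using assms a by (intro tendsto_integral_dominated[where w=w]) (auto simp: continuous_on_def eventually_at_filter)
qed

text \<open>The bound on the derivative over a ball also bounds the difference quotients, by the
  mean value inequality. Dominated convergence over all increments at once then gives the full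
  derivative and not only directional ones.\<close>

lemma has_derivative_integral:
  fixes f :: "'v::{real_normed_vector, perfect_space} \<Rightarrow> 'x \<Rightarrow> 'b::euclidean_space"
  assumes r: "r > 0"
    and meas: "\<And>z. z \<in> ball z0 r \<Longrightarrow> f z \<in> borel_measurable M" "\<And>v. (\<lambda>x. f' z0 x v) \<in> borel_measurable M"
    and der: "\<And>z x. z \<in> ball z0 r \<Longrightarrow> x \<in> space M \<Longrightarrow> ((\<lambda>z. f z x) has_derivative f' z x) (at z)"
    and bound: "\<And>z x v. z \<in> ball z0 r \<Longrightarrow> x \<in> space M \<Longrightarrow> norm (f' z x v) \<le> w x * norm v"
    and int: "integrable M w" "integrable M (f z0)"
  shows "((\<lambda>z. \<integral>x. f z x \<partial>M) has_derivative (\<lambda>v. \<integral>x. f' z0 x v \<partial>M)) (at z0)"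
proof -
  have z0: "z0 \<in> ball z0 r" using r by simp
  have int': "integrable M (\<lambda>x. f' z0 x v)" for v
  proof (rule Bochner_Integration.integrable_bound[of M "\<lambda>x. w x * norm v"])
    show "AE x in M. norm (f' z0 x v) \<le> norm (w x * norm v)"
      unfolding real_norm_def by (rule AE_I2, rule order_trans[OF bound[OF z0] abs_ge_self])
  qed (use int meas in auto)
  have lip: "norm (f (z0 + h) x - f z0 x) \<le> w x * norm h" if "norm h < r" "x \<in> space M" for h x
  proof -
    have "norm (f (z0 + h) x - f z0 x) \<le> w x * norm ((z0 + h) - z0)"
    proof (rule differentiable_bound[where S="ball z0 r" and f = "\<lambda>z. f z x" and f'="\<lambda>z. f' z x"])
      show "\<And>z. z \<in> ball z0 r \<Longrightarrow> ((\<lambda>z. f z x) has_derivative f' z x) (at z within ball z0 r)"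
        using der that(2) by (blast intro: has_derivative_at_withinI)
      show "\<And>z. z \<in> ball z0 r \<Longrightarrow> onorm (f' z x) \<le> w x"
        using bound[OF _ that(2)] by (intro onorm_le) blast
    qed (use that r in \<open>auto simp: dist_norm\<close>)
    then show ?thesis by simp
  qed
  have intz: "integrable M (f (z0 + h))" if "norm h < r" for h
  proof -
    have "integrable M (\<lambda>x. f (z0 + h) x - f z0 x)"
    proof (rule Bochner_Integration.integrable_bound[of M "\<lambda>x. w x * norm h"])
      show "AE x in M. norm (f (z0 + h) x - f z0 x) \<le> norm (w x * norm h)"
        unfolding real_norm_def by (rule AE_I2, rule order_trans[OF lip[OF that] abs_ge_self])
      show "(\<lambda>x. f (z0 + h) x - f z0 x) \<in> borel_measurable M"
        by (intro borel_measurable_diff meas) (use that r in \<open>auto simp: dist_norm\<close>)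
    qed (use int in auto)
    from Bochner_Integration.integrable_add[OF this int(2)] show ?thesis by simp
  qed
  have lin: "linear (f' z0 x)" if "x \<in> space M" for x
    using der[OF z0 that] has_derivative_linear by blast
  have bl: "bounded_linear (\<lambda>v. \<integral>x. f' z0 x v \<partial>M)"
  proof (rule bounded_linear_intro[where K="\<integral>x. w x \<partial>M"])
    fix u v show "(\<integral>x. f' z0 x (u + v) \<partial>M) = (\<integral>x. f' z0 x u \<partial>M) + (\<integral>x. f' z0 x v \<partial>M)"
      by (subst Bochner_Integration.integral_add[OF int' int', symmetric])
         (rule Bochner_Integration.integral_cong[OF refl linear_add[OF lin]])
    fix c show "(\<integral>x. f' z0 x (c *\<^sub>R v) \<partial>M) = c *\<^sub>R (\<integral>x. f' z0 x v \<partial>M)"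
      by (subst Bochner_Integration.integral_scaleR_right[symmetric])
         (rule Bochner_Integration.integral_cong[OF refl linear_scale[OF lin]])
    have "norm (\<integral>x. f' z0 x v \<partial>M) \<le> (\<integral>x. w x * norm v \<partial>M)"
      by (rule order_trans[OF integral_norm_bound integral_mono]) (use int int' bound[OF z0] in auto)
    then show "norm (\<integral>x. f' z0 x v \<partial>M) \<le> norm v * (\<integral>x. w x \<partial>M)" by (simp add: mult.commute)
  qed
  have ev: "eventually (\<lambda>h. norm h < r) (at (0::'v))"
    using r by (auto simp: eventually_at dist_norm)
  \<comment> \<open>In the dominating function \<open>2 * w x\<close> one copy of \<open>w x\<close>
    controls the difference quotient and the other the linear term.\<close>
  have "((\<lambda>h. \<integral>x. (f (z0 + h) x - f z0 x - f' z0 x h) /\<^sub>R norm h \<partial>M) \<longlongrightarrow> (\<integral>x. 0 \<partial>M)) (at 0)"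
  proof (rule tendsto_integral_dominated[where w = "\<lambda>x. 2 * w x"])
    show "\<forall>\<^sub>F z in at 0. (\<lambda>x. (f (z0 + z) x - f z0 x - f' z0 x z) /\<^sub>R norm z) \<in> borel_measurable M"
      using ev by eventually_elim (use meas z0 in \<open>auto intro!: borel_measurable_scaleR borel_measurable_diff simp: dist_norm\<close>)
    fix x assume x: "x \<in> space M"
    show "((\<lambda>z. (f (z0 + z) x - f z0 x - f' z0 x z) /\<^sub>R norm z) \<longlongrightarrow> 0) (at 0)"
      using der[OF z0 x] unfolding has_derivative_at
      by (subst tendsto_norm_zero_iff[symmetric]) (simp add: divide_inverse mult.commute)
  next
    show "\<forall>\<^sub>F z in at 0. \<forall>x\<in>space M. norm ((f (z0 + z) x - f z0 x - f' z0 x z) /\<^sub>R norm z) \<le> 2 * w x"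
      using ev eventually_neq_at_within[of 0 0 UNIV]
    proof eventually_elim
      case (elim h)
      have "norm (f (z0 + h) x - f z0 x - f' z0 x h) \<le> 2 * w x * norm h" if "x \<in> space M" for x
        using norm_triangle_ineq4[of "f (z0 + h) x - f z0 x" "f' z0 x h"] lip[OF elim(1) that] bound[OF z0 that, of h] by simp
      moreover have "norm h > 0" using elim(2) by simp
      ultimately show ?case by (simp add: pos_divide_le_eq divide_inverse_commute[symmetric])
    qed
  qed (use int in auto)
  then have "((\<lambda>h. norm (\<integral>x. (f (z0 + h) x - f z0 x - f' z0 x h) /\<^sub>R norm h \<partial>M)) \<longlongrightarrow> 0) (at 0)"
    using tendsto_norm_zero by force
  then have "((\<lambda>h. norm ((\<integral>x. f (z0 + h) x \<partial>M) - (\<integral>x. f z0 x \<partial>M) - (\<integral>x. f' z0 x h \<partial>M)) / norm h) \<longlongrightarrow> 0) (at 0)"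
  proof (rule Lim_transform_eventually)
    show "\<forall>\<^sub>F h in at 0. norm (\<integral>x. (f (z0 + h) x - f z0 x - f' z0 x h) /\<^sub>R norm h \<partial>M)
       = norm ((\<integral>x. f (z0 + h) x \<partial>M) - (\<integral>x. f z0 x \<partial>M) - (\<integral>x. f' z0 x h \<partial>M)) / norm h"
      using ev
    proof eventually_elim
      case (elim h)
      then show ?case using intz[OF elim] int int'
        by (simp add: Bochner_Integration.integral_diff Bochner_Integration.integrable_diff divide_inverse)
    qed
  qed
  then show ?thesis unfolding has_derivative_at using bl by simp
qed

lemma integrable_exp_abs_real:
  fixes a :: real assumes "a > 0"
  shows "(\<integral>\<^sup>+x. ennreal (exp (- a * \<bar>x\<bar>)) \<partial>lborel) < \<infinity>"
proof -
  have 1: "(\<integral>\<^sup>+x. ennreal (exp (- a * x)) * indicator {0..} x \<partial>lborel) = ennreal (0 - (- exp (- a * 0) / a))"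
  proof (rule nn_integral_FTC_atLeast)
    have "((\<lambda>x. - exp (- a * x) / a) \<longlongrightarrow> - 0 / a) at_top"
      using assms by (intro tendsto_intros filterlim_compose[OF exp_at_bot] filterlim_tendsto_neg_mult_at_bot[OF tendsto_const] filterlim_ident) auto
    then show "((\<lambda>x. - exp (- a * x) / a) \<longlongrightarrow> 0) at_top" by simp
  qed (use assms in \<open>auto intro!: derivative_eq_intros\<close>)
  have 2: "(\<integral>\<^sup>+x. ennreal (exp (a * x)) * indicator {..0} x \<partial>lborel) = (\<integral>\<^sup>+x. ennreal (exp (- a * x)) * indicator {0..} x \<partial>lborel)"
    by (subst nn_integral_real_affine[where c="-1" and t=0]) (auto intro!: nn_integral_cong split: split_indicator)
  have "(\<integral>\<^sup>+x. ennreal (exp (- a * \<bar>x\<bar>)) \<partial>lborel) \<le> (\<integral>\<^sup>+x. ennreal (exp (- a * x)) * indicator {0..} x + ennreal (exp (a * x)) * indicator {..0} x \<partial>lborel)"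
    by (intro nn_integral_mono) (auto split: split_indicator)
  also have "\<dots> = (\<integral>\<^sup>+x. ennreal (exp (- a * x)) * indicator {0..} x \<partial>lborel) + (\<integral>\<^sup>+x. ennreal (exp (a * x)) * indicator {..0} x \<partial>lborel)"
    by (rule nn_integral_add) auto
  also have "\<dots> < \<infinity>" unfolding 2 unfolding 1 by simp
  finally show ?thesis .
qed

text \<open>The norm is at least the average of the absolute coordinates, which bounds the integrand
  by a product of one-dimensional exponentials; this is why \<open>c\<close> is \<open>a\<close>
  divided by the dimension.\<close>

lemma integrable_exp_norm:
  fixes a :: real assumes "a > 0"
  shows "integrable lborel (\<lambda>x::'v::euclidean_space. exp (- a * norm x))"
proof (rule integrableI_nonneg)
  define c where "c = a / DIM('v)"
  have c: "c > 0" using assms by (simp add: c_def)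
  have "(\<integral>\<^sup>+x. ennreal (exp (- a * norm (x::'v))) \<partial>lborel) \<le> (\<integral>\<^sup>+x. (\<Prod>b\<in>(Basis::'v set). ennreal (exp (- c * \<bar>x \<bullet> b\<bar>))) \<partial>lborel)"
  proof (rule nn_integral_mono)
    fix x :: 'v
    have "(\<Sum>b\<in>Basis. c * \<bar>x \<bullet> b\<bar>) \<le> (\<Sum>b\<in>(Basis::'v set). c * norm x)"
      using c by (intro sum_mono mult_left_mono Basis_le_norm) auto
    also have "\<dots> = a * norm x" by (simp add: c_def)
    finally show "ennreal (exp (- a * norm x)) \<le> (\<Prod>b\<in>Basis. ennreal (exp (- c * \<bar>x \<bullet> b\<bar>)))"
      by (subst prod_ennreal) (auto simp: exp_sum[symmetric] sum_negf intro!: ennreal_leI)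
  qed
  also have "\<dots> = (\<Prod>b\<in>(Basis::'v set). (\<integral>\<^sup>+x. ennreal (exp (- c * \<bar>x\<bar>)) \<partial>lborel))"
    by (rule nn_integral_lborel_prod[where f = "\<lambda>b x. ennreal (exp (- c * \<bar>x\<bar>))"]) auto
  also have "\<dots> < \<infinity>" using integrable_exp_abs_real[OF c] by (simp add: power_less_top_ennreal)
  finally show "(\<integral>\<^sup>+x. ennreal (exp (- a * norm (x::'v))) \<partial>lborel) < \<infinity>" .
qed auto

text \<open>The \<open>k\<close>-th power of \<open>1 + x \<le> m * exp (a * x / k)\<close>, which
  holds as soon as \<open>m \<ge> 1\<close> and \<open>m \<ge> k / a\<close>.\<close>

lemma power_exp_bounded:
  fixes a :: real assumes "a > 0"
  obtains C where "C \<ge> 0" "\<And>x. x \<ge> 0 \<Longrightarrow> (1 + x) ^ k \<le> C * exp (a * x)"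
proof -
  define C where "C = (if k = 0 then 1 else (max 1 (real k / a)) ^ k)"
  have "(1 + x) ^ k \<le> C * exp (a * x)" if "x \<ge> 0" for x
  proof (cases "k = 0")
    case True then show ?thesis using assms that by (simp add: C_def)
  next
    case False
    define m where "m = max 1 (real k / a)"
    have m: "m \<ge> 1" "m * a / real k \<ge> 1" using assms False by (auto simp: m_def max_def field_simps)
    have "1 + x \<le> m * (1 + a * x / real k)"
      using m(1) mult_right_mono[OF m(2) that] by (simp add: algebra_simps)
    also have "\<dots> \<le> m * exp (a * x / real k)" using m by (intro mult_left_mono exp_ge_add_one_self) auto
    finally have "(1 + x) ^ k \<le> (m * exp (a * x / real k)) ^ k" using that by (intro power_mono) auto
    also have "\<dots> = C * exp (real k * (a * x / real k))" using False
      by (simp only: C_def m_def power_mult_distrib exp_of_nat_mult if_False)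
    also have "\<dots> = C * exp (a * x)" using False by simp
    finally show ?thesis .
  qed
  moreover have "C \<ge> 0" by (simp add: C_def)
  ultimately show thesis using that by blast
qed

lemma integrable_power_exp_norm:
  fixes a :: real assumes "a > 0"
  shows "integrable lborel (\<lambda>x::'v::euclidean_space. (1 + norm x) ^ k * exp (- a * norm x))"
proof -
  obtain C where C: "C \<ge> 0" "\<And>x::real. x \<ge> 0 \<Longrightarrow> (1 + x) ^ k \<le> C * exp (a / 2 * x)"
    using power_exp_bounded[of "a / 2" k] assms by auto
  show ?thesis
  proof (rule Bochner_Integration.integrable_bound)
    show "integrable lborel (\<lambda>x::'v. C * exp (- (a / 2) * norm x))"
      using integrable_exp_norm[of "a / 2"] assms by auto
    show "AE x::'v in lborel. norm ((1 + norm x) ^ k * exp (- a * norm x)) \<le> norm (C * exp (- (a / 2) * norm x))"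
    proof (rule AE_I2)
      fix x :: 'v
      have "(1 + norm x) ^ k * exp (- a * norm x) \<le> C * exp (a / 2 * norm x) * exp (- a * norm x)"
        by (intro mult_right_mono C) auto
      also have "\<dots> = C * exp (- (a / 2) * norm x)" by (simp add: exp_add[symmetric] mult.assoc algebra_simps)
      finally show "norm ((1 + norm x) ^ k * exp (- a * norm x)) \<le> norm (C * exp (- (a / 2) * norm x))"
        using C by simp
    qed
  qed simp
qed

lemma lborel_integral_translate:
  fixes f :: "'v::euclidean_space \<Rightarrow> 'b::{banach, second_countable_topology}"
  assumes "f \<in> borel_measurable borel"
  shows "(\<integral>x. f (x + c) \<partial>lborel) = (\<integral>x. f x \<partial>lborel)"
proof -
  have "(\<integral>x. f x \<partial>lborel) = (\<integral>x. f x \<partial>distr lborel borel ((+) c))" by (simp add: lborel_distr_plus)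
  also have "\<dots> = (\<integral>x. f (c + x) \<partial>lborel)" using assms by (subst integral_distr) auto
  finally show ?thesis by (simp add: add.commute)
qed

lemma lborel_integrable_translate:
  fixes f :: "'v::euclidean_space \<Rightarrow> 'b::{banach, second_countable_topology}"
  assumes "integrable lborel f"
  shows "integrable lborel (\<lambda>x. f (x + c))"
proof -
  have "integrable (distr lborel borel ((+) c)) f" using assms by (simp add: lborel_distr_plus)
  then have "integrable lborel (\<lambda>x. f (c + x))" by (rule integrable_distr[rotated]) auto
  then show ?thesis by (simp add: add.commute)
qed

text \<open>Serves two rescalings of Gaussians: the one that removes the singularity of the heat
  kernel, and the one that turns narrow Gaussians into an approximate identity.\<close>

lemma lborel_integral_diag:
  fixes f :: "'v::euclidean_space \<Rightarrow> complex"
  assumes "\<And>b. b \<in> Basis \<Longrightarrow> c b > 0" "f \<in> borel_measurable borel"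
  shows "(\<integral>x. f x \<partial>lborel) = of_real (\<Prod>b\<in>Basis. c b) * (\<integral>x. f (\<Sum>b\<in>Basis. (c b * (x \<bullet> b)) *\<^sub>R b) \<partial>lborel)"
proof -
  have p: "(\<Prod>b\<in>Basis. \<bar>c b\<bar>) = (\<Prod>b\<in>Basis. c b)" using assms by (intro prod.cong) (auto simp: less_imp_le)
  have "(\<integral>x. f x \<partial>lborel) = (\<integral>x. f x \<partial>density (distr lborel borel (\<lambda>x. 0 + (\<Sum>j\<in>Basis. (c j * (x \<bullet> j)) *\<^sub>R j))) (\<lambda>_. (\<Prod>j\<in>Basis. \<bar>c j\<bar>)))"
    using assms(1) by (subst lborel_affine_euclidean[where c = c and t = 0]) force+
  also have "\<dots> = (\<integral>x. (\<Prod>b\<in>Basis. c b) *\<^sub>R f (\<Sum>b\<in>Basis. (c b * (x \<bullet> b)) *\<^sub>R b) \<partial>lborel)"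
    using assms unfolding p
    by (subst integral_density) (auto simp: integral_distr intro!: prod_nonneg prod_pos less_imp_le AE_I2)
  finally show ?thesis by (simp add: scaleR_conv_of_real)
qed

section \<open>Lattices and periodic functions\<close>

definition periodic :: "'v::real_vector set \<Rightarrow> ('v \<Rightarrow> 'b) \<Rightarrow> bool" where
  "periodic U f \<longleftrightarrow> (\<forall>u\<in>U. \<forall>z. f (z + u) = f z)"

lemma vector_derivative_difference_quotient:
  fixes g :: "'v::real_normed_vector \<Rightarrow> 'b::real_normed_vector"
  assumes "((\<lambda>t. g (z + t *\<^sub>R w)) has_vector_derivative D) (at 0)"
  shows "((\<lambda>h. (1 / h) *\<^sub>R (g (z + h *\<^sub>R w) - g z)) \<longlongrightarrow> D) (at 0)"
proof -
  have "((\<lambda>h. norm (g (z + h *\<^sub>R w) - g z - h *\<^sub>R D) / norm h) \<longlongrightarrow> 0) (at 0)"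
    using assms unfolding has_vector_derivative_def has_derivative_iff_norm by simp
  moreover have "eventually (\<lambda>h. norm (g (z + h *\<^sub>R w) - g z - h *\<^sub>R D) / norm h = norm ((1 / h) *\<^sub>R (g (z + h *\<^sub>R w) - g z) - D)) (at 0)"
    using eventually_neq_at_within[of "0::real" 0 UNIV]
  proof eventually_elim
    case (elim h)
    then have "g (z + h *\<^sub>R w) - g z - h *\<^sub>R D = h *\<^sub>R ((1 / h) *\<^sub>R (g (z + h *\<^sub>R w) - g z) - D)"
      by (simp add: scaleR_right_diff_distrib)
    then show ?case using elim by simp
  qed
  ultimately have "((\<lambda>h. norm ((1 / h) *\<^sub>R (g (z + h *\<^sub>R w) - g z) - D)) \<longlongrightarrow> 0) (at 0)"
    by (rule Lim_transform_eventually)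
  then show ?thesis using tendsto_norm_zero_iff LIM_zero_iff by blast
qed

text \<open>A real basis with its integer span. Passing to this description from a discrete subgroup
  of full rank is the content of \<open>is_lattice_obtain\<close>.\<close>

locale lattice =
  fixes B U :: "'v::euclidean_space set"
  assumes B: "independent B" "span B = UNIV"
    and U_eq: "U = {\<Sum>b\<in>B. of_int (k b) *\<^sub>R b | k. True}"
begin

lemma finite_B [simp]: "finite B" using B(1) by (rule independent_imp_finite)

definition crd :: "'v \<Rightarrow> 'v \<Rightarrow> real" where "crd b z = representation B z b"

lemma crd_sum: "(\<Sum>b\<in>B. crd b z *\<^sub>R b) = z"
  unfolding crd_def using B by (intro real_vector.sum_representation_eq) auto

lemma crd_combination:
  assumes "b \<in> B" shows "crd b (\<Sum>c\<in>B. f c *\<^sub>R c) = f b"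
proof -
  have "representation B (\<Sum>c\<in>B. f c *\<^sub>R c) b = (\<Sum>c\<in>B. f c * representation B c b)"
    using B by (simp add: real_vector.representation_sum real_vector.representation_scale)
  also have "\<dots> = (\<Sum>c\<in>B. if c = b then f b else 0)"
    using B by (intro sum.cong) (auto simp: real_vector.representation_basis)
  finally show ?thesis using assms by (simp add: crd_def)
qed

lemma linear_crd: "linear (crd b)"
  by (rule linearI) (use B in \<open>auto simp: crd_def real_vector.representation_add real_vector.representation_scale\<close>)

lemma crd_eqI: "(\<And>b. b \<in> B \<Longrightarrow> crd b z = crd b w) \<Longrightarrow> z = w"
  using crd_sum[of z] crd_sum[of w] by (metis (no_types, lifting) sum.cong)

lemma crd_simps [simp]: "crd b (z + w) = crd b z + crd b w" "crd b (z - w) = crd b z - crd b w" "crd b (- z) = - crd b z" "crd b 0 = 0"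
  using linear_crd[of b] by (simp_all add: linear_add linear_diff linear_neg linear_0)

lemma continuous_on_crd [continuous_intros]: "continuous_on S f \<Longrightarrow> continuous_on S (\<lambda>x. crd b (f x))"
  by (rule bounded_linear.continuous_on[OF linear_conv_bounded_linear[THEN iffD1, OF linear_crd]])

lemma measurable_crd [measurable]: "crd b \<in> borel_measurable borel"
  using continuous_on_crd[of UNIV "\<lambda>z. z"] by (intro borel_measurable_continuous_onI) auto

lemma U_iff: "u \<in> U \<longleftrightarrow> (\<forall>b\<in>B. crd b u \<in> \<int>)"
proof
  assume "\<forall>b\<in>B. crd b u \<in> \<int>"
  then have *: "u = (\<Sum>b\<in>B. of_int \<lfloor>crd b u\<rfloor> *\<^sub>R b)"
    by (subst crd_sum[of u, symmetric]) (auto simp: of_int_floor intro!: sum.cong)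
  show "u \<in> U" unfolding U_eq by (intro CollectI exI[of _ "\<lambda>b. \<lfloor>crd b u\<rfloor>"] conjI TrueI *)
qed (auto simp: U_eq crd_combination)

lemma U_group: "0 \<in> U" "u \<in> U \<Longrightarrow> v \<in> U \<Longrightarrow> u + v \<in> U" "u \<in> U \<Longrightarrow> v \<in> U \<Longrightarrow> u - v \<in> U" "u \<in> U \<Longrightarrow> - u \<in> U"
  by (auto simp: U_iff)

lemma crd_bound: "\<exists>K. \<forall>b\<in>B. \<forall>z. \<bar>crd b z\<bar> \<le> K * norm z"
proof -
  have "\<forall>b. \<exists>K. \<forall>z. norm (crd b z) \<le> norm z * K"
    using linear_crd linear_conv_bounded_linear bounded_linear.bounded by blast
  then obtain K where K: "\<And>b z. \<bar>crd b z\<bar> \<le> norm z * K b" by (metis real_norm_def)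
  have "\<bar>crd b z\<bar> \<le> (\<Sum>b\<in>B. \<bar>K b\<bar>) * norm z" if "b \<in> B" for b z
  proof -
    have "norm z * K b \<le> norm z * (\<Sum>b\<in>B. \<bar>K b\<bar>)"
      using member_le_sum[OF that, of "\<lambda>b. \<bar>K b\<bar>"] abs_ge_self[of "K b"] by (intro mult_left_mono) auto
    then show ?thesis using K[of b z] by (simp add: mult.commute)
  qed
  then show ?thesis by blast
qed

text \<open>A bound on the norm bounds the integer coordinates, which leaves a finite box.\<close>

lemma finite_U_bounded: "finite {u \<in> U. norm u \<le> R}"
proof -
  obtain K where K: "\<forall>b\<in>B. \<forall>z. \<bar>crd b z\<bar> \<le> K * norm z" using crd_bound by blast
  let ?M = "\<lceil>\<bar>K\<bar> * \<bar>R\<bar>\<rceil>"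
  have "{u \<in> U. norm u \<le> R} \<subseteq> (\<lambda>k. \<Sum>b\<in>B. of_int (k b) *\<^sub>R b) ` (PiE B (\<lambda>_. {- ?M .. ?M}))"
  proof safe
    fix u assume u: "u \<in> U" "norm u \<le> R"
    define k where "k = restrict (\<lambda>b. \<lfloor>crd b u\<rfloor>) B"
    have k: "of_int (k b) = crd b u" if "b \<in> B" for b using u that by (auto simp: U_iff k_def of_int_floor)
    have "k b \<in> {- ?M .. ?M}" if b: "b \<in> B" for b
    proof -
      have "\<bar>crd b u\<bar> \<le> K * norm u" using K b by blast
      also have "\<dots> \<le> \<bar>K\<bar> * \<bar>R\<bar>" using u by (intro mult_mono) auto
      finally have "\<bar>of_int (k b)\<bar> \<le> real_of_int ?M" using k[OF b] by linarith
      then show ?thesis by (simp add: abs_le_iff)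
    qed
    then have "k \<in> PiE B (\<lambda>_. {- ?M .. ?M})" by (auto simp: k_def)
    moreover have "u = (\<Sum>b\<in>B. of_int (k b) *\<^sub>R b)" using crd_sum[of u] k by simp
    ultimately show "u \<in> (\<lambda>k. \<Sum>b\<in>B. of_int (k b) *\<^sub>R b) ` (PiE B (\<lambda>_. {- ?M .. ?M}))" by blast
  qed
  then show ?thesis by (rule finite_subset) (auto intro!: finite_imageI finite_PiE)
qed

text \<open>Half open, so that translates tile without overlap. The base point is kept free in order
  that any prescribed point can be made interior.\<close>

definition cell :: "'v \<Rightarrow> 'v set" where "cell c = {z. \<forall>b\<in>B. 0 \<le> crd b (z - c) \<and> crd b (z - c) < 1}"

definition lattice_floor :: "'v \<Rightarrow> 'v" where "lattice_floor z = (\<Sum>b\<in>B. of_int \<lfloor>crd b z\<rfloor> *\<^sub>R b)"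

lemma lattice_floor_U: "lattice_floor z \<in> U" by (auto simp: lattice_floor_def U_eq)
lemma crd_lattice_floor: "b \<in> B \<Longrightarrow> crd b (lattice_floor z) = of_int \<lfloor>crd b z\<rfloor>"
  by (simp add: lattice_floor_def crd_combination)
lemma lattice_floor_add: "u \<in> U \<Longrightarrow> lattice_floor (z + u) = lattice_floor z + u"
  by (rule crd_eqI) (auto simp: U_iff crd_lattice_floor elim!: Ints_cases)

lemma bounded_cell: "bounded (cell c)"
  unfolding bounded_def
proof (intro exI ballI)
  fix z assume z: "z \<in> cell c"
  have "norm (z - c) \<le> (\<Sum>b\<in>B. norm (crd b (z - c) *\<^sub>R b))"
    using norm_sum[of "\<lambda>b. crd b (z - c) *\<^sub>R b" B] by (simp only: crd_sum)
  also have "\<dots> \<le> (\<Sum>b\<in>B. norm b)" using z by (intro sum_mono) (auto simp: cell_def intro!: mult_left_le_one_le)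
  finally show "dist c z \<le> (\<Sum>b\<in>B. norm b)" by (simp add: dist_norm norm_minus_commute)
qed

lemma fundamental_domain_cell: "fundamental_domain U (cell c)"
  unfolding fundamental_domain_def
proof (intro conjI allI bounded_cell)
  have "cell c = (\<Inter>b\<in>B. {z. 0 \<le> crd b (z - c) \<and> crd b (z - c) < 1}) \<inter> UNIV" by (auto simp: cell_def)
  moreover have "{z. 0 \<le> crd b (z - c) \<and> crd b (z - c) < 1} \<in> sets borel" for b
    by measurable
  ultimately show "cell c \<in> sets borel"
    by (cases "B = {}") (auto intro!: sets.finite_INT)
  fix z show "\<exists>!u. u \<in> U \<and> z - u \<in> cell c"
  proof (rule ex1I[of _ "lattice_floor (z - c)"])
    show "lattice_floor (z - c) \<in> U \<and> z - lattice_floor (z - c) \<in> cell c"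
      by (auto simp: lattice_floor_U cell_def crd_lattice_floor) linarith+
    fix u assume u: "u \<in> U \<and> z - u \<in> cell c"
    show "u = lattice_floor (z - c)"
    proof (rule crd_eqI)
      fix b assume b: "b \<in> B"
      then obtain k where k: "crd b u = of_int k" using u by (auto simp: U_iff elim!: Ints_cases)
      have "0 \<le> crd b z - of_int k - crd b c" "crd b z - of_int k - crd b c < 1"
        using u b k by (auto simp: cell_def)
      then have "\<lfloor>crd b z - crd b c\<rfloor> = k" by linarith
      then show "crd b u = crd b (lattice_floor (z - c))" using b k by (simp add: crd_lattice_floor)
    qed
  qed
qed

text \<open>The cell is placed so that all coordinates of \<open>z\<close> in it are
  \<open>1/2\<close>. Within the chosen radius no coordinate moves by \<open>1/2\<close> or
  more.\<close>

lemma interior_cell: "\<exists>r>0. ball z r \<subseteq> cell (z - (1/2) *\<^sub>R (\<Sum>b\<in>B. b))"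
proof -
  obtain K where K: "\<forall>b\<in>B. \<forall>z. \<bar>crd b z\<bar> \<le> K * norm z" using crd_bound by blast
  have half: "crd b ((1/2) *\<^sub>R (\<Sum>b\<in>B. b)) = 1/2" if "b \<in> B" for b
    using crd_combination[OF that, of "\<lambda>_. 1/2"] by (simp add: scaleR_sum_right)
  have "ball z (1 / (2 * (\<bar>K\<bar> + 1))) \<subseteq> cell (z - (1/2) *\<^sub>R (\<Sum>b\<in>B. b))"
  proof (unfold cell_def, intro subsetI CollectI ballI)
    fix w b assume "w \<in> ball z (1 / (2 * (\<bar>K\<bar> + 1)))" and b: "b \<in> B"
    then have w: "norm (z - w) < 1 / (2 * \<bar>K\<bar> + 2)" by (simp add: dist_norm)
    have "\<bar>crd b (z - w)\<bar> \<le> K * norm (z - w)" using K b by blast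
    also have "\<dots> \<le> (\<bar>K\<bar> + 1) * norm (z - w)" by (intro mult_right_mono) auto
    also have "\<dots> < (\<bar>K\<bar> + 1) * (1 / (2 * \<bar>K\<bar> + 2))" using w by (intro mult_strict_left_mono) auto
    also have "\<dots> = 1/2" by (simp add: field_simps)
    finally show "0 \<le> crd b (w - (z - (1/2) *\<^sub>R \<Sum> B)) \<and> crd b (w - (z - (1/2) *\<^sub>R \<Sum> B)) < 1"
      using half[OF b] unfolding crd_simps by linarith
  qed
  then show ?thesis by (intro exI[of _ "1 / (2 * (\<bar>K\<bar> + 1))"]) auto
qed

lemma periodic_bounded:
  assumes "periodic U f" "continuous_on UNIV f"
  shows "\<exists>C\<ge>0. \<forall>z. norm (f z :: 'b::real_normed_vector) \<le> C"
proof -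
  have "compact (f ` closure (cell 0))"
    using assms(2) bounded_cell by (intro compact_continuous_image) (auto intro: continuous_on_subset)
  from compact_imp_bounded[OF this] obtain C where C: "\<And>w. w \<in> closure (cell 0) \<Longrightarrow> norm (f w) \<le> C"
    by (auto simp: bounded_iff)
  have C': "norm (f z) \<le> C" for z
  proof -
    obtain u where u: "u \<in> U" "z - u \<in> cell 0" using fundamental_domain_cell[of 0] unfolding fundamental_domain_def by blast
    have "f z = f (z - u)" using assms(1) u(1) unfolding periodic_def by (metis diff_add_cancel)
    then show ?thesis using C u(2) closure_subset by (metis subsetD)
  qed
  then show ?thesis using norm_ge_zero order_trans by blast
qed

lemma set_integrable_domain:
  assumes "fundamental_domain U F" "continuous_on UNIV f" "periodic U f"
  shows "set_integrable lborel F (f :: 'v \<Rightarrow> complex)"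
proof -
  obtain C where C: "\<And>z. norm (f z) \<le> C" using periodic_bounded assms by blast
  have F: "F \<in> sets borel" "bounded F" using assms(1) by (auto simp: fundamental_domain_def)
  show ?thesis unfolding set_integrable_def
  proof (rule integrableI_bounded_set_indicator[where B=C])
    show "f \<in> borel_measurable lborel" using borel_measurable_continuous_onI[OF assms(2)] by simp
    show "emeasure lborel F < \<infinity>" using emeasure_bounded_finite[OF F(2)] .
  qed (use F C in auto)
qed

text \<open>Needed because the integral over the torus is defined with an arbitrarily chosen domain.
  \<open>F\<close> is cut into its intersections with the translates of \<open>F'\<close>, and each
  piece is moved into \<open>F'\<close> by a lattice vector, which changes neither Lebesgue measure
  nor the periodic function.\<close>

lemma domain_integral_independent:
  assumes F: "fundamental_domain U F" and F': "fundamental_domain U F'" and f: "continuous_on UNIV f" "periodic U f"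
  shows "set_lebesgue_integral lborel F f = set_lebesgue_integral lborel F' (f :: 'v \<Rightarrow> complex)"
proof -
  have Fb: "F \<in> sets borel" "bounded F" and F'b: "F' \<in> sets borel" "bounded F'"
    using F F' by (auto simp: fundamental_domain_def)
  note [measurable] = Fb(1) F'b(1) borel_measurable_continuous_onI[OF f(1)]
  \<comment> \<open>The lattice vectors whose translate of \<open>F'\<close> meets \<open>F\<close>;
    finitely many, since both domains are bounded.\<close>
  define N where "N = {u \<in> U. \<exists>z\<in>F. z - u \<in> F'}"
  obtain R R' where R: "\<forall>z\<in>F. norm z \<le> R" "\<forall>z\<in>F'. norm z \<le> R'" using Fb F'b unfolding bounded_iff by blast
  have "N \<subseteq> {u \<in> U. norm u \<le> R + R'}"
  proof (safe)
    fix u assume "u \<in> N"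
    then obtain z where z: "u \<in> U" "z \<in> F" "z - u \<in> F'" by (auto simp: N_def)
    have "norm u \<le> norm z + norm (z - u)" using norm_triangle_ineq4[of z "z - u"] by simp
    then show "u \<in> U" "norm u \<le> R + R'" using R(1)[rule_format, OF z(2)] R(2)[rule_format, OF z(3)] z(1) by auto
  qed
  then have finN: "finite N" using finite_U_bounded finite_subset by blast
  define T where "T u z = indicator F z *\<^sub>R indicator F' (z - u) *\<^sub>R f z" for u z
  have m: "T u \<in> borel_measurable borel" for u unfolding T_def by measurable
  have intT: "integrable lborel (T u)" for u
  proof (rule Bochner_Integration.integrable_bound)
    show "integrable lborel (\<lambda>z. indicator F z *\<^sub>R f z)"
      using set_integrable_domain[OF F f] by (simp add: set_integrable_def)
  qed (use m in \<open>auto simp: T_def split: split_indicator\<close>)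
  have e1: "indicator F z *\<^sub>R f z = (\<Sum>u\<in>N. T u z)" for z
  proof (cases "z \<in> F")
    case True
    obtain u where u: "u \<in> U" "z - u \<in> F'" "\<And>v. v \<in> U \<Longrightarrow> z - v \<in> F' \<Longrightarrow> v = u"
      using F' unfolding fundamental_domain_def by metis
    have uN: "u \<in> N" using u(1,2) True by (auto simp: N_def)
    have "(\<Sum>u\<in>N. T u z) = (\<Sum>v\<in>N. if v = u then f z else 0)"
    proof (rule sum.cong[OF refl])
      fix v assume "v \<in> N"
      then have "z - v \<in> F' \<longleftrightarrow> v = u" using u(2) u(3)[of v] by (auto simp: N_def)
      then show "T v z = (if v = u then f z else 0)" using True u(2) by (auto simp: T_def)
    qed
    then show ?thesis using True uN finN by simp
  qed (simp add: T_def)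
  have e2: "indicator F' z *\<^sub>R f z = (\<Sum>u\<in>N. T u (z + u))" for z
  proof (cases "z \<in> F'")
    case True
    obtain u where u: "u \<in> U" "z - u \<in> F" "\<And>v. v \<in> U \<Longrightarrow> z - v \<in> F \<Longrightarrow> v = u"
      using F unfolding fundamental_domain_def by metis
    have uN: "- u \<in> N" using u(1,2) True U_group(4) by (auto simp: N_def intro!: bexI[of _ "z - u"])
    have "(\<Sum>v\<in>N. T v (z + v)) = (\<Sum>v\<in>N. if v = - u then f z else 0)"
    proof (rule sum.cong[OF refl])
      fix v assume v: "v \<in> N"
      then have vU: "v \<in> U" by (simp add: N_def)
      have "z + v \<in> F \<longleftrightarrow> v = - u" using u(2) u(3)[of "- v"] U_group(4)[OF vU] by auto
      then show "T v (z + v) = (if v = - u then f z else 0)"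
        using True vU f(2) by (auto simp: T_def periodic_def split: split_indicator)
    qed
    then show ?thesis using True uN finN by simp
  qed (simp add: T_def)
  have "set_lebesgue_integral lborel F f = (\<Sum>u\<in>N. \<integral>z. T u z \<partial>lborel)"
    unfolding set_lebesgue_integral_def e1 using intT by (intro Bochner_Integration.integral_sum)
  also have "\<dots> = (\<Sum>u\<in>N. \<integral>z. T u (z + u) \<partial>lborel)"
    using m by (intro sum.cong refl lborel_integral_translate[symmetric])
  also have "\<dots> = set_lebesgue_integral lborel F' f"
    unfolding set_lebesgue_integral_def e2 using lborel_integrable_translate[OF intT]
    by (intro Bochner_Integration.integral_sum[symmetric])
  finally show ?thesis .
qed

text \<open>A translated fundamental domain is again one, and the integral does not depend on the
  domain.\<close>

lemma domain_integral_translate: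
  assumes F: "fundamental_domain U F" and f: "continuous_on UNIV f" "periodic U f"
  shows "set_lebesgue_integral lborel F (\<lambda>z. f (z + h)) = set_lebesgue_integral lborel F (f :: 'v \<Rightarrow> complex)"
proof -
  define F' where "F' = (\<lambda>z. z - h) -` F"
  have Fb: "F \<in> sets borel" "bounded F" using F by (auto simp: fundamental_domain_def)
  note [measurable] = Fb(1) borel_measurable_continuous_onI[OF f(1)]
  have F'b: "F' \<in> sets borel"
    unfolding F'_def using measurable_sets_borel[OF _ Fb(1), of "\<lambda>z. z - h"] by simp
  have "F' = (\<lambda>z. h + z) ` F" unfolding F'_def by (auto simp: image_iff intro!: bexI[of _ "_ - h"])
  then have "bounded F'" using bounded_translation[OF Fb(2)] by simp
  moreover have "\<exists>!u. u \<in> U \<and> z - u \<in> F'" for z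
  proof -
    have "\<exists>!u. u \<in> U \<and> z - h - u \<in> F" using F unfolding fundamental_domain_def by blast
    moreover have "z - h - u = z - u - h" for u by simp
    ultimately show ?thesis unfolding F'_def vimage_def mem_Collect_eq by simp
  qed
  ultimately have F': "fundamental_domain U F'" using F'b by (simp add: fundamental_domain_def)
  have [measurable]: "F' \<in> sets borel" by (rule F'b)
  have "set_lebesgue_integral lborel F f = (\<integral>z. indicator F' z *\<^sub>R f z \<partial>lborel)"
    using domain_integral_independent[OF F F' f] by (simp add: set_lebesgue_integral_def)
  also have "\<dots> = (\<integral>z. indicator F' (z + h) *\<^sub>R f (z + h) \<partial>lborel)"
    by (rule lborel_integral_translate[symmetric]) measurable
  also have "\<dots> = set_lebesgue_integral lborel F (\<lambda>z. f (z + h))"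
    by (simp add: set_lebesgue_integral_def F'_def indicator_def)
  finally show ?thesis by simp
qed

lemma periodic_dird:
  assumes "periodic U f" "\<And>z. f differentiable (at z)"
  shows "periodic U (dird w f)"
  unfolding periodic_def
proof (intro ballI allI)
  fix u z assume u: "u \<in> U"
  have "(\<lambda>z. f (z + u)) = f" using assms(1) u by (auto simp: periodic_def)
  then show "dird w f (z + u) = dird w f z"
    using dird_affine_comp[OF bounded_linear_ident assms(2), of w u] by metis
qed

text \<open>Instead of a boundary argument: difference quotients have integral zero by translation
  invariance, are bounded by the supremum of the derivative, and converge to it.\<close>

lemma domain_integral_dird:
  assumes F: "fundamental_domain U F" and f: "smooth_function f" "periodic U f"
  shows "set_lebesgue_integral lborel F (dird w f) = 0"
proof -
  have Fb: "F \<in> sets borel" "bounded F" using F by (auto simp: fundamental_domain_def)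
  have cont: "continuous_on UNIV f" "continuous_on UNIV (dird w f)"
    using f(1) smooth_function_dird smooth_function_continuous by blast+
  note [measurable] = Fb(1) borel_measurable_continuous_onI[OF cont(1)] borel_measurable_continuous_onI[OF cont(2)]
  have diff: "f differentiable (at z)" for z using f(1) by (rule smooth_function_differentiable)
  obtain C where C: "\<And>z. norm (dird w f z) \<le> C"
    using periodic_bounded[OF periodic_dird[OF f(2) diff] cont(2)] by blast
  define s where "s i z = indicator F z *\<^sub>R (real (Suc i) *\<^sub>R (f (z + (1 / real (Suc i)) *\<^sub>R w) - f z))" for i z
  have per: "continuous_on UNIV (\<lambda>z. f (z + c))" for c
    using smooth_function_continuous[OF smooth_function_translate[OF f(1)]] .
  have zero: "(\<integral>z. s i z \<partial>lborel) = 0" for i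
  proof -
    have "set_integrable lborel F (\<lambda>z. f (z + (1 / real (Suc i)) *\<^sub>R w))"
      using f(2) by (intro set_integrable_domain[OF F per]) (auto simp: periodic_def add.assoc add.commute[of _ "_ *\<^sub>R w"], simp add: add.assoc[symmetric])
    then have "set_lebesgue_integral lborel F (\<lambda>z. f (z + (1 / real (Suc i)) *\<^sub>R w) - f z) = 0"
      using set_integrable_domain[OF F cont(1) f(2)] domain_integral_translate[OF F cont(1) f(2)]
      by (simp add: set_integral_diff)
    moreover have "(\<integral>z. s i z \<partial>lborel) = (\<integral>z. real (Suc i) *\<^sub>R (indicator F z *\<^sub>R (f (z + (1 / real (Suc i)) *\<^sub>R w) - f z)) \<partial>lborel)"
      unfolding s_def by (simp add: mult.commute)
    ultimately show ?thesis by (simp only: integral_scaleR_right set_lebesgue_integral_def scaleR_zero_right)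
  qed
  have "(\<lambda>i. \<integral>z. s i z \<partial>lborel) \<longlonglongrightarrow> (\<integral>z. indicator F z *\<^sub>R dird w f z \<partial>lborel)"
  proof (rule integral_dominated_convergence[where w = "\<lambda>z. indicator F z * C"])
    show "s i \<in> borel_measurable lborel" for i unfolding s_def by measurable
    show "integrable lborel (\<lambda>z. indicator F z * C)"
      using integrable_real_indicator[of F lborel] emeasure_bounded_finite[OF Fb(2)] by auto
    show "AE z in lborel. (\<lambda>i. s i z) \<longlonglongrightarrow> indicator F z *\<^sub>R dird w f z"
    proof (rule AE_I2)
      fix z
      have "((\<lambda>t. f (z + t *\<^sub>R w)) has_vector_derivative dird w f z) (at 0)"
        using dird_has_vector_derivative[OF diff, of z w 0] by simp
      then have "((\<lambda>h. (1 / h) *\<^sub>R (f (z + h *\<^sub>R w) - f z)) \<longlongrightarrow> dird w f z) (at 0)"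
        by (rule vector_derivative_difference_quotient)
      moreover have "filterlim (\<lambda>i. 1 / real (Suc i)) (at 0) sequentially"
        unfolding filterlim_at using LIMSEQ_inverse_real_of_nat by (auto simp: inverse_eq_divide)
      ultimately have "(\<lambda>i. (1 / (1 / real (Suc i))) *\<^sub>R (f (z + (1 / real (Suc i)) *\<^sub>R w) - f z)) \<longlonglongrightarrow> dird w f z"
        by (rule filterlim_compose)
      then show "(\<lambda>i. s i z) \<longlonglongrightarrow> indicator F z *\<^sub>R dird w f z"
        unfolding s_def by (intro tendsto_intros) simp
    qed
    have lip: "norm (f (z + t *\<^sub>R w) - f z) \<le> C * t" if "t \<ge> 0" for z t
    proof -
      have "norm ((\<lambda>t. f (z + t *\<^sub>R w)) t - (\<lambda>t. f (z + t *\<^sub>R w)) 0) \<le> C * norm (t - 0)"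
      proof (rule differentiable_bound[where S = UNIV])
        show "((\<lambda>t. f (z + t *\<^sub>R w)) has_derivative (\<lambda>s. s *\<^sub>R dird w f (z + x *\<^sub>R w))) (at x within UNIV)" for x
          using dird_has_vector_derivative[OF diff] by (simp add: has_vector_derivative_def)
        show "onorm (\<lambda>s. s *\<^sub>R dird w f (z + x *\<^sub>R w)) \<le> C" for x
          by (rule onorm_le, simp, subst mult.commute, rule mult_right_mono[OF C abs_ge_zero])
      qed auto
      then show ?thesis using that by simp
    qed
    show "AE z in lborel. norm (s i z) \<le> indicator F z * C" for i
    proof (rule AE_I2)
      fix z
      have "real (Suc i) * norm (f (z + (1 / real (Suc i)) *\<^sub>R w) - f z) \<le> real (Suc i) * (C * (1 / real (Suc i)))"
        by (intro mult_left_mono lip) auto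
      then show "norm (s i z) \<le> indicator F z * C"
        unfolding s_def norm_scaleR by (auto split: split_indicator)
    qed
  qed simp
  then have "(\<lambda>i. 0) \<longlonglongrightarrow> (\<integral>z. indicator F z *\<^sub>R dird w f z \<partial>lborel)" by (simp only: zero)
  then show ?thesis unfolding set_lebesgue_integral_def using LIMSEQ_unique tendsto_const by blast
qed

text \<open>A given domain need not contain a neighbourhood of \<open>z0\<close>. It is exchanged
  for a cell with \<open>z0\<close> in its interior, where the function is at least
  \<open>f z0 / 2\<close> on a ball.\<close>

lemma domain_integral_pos:
  fixes f :: "'v \<Rightarrow> real"
  assumes F: "fundamental_domain U F" and f: "continuous_on UNIV f" "periodic U f" "\<And>z. f z \<ge> 0" "f z0 \<noteq> 0"
  shows "Re (set_lebesgue_integral lborel F (\<lambda>z. complex_of_real (f z))) > 0"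
proof -
  have cf: "continuous_on UNIV (\<lambda>z. complex_of_real (f z))" "periodic U (\<lambda>z. complex_of_real (f z))"
    using f by (auto intro: continuous_intros simp: periodic_def)
  obtain r where r: "r > 0" "ball z0 r \<subseteq> cell (z0 - (1/2) *\<^sub>R (\<Sum>b\<in>B. b))" using interior_cell by blast
  let ?C = "cell (z0 - (1/2) *\<^sub>R (\<Sum>b\<in>B. b))"
  have C: "fundamental_domain U ?C" by (rule fundamental_domain_cell)
  then have [measurable]: "?C \<in> sets borel" by (simp add: fundamental_domain_def)
  have f0: "f z0 > 0" using f(3)[of z0] f(4) by linarith
  have "isCont f z0" using f(1) by (simp add: continuous_on_eq_continuous_at)
  then obtain r' where r': "r' > 0" "\<And>y. dist y z0 < r' \<Longrightarrow> dist (f y) (f z0) < f z0 / 2"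
    using f0 unfolding continuous_at_eps_delta by (metis half_gt_zero)
  define s where "s = min r r'"
  have s: "s > 0" "ball z0 s \<subseteq> ?C" "\<And>y. y \<in> ball z0 s \<Longrightarrow> f y \<ge> f z0 / 2"
  proof -
    show "f y \<ge> f z0 / 2" if "y \<in> ball z0 s" for y
    proof -
      have "dist y z0 < r'" using that by (simp add: s_def dist_commute)
      from r'(2)[OF this] show ?thesis unfolding dist_real_def by (simp add: abs_if split: if_splits)
    qed
  qed (use r r' in \<open>auto simp: s_def\<close>)
  have int: "integrable lborel (\<lambda>z. indicator ?C z *\<^sub>R complex_of_real (f z))"
    using set_integrable_domain[OF C cf] by (simp add: set_integrable_def)
  have intr: "integrable lborel (\<lambda>z. indicator ?C z * f z)"
    using Bochner_Integration.integrable_Re[OF int] by simp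
  have "Re (set_lebesgue_integral lborel F (\<lambda>z. complex_of_real (f z))) = Re (\<integral>z. indicator ?C z *\<^sub>R complex_of_real (f z) \<partial>lborel)"
    using domain_integral_independent[OF F C cf] by (simp add: set_lebesgue_integral_def)
  also have "\<dots> = (\<integral>z. indicator ?C z * f z \<partial>lborel)"
    by (subst integral_Re[OF int, symmetric]) simp
  also have "\<dots> \<ge> (\<integral>z. indicator (ball z0 s) z * (f z0 / 2) \<partial>lborel)"
    using s f(3) emeasure_bounded_finite[of "ball z0 s"] f0
    by (intro integral_mono intr) (auto split: split_indicator intro!: integrable_real_indicator)
  moreover have "(\<integral>z. indicator (ball z0 s) z * (f z0 / 2) \<partial>lborel) = measure lborel (ball z0 s) * (f z0 / 2)"
    by simp
  moreover have "measure lborel (ball z0 s) > 0" using s(1) content_ball_pos by simp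
  ultimately show ?thesis using f0 by (smt (verit, best) half_gt_zero mult_pos_pos)
qed

end

section \<open>Magnetic derivatives on quasi-periodic functions\<close>

text \<open>The situation after the gauge transformation: of the hermitian form only the imaginary
  part \<open>E\<close> remains, and the multipliers have modulus one.\<close>

locale magnetic = lattice B U for B U :: "'v::euclidean_space set" +
  fixes E :: "'v \<Rightarrow> 'v \<Rightarrow> real" and \<alpha> :: "'v \<Rightarrow> complex" and D :: "'v set"
  assumes bilinear: "bounded_bilinear E" and alternating: "E v v = 0"
    and norm_\<alpha>: "u \<in> U \<Longrightarrow> norm (\<alpha> u) = 1"
    and \<alpha>_add: "u \<in> U \<Longrightarrow> v \<in> U \<Longrightarrow> \<alpha> (u + v) = \<alpha> u * \<alpha> v * cis (pi * E u v)"
    and D: "fundamental_domain U D"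
begin

sublocale E: bounded_bilinear E by (rule bilinear)

lemma skew: "E w v = - E v w"
  using alternating[of "v + w"] alternating[of v] alternating[of w] by (simp add: E.add_left E.add_right)

definition quasi_periodic :: "('v \<Rightarrow> complex) \<Rightarrow> bool" where
  "quasi_periodic F \<longleftrightarrow> (\<forall>u\<in>U. \<forall>z. F (z + u) = \<alpha> u * cis (pi * E z u) * F z)"

definition S :: "('v \<Rightarrow> complex) set" where "S = {F. smooth_function F \<and> quasi_periodic F}"

text \<open>Magnetic translation: the time one map of the flow generated by the covariant derivative
  \<open>nabla v\<close>. The sign of the phase makes it compatible with the multipliers of the
  lattice.\<close>

definition W :: "'v \<Rightarrow> ('v \<Rightarrow> complex) \<Rightarrow> 'v \<Rightarrow> complex" where "W v F z = cis (pi * E z v) * F (z + v)"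

definition nabla :: "'v \<Rightarrow> ('v \<Rightarrow> complex) \<Rightarrow> 'v \<Rightarrow> complex" where
  "nabla w F = (\<lambda>z. dird w F z + \<i> * of_real (pi * E z w) * F z)"

lemma S_smooth: "F \<in> S \<Longrightarrow> smooth_function F" by (simp add: S_def)
lemma S_differentiable: "F \<in> S \<Longrightarrow> F differentiable (at z)" by (simp add: S_def smooth_function_differentiable)
lemma S_continuous: "F \<in> S \<Longrightarrow> continuous_on A F" by (simp add: S_def smooth_function_continuous)
lemma S_measurable: "F \<in> S \<Longrightarrow> F \<in> borel_measurable borel"
  by (intro borel_measurable_continuous_onI S_continuous)

lemma S_subspace: "fun_space.subspace S"
  unfolding fun_space.subspace_def S_def quasi_periodic_def fscale_def
  by (auto simp: plus_fun_def zero_fun_def smooth_function_const smooth_function_add smooth_function_cmult algebra_simps)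

lemma smooth_function_linear_E: "smooth_function (\<lambda>z. complex_of_real (c * E z w))"
proof (rule smooth_function_bounded_linear)
  show "bounded_linear (\<lambda>z. complex_of_real (c * E z w))"
    by (intro bounded_linear_compose[OF bounded_linear_of_real] bounded_linear_const_mult E.bounded_linear_left)
qed

text \<open>Differentiating the multiplier produces a term with \<open>E w u\<close>; it is
  cancelled by the change of the connection from \<open>E z w\<close> to
  \<open>E (z + u) w\<close>.\<close>

lemma nabla_in:
  assumes "F \<in> S" shows "nabla w F \<in> S"
proof -
  have sm: "smooth_function (nabla w F)" unfolding nabla_def
    by (intro smooth_function_add smooth_function_mult smooth_function_dird S_smooth assms smooth_function_const smooth_function_linear_E)
  have "nabla w F (z + u) = \<alpha> u * cis (pi * E z u) * nabla w F z" if u: "u \<in> U" for u z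
  proof -
    have qp: "(\<lambda>z. F (z + u)) = (\<lambda>z. \<alpha> u * (cis (pi * E z u) * F z))"
      using assms u by (auto simp: S_def quasi_periodic_def mult.assoc)
    define q where "q = (\<lambda>z. \<i> * complex_of_real (pi * E z u))"
    have smq: "smooth_function q" unfolding q_def
      by (intro smooth_function_mult smooth_function_const smooth_function_linear_E)
    have cis: "cis (pi * E z u) = exp (q z)" for z by (simp add: cis_conv_exp q_def)
    have expd: "((\<lambda>z. exp (q z)) has_derivative (\<lambda>v. dird v q z * exp (q z))) (at z)" for z
      using has_derivative_compose[OF differentiable_has_derivative_dird[OF smooth_function_differentiable[OF smq]] DERIV_exp[unfolded has_field_derivative_def], of z]
      by (simp add: mult.commute)
    have "dird w (\<lambda>z. \<alpha> u * (cis (pi * E z u) * F z)) z = \<alpha> u * (exp (q z) * dird w F z + dird w q z * exp (q z) * F z)"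
      unfolding cis
      by (rule dird_eqI[OF has_derivative_mult_right[OF has_derivative_mult[OF expd differentiable_has_derivative_dird[OF S_differentiable[OF assms]]]]])
    moreover have "dird w q z = \<i> * of_real (pi * E w u)"
      unfolding q_def by (rule dird_eqI[OF has_derivative_mult_right[OF bounded_linear_imp_has_derivative]])
        (intro bounded_linear_compose[OF bounded_linear_of_real] bounded_linear_const_mult E.bounded_linear_left)
    moreover have "dird w F (z + u) = dird w (\<lambda>z. F (z + u)) z"
      using dird_affine_comp[OF bounded_linear_ident S_differentiable[OF assms], of w u] by metis
    ultimately have d: "dird w F (z + u) = \<alpha> u * cis (pi * E z u) * (dird w F z + \<i> * of_real (pi * E w u) * F z)"
      unfolding qp cis by (simp add: algebra_simps)
    have F: "F (z + u) = \<alpha> u * cis (pi * E z u) * F z" using qp by (metis mult.assoc)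
    show ?thesis unfolding nabla_def d F using skew[of w u] by (simp add: E.add_left algebra_simps)
  qed
  then show ?thesis using sm by (simp add: S_def quasi_periodic_def)
qed

lemma nabla_add: "F \<in> S \<Longrightarrow> G \<in> S \<Longrightarrow> nabla w (F + G) = nabla w F + nabla w G"
  using dird_add[of F G w] by (auto simp: nabla_def plus_fun_def S_differentiable algebra_simps)

lemma nabla_scale:
  assumes "F \<in> S" shows "nabla w (fscale c F) = fscale c (nabla w F)"
  using dird_mult[of "\<lambda>_. c" F w] assms by (auto simp: nabla_def fscale_def S_differentiable dird_const algebra_simps)

lemma nabla_linear:
  assumes "F \<in> S"
  shows "nabla (v + w) F z = nabla v F z + nabla w F z" "nabla (c *\<^sub>R v) F z = c *\<^sub>R nabla v F z" "nabla (- v) F z = - nabla v F z"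
  by (simp_all add: nabla_def dird_linear_combination[OF S_differentiable[OF assms]] E.add_right E.scaleR_right E.minus_right algebra_simps scaleR_conv_of_real)

lemma nabla_sum:
  assumes "F \<in> S" "finite A" shows "nabla (\<Sum>i\<in>A. v i) F z = (\<Sum>i\<in>A. nabla (v i) F z)"
  using assms(2)
proof (induction A rule: finite_induct)
  case empty then show ?case using nabla_linear(2)[OF assms(1), of 0 0 z] by simp
qed (simp add: nabla_linear[OF assms(1)])

text \<open>Ordinary derivatives commute, so only the curvature survives, and it is constant. The
  canonical commutation relations come from here.\<close>

lemma nabla_commutator:
  assumes "F \<in> S"
  shows "nabla v (nabla w F) = (\<lambda>z. nabla w (nabla v F) z + \<i> * of_real (2 * pi * E v w) * F z)"
proof
  fix z
  note sm = S_smooth[OF assms] smooth_function_dird[OF S_smooth[OF assms]]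
  have d: "dird v (nabla w F) z = dird v (dird w F) z + \<i> * of_real (pi * E z w) * dird v F z + \<i> * of_real (pi * E v w) * F z" for v w
  proof -
    have 1: "smooth_function (\<lambda>z. \<i> * complex_of_real (pi * E z w) * F z)" "smooth_function (\<lambda>z. \<i> * complex_of_real (pi * E z w))"
      by (intro smooth_function_mult smooth_function_const smooth_function_linear_E sm)+
    have "dird v (nabla w F) z = dird v (dird w F) z + dird v (\<lambda>z. \<i> * of_real (pi * E z w) * F z) z"
      unfolding nabla_def using dird_add[of "dird w F" "\<lambda>z. \<i> * complex_of_real (pi * E z w) * F z" v] smooth_function_differentiable[OF 1(1)] smooth_function_differentiable[OF sm(2)] by meson
    also have "dird v (\<lambda>z. \<i> * of_real (pi * E z w) * F z) z = \<i> * of_real (pi * E z w) * dird v F z + dird v (\<lambda>z. \<i> * complex_of_real (pi * E z w)) z * F z"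
      using dird_mult[of "\<lambda>z. \<i> * complex_of_real (pi * E z w)" F v] smooth_function_differentiable[OF 1(2)] smooth_function_differentiable[OF sm(1)] by meson
    also have "dird v (\<lambda>z. \<i> * complex_of_real (pi * E z w)) z = \<i> * of_real (pi * E v w)"
      by (rule dird_eqI[OF has_derivative_mult_right[OF bounded_linear_imp_has_derivative]])
         (intro bounded_linear_compose[OF bounded_linear_of_real] bounded_linear_const_mult E.bounded_linear_left)
    finally show ?thesis by simp
  qed
  have c: "dird v (dird w F) z = dird w (dird v F) z" using dird_commute[OF sm(1)] by metis
  have n: "nabla v G z = dird v G z + \<i> * of_real (pi * E z v) * G z" for v G by (simp add: nabla_def)
  show "nabla v (nabla w F) z = nabla w (nabla v F) z + \<i> * of_real (2 * pi * E v w) * F z"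
    unfolding n[of _ "nabla _ F"] d c unfolding n using skew[of v w] by (simp add: algebra_simps)
qed

lemma S_bounded:
  assumes "F \<in> S" shows "\<exists>C\<ge>0. \<forall>z. norm (F z) \<le> C"
proof -
  have "periodic U (\<lambda>z. norm (F z))"
    using assms by (auto simp: periodic_def S_def quasi_periodic_def norm_mult norm_\<alpha>)
  from periodic_bounded[OF this] show ?thesis using S_continuous[OF assms] by (auto intro: continuous_intros)
qed

lemma nabla_bounded:
  assumes "F \<in> S" shows "\<exists>C\<ge>0. \<forall>w z. norm (nabla w F z) \<le> C * norm w"
proof -
  have "\<forall>b. \<exists>C\<ge>0. \<forall>z. norm (nabla b F z) \<le> C" using S_bounded[OF nabla_in[OF assms]] by blast
  then obtain C where C: "\<And>b. C b \<ge> 0" "\<And>b z. norm (nabla b F z) \<le> C b" by metis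
  have "norm (nabla w F z) \<le> (\<Sum>b\<in>Basis. C b) * norm w" for w z
  proof -
    have "nabla w F z = nabla (\<Sum>b\<in>Basis. (w \<bullet> b) *\<^sub>R b) F z" by (simp add: euclidean_representation)
    also have "\<dots> = (\<Sum>b\<in>Basis. (w \<bullet> b) *\<^sub>R nabla b F z)" by (simp add: nabla_sum[OF assms] nabla_linear[OF assms])
    finally have "norm (nabla w F z) \<le> (\<Sum>b\<in>Basis. norm ((w \<bullet> b) *\<^sub>R nabla b F z))" by (simp only: norm_sum)
    also have "\<dots> \<le> (\<Sum>b\<in>Basis. C b * norm w)" using C Basis_le_norm
      by (intro sum_mono) (auto simp: mult.commute[of "C _"] intro!: mult_mono)
    finally show ?thesis by (simp add: sum_distrib_right)
  qed
  then show ?thesis using C by (auto intro!: exI[of _ "\<Sum>b\<in>Basis. C b"] sum_nonneg)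
qed

definition ip :: "('v \<Rightarrow> complex) \<Rightarrow> ('v \<Rightarrow> complex) \<Rightarrow> complex" where
  "ip F G = set_lebesgue_integral lborel D (\<lambda>z. F z * cnj (G z))"

lemma periodic_product: "F \<in> S \<Longrightarrow> G \<in> S \<Longrightarrow> periodic U (\<lambda>z. F z * cnj (G z))"
proof (unfold periodic_def, intro ballI allI)
  fix u z assume F: "F \<in> S" and G: "G \<in> S" and u: "u \<in> U"
  have "F (z + u) * cnj (G (z + u)) = (\<alpha> u * cnj (\<alpha> u)) * (cis (pi * E z u) * cnj (cis (pi * E z u))) * (F z * cnj (G z))"
    using F G u by (simp add: S_def quasi_periodic_def)
  then show "F (z + u) * cnj (G (z + u)) = F z * cnj (G z)"
    unfolding complex_norm_square[symmetric] using norm_\<alpha>[OF u] by simp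
qed

lemma set_integrable_product: "F \<in> S \<Longrightarrow> G \<in> S \<Longrightarrow> set_integrable lborel D (\<lambda>z. F z * cnj (G z))"
  by (intro set_integrable_domain[OF D] periodic_product continuous_intros S_continuous)

lemma ip_add: "F \<in> S \<Longrightarrow> G \<in> S \<Longrightarrow> K \<in> S \<Longrightarrow> ip (F + G) K = ip F K + ip G K"
  using set_integral_add(2)[OF set_integrable_product[of F K] set_integrable_product[of G K]]
  by (simp add: ip_def algebra_simps)
lemma ip_scale: "ip (fscale c F) K = c * ip F K"
  by (simp add: ip_def fscale_def mult.assoc)
lemma ip_cnj: "ip G F = cnj (ip F G)"
  unfolding ip_def set_lebesgue_integral_def
  by (subst Bochner_Integration.integral_cnj[symmetric]) (simp add: mult.commute scaleR_conv_of_real)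

lemma ip_pos:
  assumes "F \<in> S" "F \<noteq> 0" shows "Re (ip F F) > 0"
proof -
  obtain z0 where "F z0 \<noteq> 0" using assms(2) by (auto simp: fun_eq_iff)
  moreover have "periodic U (\<lambda>z. (norm (F z))\<^sup>2)"
    using assms by (auto simp: periodic_def S_def quasi_periodic_def norm_mult norm_\<alpha>)
  ultimately have "Re (set_lebesgue_integral lborel D (\<lambda>z. complex_of_real ((norm (F z))\<^sup>2))) > 0"
    by (intro domain_integral_pos[OF D, where ?z0.0 = z0] continuous_intros S_continuous assms) auto
  then show ?thesis unfolding ip_def complex_norm_square[symmetric] by simp
qed

text \<open>The connection is unitary: its zeroth order terms cancel in
  \<open>nabla w F * cnj G + F * cnj (nabla w G)\<close>, which is therefore the derivative of a
  periodic function and has integral zero.\<close>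

lemma ip_nabla:
  assumes "F \<in> S" "G \<in> S" shows "ip (nabla w F) G = - ip F (nabla w G)"
proof -
  have sm: "smooth_function F" "smooth_function (\<lambda>z. cnj (G z))"
    using assms S_smooth smooth_function_cnj by auto
  have "dird w (\<lambda>z. F z * cnj (G z)) = (\<lambda>z. F z * cnj (dird w G z) + dird w F z * cnj (G z))"
    using dird_mult[of F "\<lambda>z. cnj (G z)" w] smooth_function_differentiable[OF sm(1)] smooth_function_differentiable[OF sm(2)]
      dird_bounded_linear_comp[OF bounded_linear_cnj S_differentiable[OF assms(2)], of w] by simp
  then have "dird w (\<lambda>z. F z * cnj (G z)) = (\<lambda>z. nabla w F z * cnj (G z) + F z * cnj (nabla w G z))"
    by (auto simp: nabla_def algebra_simps)
  then have "set_lebesgue_integral lborel D (\<lambda>z. nabla w F z * cnj (G z) + F z * cnj (nabla w G z)) = 0"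
    using domain_integral_dird[OF D smooth_function_mult[OF sm] periodic_product[OF assms], of w] by simp
  then show ?thesis unfolding ip_def
    using set_integral_add(2)[OF set_integrable_product[OF nabla_in[OF assms(1)] assms(2)] set_integrable_product[OF assms(1) nabla_in[OF assms(2)]]]
    by (simp add: eq_neg_iff_add_eq_0)
qed

section \<open>Averaging over magnetic translations\<close>

text \<open>All moments are required because every derivative of an average multiplies the kernel by
  a factor linear in the displacement. The parameter space is arbitrary: it is the space of
  coordinates for Gaussian averages, and time times coordinates for the Laplace transform.\<close>

definition moments :: "'x measure \<Rightarrow> ('x \<Rightarrow> 'v) \<Rightarrow> ('x \<Rightarrow> complex) \<Rightarrow> bool" where
  "moments M v k \<longleftrightarrow> k \<in> borel_measurable M \<and> v \<in> borel_measurable M \<and> (\<forall>j. integrable M (\<lambda>x. (1 + norm (v x)) ^ j * norm (k x)))"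

definition T :: "'x measure \<Rightarrow> ('x \<Rightarrow> 'v) \<Rightarrow> ('x \<Rightarrow> complex) \<Rightarrow> ('v \<Rightarrow> complex) \<Rightarrow> 'v \<Rightarrow> complex" where
  "T M v k F z = (\<integral>x. k x * W (v x) F z \<partial>M)"

lemma E_bound: "\<exists>K\<ge>0. \<forall>v w. \<bar>E v w\<bar> \<le> K * norm v * norm w"
  using E.nonneg_bounded by (auto simp: mult.commute mult.left_commute)

lemma measurable_E [measurable (raw)]:
  assumes "f \<in> borel_measurable M" "g \<in> borel_measurable M"
  shows "(\<lambda>x. E (f x) (g x)) \<in> borel_measurable M"
  by (rule borel_measurable_continuous_Pair[OF assms]) (auto intro!: E.continuous_on continuous_intros)

lemma measurable_cis [measurable (raw)]: "f \<in> borel_measurable M \<Longrightarrow> (\<lambda>x. cis (f x)) \<in> borel_measurable M"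
  by (rule borel_measurable_continuous_on[of cis]) (auto intro!: continuous_intros)

lemma measurable_W [measurable (raw)]:
  assumes "v \<in> borel_measurable M" "F \<in> borel_measurable borel"
  shows "(\<lambda>x. W (v x) F z) \<in> borel_measurable M"
  unfolding W_def by (intro borel_measurable_times measurable_cis measurable_E borel_measurable_const assms measurable_compose[OF _ assms(2)] borel_measurable_add)

lemma norm_W: "norm (W v F z) = norm (F (z + v))" by (simp add: W_def norm_mult)

lemma moments_E:
  assumes "moments M v k" shows "moments M v (\<lambda>x. c * of_real (E w (v x)) * k x)"
  unfolding moments_def
proof (intro conjI allI)
  have [measurable]: "k \<in> borel_measurable M" "v \<in> borel_measurable M" using assms by (auto simp: moments_def)
  show "v \<in> borel_measurable M" "(\<lambda>x. c * of_real (E w (v x)) * k x) \<in> borel_measurable M" by measurable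
  fix j
  obtain K where K: "K \<ge> 0" "\<And>v w. \<bar>E v w\<bar> \<le> K * norm v * norm w" using E_bound by blast
  show "integrable M (\<lambda>x. (1 + norm (v x)) ^ j * norm (c * of_real (E w (v x)) * k x))"
  proof (rule Bochner_Integration.integrable_bound)
    show "integrable M (\<lambda>x. (norm c * K * norm w) * ((1 + norm (v x)) ^ (Suc j) * norm (k x)))"
      using assms unfolding moments_def by (intro integrable_mult_right) blast
    show "AE x in M. norm ((1 + norm (v x)) ^ j * norm (c * of_real (E w (v x)) * k x)) \<le> norm ((norm c * K * norm w) * ((1 + norm (v x)) ^ (Suc j) * norm (k x)))"
    proof (rule AE_I2)
      fix x
      have "\<bar>E w (v x)\<bar> \<le> K * norm w * (1 + norm (v x))"
        using K(2)[of w "v x"] mult_left_mono[of "norm (v x)" "1 + norm (v x)" "K * norm w"] K(1) by simp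
      then have "(1 + norm (v x)) ^ j * (norm c * \<bar>E w (v x)\<bar> * norm (k x)) \<le> (1 + norm (v x)) ^ j * (norm c * (K * norm w * (1 + norm (v x))) * norm (k x))"
        by (intro mult_left_mono mult_right_mono) auto
      then show "norm ((1 + norm (v x)) ^ j * norm (c * of_real (E w (v x)) * k x)) \<le> norm ((norm c * K * norm w) * ((1 + norm (v x)) ^ (Suc j) * norm (k x)))"
        using K(1) by (simp add: norm_mult abs_mult mult_ac)
    qed
  qed measurable
qed

lemma moments_integrable_W:
  assumes "moments M v k" "F \<in> borel_measurable borel" "\<And>z. norm (F z) \<le> C"
  shows "integrable M (\<lambda>x. k x * W (v x) F z)"
proof (rule Bochner_Integration.integrable_bound)
  have [measurable]: "k \<in> borel_measurable M" "v \<in> borel_measurable M" "F \<in> borel_measurable borel" using assms by (auto simp: moments_def)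
  have "integrable M (\<lambda>x. (1 + norm (v x)) ^ 0 * norm (k x))" using assms(1) unfolding moments_def by blast
  then show "integrable M (\<lambda>x. C * norm (k x))" by simp
  show "(\<lambda>x. k x * W (v x) F z) \<in> borel_measurable M" by measurable
  show "AE x in M. norm (k x * W (v x) F z) \<le> norm (C * norm (k x))"
    using assms(3) by (intro AE_I2) (auto simp: norm_mult norm_W abs_mult mult.commute[of C] intro!: mult_left_mono order_trans[OF _ abs_ge_self])
qed

text \<open>Magnetic translations commute with the action of the lattice:
  \<open>E (z + u) v + E (z + v) u\<close> equals \<open>E z u + E z v\<close> because
  \<open>E\<close> is alternating.\<close>

lemma T_quasi_periodic:
  assumes "quasi_periodic F" shows "quasi_periodic (T M v k F)"
  unfolding quasi_periodic_def
proof (intro ballI allI)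
  fix u z assume u: "u \<in> U"
  have "W v F (z + u) = \<alpha> u * cis (pi * E z u) * W v F z" for v
  proof -
    have "W v F (z + u) = cis (pi * E (z + u) v) * F ((z + v) + u)" by (simp add: W_def algebra_simps)
    also have "F ((z + v) + u) = \<alpha> u * cis (pi * E (z + v) u) * F (z + v)" using assms u by (simp add: quasi_periodic_def)
    also have "cis (pi * E (z + u) v) * (\<alpha> u * cis (pi * E (z + v) u) * F (z + v)) = \<alpha> u * (cis (pi * E (z + u) v) * cis (pi * E (z + v) u)) * F (z + v)" by simp
    also have "cis (pi * E (z + u) v) * cis (pi * E (z + v) u) = cis (pi * E z u) * cis (pi * E z v)"
      unfolding cis_mult using skew[of v u] by (intro arg_cong[of _ _ cis]) (simp add: E.add_left algebra_simps)
    finally show ?thesis by (simp add: W_def)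
  qed
  then have "T M v k F (z + u) = (\<integral>x. (\<alpha> u * cis (pi * E z u)) * (k x * W (v x) F z) \<partial>M)"
    unfolding T_def by (intro Bochner_Integration.integral_cong) auto
  then show "T M v k F (z + u) = \<alpha> u * cis (pi * E z u) * T M v k F z" by (simp add: T_def)
qed

text \<open>Of the two copies of \<open>E w v\<close>, one is the derivative of the phase in
  \<open>W\<close>; the other arises because \<open>nabla w F\<close> is evaluated at
  \<open>z + v\<close>, where the connection form differs from that at \<open>z\<close>.\<close>

lemma W_has_derivative:
  assumes "F \<in> S"
  shows "((\<lambda>z. W v F z) has_derivative (\<lambda>w. W v (nabla w F) z + \<i> * of_real (pi * (2 * E w v - E z w)) * W v F z)) (at z)"
proof -
  have "((\<lambda>z. z + v) has_derivative (\<lambda>w. w)) (at z)" by (auto intro!: derivative_eq_intros)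
  then have F: "((\<lambda>z. F (z + v)) has_derivative (\<lambda>w. dird w F (z + v))) (at z)"
    using has_derivative_compose[of "\<lambda>z. z + v" "\<lambda>w. w" z UNIV F, OF _ differentiable_has_derivative_dird[OF S_differentiable[OF assms]]] by blast
  have "((\<lambda>z. \<i> * complex_of_real (pi * E z v)) has_derivative (\<lambda>w. \<i> * complex_of_real (pi * E w v))) (at z)"
    by (intro bounded_linear_imp_has_derivative bounded_linear_compose[OF bounded_linear_mult_right] bounded_linear_compose[OF bounded_linear_of_real] bounded_linear_const_mult E.bounded_linear_left)
  from has_derivative_compose[OF this DERIV_exp[unfolded has_field_derivative_def]]
  have c: "((\<lambda>z. cis (pi * E z v)) has_derivative (\<lambda>w. cis (pi * E z v) * (\<i> * of_real (pi * E w v)))) (at z)"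
    by (simp add: cis_conv_exp)
  have eq: "(\<lambda>w. W v (nabla w F) z + \<i> * of_real (pi * (2 * E w v - E z w)) * W v F z)
    = (\<lambda>w. cis (pi * E z v) * dird w F (z + v) + cis (pi * E z v) * (\<i> * of_real (pi * E w v)) * F (z + v))"
  proof
    fix w show "W v (nabla w F) z + \<i> * of_real (pi * (2 * E w v - E z w)) * W v F z = cis (pi * E z v) * dird w F (z + v) + cis (pi * E z v) * (\<i> * of_real (pi * E w v)) * F (z + v)"
      using skew[of w v] by (simp add: W_def nabla_def E.add_left algebra_simps)
  qed
  show ?thesis unfolding eq using has_derivative_mult[OF c F] by (simp add: W_def[abs_def])
qed

lemma T_derivative:
  assumes k: "moments M v k" and F: "F \<in> S"
  shows "(T M v k F has_derivative (\<lambda>w. T M v k (nabla w F) z + T M v (\<lambda>x. (2 * pi * \<i>) * of_real (E w (v x)) * k x) F z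
          - \<i> * of_real (pi * E z w) * T M v k F z)) (at z)"
proof -
  have km [measurable]: "k \<in> borel_measurable M" "v \<in> borel_measurable M" using k by (auto simp: moments_def)
  obtain K where K: "K \<ge> 0" "\<And>v w. \<bar>E v w\<bar> \<le> K * norm v * norm w" using E_bound by blast
  obtain C0 where C0: "C0 \<ge> 0" "\<And>z. norm (F z) \<le> C0" using S_bounded[OF F] by blast
  obtain C1 where C1: "C1 \<ge> 0" "\<And>w z. norm (nabla w F z) \<le> C1 * norm w" using nabla_bounded[OF F] by blast
  \<comment> \<open>Covers the whole unit ball around \<open>z\<close>: the summand \<open>2\<close>
    belongs to \<open>2 * E w (v x)\<close>, and \<open>norm z + 1\<close> bounds the base point in
    \<open>E y w\<close>.\<close>
  define C where "C = C1 + pi * K * (2 + norm z + 1) * C0"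
  note [measurable] = S_measurable[OF F] S_measurable[OF nabla_in[OF F]]
  have der: "(T M v k F has_derivative (\<lambda>w. \<integral>x. k x * (W (v x) (nabla w F) z + \<i> * of_real (pi * (2 * E w (v x) - E z w)) * W (v x) F z) \<partial>M)) (at z)"
    unfolding T_def[abs_def]
  proof (rule has_derivative_integral[where r = 1 and w = "\<lambda>x. C * ((1 + norm (v x)) ^ 1 * norm (k x))"])
    show "(\<lambda>x. k x * W (v x) F y) \<in> borel_measurable M" for y by measurable
    show "(\<lambda>x. k x * (W (v x) (nabla w F) z + \<i> * of_real (pi * (2 * E w (v x) - E z w)) * W (v x) F z)) \<in> borel_measurable M" for w by measurable
    show "((\<lambda>z. k x * W (v x) F z) has_derivative (\<lambda>w. k x * (W (v x) (nabla w F) y + \<i> * of_real (pi * (2 * E w (v x) - E y w)) * W (v x) F y))) (at y)" for x y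
      by (rule has_derivative_mult_right[OF W_has_derivative[OF F]])
    show "integrable M (\<lambda>x. k x * W (v x) F z)" by (rule moments_integrable_W[OF k _ C0(2)]) measurable
    show "integrable M (\<lambda>x. C * ((1 + norm (v x)) ^ 1 * norm (k x)))"
      using k unfolding moments_def by (intro integrable_mult_right) blast
    fix y x w assume y: "y \<in> ball z 1"
    have ny: "norm y \<le> norm z + 1" using y norm_triangle_ineq2[of y z] by (simp add: dist_norm norm_minus_commute)
    have "norm (W (v x) (nabla w F) y + \<i> * of_real (pi * (2 * E w (v x) - E y w)) * W (v x) F y)
       \<le> norm (nabla w F (y + v x)) + pi * \<bar>2 * E w (v x) - E y w\<bar> * norm (F (y + v x))"
      by (rule order_trans[OF norm_triangle_ineq]) (simp only: norm_mult norm_W norm_ii norm_of_real abs_mult abs_of_pos[OF pi_gt_zero] mult_1 order_refl)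
    also have "\<dots> \<le> C1 * norm w + pi * (2 * (K * norm w * norm (v x)) + K * norm y * norm w) * C0"
      using K(2)[of w "v x"] K(2)[of y w] K(1) C0 C1
      by (intro add_mono C1 mult_mono C0) (auto intro!: mult_nonneg_nonneg add_nonneg_nonneg)
    also have "\<dots> \<le> C1 * norm w * (1 + norm (v x)) + pi * (2 * (K * norm w * (1 + norm (v x))) + K * (norm z + 1) * norm w * (1 + norm (v x))) * C0"
    proof (intro add_mono mult_left_mono mult_right_mono)
      have "K * norm y * norm w \<le> K * (norm z + 1) * norm w" using ny K(1) by (intro mult_mono) auto
      also have "\<dots> \<le> K * (norm z + 1) * norm w * (1 + norm (v x))"
        using mult_left_mono[of 1 "1 + norm (v x)" "K * (norm z + 1) * norm w"] K(1) by simp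
      finally show "K * norm y * norm w \<le> K * (norm z + 1) * norm w * (1 + norm (v x))" .
      show "C1 * norm w \<le> C1 * norm w * (1 + norm (v x))"
        using mult_left_mono[of 1 "1 + norm (v x)" "C1 * norm w"] C1(1) by simp
    qed (use K C0 in auto)
    also have "\<dots> = C * (1 + norm (v x)) * norm w" by (simp add: C_def algebra_simps)
    finally have "norm (k x) * norm (W (v x) (nabla w F) y + \<i> * of_real (pi * (2 * E w (v x) - E y w)) * W (v x) F y) \<le> norm (k x) * (C * (1 + norm (v x)) * norm w)"
      by (rule mult_left_mono) simp
    then show "norm (k x * (W (v x) (nabla w F) y + \<i> * of_real (pi * (2 * E w (v x) - E y w)) * W (v x) F y)) \<le> C * ((1 + norm (v x)) ^ 1 * norm (k x)) * norm w"
      by (simp only: norm_mult power_one_right mult_ac)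
  qed simp
  have eq: "(\<integral>x. k x * (W (v x) (nabla w F) z + \<i> * of_real (pi * (2 * E w (v x) - E z w)) * W (v x) F z) \<partial>M)
     = T M v k (nabla w F) z + T M v (\<lambda>x. (2 * pi * \<i>) * of_real (E w (v x)) * k x) F z - \<i> * of_real (pi * E z w) * T M v k F z" for w
  proof -
    obtain C2 where C2: "\<And>z. norm (nabla w F z) \<le> C2" using S_bounded[OF nabla_in[OF F]] by blast
    have i1: "integrable M (\<lambda>x. k x * W (v x) (nabla w F) z)" by (rule moments_integrable_W[OF k _ C2]) measurable
    have i2: "integrable M (\<lambda>x. (2 * pi * \<i>) * of_real (E w (v x)) * k x * W (v x) F z)" by (rule moments_integrable_W[OF moments_E[OF k] _ C0(2)]) measurable
    have i3: "integrable M (\<lambda>x. k x * W (v x) F z)" by (rule moments_integrable_W[OF k _ C0(2)]) measurable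
    have "(\<integral>x. k x * (W (v x) (nabla w F) z + \<i> * of_real (pi * (2 * E w (v x) - E z w)) * W (v x) F z) \<partial>M)
      = (\<integral>x. k x * W (v x) (nabla w F) z + (2 * pi * \<i>) * of_real (E w (v x)) * k x * W (v x) F z - \<i> * of_real (pi * E z w) * (k x * W (v x) F z) \<partial>M)"
      by (intro Bochner_Integration.integral_cong) (auto simp: algebra_simps)
    then show ?thesis unfolding T_def using i1 i2 i3 by simp
  qed
  show ?thesis using der unfolding eq .
qed

lemma nabla_T:
  assumes k: "moments M v k" and F: "F \<in> S"
  shows "nabla w (T M v k F) z = T M v k (nabla w F) z + T M v (\<lambda>x. (2 * pi * \<i>) * of_real (E w (v x)) * k x) F z"
  using dird_eqI[OF T_derivative[OF assms]] by (simp add: nabla_def)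

text \<open>The derivative of an average is a combination of averages, of a derivative of
  \<open>F\<close> or with a kernel multiplied by a linear factor. Both stay in the class, so the
  induction on the order runs over all kernels and functions.\<close>

lemma T_in:
  assumes k: "moments M v k" and F: "F \<in> S" shows "T M v k F \<in> S"
proof -
  have "times_differentiable m (T M v k F)" if "moments M v k" "F \<in> S" for m k F
    using that
  proof (induction m arbitrary: k F)
    case 0
    have "T M v k F differentiable (at z)" for z using T_derivative[OF 0] differentiable_def by blast
    then show ?case by (auto simp: continuous_on_eq_continuous_at intro: differentiable_imp_continuous_within)
  next
    case (Suc m)
    have d: "dird w (T M v k F) = (\<lambda>z. T M v k (nabla w F) z + T M v (\<lambda>x. (2 * pi * \<i>) * of_real (E w (v x)) * k x) F z
          + - \<i> * (of_real (pi * E z w) * T M v k F z))" for w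
      using dird_eqI[OF T_derivative[OF Suc.prems]] by (auto simp: algebra_simps)
    have lin: "times_differentiable m (\<lambda>z. complex_of_real (pi * E z w))" for w
      using smooth_function_linear_E smooth_function_def by blast
    have "times_differentiable m (dird w (T M v k F))" for w
      unfolding d by (intro times_differentiable_add times_differentiable_mult times_differentiable_const lin Suc.IH Suc.prems nabla_in moments_E)
    moreover have "T M v k F differentiable (at z)" for z using T_derivative[OF Suc.prems] differentiable_def by blast
    ultimately show ?case by (simp add: times_differentiable_Suc_dird del: times_differentiable.simps)
  qed
  then show ?thesis using assms T_quasi_periodic by (auto simp: S_def smooth_function_def)
qed

end

section \<open>Gaussian kernels\<close>

definition gauss :: "('v::euclidean_space \<Rightarrow> real) \<Rightarrow> 'v \<Rightarrow> complex" where
  "gauss a \<xi> = of_real (exp (- (\<Sum>b\<in>Basis. a b * (\<xi> \<bullet> b)\<^sup>2)))"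

text \<open>Polynomials times a fixed Gaussian, generated by the operations that derivatives
  produce; closure and decay are then proved by induction without any notion of degree.\<close>

inductive_set poly_gauss :: "('v::euclidean_space \<Rightarrow> real) \<Rightarrow> ('v \<Rightarrow> complex) set" for a where
  gauss: "gauss a \<in> poly_gauss a"
| coord: "\<kappa> \<in> poly_gauss a \<Longrightarrow> b \<in> Basis \<Longrightarrow> (\<lambda>\<xi>. of_real (\<xi> \<bullet> b) * \<kappa> \<xi>) \<in> poly_gauss a"
| add: "\<kappa> \<in> poly_gauss a \<Longrightarrow> \<kappa>' \<in> poly_gauss a \<Longrightarrow> (\<lambda>\<xi>. \<kappa> \<xi> + \<kappa>' \<xi>) \<in> poly_gauss a"
| scale: "\<kappa> \<in> poly_gauss a \<Longrightarrow> (\<lambda>\<xi>. c * \<kappa> \<xi>) \<in> poly_gauss a"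

lemma poly_gauss_sum:
  assumes "\<And>i. i \<in> J \<Longrightarrow> \<kappa> i \<in> poly_gauss a" "finite J"
  shows "(\<lambda>\<xi>. \<Sum>i\<in>J. \<kappa> i \<xi>) \<in> poly_gauss a"
  using assms(2,1)
proof (induction J rule: finite_induct)
  case empty
  show ?case using poly_gauss.scale[OF poly_gauss.gauss, of 0] by simp
qed (simp add: poly_gauss.add)

lemma poly_gauss_linear:
  assumes "\<kappa> \<in> poly_gauss a" "linear f"
  shows "(\<lambda>\<xi>. of_real (f \<xi>) * \<kappa> \<xi>) \<in> poly_gauss a"
proof -
  have "f \<xi> = (\<Sum>b\<in>Basis. (\<xi> \<bullet> b) * f b)" for \<xi>
    using linear_sum[OF assms(2), of "\<lambda>b. (\<xi> \<bullet> b) *\<^sub>R b" Basis]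
    by (simp only: euclidean_representation linear_scale[OF assms(2)] real_scaleR_def)
  then have "complex_of_real (f \<xi>) = of_real (\<Sum>b\<in>Basis. (\<xi> \<bullet> b) * f b)" for \<xi> by (rule arg_cong)
  then have "(\<lambda>\<xi>. of_real (f \<xi>) * \<kappa> \<xi>) = (\<lambda>\<xi>. of_real (\<Sum>b\<in>Basis. (\<xi> \<bullet> b) * f b) * \<kappa> \<xi>)" by (rule ext[OF arg_cong])
  also have "\<dots> = (\<lambda>\<xi>. \<Sum>b\<in>Basis. of_real (f b) * (of_real (\<xi> \<bullet> b) * \<kappa> \<xi>))"
    by (auto simp: sum_distrib_left sum_distrib_right mult_ac)
  finally show ?thesis using assms(1) by (auto intro!: poly_gauss_sum poly_gauss.intros)
qed

lemma gauss_has_derivative: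
  "(gauss a has_derivative (\<lambda>\<eta>. \<Sum>b\<in>Basis. of_real (\<eta> \<bullet> b) * (of_real (- 2 * a b) * (of_real (\<xi> \<bullet> b) * gauss a \<xi>)))) (at \<xi>)"
proof -
  have "((\<lambda>\<xi>. exp (- (\<Sum>b\<in>Basis. a b * (\<xi> \<bullet> b)\<^sup>2))) has_derivative (\<lambda>\<eta>. exp (- (\<Sum>b\<in>Basis. a b * (\<xi> \<bullet> b)\<^sup>2)) * - (\<Sum>b\<in>Basis. a b * (2 * (\<xi> \<bullet> b) * (\<eta> \<bullet> b))))) (at \<xi>)"
    by (auto intro!: derivative_eq_intros simp: algebra_simps)
  from bounded_linear.has_derivative[OF bounded_linear_of_real[where 'a=complex] this]
  show ?thesis unfolding gauss_def[abs_def]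
    by (simp add: sum_distrib_left sum_negf[symmetric] mult_ac)
qed

lemma poly_gauss_derivative:
  assumes "\<kappa> \<in> poly_gauss a"
  shows "\<kappa> differentiable (at \<xi>) \<and> dird \<eta> \<kappa> \<in> poly_gauss a"
  using assms
proof (induction arbitrary: \<eta> \<xi> rule: poly_gauss.induct)
  case gauss
  have "gauss a differentiable (at \<xi>)" using gauss_has_derivative differentiable_def by blast
  moreover have "dird \<eta> (gauss a) = (\<lambda>\<xi>. \<Sum>b\<in>Basis. of_real (\<eta> \<bullet> b) * (of_real (- 2 * a b) * (of_real (\<xi> \<bullet> b) * gauss a \<xi>)))"
    using dird_eqI[OF gauss_has_derivative] by blast
  ultimately show ?case
    by (simp only:) (intro conjI TrueI poly_gauss_sum poly_gauss.scale poly_gauss.coord poly_gauss.gauss finite_Basis)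
next
  case (coord \<kappa> b)
  have bl: "bounded_linear (\<lambda>\<xi>. complex_of_real (\<xi> \<bullet> b))"
    by (intro bounded_linear_compose[OF bounded_linear_of_real] bounded_linear_inner_left)
  have "(\<lambda>\<xi>. of_real (\<xi> \<bullet> b) * \<kappa> \<xi>) differentiable (at \<xi>)"
    using coord by (intro differentiable_mult[OF bounded_linear_imp_differentiable[OF bl]]) auto
  moreover have "dird \<eta> (\<lambda>\<xi>. of_real (\<xi> \<bullet> b) * \<kappa> \<xi>) = (\<lambda>\<xi>. of_real (\<xi> \<bullet> b) * dird \<eta> \<kappa> \<xi> + of_real (\<eta> \<bullet> b) * \<kappa> \<xi>)"
    using coord by (subst dird_mult) (auto simp: dird_bounded_linear[OF bl] intro!: bounded_linear_imp_differentiable[OF bl])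
  ultimately show ?case using coord by (auto intro!: poly_gauss.intros)
next
  case (add \<kappa> \<kappa>')
  then show ?case by (auto simp: dird_add intro!: poly_gauss.intros)
next
  case (scale \<kappa> c)
  have "dird \<eta> (\<lambda>\<xi>. c * \<kappa> \<xi>) = (\<lambda>\<xi>. c * dird \<eta> \<kappa> \<xi>)"
    using scale by (subst dird_mult) (auto simp: dird_const)
  then show ?case using scale by (auto intro!: poly_gauss.intros)
qed

lemma poly_gauss_continuous: "\<kappa> \<in> poly_gauss a \<Longrightarrow> continuous_on S \<kappa>"
  using poly_gauss_derivative by (meson continuous_at_imp_continuous_on differentiable_imp_continuous_within)

lemma poly_gauss_measurable: "\<kappa> \<in> poly_gauss a \<Longrightarrow> \<kappa> \<in> borel_measurable borel"
  by (rule borel_measurable_continuous_onI[OF poly_gauss_continuous])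

lemma norm_gauss_le:
  fixes \<xi> :: "'v::euclidean_space"
  assumes "\<And>b. b \<in> Basis \<Longrightarrow> a b \<ge> m"
  shows "norm (gauss a \<xi>) \<le> exp (- m * (norm \<xi>)\<^sup>2)"
proof -
  have "m * (norm \<xi>)\<^sup>2 = (\<Sum>b\<in>Basis. m * (\<xi> \<bullet> b)\<^sup>2)"
    unfolding power2_norm_eq_inner euclidean_inner[of \<xi> \<xi>] by (simp add: sum_distrib_left power2_eq_square)
  also have "\<dots> \<le> (\<Sum>b\<in>Basis. a b * (\<xi> \<bullet> b)\<^sup>2)" using assms by (intro sum_mono mult_right_mono) auto
  finally show ?thesis by (simp add: gauss_def)
qed

text \<open>Expanding \<open>0 \<le> m * (x - 1)\<^sup>2\<close>. It replaces Gaussian decay by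
  exponential decay, so that a single integrability result suffices everywhere.\<close>

lemma gauss_exp_bound:
  fixes m x :: real assumes "m \<ge> 0" shows "exp (- m * x\<^sup>2) \<le> exp m * exp (- 2 * m * x)"
proof -
  have "0 \<le> m * (x - 1)\<^sup>2" using assms by simp
  then show ?thesis unfolding exp_add[symmetric] by (simp add: power2_eq_square algebra_simps)
qed

text \<open>The Gaussian supplies the rate \<open>2 * m\<close>; half of it is spent on absorbing
  the polynomial factor.\<close>

lemma poly_gauss_bound:
  fixes a :: "'v::euclidean_space \<Rightarrow> real"
  assumes "\<kappa> \<in> poly_gauss a" and m: "m > 0" "\<And>b. b \<in> Basis \<Longrightarrow> a b \<ge> m"
  shows "\<exists>C\<ge>0. \<forall>\<xi>. norm (\<kappa> \<xi>) \<le> C * exp (- m * norm \<xi>)"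
proof -
  have "\<exists>C k. C \<ge> 0 \<and> (\<forall>\<xi>. norm (\<kappa> \<xi>) \<le> C * (1 + norm \<xi>) ^ k * exp (- 2 * m * norm \<xi>))"
    using assms(1)
  proof (induction rule: poly_gauss.induct)
    case gauss
    show ?case using order_trans[OF norm_gauss_le[OF m(2)] gauss_exp_bound[of m]] m(1)
      by (intro exI[of _ "exp m"] exI[of _ 0]) auto
  next
    case (coord \<kappa> b)
    then obtain C k where C: "C \<ge> 0" "\<And>\<xi>. norm (\<kappa> \<xi>) \<le> C * (1 + norm \<xi>) ^ k * exp (- 2 * m * norm \<xi>)" by auto
    have "norm (of_real (\<xi> \<bullet> b) * \<kappa> \<xi>) \<le> C * (1 + norm \<xi>) ^ Suc k * exp (- 2 * m * norm \<xi>)" for \<xi>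
    proof -
      have "norm (of_real (\<xi> \<bullet> b) * \<kappa> \<xi>) \<le> (1 + norm \<xi>) * (C * (1 + norm \<xi>) ^ k * exp (- 2 * m * norm \<xi>))"
        unfolding norm_mult norm_of_real using Basis_le_norm[OF coord.hyps(2), of \<xi>] C(2)[of \<xi>] by (intro mult_mono) auto
      then show ?thesis by (simp add: mult_ac)
    qed
    then show ?case using C(1) by blast
  next
    case (add \<kappa> \<kappa>')
    then obtain C k C' k' where C: "C \<ge> 0" "\<And>\<xi>. norm (\<kappa> \<xi>) \<le> C * (1 + norm \<xi>) ^ k * exp (- 2 * m * norm \<xi>)"
      and C': "C' \<ge> 0" "\<And>\<xi>. norm (\<kappa>' \<xi>) \<le> C' * (1 + norm \<xi>) ^ k' * exp (- 2 * m * norm \<xi>)" by auto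
    have "norm (\<kappa> \<xi> + \<kappa>' \<xi>) \<le> (C + C') * (1 + norm \<xi>) ^ max k k' * exp (- 2 * m * norm \<xi>)" for \<xi>
    proof -
      have "norm (\<kappa> \<xi> + \<kappa>' \<xi>) \<le> C * (1 + norm \<xi>) ^ k * exp (- 2 * m * norm \<xi>) + C' * (1 + norm \<xi>) ^ k' * exp (- 2 * m * norm \<xi>)"
        using norm_triangle_ineq[of "\<kappa> \<xi>" "\<kappa>' \<xi>"] C(2)[of \<xi>] C'(2)[of \<xi>] by linarith
      also have "\<dots> \<le> C * (1 + norm \<xi>) ^ max k k' * exp (- 2 * m * norm \<xi>) + C' * (1 + norm \<xi>) ^ max k k' * exp (- 2 * m * norm \<xi>)"
        using C(1) C'(1) by (intro add_mono mult_right_mono mult_left_mono power_increasing) auto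
      finally show ?thesis by (simp add: algebra_simps)
    qed
    then show ?case using C(1) C'(1) by (intro exI[of _ "C + C'"] exI[of _ "max k k'"]) auto
  next
    case (scale \<kappa> c)
    then obtain C k where C: "C \<ge> 0" "\<And>\<xi>. norm (\<kappa> \<xi>) \<le> C * (1 + norm \<xi>) ^ k * exp (- 2 * m * norm \<xi>)" by auto
    have "norm (c * \<kappa> \<xi>) \<le> (norm c * C) * (1 + norm \<xi>) ^ k * exp (- 2 * m * norm \<xi>)" for \<xi>
      using mult_left_mono[OF C(2)[of \<xi>], of "norm c"] by (simp add: norm_mult mult_ac)
    then show ?case using C(1) by (intro exI[of _ "norm c * C"] exI[of _ k]) auto
  qed
  then obtain C k where C: "C \<ge> 0" "\<And>\<xi>. norm (\<kappa> \<xi>) \<le> C * (1 + norm \<xi>) ^ k * exp (- 2 * m * norm \<xi>)" by blast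
  obtain C' where C': "C' \<ge> 0" "\<And>x::real. x \<ge> 0 \<Longrightarrow> (1 + x) ^ k \<le> C' * exp (m * x)" using power_exp_bounded[OF m(1)] by metis
  have "norm (\<kappa> \<xi>) \<le> (C * C') * exp (- m * norm \<xi>)" for \<xi>
  proof -
    have "norm (\<kappa> \<xi>) \<le> C * (C' * exp (m * norm \<xi>)) * exp (- 2 * m * norm \<xi>)"
      by (rule order_trans[OF C(2)]) (intro mult_right_mono mult_left_mono C C', auto)
    also have "\<dots> = C * C' * exp (m * norm \<xi> + - 2 * m * norm \<xi>)" by (simp only: exp_add mult.assoc)
    finally show ?thesis by simp
  qed
  then show ?thesis using C C' by (intro exI[of _ "C * C'"]) auto
qed

lemma pos_lower_bound:
  fixes a :: "'v::euclidean_space \<Rightarrow> real"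
  assumes "\<And>b. b \<in> Basis \<Longrightarrow> a b > 0"
  obtains m where "m > 0" "\<And>b. b \<in> Basis \<Longrightarrow> a b \<ge> m"
proof
  have "Min (a ` Basis) \<in> a ` Basis" by (intro Min_in) auto
  then show "Min (a ` Basis) > 0" using assms by auto
qed auto

section \<open>Coordinates adapted to the alternating form, and averages with Gaussian
  kernels\<close>

text \<open>\<open>X i\<close>, \<open>Y i\<close> is a frame in which \<open>E\<close> splits into
  planes, with the sign and size of \<open>E (X i) (Y i)\<close> chosen to make the commutator of
  annihilation and creation equal to \<open>\<nu> i\<close>. The vectors \<open>dx i\<close>,
  \<open>dy i\<close> merely enumerate the auxiliary orthonormal \<open>Basis\<close> and provide
  coordinates for integration.\<close>

locale magnetic_frame = magnetic B U E \<alpha> D for B U :: "'v::euclidean_space set" and E \<alpha> D +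
  fixes I :: "nat set" and X Y dx dy :: "nat \<Rightarrow> 'v" and \<nu> :: "nat \<Rightarrow> real"
  assumes finite_I [simp]: "finite I"
    and inj: "inj_on dx I" "inj_on dy I" and disj: "dx ` I \<inter> dy ` I = {}" and Basis_eq: "dx ` I \<union> dy ` I = Basis"
    and E_XX: "i \<in> I \<Longrightarrow> j \<in> I \<Longrightarrow> E (X i) (X j) = 0"
    and E_YY: "i \<in> I \<Longrightarrow> j \<in> I \<Longrightarrow> E (Y i) (Y j) = 0"
    and E_XY: "i \<in> I \<Longrightarrow> j \<in> I \<Longrightarrow> E (X i) (Y j) = (if i = j then - \<nu> i / pi else 0)"
    and \<nu>_pos: "i \<in> I \<Longrightarrow> \<nu> i > 0"
begin

lemma E_YX: "i \<in> I \<Longrightarrow> j \<in> I \<Longrightarrow> E (Y i) (X j) = (if i = j then \<nu> i / pi else 0)"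
  using skew[of "Y i" "X j"] E_XY by auto

lemma sum_Basis: "(\<Sum>b\<in>Basis. f b) = (\<Sum>i\<in>I. f (dx i) + f (dy i))"
  unfolding Basis_eq[symmetric] using disj inj
  by (simp add: sum.union_disjoint sum.reindex sum.distrib)
lemma prod_Basis: "(\<Prod>b\<in>Basis. f b) = (\<Prod>i\<in>I. f (dx i) * f (dy i))"
  unfolding Basis_eq[symmetric] using disj inj
  by (simp add: prod.union_disjoint prod.reindex prod.distrib)

lemma Basis_frame: "i \<in> I \<Longrightarrow> dx i \<in> Basis" "i \<in> I \<Longrightarrow> dy i \<in> Basis" using Basis_eq by auto
lemma inner_frame:
  assumes "i \<in> I" "j \<in> I"
  shows "dx i \<bullet> dx j = (if i = j then 1 else 0)" "dy i \<bullet> dy j = (if i = j then 1 else 0)" "dx i \<bullet> dy j = 0" "dy i \<bullet> dx j = 0"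
  using assms inj disj Basis_frame by (auto simp: inner_Basis inj_on_def)

definition Lam :: "'v \<Rightarrow> 'v" where "Lam \<xi> = (\<Sum>i\<in>I. (\<xi> \<bullet> dx i) *\<^sub>R X i + (\<xi> \<bullet> dy i) *\<^sub>R Y i)"
text \<open>The inverse of \<open>Lam\<close>, given explicitly: pairing with \<open>Y i\<close> and
  \<open>X i\<close> under \<open>E\<close> reads off the two coordinates of the \<open>i\<close>-th
  plane.\<close>

definition Lam' :: "'v \<Rightarrow> 'v" where
  "Lam' z = (\<Sum>i\<in>I. (- pi * E z (Y i) / \<nu> i) *\<^sub>R dx i + (pi * E z (X i) / \<nu> i) *\<^sub>R dy i)"

lemma linear_Lam: "linear Lam"
  by (rule linearI) (simp_all add: Lam_def inner_add_left scaleR_add_left sum.distrib scaleR_sum_right scaleR_add_right algebra_simps)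
lemma linear_Lam': "linear Lam'"
proof (rule linearI)
  show "Lam' (z + w) = Lam' z + Lam' w" for z w
    unfolding Lam'_def sum.distrib[symmetric]
    by (rule sum.cong) (simp_all add: E.add_left add_divide_distrib diff_divide_distrib scaleR_add_left scaleR_diff_left algebra_simps)
  show "Lam' (c *\<^sub>R z) = c *\<^sub>R Lam' z" for c z
    unfolding Lam'_def scaleR_sum_right
    by (rule sum.cong) (simp_all add: E.scaleR_left scaleR_diff_right algebra_simps)
qed

lemma Lam_dx: "i \<in> I \<Longrightarrow> Lam (dx i) = X i"
proof -
  assume i: "i \<in> I"
  have "Lam (dx i) = (\<Sum>j\<in>I. if j = i then X j else 0)"
    unfolding Lam_def using i by (intro sum.cong) (auto simp: inner_frame)
  then show ?thesis using i by simp
qed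
lemma Lam_dy: "i \<in> I \<Longrightarrow> Lam (dy i) = Y i"
proof -
  assume i: "i \<in> I"
  have "Lam (dy i) = (\<Sum>j\<in>I. if j = i then Y j else 0)"
    unfolding Lam_def using i by (intro sum.cong) (auto simp: inner_frame)
  then show ?thesis using i by simp
qed

lemma E_Lam:
  assumes "j \<in> I"
  shows "E (X j) (Lam \<xi>) = - \<nu> j / pi * (\<xi> \<bullet> dy j)" "E (Y j) (Lam \<xi>) = \<nu> j / pi * (\<xi> \<bullet> dx j)"
proof -
  have "E (X j) (Lam \<xi>) = (\<Sum>i\<in>I. if i = j then - \<nu> j / pi * (\<xi> \<bullet> dy j) else 0)"
    unfolding Lam_def E.sum_right using assms
    by (intro sum.cong) (auto simp: E.add_right E.scaleR_right E_XX E_XY)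
  then show "E (X j) (Lam \<xi>) = - \<nu> j / pi * (\<xi> \<bullet> dy j)" using assms by simp
  have "E (Y j) (Lam \<xi>) = (\<Sum>i\<in>I. if i = j then \<nu> j / pi * (\<xi> \<bullet> dx j) else 0)"
    unfolding Lam_def E.sum_right using assms
    by (intro sum.cong) (auto simp: E.add_right E.scaleR_right E_YY E_YX)
  then show "E (Y j) (Lam \<xi>) = \<nu> j / pi * (\<xi> \<bullet> dx j)" using assms by simp
qed

lemma Lam'_Lam: "Lam' (Lam \<xi>) = \<xi>"
proof -
  have "Lam' (Lam \<xi>) = (\<Sum>i\<in>I. (\<xi> \<bullet> dx i) *\<^sub>R dx i + (\<xi> \<bullet> dy i) *\<^sub>R dy i)"
    unfolding Lam'_def using \<nu>_pos
    by (intro sum.cong refl) (simp add: skew[of "Lam \<xi>"] E_Lam less_imp_neq[symmetric])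
  also have "\<dots> = \<xi>" using sum_Basis[of "\<lambda>b. (\<xi> \<bullet> b) *\<^sub>R b"] by (simp add: euclidean_representation)
  finally show ?thesis .
qed

lemma Lam_Lam': "Lam (Lam' z) = z"
proof -
  have "Lam' \<circ> Lam = id" using Lam'_Lam by (simp add: fun_eq_iff)
  then have "Lam \<circ> Lam' = id" using linear_inverse_left[OF linear_Lam' linear_Lam] by blast
  then show ?thesis by (simp add: fun_eq_iff)
qed

lemma Lam'_X: "i \<in> I \<Longrightarrow> Lam' (X i) = dx i" and Lam'_Y: "i \<in> I \<Longrightarrow> Lam' (Y i) = dy i"
  using Lam'_Lam Lam_dx Lam_dy by metis+

lemma Lam_bound: "\<exists>L>0. \<forall>\<xi>. norm (Lam \<xi>) \<le> L * norm \<xi>" and Lam'_bound: "\<exists>L>0. \<forall>\<xi>. norm (Lam' \<xi>) \<le> L * norm \<xi>"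
  using linear_bounded_pos linear_Lam linear_Lam' by blast+

lemma Lam_measurable [measurable]: "Lam \<in> borel_measurable borel"
  using linear_Lam by (intro borel_measurable_continuous_onI linear_continuous_on) (simp add: linear_conv_bounded_linear)

abbreviation G :: "('v \<Rightarrow> complex) \<Rightarrow> ('v \<Rightarrow> complex) \<Rightarrow> 'v \<Rightarrow> complex" where "G \<equiv> T lborel Lam"

lemma poly_gauss_moments:
  assumes "\<kappa> \<in> poly_gauss a" "\<And>b. b \<in> Basis \<Longrightarrow> a b > 0"
  shows "moments lborel Lam \<kappa>"
  unfolding moments_def
proof (intro conjI allI)
  obtain m where m: "m > 0" "\<And>b. b \<in> Basis \<Longrightarrow> a b \<ge> m" using pos_lower_bound assms(2) by metis
  obtain C where C: "C \<ge> 0" "\<And>\<xi>. norm (\<kappa> \<xi>) \<le> C * exp (- m * norm \<xi>)" using poly_gauss_bound[OF assms(1) m] by blast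
  obtain L where L: "L > 0" "\<And>\<xi>. norm (Lam \<xi>) \<le> L * norm \<xi>" using Lam_bound by blast
  note [measurable] = poly_gauss_measurable[OF assms(1)]
  show "\<kappa> \<in> borel_measurable lborel" "Lam \<in> borel_measurable lborel" by measurable
  fix j
  show "integrable lborel (\<lambda>\<xi>. (1 + norm (Lam \<xi>)) ^ j * norm (\<kappa> \<xi>))"
  proof (rule Bochner_Integration.integrable_bound)
    show "integrable lborel (\<lambda>\<xi>::'v. ((1 + L) ^ j * C) * ((1 + norm \<xi>) ^ j * exp (- m * norm \<xi>)))"
      by (intro integrable_mult_right integrable_power_exp_norm m)
    show "AE \<xi> in lborel. norm ((1 + norm (Lam \<xi>)) ^ j * norm (\<kappa> \<xi>)) \<le> norm (((1 + L) ^ j * C) * ((1 + norm \<xi>) ^ j * exp (- m * norm \<xi>)))"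
    proof (rule AE_I2)
      fix \<xi>
      have "1 + norm (Lam \<xi>) \<le> (1 + L) * (1 + norm \<xi>)" using L(2)[of \<xi>] L(1) by (simp add: algebra_simps) (smt (verit) norm_ge_zero)
      then have "(1 + norm (Lam \<xi>)) ^ j * norm (\<kappa> \<xi>) \<le> ((1 + L) * (1 + norm \<xi>)) ^ j * (C * exp (- m * norm \<xi>))"
        by (intro mult_mono power_mono C) (use L in \<open>auto intro!: zero_le_power mult_nonneg_nonneg\<close>)
      then show "norm ((1 + norm (Lam \<xi>)) ^ j * norm (\<kappa> \<xi>)) \<le> norm (((1 + L) ^ j * C) * ((1 + norm \<xi>) ^ j * exp (- m * norm \<xi>)))"
        using C(1) L(1) by (simp add: power_mult_distrib abs_mult mult_ac)
    qed
  qed measurable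
qed

text \<open>What \<open>nabla w\<close> does to the kernel of an average when the derivative is
  moved off the averaged function.\<close>

definition \<delta> :: "'v \<Rightarrow> ('v \<Rightarrow> complex) \<Rightarrow> 'v \<Rightarrow> complex" where
  "\<delta> w \<kappa> \<xi> = - dird (Lam' w) \<kappa> \<xi> + \<i> * of_real (pi * E w (Lam \<xi>)) * \<kappa> \<xi>"

lemma \<delta>_poly_gauss: "\<kappa> \<in> poly_gauss a \<Longrightarrow> \<delta> w \<kappa> \<in> poly_gauss a"
proof -
  assume k: "\<kappa> \<in> poly_gauss a"
  have "linear (\<lambda>\<xi>. pi * E w (Lam \<xi>))"
    by (rule linearI) (simp_all add: linear_add[OF linear_Lam] linear_scale[OF linear_Lam] E.add_right E.scaleR_right algebra_simps)
  from poly_gauss.add[OF poly_gauss.scale[of "dird (Lam' w) \<kappa>" a "-1"] poly_gauss.scale[OF poly_gauss_linear[OF k this], of \<i>]]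
  show ?thesis using poly_gauss_derivative[OF k] by (simp add: \<delta>_def[abs_def] mult.assoc)
qed

lemma G_derivative:
  assumes k: "\<kappa> \<in> poly_gauss a" and a: "\<And>b. b \<in> Basis \<Longrightarrow> a b > 0"
    and F [measurable]: "F \<in> borel_measurable borel" and FC: "\<And>z. norm (F z) \<le> C"
  shows "(G \<kappa> F has_derivative (\<lambda>w. G (\<delta> w \<kappa>) F z - \<i> * of_real (pi * E z w) * G \<kappa> F z)) (at z)"
proof -
  note [measurable] = poly_gauss_measurable[OF k] poly_gauss_measurable[OF conjunct2[OF poly_gauss_derivative[OF k]]]
  have Lam'm [measurable]: "Lam' \<in> borel_measurable borel"
    using linear_Lam' by (intro borel_measurable_continuous_onI linear_continuous_on) (simp add: linear_conv_bounded_linear)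
  obtain m where m: "m > 0" "\<And>b. b \<in> Basis \<Longrightarrow> a b \<ge> m" using pos_lower_bound a by metis
  obtain C0 where C0: "C0 \<ge> 0" "\<And>\<xi>. norm (\<kappa> \<xi>) \<le> C0 * exp (- m * norm \<xi>)" using poly_gauss_bound[OF k m] by blast
  have "\<forall>b. \<exists>C\<ge>0. \<forall>\<xi>. norm (dird b \<kappa> \<xi>) \<le> C * exp (- m * norm \<xi>)"
    using poly_gauss_bound[OF conjunct2[OF poly_gauss_derivative[OF k]] m] by blast
  then obtain Cb where Cb: "\<And>b. Cb b \<ge> 0" "\<And>b \<xi>. norm (dird b \<kappa> \<xi>) \<le> Cb b * exp (- m * norm \<xi>)" by metis
  define C1 where "C1 = (\<Sum>b\<in>Basis. Cb b)"
  have C1: "C1 \<ge> 0" unfolding C1_def using Cb by (auto intro: sum_nonneg)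
  have kd: "\<kappa> differentiable (at \<xi>)" for \<xi> using poly_gauss_derivative[OF k] by blast
  have C1': "norm (dird \<eta> \<kappa> \<xi>) \<le> C1 * exp (- m * norm \<xi>) * norm \<eta>" for \<eta> \<xi>
  proof -
    have lin: "linear (\<lambda>v. dird v \<kappa> \<xi>)" using differentiable_has_derivative_dird[OF kd] has_derivative_linear by blast
    have "dird \<eta> \<kappa> \<xi> = (\<Sum>b\<in>Basis. (\<eta> \<bullet> b) *\<^sub>R dird b \<kappa> \<xi>)"
      using linear_sum[OF lin, of "\<lambda>b. (\<eta> \<bullet> b) *\<^sub>R b" Basis]
      by (simp only: euclidean_representation linear_scale[OF lin])
    then have "norm (dird \<eta> \<kappa> \<xi>) \<le> (\<Sum>b\<in>Basis. norm ((\<eta> \<bullet> b) *\<^sub>R dird b \<kappa> \<xi>))" by (simp only: norm_sum)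
    also have "\<dots> \<le> (\<Sum>b\<in>Basis. norm \<eta> * (Cb b * exp (- m * norm \<xi>)))"
      unfolding norm_scaleR using Cb Basis_le_norm by (intro sum_mono mult_mono) auto
    finally show ?thesis by (simp add: C1_def sum_distrib_left sum_distrib_right mult_ac)
  qed
  obtain L where L: "L > 0" "\<And>\<xi>. norm (Lam \<xi>) \<le> L * norm \<xi>" using Lam_bound by blast
  obtain L' where L': "L' > 0" "\<And>\<xi>. norm (Lam' \<xi>) \<le> L' * norm \<xi>" using Lam'_bound by blast
  obtain K where K: "K \<ge> 0" "\<And>v w. \<bar>E v w\<bar> \<le> K * norm v * norm w" using E_bound by blast
  have Cpos: "C \<ge> 0" using order_trans[OF norm_ge_zero FC] .
  define f where "f = (\<lambda>y \<xi>. \<kappa> (\<xi> - Lam' y) * cis (pi * E y (Lam \<xi>)) * F (Lam \<xi>))"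
  define f' where "f' = (\<lambda>y \<xi> w. (- dird (Lam' w) \<kappa> (\<xi> - Lam' y) + \<i> * of_real (pi * E w (Lam \<xi>)) * \<kappa> (\<xi> - Lam' y)) * cis (pi * E y (Lam \<xi>)) * F (Lam \<xi>))"
  have shift: "cis (pi * E y (Lam (\<xi> + Lam' y))) = cis (pi * E y (Lam \<xi>))" "Lam (\<xi> + Lam' y) = y + Lam \<xi>" for y \<xi>
    by (simp_all add: linear_add[OF linear_Lam] Lam_Lam' E.add_right alternating add.commute)
  have fm: "f y \<in> borel_measurable borel" "(\<lambda>\<xi>. f' y \<xi> w) \<in> borel_measurable borel" for y w
    unfolding f_def f'_def by measurable
  have Gf: "G \<kappa> F y = (\<integral>\<xi>. f y \<xi> \<partial>lborel)" for y
    unfolding lborel_integral_translate[OF fm(1), of y "Lam' y", symmetric] T_def W_def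
    by (simp add: f_def shift mult.assoc E.add_right alternating)
  have Gfun: "G \<kappa> F = (\<lambda>y. \<integral>\<xi>. f y \<xi> \<partial>lborel)" using Gf by blast
  \<comment> \<open>The price for replacing \<open>\<xi> - Lam' y\<close> by \<open>\<xi>\<close> in
    the exponential bound, uniformly for \<open>y\<close> in the unit ball around
    \<open>z\<close>.\<close>
  define R where "R = exp (m * (L' * (norm z + 1)))"
  define Cw where "Cw = (C1 * L' + pi * K * L * C0) * R * C"
  have "((\<lambda>y. \<integral>\<xi>. f y \<xi> \<partial>lborel) has_derivative (\<lambda>w. \<integral>\<xi>. f' z \<xi> w \<partial>lborel)) (at z)"
  proof (rule has_derivative_integral[where r=1 and w = "\<lambda>\<xi>. Cw * ((1 + norm \<xi>) ^ 1 * exp (- m * norm \<xi>))"])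
    show "integrable lborel (\<lambda>\<xi>::'v. Cw * ((1 + norm \<xi>) ^ 1 * exp (- m * norm \<xi>)))"
      by (intro integrable_mult_right integrable_power_exp_norm m)
    have "integrable lborel (\<lambda>\<xi>. \<kappa> \<xi> * W (Lam \<xi>) F z)"
      by (rule moments_integrable_W[OF poly_gauss_moments[OF k a] F FC])
    then have "integrable lborel (\<lambda>\<xi>. f z (\<xi> + Lam' z))" by (simp add: f_def shift W_def mult.assoc E.add_right alternating)
    from lborel_integrable_translate[OF this, of "- Lam' z"] show "integrable lborel (f z)" by simp
    show "((\<lambda>y. f y \<xi>) has_derivative f' y \<xi>) (at y)" for y \<xi>
    proof -
      have "((\<lambda>y. \<xi> - Lam' y) has_derivative (\<lambda>w. - Lam' w)) (at y)"
        using bounded_linear_imp_has_derivative[of Lam' "at y"] linear_Lam' by (auto intro!: derivative_eq_intros simp: linear_conv_bounded_linear)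
      from has_derivative_compose[OF this differentiable_has_derivative_dird[OF kd]]
      have 1: "((\<lambda>y. \<kappa> (\<xi> - Lam' y)) has_derivative (\<lambda>w. - dird (Lam' w) \<kappa> (\<xi> - Lam' y))) (at y)"
        by (simp add: dird_linear_combination(3)[OF kd])
      have "((\<lambda>z. \<i> * complex_of_real (pi * E z (Lam \<xi>))) has_derivative (\<lambda>w. \<i> * complex_of_real (pi * E w (Lam \<xi>)))) (at y)"
        by (intro bounded_linear_imp_has_derivative bounded_linear_compose[OF bounded_linear_mult_right] bounded_linear_compose[OF bounded_linear_of_real] bounded_linear_const_mult E.bounded_linear_left)
      from has_derivative_compose[OF this DERIV_exp[unfolded has_field_derivative_def]]
      have 2: "((\<lambda>y. cis (pi * E y (Lam \<xi>))) has_derivative (\<lambda>w. cis (pi * E y (Lam \<xi>)) * (\<i> * of_real (pi * E w (Lam \<xi>))))) (at y)"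
        by (simp add: cis_conv_exp)
      show ?thesis unfolding f_def f'_def
        by (rule has_derivative_eq_rhs[OF has_derivative_mult_left[OF has_derivative_mult[OF 1 2]]]) (simp add: fun_eq_iff algebra_simps)
    qed
    fix y \<xi> w assume "y \<in> ball z 1"
    then have ny: "norm y \<le> norm z + 1" using norm_triangle_ineq2[of y z] by (simp add: dist_norm norm_minus_commute)
    have "L' * norm y \<le> L' * (norm z + 1)" using ny L'(1) by simp
    then have nx: "norm \<xi> \<le> norm (\<xi> - Lam' y) + L' * (norm z + 1)"
      using norm_triangle_ineq2[of \<xi> "Lam' y"] L'(2)[of y] by linarith
    have "m * norm \<xi> \<le> m * norm (\<xi> - Lam' y) + m * (L' * (norm z + 1))"
      unfolding distrib_left[symmetric] using m(1) nx by (intro mult_left_mono) auto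
    then have ex: "exp (- m * norm (\<xi> - Lam' y)) \<le> R * exp (- m * norm \<xi>)"
      unfolding R_def exp_add[symmetric] exp_le_cancel_iff by linarith
    have "norm (- dird (Lam' w) \<kappa> (\<xi> - Lam' y) + \<i> * of_real (pi * E w (Lam \<xi>)) * \<kappa> (\<xi> - Lam' y))
       \<le> norm (dird (Lam' w) \<kappa> (\<xi> - Lam' y)) + pi * \<bar>E w (Lam \<xi>)\<bar> * norm (\<kappa> (\<xi> - Lam' y))"
      by (rule order_trans[OF norm_triangle_ineq]) (simp add: norm_mult abs_mult)
    also have "\<dots> \<le> C1 * (R * exp (- m * norm \<xi>)) * (L' * norm w) + pi * (K * norm w * (L * norm \<xi>)) * (C0 * (R * exp (- m * norm \<xi>)))"
    proof (intro add_mono mult_mono)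
      show "norm (dird (Lam' w) \<kappa> (\<xi> - Lam' y)) \<le> C1 * (R * exp (- m * norm \<xi>)) * (L' * norm w)"
        by (rule order_trans[OF C1']) (intro mult_mono ex L'(2), use C1 in \<open>auto simp: R_def\<close>)
      show "\<bar>E w (Lam \<xi>)\<bar> \<le> K * norm w * (L * norm \<xi>)"
        by (rule order_trans[OF K(2)]) (intro mult_left_mono L(2), use K in auto)
      show "norm (\<kappa> (\<xi> - Lam' y)) \<le> C0 * (R * exp (- m * norm \<xi>))"
        by (rule order_trans[OF C0(2)]) (intro mult_left_mono ex C0(1))
    qed (use K L in auto)
    also have "\<dots> \<le> C1 * (R * exp (- m * norm \<xi>)) * (L' * norm w) * (1 + norm \<xi>) + pi * (K * norm w * (L * (1 + norm \<xi>))) * (C0 * (R * exp (- m * norm \<xi>)))"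
    proof (rule add_mono)
      show "C1 * (R * exp (- m * norm \<xi>)) * (L' * norm w) \<le> C1 * (R * exp (- m * norm \<xi>)) * (L' * norm w) * (1 + norm \<xi>)"
        using mult_left_mono[of 1 "1 + norm \<xi>" "C1 * (R * exp (- m * norm \<xi>)) * (L' * norm w)"] C1 L' by (simp add: R_def)
      show "pi * (K * norm w * (L * norm \<xi>)) * (C0 * (R * exp (- m * norm \<xi>))) \<le> pi * (K * norm w * (L * (1 + norm \<xi>))) * (C0 * (R * exp (- m * norm \<xi>)))"
        using K(1) L(1) C0(1) by (intro mult_right_mono mult_left_mono) (auto simp: R_def)
    qed
    finally have "norm (- dird (Lam' w) \<kappa> (\<xi> - Lam' y) + \<i> * of_real (pi * E w (Lam \<xi>)) * \<kappa> (\<xi> - Lam' y))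
        \<le> (C1 * L' + pi * K * L * C0) * R * (1 + norm \<xi>) * exp (- m * norm \<xi>) * norm w" (is "?l \<le> ?r") by (simp add: algebra_simps)
    then have "?l * norm (F (Lam \<xi>)) \<le> ?r * C" using FC Cpos C1 K L L' C0
      by (intro mult_mono) (auto simp: R_def intro!: mult_nonneg_nonneg add_nonneg_nonneg)
    then show "norm (f' y \<xi> w) \<le> Cw * ((1 + norm \<xi>) ^ 1 * exp (- m * norm \<xi>)) * norm w"
      unfolding f'_def Cw_def by (simp only: norm_mult norm_cis mult_1_right power_one_right) (simp only: mult_ac)
  qed (use fm in auto)
  moreover have "(\<integral>\<xi>. f' z \<xi> w \<partial>lborel) = G (\<delta> w \<kappa>) F z - \<i> * of_real (pi * E z w) * G \<kappa> F z" for w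
  proof -
    have i1: "integrable lborel (\<lambda>\<xi>. \<delta> w \<kappa> \<xi> * W (Lam \<xi>) F z)"
      by (rule moments_integrable_W[OF poly_gauss_moments[OF \<delta>_poly_gauss[OF k] a] F FC])
    have i2: "integrable lborel (\<lambda>\<xi>. \<kappa> \<xi> * W (Lam \<xi>) F z)"
      by (rule moments_integrable_W[OF poly_gauss_moments[OF k a] F FC])
    have "(\<integral>\<xi>. f' z \<xi> w \<partial>lborel) = (\<integral>\<xi>. f' z (\<xi> + Lam' z) w \<partial>lborel)"
      by (rule lborel_integral_translate[OF fm(2), symmetric])
    also have "\<dots> = (\<integral>\<xi>. \<delta> w \<kappa> \<xi> * W (Lam \<xi>) F z - \<i> * of_real (pi * E z w) * (\<kappa> \<xi> * W (Lam \<xi>) F z) \<partial>lborel)"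
      by (intro Bochner_Integration.integral_cong refl)
         (simp add: f'_def shift W_def \<delta>_def E.add_right skew[of w z] alternating algebra_simps)
    finally show ?thesis unfolding T_def using i1 i2 by simp
  qed
  ultimately show ?thesis unfolding Gfun by simp
qed

lemma nabla_G:
  assumes "\<kappa> \<in> poly_gauss a" "\<And>b. b \<in> Basis \<Longrightarrow> a b > 0" "F \<in> borel_measurable borel" "\<And>z. norm (F z) \<le> C"
  shows "nabla w (G \<kappa> F) = G (\<delta> w \<kappa>) F"
  using dird_eqI[OF G_derivative[OF assms]] by (auto simp: nabla_def)

text \<open>The smoothing property: a bounded measurable quasi-periodic function is turned into an
  element of \<open>S\<close>. It is applied to a discontinuous function when a nonzero element is
  constructed.\<close>

lemma G_in:
  assumes k: "\<kappa> \<in> poly_gauss a" and a: "\<And>b. b \<in> Basis \<Longrightarrow> a b > 0"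
    and F: "F \<in> borel_measurable borel" "\<And>z. norm (F z) \<le> C" "quasi_periodic F"
  shows "G \<kappa> F \<in> S"
proof -
  have "times_differentiable m (G \<kappa> F)" if "\<kappa> \<in> poly_gauss a" for m \<kappa>
    using that
  proof (induction m arbitrary: \<kappa>)
    case 0
    have "G \<kappa> F differentiable (at z)" for z using G_derivative[OF 0 a F(1,2)] differentiable_def by blast
    then show ?case by (auto simp: continuous_on_eq_continuous_at intro: differentiable_imp_continuous_within)
  next
    case (Suc m)
    have d: "dird w (G \<kappa> F) = (\<lambda>z. G (\<delta> w \<kappa>) F z + - \<i> * (of_real (pi * E z w) * G \<kappa> F z))" for w
      using dird_eqI[OF G_derivative[OF Suc.prems a F(1,2)]] by (auto simp: algebra_simps)
    have lin: "times_differentiable m (\<lambda>z. complex_of_real (pi * E z w))" for w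
      using smooth_function_linear_E smooth_function_def by blast
    have "times_differentiable m (dird w (G \<kappa> F))" for w
      unfolding d by (intro times_differentiable_add times_differentiable_mult times_differentiable_const lin Suc.IH Suc.prems \<delta>_poly_gauss)
    moreover have "G \<kappa> F differentiable (at z)" for z using G_derivative[OF Suc.prems a F(1,2)] differentiable_def by blast
    ultimately show ?case by (simp add: times_differentiable_Suc_dird del: times_differentiable.simps)
  qed
  then show ?thesis using k T_quasi_periodic[OF F(3)] by (auto simp: S_def smooth_function_def)
qed

end

section \<open>Annihilation and creation operators, and the Hamiltonian\<close>

context magnetic_frame
begin

text \<open>Modelled on \<open>(d/dx + \<i> d/dy) / 2\<close>. As \<open>nabla\<close> is
  skew-adjoint, the adjoint \<open>cr i\<close> carries the opposite overall sign and the conjugate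
  coefficient.\<close>

definition an :: "nat \<Rightarrow> ('v \<Rightarrow> complex) \<Rightarrow> 'v \<Rightarrow> complex" where
  "an i F = fscale (1/2) (nabla (X i) F + fscale \<i> (nabla (Y i) F))"
definition cr :: "nat \<Rightarrow> ('v \<Rightarrow> complex) \<Rightarrow> 'v \<Rightarrow> complex" where
  "cr i F = fscale (-1/2) (nabla (X i) F + fscale (- \<i>) (nabla (Y i) F))"

lemma S_closed [simp, intro]:
  "0 \<in> S" "F \<in> S \<Longrightarrow> K \<in> S \<Longrightarrow> F + K \<in> S" "F \<in> S \<Longrightarrow> K \<in> S \<Longrightarrow> F - K \<in> S" "F \<in> S \<Longrightarrow> fscale c F \<in> S"
  "(\<And>i. i \<in> J \<Longrightarrow> H i \<in> S) \<Longrightarrow> (\<Sum>i\<in>J. H i) \<in> S"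
  using S_subspace by (auto intro: fun_space.subspace_0 fun_space.subspace_add fun_space.subspace_diff fun_space.subspace_scale fun_space.subspace_sum)

lemma an_in: "F \<in> S \<Longrightarrow> an i F \<in> S" and cr_in: "F \<in> S \<Longrightarrow> cr i F \<in> S"
  unfolding an_def cr_def by (intro S_closed nabla_in; assumption)+

lemma an_apply: "an i F z = (nabla (X i) F z + \<i> * nabla (Y i) F z) / 2"
  and cr_apply: "cr i F z = - (nabla (X i) F z - \<i> * nabla (Y i) F z) / 2"
  by (simp_all add: an_def cr_def fscale_def field_simps)

lemma nabla_an: "F \<in> S \<Longrightarrow> nabla w (an i F) z = (nabla w (nabla (X i) F) z + \<i> * nabla w (nabla (Y i) F) z) / 2"
  unfolding an_def by (simp add: nabla_scale nabla_add nabla_in) (simp add: fscale_def)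
lemma nabla_cr:
  assumes F: "F \<in> S" shows "nabla w (cr i F) z = - (nabla w (nabla (X i) F) z - \<i> * nabla w (nabla (Y i) F) z) / 2"
proof -
  have "nabla w (cr i F) = fscale (-1/2) (nabla w (nabla (X i) F) + fscale (- \<i>) (nabla w (nabla (Y i) F)))"
    unfolding cr_def
    by (simp only: nabla_scale[OF S_closed(2)[OF nabla_in[OF F] S_closed(4)[OF nabla_in[OF F]]]]
        nabla_add[OF nabla_in[OF F] S_closed(4)[OF nabla_in[OF F]]] nabla_scale[OF nabla_in[OF F]])
  then show ?thesis by (simp only: fscale_def plus_fun_apply) (simp add: field_simps)
qed

lemma comm: "F \<in> S \<Longrightarrow> nabla v (nabla w F) z = nabla w (nabla v F) z + \<i> * of_real (2 * pi * E v w) * F z"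
  using nabla_commutator by metis

text \<open>The pure second derivatives form a covariant Laplacian, and the mixed ones leave only
  their commutator, the constant curvature.\<close>

lemma cr_an_apply:
  assumes "i \<in> I" "F \<in> S"
  shows "cr i (an i F) z = - (nabla (X i) (nabla (X i) F) z + nabla (Y i) (nabla (Y i) F) z) / 4 - of_real (\<nu> i) / 2 * F z"
  unfolding cr_apply nabla_an[OF assms(2)] comm[OF assms(2), of "Y i" "X i"] E_YX[OF assms(1,1)]
  by (simp add: field_simps)

definition hamiltonian :: "('v \<Rightarrow> complex) \<Rightarrow> 'v \<Rightarrow> complex" where
  "hamiltonian F = (\<Sum>i\<in>I. cr i (an i F))"

lemma hamiltonian_apply:
  assumes "F \<in> S"
  shows "hamiltonian F z = (\<Sum>i\<in>I. - (nabla (X i) (nabla (X i) F) z + nabla (Y i) (nabla (Y i) F) z) / 4 - of_real (\<nu> i) / 2 * F z)"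
  unfolding hamiltonian_def sum_fun_apply using cr_an_apply[OF _ assms] by simp

section \<open>The heat kernel\<close>

lemma gauss_dird:
  assumes "i \<in> I"
  shows "dird (dx i) (gauss a) \<xi> = of_real (- 2 * a (dx i) * (\<xi> \<bullet> dx i)) * gauss a \<xi>"
    "dird (dy i) (gauss a) \<xi> = of_real (- 2 * a (dy i) * (\<xi> \<bullet> dy i)) * gauss a \<xi>"
proof -
  have "dird b (gauss a) \<xi> = of_real (- 2 * a b * (\<xi> \<bullet> b)) * gauss a \<xi>" if b: "b \<in> Basis" for b
  proof -
    have "dird b (gauss a) \<xi> = (\<Sum>c\<in>Basis. if c = b then of_real (- 2 * a b * (\<xi> \<bullet> b)) * gauss a \<xi> else 0)"
      unfolding dird_eqI[OF gauss_has_derivative] using b by (intro sum.cong) (auto simp: inner_Basis)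
    then show ?thesis using b by simp
  qed
  then show "dird (dx i) (gauss a) \<xi> = of_real (- 2 * a (dx i) * (\<xi> \<bullet> dx i)) * gauss a \<xi>"
    "dird (dy i) (gauss a) \<xi> = of_real (- 2 * a (dy i) * (\<xi> \<bullet> dy i)) * gauss a \<xi>" using Basis_frame[OF assms] by auto
qed

lemma dird_linear_gauss:
  assumes "bounded_linear (f :: 'v \<Rightarrow> complex)"
  shows "dird w (\<lambda>\<xi>. f \<xi> * gauss a \<xi>) \<xi> = f \<xi> * dird w (gauss a) \<xi> + f w * gauss a \<xi>"
  using dird_mult[of f "gauss a" w] bounded_linear_imp_differentiable[OF assms] poly_gauss_derivative[OF poly_gauss.gauss, of a]
  by (simp add: dird_bounded_linear[OF assms])

lemma bounded_linear_coords: "bounded_linear (\<lambda>\<xi>::'v. c * complex_of_real (\<xi> \<bullet> b) + d * of_real (\<xi> \<bullet> b'))"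
  by (intro bounded_linear_add bounded_linear_const_mult bounded_linear_compose[OF bounded_linear_of_real] bounded_linear_inner_left)

lemma \<delta>_gauss:
  assumes i: "i \<in> I" and a: "a (dx i) = A" "a (dy i) = A"
  shows "\<delta> (X i) (gauss a) = (\<lambda>\<xi>. (of_real (2 * A) * of_real (\<xi> \<bullet> dx i) + (- \<i> * of_real (\<nu> i)) * of_real (\<xi> \<bullet> dy i)) * gauss a \<xi>)"
    "\<delta> (Y i) (gauss a) = (\<lambda>\<xi>. ((\<i> * of_real (\<nu> i)) * of_real (\<xi> \<bullet> dx i) + of_real (2 * A) * of_real (\<xi> \<bullet> dy i)) * gauss a \<xi>)"
  unfolding \<delta>_def using i a by (simp_all add: fun_eq_iff Lam'_X Lam'_Y gauss_dird E_Lam algebra_simps)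

text \<open>With equal weights in both directions of a plane the mixed products of coordinates
  cancel between the two summands, which leaves a rotation invariant polynomial. Its quadratic part
  vanishes exactly for \<open>2 * A = \<nu> i\<close> among positive weights.\<close>

lemma \<delta>_\<delta>_gauss:
  assumes i: "i \<in> I" and a: "a (dx i) = A" "a (dy i) = A"
  shows "\<delta> (X i) (\<delta> (X i) (gauss a)) \<xi> + \<delta> (Y i) (\<delta> (Y i) (gauss a)) \<xi>
    = of_real (- 4 * A + (4 * A\<^sup>2 - (\<nu> i)\<^sup>2) * ((\<xi> \<bullet> dx i)\<^sup>2 + (\<xi> \<bullet> dy i)\<^sup>2)) * gauss a \<xi>"
  unfolding \<delta>_gauss[OF assms] unfolding \<delta>_def dird_linear_gauss[OF bounded_linear_coords]
  using i a by (simp add: Lam'_X Lam'_Y gauss_dird E_Lam inner_frame algebra_simps power2_eq_square)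

text \<open>The factor by which the Hamiltonian multiplies the kernel \<open>gauss a\<close>. For
  \<open>a = ha t\<close> it is minus the logarithmic time derivative of Mehler's normalized
  kernel.\<close>

definition heat_poly :: "('v \<Rightarrow> real) \<Rightarrow> 'v \<Rightarrow> real" where
  "heat_poly a \<xi> = (\<Sum>i\<in>I. a (dx i) - \<nu> i / 2 - ((a (dx i))\<^sup>2 - (\<nu> i)\<^sup>2 / 4) * ((\<xi> \<bullet> dx i)\<^sup>2 + (\<xi> \<bullet> dy i)\<^sup>2))"

lemma hamiltonian_G_gauss:
  assumes a: "\<And>b. b \<in> Basis \<Longrightarrow> a b > 0" "\<And>i. i \<in> I \<Longrightarrow> a (dy i) = a (dx i)" and F: "F \<in> S"
  shows "hamiltonian (G (gauss a) F) z = G (\<lambda>\<xi>. of_real (heat_poly a \<xi>) * gauss a \<xi>) F z"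
proof -
  obtain C where C: "\<And>z. norm (F z) \<le> C" using S_bounded[OF F] by blast
  note F' = S_measurable[OF F] C
  have qp: "quasi_periodic F" using F by (simp add: S_def)
  note pg = poly_gauss.gauss[of a]
  have in_S: "G (gauss a) F \<in> S" by (rule G_in[OF pg a(1) F' qp])
  have nn: "nabla w (nabla w (G (gauss a) F)) = G (\<delta> w (\<delta> w (gauss a))) F" for w
    by (simp add: nabla_G[OF pg a(1) F'] nabla_G[OF \<delta>_poly_gauss[OF pg] a(1) F'])
  have int: "integrable lborel (\<lambda>\<xi>. \<kappa> \<xi> * W (Lam \<xi>) F z)" if "\<kappa> \<in> poly_gauss a" for \<kappa>
    by (rule moments_integrable_W[OF poly_gauss_moments[OF that a(1)] F'])
  have "hamiltonian (G (gauss a) F) z = (\<Sum>i\<in>I. \<integral>\<xi>. (- (\<delta> (X i) (\<delta> (X i) (gauss a)) \<xi> * W (Lam \<xi>) F z + \<delta> (Y i) (\<delta> (Y i) (gauss a)) \<xi> * W (Lam \<xi>) F z) / 4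
      - of_real (\<nu> i) / 2 * (gauss a \<xi> * W (Lam \<xi>) F z)) \<partial>lborel)"
    unfolding hamiltonian_apply[OF in_S] nn unfolding T_def
    using int[OF pg] int[OF \<delta>_poly_gauss[OF \<delta>_poly_gauss[OF pg]]] by (intro sum.cong refl) simp
  also have "\<dots> = (\<integral>\<xi>. (\<Sum>i\<in>I. (- (\<delta> (X i) (\<delta> (X i) (gauss a)) \<xi> * W (Lam \<xi>) F z + \<delta> (Y i) (\<delta> (Y i) (gauss a)) \<xi> * W (Lam \<xi>) F z) / 4
      - of_real (\<nu> i) / 2 * (gauss a \<xi> * W (Lam \<xi>) F z))) \<partial>lborel)"
    using int[OF pg] int[OF \<delta>_poly_gauss[OF \<delta>_poly_gauss[OF pg]]]
    by (intro Bochner_Integration.integral_sum[symmetric] Bochner_Integration.integrable_diff integrable_mult_right Bochner_Integration.integrable_divide integrable_minus Bochner_Integration.integrable_add) auto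
  also have "\<dots> = G (\<lambda>\<xi>. of_real (heat_poly a \<xi>) * gauss a \<xi>) F z"
    unfolding T_def
  proof (intro Bochner_Integration.integral_cong refl)
    fix \<xi>
    have "- (\<delta> (X i) (\<delta> (X i) (gauss a)) \<xi> * W (Lam \<xi>) F z + \<delta> (Y i) (\<delta> (Y i) (gauss a)) \<xi> * W (Lam \<xi>) F z) / 4 - of_real (\<nu> i) / 2 * (gauss a \<xi> * W (Lam \<xi>) F z)
      = of_real (a (dx i) - \<nu> i / 2 - ((a (dx i))\<^sup>2 - (\<nu> i)\<^sup>2 / 4) * ((\<xi> \<bullet> dx i)\<^sup>2 + (\<xi> \<bullet> dy i)\<^sup>2)) * gauss a \<xi> * W (Lam \<xi>) F z" if i: "i \<in> I" for i
      unfolding distrib_right[symmetric] \<delta>_\<delta>_gauss[OF i refl a(2)[OF i]] by (simp add: field_simps)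
    then show "(\<Sum>i\<in>I. - (\<delta> (X i) (\<delta> (X i) (gauss a)) \<xi> * W (Lam \<xi>) F z + \<delta> (Y i) (\<delta> (Y i) (gauss a)) \<xi> * W (Lam \<xi>) F z) / 4 - of_real (\<nu> i) / 2 * (gauss a \<xi> * W (Lam \<xi>) F z))
       = of_real (heat_poly a \<xi>) * gauss a \<xi> * W (Lam \<xi>) F z"
      by (simp add: heat_poly_def sum_distrib_right)
  qed
  finally show ?thesis .
qed

text \<open>Second-order expansion of the Hamiltonian applied to a magnetic translate, in terms of derivatives of the
  translated section.\<close>

definition ham_W :: "'v \<Rightarrow> ('v \<Rightarrow> complex) \<Rightarrow> 'v \<Rightarrow> complex" where
  "ham_W v F z = (\<Sum>i\<in>I. - ((W v (nabla (X i) (nabla (X i) F)) z + 2 * ((2 * pi * \<i>) * of_real (E (X i) v)) * W v (nabla (X i) F) z + ((2 * pi * \<i>) * of_real (E (X i) v))\<^sup>2 * W v F z)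
     + (W v (nabla (Y i) (nabla (Y i) F)) z + 2 * ((2 * pi * \<i>) * of_real (E (Y i) v)) * W v (nabla (Y i) F) z + ((2 * pi * \<i>) * of_real (E (Y i) v))\<^sup>2 * W v F z)) / 4
     - of_real (\<nu> i) / 2 * W v F z)"

text \<open>All derivatives act on \<open>F\<close> and none on the kernel. The formula therefore
  applies to the kernel obtained by integrating over time, whose singularity at \<open>t = 0\<close>
  rules out differentiating it.\<close>

lemma hamiltonian_T:
  assumes k: "moments M v k" and F: "F \<in> S"
  shows "integrable M (\<lambda>x. k x * ham_W (v x) F z)" "hamiltonian (T M v k F) z = (\<integral>x. k x * ham_W (v x) F z \<partial>M)"
proof -
  define ee where "ee w x = (2 * pi * \<i>) * of_real (E w (v x))" for w x
  have int: "integrable M (\<lambda>x. k x * W (v x) F z)" if k: "moments M v k" and F: "F \<in> S" for k F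
  proof -
    obtain C where C: "\<And>z. norm (F z) \<le> C" using S_bounded[OF F] by blast
    show ?thesis by (rule moments_integrable_W[OF k S_measurable[OF F] C])
  qed
  have k1: "moments M v (\<lambda>x. ee w x * k x)" if "moments M v k" for w k unfolding ee_def by (rule moments_E[OF that])
  have k2: "moments M v (\<lambda>x. ee w x * (ee w x * k x))" for w by (intro k1 k)
  have nT: "nabla w (T M v k F) = T M v k (nabla w F) + T M v (\<lambda>x. ee w x * k x) F" if k: "moments M v k" and F: "F \<in> S" for k F w
    using nabla_T[OF k F] by (auto simp: ee_def)
  define hh where "hh w x = k x * W (v x) (nabla w (nabla w F)) z + 2 * (ee w x * k x * W (v x) (nabla w F) z) + ee w x * (ee w x * k x) * W (v x) F z" for w x
  have nn: "nabla w (nabla w (T M v k F)) z = (\<integral>x. hh w x \<partial>M)" for w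
  proof -
    have "nabla w (nabla w (T M v k F)) = nabla w (T M v k (nabla w F)) + nabla w (T M v (\<lambda>x. ee w x * k x) F)"
      unfolding nT[OF k F] by (intro nabla_add T_in nabla_in k k1[OF k] F)
    also have "\<dots> = T M v k (nabla w (nabla w F)) + T M v (\<lambda>x. ee w x * k x) (nabla w F)
        + (T M v (\<lambda>x. ee w x * k x) (nabla w F) + T M v (\<lambda>x. ee w x * (ee w x * k x)) F)"
      by (simp only: nT[OF k nabla_in[OF F]] nT[OF k1[OF k] F])
    finally have "nabla w (nabla w (T M v k F)) z = T M v k (nabla w (nabla w F)) z + 2 * T M v (\<lambda>x. ee w x * k x) (nabla w F) z + T M v (\<lambda>x. ee w x * (ee w x * k x)) F z"
      by simp
    also have "\<dots> = (\<integral>x. hh w x \<partial>M)" unfolding T_def hh_def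
      by (simp only: Bochner_Integration.integral_add[OF Bochner_Integration.integrable_add[OF int[OF k nabla_in[OF nabla_in[OF F]]] integrable_mult_right[OF int[OF k1[OF k] nabla_in[OF F]]]] int[OF k2 F]]
         Bochner_Integration.integral_add[OF int[OF k nabla_in[OF nabla_in[OF F]]] integrable_mult_right[OF int[OF k1[OF k] nabla_in[OF F]]]] integral_mult_right_zero)
    finally show ?thesis .
  qed
  have inth: "integrable M (hh w)" for w unfolding hh_def
    by (intro Bochner_Integration.integrable_add integrable_mult_right int k k1 k2 nabla_in F)
  define g where "g x = k x * W (v x) F z" for x
  have intg: "integrable M g" unfolding g_def by (rule int[OF k F])
  have eq: "k x * ham_W (v x) F z = (\<Sum>i\<in>I. - (hh (X i) x + hh (Y i) x) / 4 - of_real (\<nu> i) / 2 * g x)" for x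
    unfolding ham_W_def ee_def[symmetric] sum_distrib_left hh_def g_def by (rule sum.cong[OF refl]) (simp add: field_simps power2_eq_square)
  have it: "integrable M (\<lambda>x. - (hh (X i) x + hh (Y i) x) / 4 - of_real (\<nu> i) / 2 * g x)" for i
    using inth intg by auto
  show "integrable M (\<lambda>x. k x * ham_W (v x) F z)" unfolding eq using it by (intro Bochner_Integration.integrable_sum)
  have "hamiltonian (T M v k F) z = (\<Sum>i\<in>I. \<integral>x. (- (hh (X i) x + hh (Y i) x) / 4 - of_real (\<nu> i) / 2 * g x) \<partial>M)"
    unfolding hamiltonian_apply[OF T_in[OF k F]] nn unfolding T_def g_def[symmetric]
    using inth intg by (intro sum.cong refl) simp
  also have "\<dots> = (\<integral>x. k x * ham_W (v x) F z \<partial>M)" unfolding eq using it by (intro Bochner_Integration.integral_sum[symmetric])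
  finally show "hamiltonian (T M v k F) z = (\<integral>x. k x * ham_W (v x) F z \<partial>M)" .
qed

lemma continuous_W: "F \<in> S \<Longrightarrow> continuous_on UNIV (\<lambda>v. W v F z)"
  unfolding W_def
  by (intro continuous_intros continuous_on_compose2[OF S_continuous[of F UNIV]] E.continuous_on continuous_on_compose2[OF continuous_on_cis[OF continuous_on_id], of UNIV]) auto

lemma continuous_ham_W: "F \<in> S \<Longrightarrow> continuous_on UNIV (\<lambda>v. ham_W v F z)"
  unfolding ham_W_def by (intro continuous_intros continuous_W nabla_in E.continuous_on) auto

lemma norm_W_bound: "F \<in> S \<Longrightarrow> \<exists>C\<ge>0. \<forall>v z. norm (W v F z) \<le> C"
  using S_bounded by (simp add: norm_W) blast

text \<open>Two covariant derivatives produce at most two factors \<open>E w v\<close>, each linear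
  in \<open>v\<close>; the translated derivatives of \<open>F\<close> are bounded.\<close>

lemma ham_W_bound:
  assumes F: "F \<in> S" shows "\<exists>C\<ge>0. \<forall>v. norm (ham_W v F z) \<le> C * (1 + norm v) ^ 2"
proof -
  define P where "P h \<longleftrightarrow> (\<exists>C\<ge>0. \<forall>v::'v. norm (h v :: complex) \<le> C * (1 + norm v) ^ 2)" for h
  have p1: "1 \<le> (1 + norm v) ^ 2" "1 + norm v \<le> (1 + norm v) ^ 2" for v :: 'v by (simp_all add: power2_eq_square algebra_simps)
  have add: "P (\<lambda>v. h v + h' v)" if h: "P h" "P h'" for h h'
  proof -
    obtain C C' where "C \<ge> 0" "C' \<ge> 0" "\<And>v. norm (h v) \<le> C * (1 + norm v) ^ 2" "\<And>v. norm (h' v) \<le> C' * (1 + norm v) ^ 2"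
      using h unfolding P_def by blast
    then have "norm (h v + h' v) \<le> (C + C') * (1 + norm v) ^ 2" for v
      unfolding distrib_right using norm_triangle_ineq[of "h v" "h' v"] by (meson add_mono order_trans)
    then show ?thesis unfolding P_def using \<open>C \<ge> 0\<close> \<open>C' \<ge> 0\<close> by (intro exI[of _ "C + C'"]) auto
  qed
  have scale: "P (\<lambda>v. c * h v)" if h: "P h" for c h
  proof -
    obtain C where "C \<ge> 0" "\<And>v. norm (h v) \<le> C * (1 + norm v) ^ 2" using h unfolding P_def by blast
    then have "norm (c * h v) \<le> (norm c * C) * (1 + norm v) ^ 2" for v
      using mult_left_mono[of "norm (h v)" _ "norm c"] by (simp add: norm_mult mult.assoc)
    then show ?thesis unfolding P_def using \<open>C \<ge> 0\<close> by (intro exI[of _ "norm c * C"]) auto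
  qed
  have sum: "P (\<lambda>v. \<Sum>i\<in>J. h i v)" if "finite J" "\<And>i. i \<in> J \<Longrightarrow> P (h i)" for J :: "nat set" and h
    using that
  proof (induction J rule: finite_induct)
    case empty then show ?case by (auto simp: P_def)
  qed (simp add: add)
  obtain K where K: "K \<ge> 0" "\<And>v w. \<bar>E v w\<bar> \<le> K * norm v * norm w" using E_bound by blast
  have W0: "P (\<lambda>v. W v F z)" if F: "F \<in> S" for F
  proof -
    obtain C where C: "C \<ge> 0" "\<And>v. norm (W v F z) \<le> C" using norm_W_bound[OF F] by blast
    have "norm (W v F z) \<le> C * (1 + norm v) ^ 2" for v
      using C(2)[of v] mult_left_mono[OF p1(1)[of v] C(1)] by simp
    then show ?thesis using C(1) unfolding P_def by blast
  qed
  have W1: "P (\<lambda>v. of_real (E w v) * W v F z)" if F: "F \<in> S" for F w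
  proof -
    obtain C where C: "C \<ge> 0" "\<And>v. norm (W v F z) \<le> C" using norm_W_bound[OF F] by blast
    have "norm (of_real (E w v) * W v F z) \<le> (K * norm w * C) * (1 + norm v) ^ 2" for v
    proof -
      have "norm (of_real (E w v) * W v F z) \<le> (K * norm w * (1 + norm v) ^ 2) * C" unfolding norm_mult norm_of_real
      proof (intro mult_mono C order_trans[OF K(2)] mult_left_mono)
        show "norm v \<le> (1 + norm v)\<^sup>2" using p1(2)[of v] by linarith
      qed (use K C in auto)
      then show ?thesis by (simp add: mult_ac)
    qed
    then show ?thesis using C(1) K(1) unfolding P_def by (intro exI[of _ "K * norm w * C"]) auto
  qed
  have W2: "P (\<lambda>v. (of_real (E w v))\<^sup>2 * W v F z)" if F: "F \<in> S" for F w
  proof -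
    obtain C where C: "C \<ge> 0" "\<And>v. norm (W v F z) \<le> C" using norm_W_bound[OF F] by blast
    have "norm ((of_real (E w v))\<^sup>2 * W v F z) \<le> ((K * norm w)\<^sup>2 * C) * (1 + norm v) ^ 2" for v
    proof -
      have "\<bar>E w v\<bar> \<le> K * norm w * (1 + norm v)"
        by (rule order_trans[OF K(2)]) (intro mult_left_mono, use K in auto)
      then have "norm ((of_real (E w v))\<^sup>2 * W v F z) \<le> (K * norm w * (1 + norm v))\<^sup>2 * C" unfolding norm_mult norm_power norm_of_real
        by (intro mult_mono C power_mono) auto
      then show ?thesis by (simp add: power_mult_distrib mult_ac)
    qed
    then show ?thesis using C(1) unfolding P_def by (intro exI[of _ "(K * norm w)\<^sup>2 * C"]) auto
  qed
  have "P (\<lambda>v. ham_W v F z)"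
  proof -
    have "P (\<lambda>v. \<Sum>i\<in>I. (-1/4) * W v (nabla (X i) (nabla (X i) F)) z + (- pi * \<i>) * (of_real (E (X i) v) * W v (nabla (X i) F) z) + (pi * pi) * ((of_real (E (X i) v))\<^sup>2 * W v F z)
       + (-1/4) * W v (nabla (Y i) (nabla (Y i) F)) z + (- pi * \<i>) * (of_real (E (Y i) v) * W v (nabla (Y i) F) z) + (pi * pi) * ((of_real (E (Y i) v))\<^sup>2 * W v F z)
       + (- of_real (\<nu> i) / 2) * W v F z)"
      by (intro sum finite_I add scale W0 W1 W2 nabla_in F)
    moreover have "(\<lambda>v. \<Sum>i\<in>I. (-1/4) * W v (nabla (X i) (nabla (X i) F)) z + (- pi * \<i>) * (of_real (E (X i) v) * W v (nabla (X i) F) z) + (pi * pi) * ((of_real (E (X i) v))\<^sup>2 * W v F z)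
       + (-1/4) * W v (nabla (Y i) (nabla (Y i) F)) z + (- pi * \<i>) * (of_real (E (Y i) v) * W v (nabla (Y i) F) z) + (pi * pi) * ((of_real (E (Y i) v))\<^sup>2 * W v F z)
       + (- of_real (\<nu> i) / 2) * W v F z) = (\<lambda>v. ham_W v F z)"
      unfolding ham_W_def by (intro ext sum.cong refl) (simp add: field_simps power_mult_distrib power2_eq_square)
    ultimately show ?thesis by simp
  qed
  then show ?thesis unfolding P_def .
qed

definition nb :: "'v \<Rightarrow> real" where "nb b = (\<Sum>i\<in>I. if b = dx i \<or> b = dy i then \<nu> i else 0)"

lemma frame_distinct:
  assumes "i \<in> I" "j \<in> I"
  shows "dx i \<noteq> dy j" "dy i \<noteq> dx j" "dx i = dx j \<longleftrightarrow> i = j" "dy i = dy j \<longleftrightarrow> i = j"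
  using assms disj inj_on_eq_iff[OF inj(1) assms] inj_on_eq_iff[OF inj(2) assms] by blast+

lemma nb_frame: assumes "i \<in> I" shows "nb (dx i) = \<nu> i" "nb (dy i) = \<nu> i"
proof -
  have "nb (dx i) = (\<Sum>j\<in>I. if j = i then \<nu> i else 0)" unfolding nb_def
    using assms by (intro sum.cong) (auto simp: frame_distinct)
  then show "nb (dx i) = \<nu> i" using assms by simp
  have "nb (dy i) = (\<Sum>j\<in>I. if j = i then \<nu> i else 0)" unfolding nb_def
    using assms by (intro sum.cong) (auto simp: frame_distinct)
  then show "nb (dy i) = \<nu> i" using assms by simp
qed

lemma nb_pos: "b \<in> Basis \<Longrightarrow> nb b > 0"
  using nb_frame \<nu>_pos unfolding Basis_eq[symmetric] by auto

text \<open>\<open>gauss (ha t)\<close>, normalized by \<open>\<Prod>i\<in>I. 1 / hs t (dx i)\<close>, is Mehler's kernel of \<open>exp (- t * hamiltonian)\<close>;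
  \<open>ha\<close> solves the Riccati equation \<open>a' = \<nu>\<^sup>2 / 4 - a\<^sup>2\<close>. The rescaling of \<open>\<xi>\<close> by \<open>sqrt (hs t)\<close> removes the
  singularity at \<open>t = 0\<close>.\<close>

definition hs :: "real \<Rightarrow> 'v \<Rightarrow> real" where "hs t b = 1 - exp (- nb b * t)"
definition ha :: "real \<Rightarrow> 'v \<Rightarrow> real" where "ha t b = nb b * (1 / hs t b - 1 / 2)"
definition hk :: "real \<Rightarrow> 'v \<Rightarrow> complex" where "hk t \<xi> = gauss (\<lambda>b. nb b * (1 - hs t b / 2)) \<xi>"
definition hv :: "real \<Rightarrow> 'v \<Rightarrow> 'v" where "hv t \<xi> = Lam (\<Sum>b\<in>Basis. (sqrt (hs t b) * (\<xi> \<bullet> b)) *\<^sub>R b)"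

lemma hs_pos: "t > 0 \<Longrightarrow> b \<in> Basis \<Longrightarrow> hs t b > 0" and hs_nonneg: "t \<ge> 0 \<Longrightarrow> b \<in> Basis \<Longrightarrow> hs t b \<ge> 0" and hs_less: "hs t b < 1"
  using nb_pos[of b] by (auto simp: hs_def mult_le_0_iff mult_less_0_iff)

lemma ha_pos: "t > 0 \<Longrightarrow> b \<in> Basis \<Longrightarrow> ha t b > 0"
proof -
  assume t: "t > 0" and b: "b \<in> Basis"
  have "1 / hs t b > 1 / 2" using hs_pos[OF t b] hs_less[of t b] by (simp add: field_simps)
  then show ?thesis using nb_pos[OF b] by (simp add: ha_def)
qed

text \<open>Mehler's normalization is the Jacobian of the rescaling: each plane contains two basis
  vectors with the same \<open>hs\<close>, so the product of square roots over \<open>Basis\<close>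
  is the product of \<open>hs t (dx i)\<close> over \<open>I\<close>.\<close>

lemma heat_scaling:
  assumes t: "t > 0" and h: "h \<in> borel_measurable borel"
  shows "(\<integral>\<xi>. hk t \<xi> * h (hv t \<xi>) \<partial>lborel) = of_real (\<Prod>i\<in>I. 1 / hs t (dx i)) * (\<integral>\<xi>. gauss (ha t) \<xi> * h (Lam \<xi>) \<partial>lborel)"
proof -
  note [measurable] = h poly_gauss_measurable[OF poly_gauss.gauss]
  have pr: "(\<Prod>b\<in>Basis. sqrt (hs t b)) = (\<Prod>i\<in>I. hs t (dx i))"
    unfolding prod_Basis
  proof (intro prod.cong refl)
    fix i assume i: "i \<in> I"
    have "hs t (dy i) = hs t (dx i)" using i by (simp add: hs_def nb_frame)
    then show "sqrt (hs t (dx i)) * sqrt (hs t (dy i)) = hs t (dx i)"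
      using hs_pos[OF t Basis_frame(1)[OF i]] by simp
  qed
  have nz: "(\<Prod>i\<in>I. hs t (dx i)) \<noteq> 0" using hs_pos[OF t] Basis_frame by (auto simp: less_imp_neq[symmetric])
  have "(\<integral>\<xi>. gauss (ha t) \<xi> * h (Lam \<xi>) \<partial>lborel) = of_real (\<Prod>b\<in>Basis. sqrt (hs t b)) * (\<integral>\<xi>. gauss (ha t) (\<Sum>b\<in>Basis. (sqrt (hs t b) * (\<xi> \<bullet> b)) *\<^sub>R b) * h (hv t \<xi>) \<partial>lborel)"
    unfolding hv_def by (rule lborel_integral_diag) (use hs_pos[OF t] in auto)
  also have "(\<lambda>\<xi>. gauss (ha t) (\<Sum>b\<in>Basis. (sqrt (hs t b) * (\<xi> \<bullet> b)) *\<^sub>R b)) = hk t"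
  proof
    fix \<xi> :: 'v
    have "(\<Sum>b\<in>Basis. ha t b * ((\<Sum>b\<in>Basis. (sqrt (hs t b) * (\<xi> \<bullet> b)) *\<^sub>R b) \<bullet> b)\<^sup>2) = (\<Sum>b\<in>Basis. nb b * (1 - hs t b / 2) * (\<xi> \<bullet> b)\<^sup>2)"
    proof (rule sum.cong[OF refl])
      fix b :: 'v assume b: "b \<in> Basis"
      have "ha t b * hs t b = nb b * (1 - hs t b / 2)" using hs_pos[OF t b] by (simp add: ha_def field_simps)
      then show "ha t b * ((\<Sum>b\<in>Basis. (sqrt (hs t b) * (\<xi> \<bullet> b)) *\<^sub>R b) \<bullet> b)\<^sup>2 = nb b * (1 - hs t b / 2) * (\<xi> \<bullet> b)\<^sup>2"
        using b hs_pos[OF t b] by (simp add: power_mult_distrib)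
    qed
    then show "gauss (ha t) (\<Sum>b\<in>Basis. (sqrt (hs t b) * (\<xi> \<bullet> b)) *\<^sub>R b) = hk t \<xi>" by (simp add: gauss_def hk_def)
  qed
  finally have "(\<integral>\<xi>. gauss (ha t) \<xi> * h (Lam \<xi>) \<partial>lborel) = of_real (\<Prod>b\<in>Basis. sqrt (hs t b)) * (\<integral>\<xi>. hk t \<xi> * h (hv t \<xi>) \<partial>lborel)" .
  then show ?thesis unfolding pr using nz by (simp add: prod_dividef)
qed

text \<open>After rescaling the weights lie between \<open>nb b / 2\<close> and \<open>nb b\<close>
  for every \<open>t \<ge> 0\<close>, which makes the Gaussian bound independent of time.\<close>

lemma hk_bound:
  assumes t: "t \<ge> 0" and m: "m > 0" "\<And>b. b \<in> Basis \<Longrightarrow> nb b / 2 \<ge> m"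
  shows "norm (hk t \<xi>) \<le> exp m * exp (- 2 * m * norm \<xi>)"
  unfolding hk_def
proof (rule order_trans[OF norm_gauss_le gauss_exp_bound])
  fix b :: 'v assume b: "b \<in> Basis"
  have "nb b * (1 / 2) \<le> nb b * (1 - hs t b / 2)" using hs_less[of t b] nb_pos[OF b] by (intro mult_left_mono) auto
  then show "m \<le> nb b * (1 - hs t b / 2)" using m(2)[OF b] by simp
qed (use m in auto)

lemma hv_bound:
  assumes t: "t \<ge> 0" and L: "L > 0" "\<And>\<xi>. norm (Lam \<xi>) \<le> L * norm \<xi>"
  shows "norm (hv t \<xi>) \<le> L * norm \<xi>"
proof -
  have "norm (\<Sum>b\<in>Basis. (sqrt (hs t b) * (\<xi> \<bullet> b)) *\<^sub>R b) \<le> norm \<xi>"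
  proof (rule norm_le_componentwise)
    fix b :: 'v assume b: "b \<in> Basis"
    have "\<bar>sqrt (hs t b) * (\<xi> \<bullet> b)\<bar> \<le> 1 * \<bar>\<xi> \<bullet> b\<bar>"
      unfolding abs_mult using hs_nonneg[OF t b] hs_less[of t b] by (intro mult_right_mono) (auto simp: less_imp_le)
    then show "\<bar>(\<Sum>b\<in>Basis. (sqrt (hs t b) * (\<xi> \<bullet> b)) *\<^sub>R b) \<bullet> b\<bar> \<le> \<bar>\<xi> \<bullet> b\<bar>" using b by simp
  qed
  then show ?thesis unfolding hv_def using L by (meson mult_left_mono less_imp_le order_trans)
qed

lemma continuous_hk: "continuous_on UNIV (\<lambda>p. hk (fst p) (snd p))"
  unfolding hk_def gauss_def hs_def by (intro continuous_intros) auto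
lemma continuous_hv: "continuous_on UNIV (\<lambda>p. hv (fst p) (snd p))"
  unfolding hv_def hs_def by (intro linear_continuous_on_compose[OF _ linear_Lam] continuous_intros)

lemma measurable_hk [measurable]: "(\<lambda>p. hk (fst p) (snd p)) \<in> borel_measurable (borel \<Otimes>\<^sub>M borel)"
  unfolding borel_prod by (rule borel_measurable_continuous_onI[OF continuous_hk])
lemma measurable_hv [measurable]: "(\<lambda>p. hv (fst p) (snd p)) \<in> borel_measurable (borel \<Otimes>\<^sub>M borel)"
  unfolding borel_prod by (rule borel_measurable_continuous_onI[OF continuous_hv])

lemma continuous_hk_hv: "continuous_on A (\<lambda>t. hk t \<xi>)" "continuous_on A' (\<lambda>\<xi>. hk t \<xi>)" "continuous_on A (\<lambda>t. hv t \<xi>)" "continuous_on A' (\<lambda>\<xi>. hv t \<xi>)"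
proof -
  have "continuous_on A (\<lambda>t. (t, \<xi>))" "continuous_on A' (\<lambda>\<xi>. (t, \<xi>))" by (intro continuous_intros)+
  then show "continuous_on A (\<lambda>t. hk t \<xi>)" "continuous_on A' (\<lambda>\<xi>. hk t \<xi>)" "continuous_on A (\<lambda>t. hv t \<xi>)" "continuous_on A' (\<lambda>\<xi>. hv t \<xi>)"
    using continuous_on_compose2[OF continuous_hk, of A "\<lambda>t. (t, \<xi>)"] continuous_on_compose2[OF continuous_hk, of A' "\<lambda>\<xi>. (t, \<xi>)"]
      continuous_on_compose2[OF continuous_hv, of A "\<lambda>t. (t, \<xi>)"] continuous_on_compose2[OF continuous_hv, of A' "\<lambda>\<xi>. (t, \<xi>)"] by auto
qed

lemma measurable_hk_hv [measurable]: "hk t \<in> borel_measurable borel" "hv t \<in> borel_measurable borel"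
  by (auto intro: borel_measurable_continuous_onI continuous_hk_hv)

text \<open>One dominating function works for all times, so both continuity up to
  \<open>t = 0\<close> and boundedness follow from it.\<close>

lemma heat_integrand:
  fixes h :: "'v \<Rightarrow> complex"
  assumes h: "continuous_on UNIV h" "C \<ge> 0" "\<And>v. norm (h v) \<le> C * (1 + norm v) ^ j"
  shows "continuous_on {0..} (\<lambda>t. \<integral>\<xi>. hk t \<xi> * h (hv t \<xi>) \<partial>lborel)"
    "\<exists>C. \<forall>t\<ge>0. norm (\<integral>\<xi>. hk t \<xi> * h (hv t \<xi>) \<partial>lborel) \<le> C"
proof -
  obtain m where m: "m > 0" "\<And>b. b \<in> Basis \<Longrightarrow> nb b / 2 \<ge> m" using pos_lower_bound[of "\<lambda>b. nb b / 2"] nb_pos by auto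
  obtain L where L: "L > 0" "\<And>\<xi>. norm (Lam \<xi>) \<le> L * norm \<xi>" using Lam_bound by blast
  have b: "norm (hk t \<xi> * h (hv t \<xi>)) \<le> (C * exp m * (1 + L) ^ j) * ((1 + norm \<xi>) ^ j * exp (- (2 * m) * norm \<xi>))" if "t \<ge> 0" for t \<xi>
  proof -
    have "1 + norm (hv t \<xi>) \<le> (1 + L) * (1 + norm \<xi>)" using hv_bound[OF that L, of \<xi>] L(1) by (simp add: algebra_simps) (smt (verit) norm_ge_zero)
    then have "norm (hk t \<xi>) * norm (h (hv t \<xi>)) \<le> (exp m * exp (- 2 * m * norm \<xi>)) * (C * ((1 + L) * (1 + norm \<xi>)) ^ j)"
      using h(2) by (intro mult_mono hk_bound[OF that m] order_trans[OF h(3)] mult_left_mono power_mono) auto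
    then show ?thesis by (simp add: norm_mult power_mult_distrib mult_ac)
  qed
  have int: "integrable lborel (\<lambda>\<xi>::'v. (C * exp m * (1 + L) ^ j) * ((1 + norm \<xi>) ^ j * exp (- (2 * m) * norm \<xi>)))"
    using m by (intro integrable_mult_right integrable_power_exp_norm) auto
  note [measurable] = borel_measurable_continuous_onI[OF h(1)]
  have meas: "(\<lambda>\<xi>. hk t \<xi> * h (hv t \<xi>)) \<in> borel_measurable lborel" for t by measurable
  show "continuous_on {0..} (\<lambda>t. \<integral>\<xi>. hk t \<xi> * h (hv t \<xi>) \<partial>lborel)"
  proof (rule continuous_on_integral_dominated[OF meas int])
    show "continuous_on {0..} (\<lambda>t. hk t \<xi> * h (hv t \<xi>))" for \<xi>
      by (intro continuous_intros continuous_hk_hv continuous_on_compose2[OF h(1)]) auto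
  qed (rule b, simp)
  have "norm (\<integral>\<xi>. hk t \<xi> * h (hv t \<xi>) \<partial>lborel) \<le> (\<integral>\<xi>. (C * exp m * (1 + L) ^ j) * ((1 + norm (\<xi>::'v)) ^ j * exp (- (2 * m) * norm \<xi>)) \<partial>lborel)" if "t \<ge> 0" for t
    by (rule Bochner_Integration.integral_norm_bound_integral[OF Bochner_Integration.integrable_bound[OF int meas] int b[OF that]])
       (rule AE_I2, unfold real_norm_def, rule order_trans[OF b[OF that] abs_ge_self])
  then show "\<exists>C. \<forall>t\<ge>0. norm (\<integral>\<xi>. hk t \<xi> * h (hv t \<xi>) \<partial>lborel) \<le> C" by blast
qed

end

lemma (in pair_sigma_finite) integrable_product:
  fixes g :: "'a \<Rightarrow> real" and h :: "'b \<Rightarrow> real"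
  assumes g: "integrable M1 g" and h: "integrable M2 h"
  shows "integrable (M1 \<Otimes>\<^sub>M M2) (\<lambda>p. g (fst p) * h (snd p))"
proof (rule Fubini_integrable)
  have [measurable]: "g \<in> borel_measurable M1" "h \<in> borel_measurable M2" using g h by auto
  show "(\<lambda>p. g (fst p) * h (snd p)) \<in> borel_measurable (M1 \<Otimes>\<^sub>M M2)" by measurable
  have "(\<lambda>x. \<integral>y. norm (g (fst (x, y)) * h (snd (x, y))) \<partial>M2) = (\<lambda>x. norm (g x) * (\<integral>y. norm (h y) \<partial>M2))"
    by (simp add: abs_mult)
  then show "integrable M1 (\<lambda>x. \<integral>y. norm (g (fst (x, y)) * h (snd (x, y))) \<partial>M2)"
    using g by (simp del: real_norm_def)
  show "AE x in M1. integrable M2 (\<lambda>y. g (fst (x, y)) * h (snd (x, y)))" using h by simp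
qed

context magnetic_frame
begin

text \<open>The heat equation for positive time. It is proved with the unscaled kernel, whose time
  derivative is explicit by the Riccati equation, and then stated with the rescaled one, which
  remains regular at zero.\<close>

lemma heat_derivative:
  assumes t0: "t0 > 0" and F: "F \<in> S"
  shows "((\<lambda>t. \<integral>\<xi>. hk t \<xi> * W (hv t \<xi>) F z \<partial>lborel) has_vector_derivative - (\<integral>\<xi>. hk t0 \<xi> * ham_W (hv t0 \<xi>) F z \<partial>lborel)) (at t0)"
proof -
  define R where "R i \<xi> = (\<xi> \<bullet> dx i)\<^sup>2 + (\<xi> \<bullet> dy i)\<^sup>2" for i \<xi>
  define \<rho> where "\<rho> t \<xi> = exp (\<Sum>i\<in>I. - ln (hs t (dx i)) - ha t (dx i) * R i \<xi>)" for t \<xi>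
  have had: "ha t (dy i) = ha t (dx i)" if "i \<in> I" for t i using that by (simp add: ha_def hs_def nb_frame)
  have \<rho>: "complex_of_real (\<rho> t \<xi>) = of_real (\<Prod>i\<in>I. 1 / hs t (dx i)) * gauss (ha t) \<xi>" if t: "t > 0" for t \<xi>
  proof -
    have "\<rho> t \<xi> = (\<Prod>i\<in>I. 1 / hs t (dx i) * exp (- (ha t (dx i) * R i \<xi>)))"
      unfolding \<rho>_def exp_sum[OF finite_I] using hs_pos[OF t] Basis_frame
      by (intro prod.cong refl) (simp add: exp_diff exp_minus divide_inverse)
    then show ?thesis
      unfolding gauss_def sum_Basis prod.distrib by (simp add: exp_sum[symmetric] R_def had algebra_simps sum_negf[symmetric] sum_subtractf)
  qed
  obtain C where C: "C \<ge> 0" "\<And>v. norm (W v F z) \<le> C" using norm_W_bound[OF F] by blast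
  note Wm = borel_measurable_continuous_onI[OF continuous_W[OF F]]
  note [measurable] = Wm poly_gauss_measurable[OF poly_gauss.gauss] borel_measurable_continuous_onI[OF continuous_ham_W[OF F]]
  have \<Phi>: "(\<integral>\<xi>. hk t \<xi> * W (hv t \<xi>) F z \<partial>lborel) = (\<integral>\<xi>. of_real (\<rho> t \<xi>) * W (Lam \<xi>) F z \<partial>lborel)" if t: "t > 0" for t
    unfolding heat_scaling[OF t Wm] \<rho>[OF t] by (simp add: mult.assoc)
  obtain m where m: "m > 0" "\<And>b. b \<in> Basis \<Longrightarrow> nb b / 2 \<ge> m" using pos_lower_bound[of "\<lambda>b. nb b / 2"] nb_pos by auto
  \<comment> \<open>The ball of radius \<open>t1\<close> around \<open>t0\<close> consists of times
    above \<open>t1\<close>, so it stays away from the singularity.\<close>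
  define t1 where "t1 = t0 / 2"
  have t1: "t1 > 0" using t0 by (simp add: t1_def)
  have mono: "hs t1 (dx i) \<le> hs t (dx i)" "ha t (dx i) \<le> ha t1 (dx i)" "\<nu> i / 2 \<le> ha t (dx i)" if "i \<in> I" "t > t1" for i t
  proof -
    show 1: "hs t1 (dx i) \<le> hs t (dx i)" using that \<nu>_pos by (simp add: hs_def nb_frame)
    have p: "hs t1 (dx i) > 0" using hs_pos[OF t1] Basis_frame that by blast
    show "ha t (dx i) \<le> ha t1 (dx i)" unfolding ha_def using 1 p nb_pos[OF Basis_frame(1)[OF that(1)]]
      by (intro mult_left_mono diff_right_mono divide_left_mono) auto
    have "1 \<le> 1 / hs t (dx i)" using 1 p hs_less[of t "dx i"] by simp
    then have "\<nu> i * (1 / 2) \<le> \<nu> i * (1 / hs t (dx i) - 1/2)" using \<nu>_pos[OF that(1)] by (intro mult_left_mono) auto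
    then show "\<nu> i / 2 \<le> ha t (dx i)" unfolding ha_def nb_frame(1)[OF that(1)] by simp
  qed
  \<comment> \<open>The bounds are the values at the lower end \<open>t1\<close>, because
    \<open>ha\<close> decreases and \<open>hs\<close> increases with time.\<close>
  define C1 where "C1 = (\<Sum>i\<in>I. ha t1 (dx i) + (ha t1 (dx i))\<^sup>2 * 2)"
  define C2 where "C2 = (\<Prod>i\<in>I. 1 / hs t1 (dx i)) * exp m"
  have C1: "C1 \<ge> 0" unfolding C1_def using ha_pos[OF t1] Basis_frame by (intro sum_nonneg) (auto simp: less_imp_le)
  have hp: "\<bar>heat_poly (ha t) \<xi>\<bar> \<le> C1 * (1 + norm \<xi>)^2" if t: "t > t1" for t \<xi>
  proof -
    have "\<bar>heat_poly (ha t) \<xi>\<bar> \<le> (\<Sum>i\<in>I. \<bar>ha t (dx i) - \<nu> i / 2 - ((ha t (dx i))\<^sup>2 - (\<nu> i)\<^sup>2 / 4) * ((\<xi> \<bullet> dx i)\<^sup>2 + (\<xi> \<bullet> dy i)\<^sup>2)\<bar>)"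
      unfolding heat_poly_def by (rule sum_abs)
    also have "\<dots> \<le> (\<Sum>i\<in>I. (ha t1 (dx i) + (ha t1 (dx i))\<^sup>2 * 2) * (1 + norm \<xi>)^2)"
    proof (rule sum_mono)
      fix i assume i: "i \<in> I"
      note mn = mono[OF i t] \<nu>_pos[OF i]
      have sq: "(\<nu> i)\<^sup>2 / 4 \<le> (ha t (dx i))\<^sup>2" using power_mono[OF mn(3), of 2] mn(4) by (simp add: power_divide)
      have sq1: "(ha t (dx i))\<^sup>2 \<le> (ha t1 (dx i))\<^sup>2" using mn by (intro power_mono) auto
      have R1: "(\<xi> \<bullet> dx i)\<^sup>2 + (\<xi> \<bullet> dy i)\<^sup>2 \<le> 2 * (1 + norm \<xi>)^2"
      proof -
        have "(\<xi> \<bullet> b)\<^sup>2 \<le> (1 + norm \<xi>)^2" if "b \<in> Basis" for b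
          unfolding power2_abs[of "\<xi> \<bullet> b", symmetric] using Basis_le_norm[OF that, of \<xi>] by (intro power_mono) auto
        from this[OF Basis_frame(1)[OF i]] this[OF Basis_frame(2)[OF i]] show ?thesis by simp
      qed
      have "((ha t (dx i))\<^sup>2 - (\<nu> i)\<^sup>2 / 4) * ((\<xi> \<bullet> dx i)\<^sup>2 + (\<xi> \<bullet> dy i)\<^sup>2) \<le> (ha t1 (dx i))\<^sup>2 * (2 * (1 + norm \<xi>)^2)"
      proof (rule mult_mono[OF _ R1])
        show "(ha t (dx i))\<^sup>2 - (\<nu> i)\<^sup>2 / 4 \<le> (ha t1 (dx i))\<^sup>2" using sq1 zero_le_power2[of "\<nu> i"] by linarith
      qed auto
      moreover have "0 \<le> ((ha t (dx i))\<^sup>2 - (\<nu> i)\<^sup>2 / 4) * ((\<xi> \<bullet> dx i)\<^sup>2 + (\<xi> \<bullet> dy i)\<^sup>2)"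
        using sq by (intro mult_nonneg_nonneg) auto
      moreover have "ha t1 (dx i) * 1 \<le> ha t1 (dx i) * (1 + norm \<xi>)^2"
        using mn by (intro mult_left_mono) (auto simp: power2_eq_square algebra_simps)
      ultimately show "\<bar>ha t (dx i) - \<nu> i / 2 - ((ha t (dx i))\<^sup>2 - (\<nu> i)\<^sup>2 / 4) * ((\<xi> \<bullet> dx i)\<^sup>2 + (\<xi> \<bullet> dy i)\<^sup>2)\<bar> \<le> (ha t1 (dx i) + (ha t1 (dx i))\<^sup>2 * 2) * (1 + norm \<xi>)^2"
        unfolding distrib_right mult.assoc using mn by linarith
    qed
    also have "\<dots> = C1 * (1 + norm \<xi>)^2" by (simp add: C1_def sum_distrib_right)
    finally show ?thesis .
  qed
  have \<rho>b: "\<bar>\<rho> t \<xi>\<bar> \<le> C2 * exp (- (2 * m) * norm \<xi>)" if t: "t > t1" for t \<xi>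
  proof -
    have tp: "t > 0" using t t1 by simp
    have "\<bar>\<rho> t \<xi>\<bar> = norm (complex_of_real (\<rho> t \<xi>))" by simp
    also have "\<dots> = (\<Prod>i\<in>I. 1 / hs t (dx i)) * norm (gauss (ha t) \<xi>)"
      unfolding \<rho>[OF tp] norm_mult norm_of_real using hs_pos[OF tp] Basis_frame by (subst abs_of_nonneg) (auto intro!: prod_nonneg simp: less_imp_le)
    also have "\<dots> \<le> (\<Prod>i\<in>I. 1 / hs t1 (dx i)) * (exp m * exp (- 2 * m * norm \<xi>))"
    proof (intro mult_mono prod_mono conjI)
      show "norm (gauss (ha t) \<xi>) \<le> exp m * exp (- 2 * m * norm \<xi>)"
      proof (rule order_trans[OF norm_gauss_le gauss_exp_bound])
        show "m \<le> ha t b" if b: "b \<in> Basis" for b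
        proof -
          have "nb b * (1 / 2) \<le> ha t b" unfolding ha_def using hs_less[of t b] hs_pos[OF tp b] nb_pos[OF b] by (intro mult_left_mono) (auto simp: field_simps)
          then show ?thesis using m(2)[OF b] by simp
        qed
      qed (use m in auto)
      fix i assume i: "i \<in> I"
      show "0 \<le> 1 / hs t (dx i)" using hs_pos[OF tp Basis_frame(1)[OF i]] by simp
      show "1 / hs t (dx i) \<le> 1 / hs t1 (dx i)" using mono(1)[OF i t] hs_pos[OF t1 Basis_frame(1)[OF i]] by (intro divide_left_mono) auto
    qed (use hs_pos[OF t1] Basis_frame in \<open>auto intro!: prod_nonneg simp: less_imp_le\<close>)
    finally show ?thesis by (simp add: C2_def)
  qed
  have C2: "C2 \<ge> 0" unfolding C2_def using hs_pos[OF t1] Basis_frame by (auto intro!: mult_nonneg_nonneg prod_nonneg simp: less_imp_le)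
  define f' where "f' t \<xi> s = of_real (s * (- heat_poly (ha t) \<xi> * \<rho> t \<xi>)) * W (Lam \<xi>) F z" for t \<xi> s
  have \<rho>cont: "continuous_on UNIV (\<rho> t)" for t unfolding \<rho>_def R_def by (intro continuous_intros)
  have hpcont: "continuous_on UNIV (heat_poly a)" for a unfolding heat_poly_def by (intro continuous_intros)
  note [measurable] = borel_measurable_continuous_onI[OF \<rho>cont] borel_measurable_continuous_onI[OF hpcont]
  have bl: "t \<in> ball t0 t1 \<Longrightarrow> t > t1" for t unfolding t1_def ball_def dist_real_def by (auto simp: abs_if split: if_splits)
  have der: "((\<lambda>t. \<integral>\<xi>. of_real (\<rho> t \<xi>) * W (Lam \<xi>) F z \<partial>lborel) has_derivative (\<lambda>s. \<integral>\<xi>. f' t0 \<xi> s \<partial>lborel)) (at t0)"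
  proof (rule has_derivative_integral[where r = t1 and w = "\<lambda>\<xi>. (C1 * C2 * C) * ((1 + norm \<xi>) ^ 2 * exp (- (2 * m) * norm \<xi>))"])
    show "(\<lambda>\<xi>. of_real (\<rho> t \<xi>) * W (Lam \<xi>) F z) \<in> borel_measurable lborel" for t by measurable
    show "(\<lambda>\<xi>. f' t0 \<xi> s) \<in> borel_measurable lborel" for s unfolding f'_def by measurable
    show "integrable lborel (\<lambda>\<xi>::'v. (C1 * C2 * C) * ((1 + norm \<xi>) ^ 2 * exp (- (2 * m) * norm \<xi>)))"
      using m by (intro integrable_mult_right integrable_power_exp_norm) auto
    obtain CF where CF: "\<And>z. norm (F z) \<le> CF" using S_bounded[OF F] by blast
    have mom: "moments lborel Lam (gauss (ha t0))" by (rule poly_gauss_moments[OF poly_gauss.gauss]) (rule ha_pos[OF t0])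
    have "integrable lborel (\<lambda>\<xi>. gauss (ha t0) \<xi> * W (Lam \<xi>) F z)"
      by (rule moments_integrable_W[OF mom S_measurable[OF F] CF])
    then show "integrable lborel (\<lambda>\<xi>. of_real (\<rho> t0 \<xi>) * W (Lam \<xi>) F z)" unfolding \<rho>[OF t0] mult.assoc by (rule integrable_mult_right)
    fix t \<xi> assume t: "t \<in> ball t0 t1"
    have tp: "t > 0" using bl[OF t] t1 by simp
    have "((\<lambda>t. \<Sum>i\<in>I. - ln (hs t (dx i)) - ha t (dx i) * R i \<xi>) has_real_derivative - heat_poly (ha t) \<xi>) (at t)"
    proof -
      have di: "((\<lambda>t. - ln (hs t (dx i)) - ha t (dx i) * R i \<xi>) has_real_derivative - (ha t (dx i) - \<nu> i / 2 - ((ha t (dx i))\<^sup>2 - (\<nu> i)\<^sup>2 / 4) * R i \<xi>)) (at t)" if i: "i \<in> I" for i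
      proof -
        have p: "hs t (dx i) > 0" using hs_pos[OF tp Basis_frame(1)[OF i]] .
        have d: "((\<lambda>t. hs t (dx i)) has_real_derivative \<nu> i * (1 - hs t (dx i))) (at t)"
          unfolding hs_def nb_frame(1)[OF i] by (auto intro!: derivative_eq_intros)
        have d3: "((\<lambda>t. - ln (hs t (dx i)) - ha t (dx i) * R i \<xi>) has_real_derivative
            - (\<nu> i * (1 - hs t (dx i)) / hs t (dx i)) - \<nu> i * (- (\<nu> i * (1 - hs t (dx i))) / (hs t (dx i))\<^sup>2) * R i \<xi>) (at t)"
        proof -
          have ln: "((\<lambda>t. ln (hs t (dx i))) has_real_derivative 1 / hs t (dx i) * (\<nu> i * (1 - hs t (dx i)))) (at t)"
            by (rule DERIV_chain2[OF DERIV_ln_divide[OF p] d])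
          have "hs t (dx i) \<noteq> 0" using p by simp
          note inv = DERIV_inverse_fun[OF d this]
          have "((\<lambda>t. - ln (hs t (dx i)) - \<nu> i * (inverse (hs t (dx i)) - 1 / 2) * R i \<xi>) has_real_derivative
            - (1 / hs t (dx i) * (\<nu> i * (1 - hs t (dx i)))) - \<nu> i * (- (\<nu> i * (1 - hs t (dx i)) * inverse (hs t (dx i) ^ Suc (Suc 0))) - 0) * R i \<xi>) (at t)"
            by (rule DERIV_diff[OF DERIV_minus[OF ln] DERIV_cmult_right[OF DERIV_cmult[OF DERIV_diff[OF inv DERIV_const]]]])
          then show ?thesis unfolding ha_def nb_frame(1)[OF i] by (simp add: inverse_eq_divide power2_eq_square mult_ac)
        qed
        \<comment> \<open>The logarithmic derivative of \<open>hs\<close> expressed through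
          \<open>ha\<close>; the next identity is the Riccati equation.\<close>
        have e1: "- (\<nu> i * (1 - hs t (dx i)) / hs t (dx i)) = - (ha t (dx i) - \<nu> i / 2)"
          unfolding ha_def nb_frame(1)[OF i] using p by (simp add: field_simps)
        have e2: "\<nu> i * (- (\<nu> i * (1 - hs t (dx i))) / (hs t (dx i))\<^sup>2) = - ((ha t (dx i))\<^sup>2 - (\<nu> i)\<^sup>2 / 4)"
          unfolding ha_def nb_frame(1)[OF i] using p by (simp add: field_simps power2_eq_square)
        show ?thesis by (rule DERIV_cong[OF d3], unfold e1 e2, simp only: left_diff_distrib mult_minus_left minus_diff_eq diff_minus_eq_add)
      qed
      have "((\<lambda>t. \<Sum>i\<in>I. - ln (hs t (dx i)) - ha t (dx i) * R i \<xi>) has_real_derivative (\<Sum>i\<in>I. - (ha t (dx i) - \<nu> i / 2 - ((ha t (dx i))\<^sup>2 - (\<nu> i)\<^sup>2 / 4) * R i \<xi>))) (at t)"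
        by (rule DERIV_sum) (rule di)
      then show ?thesis unfolding heat_poly_def R_def sum_negf .
    qed
    from DERIV_fun_exp[OF this] have "((\<lambda>t. \<rho> t \<xi>) has_real_derivative - heat_poly (ha t) \<xi> * \<rho> t \<xi>) (at t)"
      unfolding \<rho>_def by (simp add: mult.commute)
    then have "((\<lambda>t. \<rho> t \<xi>) has_derivative (\<lambda>s. s * (- heat_poly (ha t) \<xi> * \<rho> t \<xi>))) (at t)"
      unfolding has_field_derivative_def by (rule has_derivative_eq_rhs) (rule ext, rule mult.commute)
    from has_derivative_mult_left[OF bounded_linear.has_derivative[OF bounded_linear_of_real[where 'a=complex] this]]
    show "((\<lambda>t. of_real (\<rho> t \<xi>) * W (Lam \<xi>) F z) has_derivative f' t \<xi>) (at t)"
      unfolding f'_def by simp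
    fix s
    have "\<bar>heat_poly (ha t) \<xi>\<bar> * \<bar>\<rho> t \<xi>\<bar> * norm (W (Lam \<xi>) F z) \<le> (C1 * (1 + norm \<xi>)^2) * (C2 * exp (- (2 * m) * norm \<xi>)) * C"
      using C1 C2 C(1) by (intro mult_mono hp \<rho>b C(2) bl[OF t]) auto
    from mult_left_mono[OF this, of "\<bar>s\<bar>"]
    show "norm (f' t \<xi> s) \<le> (C1 * C2 * C) * ((1 + norm \<xi>) ^ 2 * exp (- (2 * m) * norm \<xi>)) * norm s"
      unfolding f'_def norm_mult norm_of_real abs_mult abs_minus_cancel real_norm_def abs_ge_zero by (simp only: mult_ac)
  qed (rule t1)
  have f'_eq: "(\<integral>\<xi>. f' t0 \<xi> s \<partial>lborel) = s *\<^sub>R - (\<integral>\<xi>. hk t0 \<xi> * ham_W (hv t0 \<xi>) F z \<partial>lborel)" for s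
  proof -
    let ?Z = "complex_of_real (\<Prod>i\<in>I. 1 / hs t0 (dx i))"
    have "(\<integral>\<xi>. f' t0 \<xi> s \<partial>lborel) = (\<integral>\<xi>. - of_real s * ?Z * (of_real (heat_poly (ha t0) \<xi>) * gauss (ha t0) \<xi> * W (Lam \<xi>) F z) \<partial>lborel)"
      unfolding f'_def of_real_mult of_real_minus \<rho>[OF t0] by (intro Bochner_Integration.integral_cong refl) (simp only: of_real_mult of_real_minus mult_minus_left mult_minus_right mult_ac)
    also have "\<dots> = - of_real s * ?Z * G (\<lambda>\<xi>. of_real (heat_poly (ha t0) \<xi>) * gauss (ha t0) \<xi>) F z"
      unfolding T_def by (rule integral_mult_right_zero)
    also have "\<dots> = - of_real s * ?Z * (\<integral>\<xi>. gauss (ha t0) \<xi> * ham_W (Lam \<xi>) F z \<partial>lborel)"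
    proof -
      have a: "ha t0 b > 0" if "b \<in> Basis" for b by (rule ha_pos[OF t0 that])
      \<comment> \<open>The Hamiltonian of the average is evaluated in two ways, with the
        derivatives on the kernel and with the derivatives on \<open>F\<close>; comparing them
        exchanges \<open>heat_poly\<close> for \<open>ham_W\<close>.\<close>
      have "G (\<lambda>\<xi>. of_real (heat_poly (ha t0) \<xi>) * gauss (ha t0) \<xi>) F z = hamiltonian (G (gauss (ha t0)) F) z"
        by (rule hamiltonian_G_gauss[OF a had F, symmetric])
      also have "\<dots> = (\<integral>\<xi>. gauss (ha t0) \<xi> * ham_W (Lam \<xi>) F z \<partial>lborel)"
        by (rule hamiltonian_T(2)[OF poly_gauss_moments[OF poly_gauss.gauss a] F])
      finally show ?thesis by simp
    qed
    also have "\<dots> = - of_real s * (\<integral>\<xi>. hk t0 \<xi> * ham_W (hv t0 \<xi>) F z \<partial>lborel)"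
      by (subst heat_scaling[OF t0 borel_measurable_continuous_onI[OF continuous_ham_W[OF F]]]) (simp only: mult.assoc)
    finally show ?thesis by (simp add: scaleR_conv_of_real)
  qed
  from der have "((\<lambda>t. \<integral>\<xi>. of_real (\<rho> t \<xi>) * W (Lam \<xi>) F z \<partial>lborel) has_vector_derivative - (\<integral>\<xi>. hk t0 \<xi> * ham_W (hv t0 \<xi>) F z \<partial>lborel)) (at t0)"
    unfolding f'_eq has_vector_derivative_def .
  then show ?thesis
    by (rule has_vector_derivative_transform_within_open[where S = "{0<..}"]) (use t0 \<Phi> in auto)
qed

lemma hamiltonian_scale: "F \<in> S \<Longrightarrow> hamiltonian (fscale c F) = fscale c (hamiltonian F)"
proof
  fix z assume F: "F \<in> S"
  show "hamiltonian (fscale c F) z = fscale c (hamiltonian F) z"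
    unfolding hamiltonian_apply[OF S_closed(4)[OF F]] nabla_scale[OF F] nabla_scale[OF nabla_in[OF F]]
    unfolding fscale_def hamiltonian_apply[OF F] sum_distrib_left by (intro sum.cong refl) (simp add: field_simps)
qed

lemma gauss_integrable: "integrable lborel (gauss nb)"
proof -
  have "moments lborel Lam (gauss nb)" by (rule poly_gauss_moments[OF poly_gauss.gauss]) (rule nb_pos)
  then have "integrable lborel (\<lambda>\<xi>. (1 + norm (Lam \<xi>)) ^ 0 * norm (gauss nb \<xi>))" unfolding moments_def by blast
  then have "integrable lborel (\<lambda>\<xi>. norm (gauss nb \<xi>))" by simp
  then show ?thesis
    by (rule Bochner_Integration.integrable_norm_cancel) (simp add: poly_gauss_measurable[OF poly_gauss.gauss])
qed

lemma gauss_integral_nonzero: "(\<integral>\<xi>. gauss nb \<xi> \<partial>lborel) \<noteq> 0"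
proof
  note int = gauss_integrable
    assume Z: "(\<integral>\<xi>. gauss nb \<xi> \<partial>lborel) = 0"
    have z: "(\<integral>\<xi>. exp (- (\<Sum>b\<in>Basis. nb b * (\<xi> \<bullet> b)\<^sup>2)) \<partial>lborel) = 0"
      using Z integral_Re[OF int] by (simp add: gauss_def)
    have "integrable lborel (\<lambda>\<xi>::'v. exp (- (\<Sum>b\<in>Basis. nb b * (\<xi> \<bullet> b)\<^sup>2)))"
      using Bochner_Integration.integrable_Re[OF int] by (simp add: gauss_def)
    from integral_nonneg_eq_0_iff_AE[OF this] have "AE \<xi> in lborel. exp (- (\<Sum>b\<in>Basis. nb b * ((\<xi>::'v) \<bullet> b)\<^sup>2)) = 0"
      using z by simp
    then have "AE \<xi> in (lborel :: 'v measure). False" by simp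
    then have "emeasure (lborel :: 'v measure) UNIV = 0" by (simp add: AE_iff_null null_sets_def)
    then show False by simp
qed

text \<open>The resolvent is the Laplace transform of the heat semigroup.\<close>

theorem hamiltonian_resolvent:
  assumes c: "Re c < 0" and F: "F \<in> S"
  shows "\<exists>u\<in>S. hamiltonian u - fscale c u = F"
proof -
  have P: "pair_sigma_finite (lborel :: real measure) (lborel :: 'v measure)" by unfold_locales
  define M where "M = (lborel :: real measure) \<Otimes>\<^sub>M (lborel :: 'v measure)"
  define k where "k p = indicator {0<..} (fst p) *\<^sub>R exp (c * of_real (fst p)) * hk (fst p) (snd p)" for p :: "real \<times> 'v"
  define v where "v p = hv (fst p) (snd p)" for p :: "real \<times> 'v"
  obtain m where m: "m > 0" "\<And>b. b \<in> Basis \<Longrightarrow> nb b / 2 \<ge> m" using pos_lower_bound[of "\<lambda>b. nb b / 2"] nb_pos by auto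
  obtain L where L: "L > 0" "\<And>\<xi>. norm (Lam \<xi>) \<le> L * norm \<xi>" using Lam_bound by blast
  have setsM: "sets M = sets (borel \<Otimes>\<^sub>M borel)" unfolding M_def by (intro sets_pair_measure_cong) auto
  have km: "k \<in> borel_measurable M" "v \<in> borel_measurable M"
    unfolding measurable_cong_sets[OF setsM refl] k_def[abs_def] v_def[abs_def] by measurable
  \<comment> \<open>Decay in time comes from \<open>Re c < 0\<close>, decay in space from the
    Gaussian bound uniform in time; a product of two integrable functions dominates.\<close>
  have mom: "moments M v k" unfolding moments_def
  proof (intro conjI km allI)
    fix j
    have g: "integrable lborel (\<lambda>t::real. exp (- (- Re c) * norm t))" using c by (intro integrable_exp_norm) simp
    have h: "integrable lborel (\<lambda>\<xi>::'v. ((1 + L) ^ j * exp m) * ((1 + norm \<xi>) ^ j * exp (- (2 * m) * norm \<xi>)))"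
      using m by (intro integrable_mult_right integrable_power_exp_norm) auto
    show "integrable M (\<lambda>p. (1 + norm (v p)) ^ j * norm (k p))"
    proof (rule Bochner_Integration.integrable_bound)
      show "integrable M (\<lambda>p. exp (- (- Re c) * norm (fst p)) * (((1 + L) ^ j * exp m) * ((1 + norm (snd p)) ^ j * exp (- (2 * m) * norm (snd p)))))"
        unfolding M_def by (rule pair_sigma_finite.integrable_product[OF P g h])
      show "(\<lambda>p. (1 + norm (v p)) ^ j * norm (k p)) \<in> borel_measurable M" using km by measurable
      show "AE p in M. norm ((1 + norm (v p)) ^ j * norm (k p)) \<le> norm (exp (- (- Re c) * norm (fst p)) * (((1 + L) ^ j * exp m) * ((1 + norm (snd p)) ^ j * exp (- (2 * m) * norm (snd p)))))"
      proof (rule AE_I2)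
        fix p :: "real \<times> 'v"
        obtain t \<xi> where p: "p = (t, \<xi>)" by force
        show "norm ((1 + norm (v p)) ^ j * norm (k p)) \<le> norm (exp (- (- Re c) * norm (fst p)) * (((1 + L) ^ j * exp m) * ((1 + norm (snd p)) ^ j * exp (- (2 * m) * norm (snd p)))))"
        proof (cases "t > 0")
          case True
          have "1 + norm (hv t \<xi>) \<le> (1 + L) * (1 + norm \<xi>)" using hv_bound[of t L \<xi>] True L by (simp add: algebra_simps) (smt (verit) norm_ge_zero)
          then have "(1 + norm (hv t \<xi>)) ^ j * norm (hk t \<xi>) \<le> ((1 + L) * (1 + norm \<xi>)) ^ j * (exp m * exp (- 2 * m * norm \<xi>))"
            using True by (intro mult_mono power_mono hk_bound m) (auto intro!: zero_le_power mult_nonneg_nonneg simp: L(1) less_imp_le)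
          from mult_left_mono[OF this, of "exp (Re c * t)"] True L(1)
          show ?thesis by (simp add: p k_def v_def norm_mult power_mult_distrib abs_mult mult_ac)
        qed (simp add: p k_def)
      qed
    qed
  qed
  define u where "u = T M v k F"
  have u: "u \<in> S" unfolding u_def by (rule T_in[OF mom F])
  obtain CF where CF: "\<And>z. norm (F z) \<le> CF" using S_bounded[OF F] by blast
  \<comment> \<open>The mass of the rescaled kernel at time zero. The kernels are not normalized to
    mass one, so \<open>u\<close> solves the equation up to this factor, which is divided out at the
    end.\<close>
  define \<Theta> where "\<Theta> = (\<integral>\<xi>. gauss nb \<xi> \<partial>lborel)"
  have main: "hamiltonian u z - c * u z = \<Theta> * F z" for z
  proof -
    obtain C0 where C0: "C0 \<ge> 0" "\<And>v. norm (W v F z) \<le> C0 * (1 + norm v) ^ 0" using norm_W_bound[OF F] by auto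
    obtain C1 where C1: "C1 \<ge> 0" "\<And>v. norm (ham_W v F z) \<le> C1 * (1 + norm v) ^ 2" using ham_W_bound[OF F] by blast
    define \<Phi> where "\<Phi> t = (\<integral>\<xi>. hk t \<xi> * W (hv t \<xi>) F z \<partial>lborel)" for t
    define \<Psi> where "\<Psi> t = (\<integral>\<xi>. hk t \<xi> * ham_W (hv t \<xi>) F z \<partial>lborel)" for t
    have \<Phi>: "continuous_on {0..} \<Phi>" "\<exists>C. \<forall>t\<ge>0. norm (\<Phi> t) \<le> C"
      unfolding \<Phi>_def by (rule heat_integrand[OF continuous_W[OF F] C0])+
    have \<Psi>: "continuous_on {0..} \<Psi>" unfolding \<Psi>_def by (rule heat_integrand[OF continuous_ham_W[OF F] C1])
    have der: "(\<Phi> has_vector_derivative - \<Psi> t) (at t)" if "t > 0" for t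
      unfolding \<Phi>_def \<Psi>_def by (rule heat_derivative[OF that F])
    have intW: "integrable M (\<lambda>p. k p * W (v p) F z)" by (rule moments_integrable_W[OF mom S_measurable[OF F] CF])
    have int: "integrable M (\<lambda>p. k p * ham_W (v p) F z - c * (k p * W (v p) F z))"
      by (intro Bochner_Integration.integrable_diff integrable_mult_right hamiltonian_T(1)[OF mom F] intW)
    define f where "f t = exp (c * of_real t) * (\<Psi> t - c * \<Phi> t)" for t
    have fub: "(\<integral>\<xi>. k (t, \<xi>) * ham_W (v (t, \<xi>)) F z - c * (k (t, \<xi>) * W (v (t, \<xi>)) F z) \<partial>lborel) = indicator {0<..} t *\<^sub>R f t" for t
    proof (cases "t > 0")
      case True
      have h: "integrable lborel (\<lambda>\<xi>. hk t \<xi> * h (hv t \<xi>))" if h: "continuous_on UNIV h" "C \<ge> 0" "\<And>v. norm (h v) \<le> C * (1 + norm v) ^ j" for h :: "'v \<Rightarrow> complex" and C j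
      proof (rule Bochner_Integration.integrable_bound)
        note [measurable] = borel_measurable_continuous_onI[OF h(1)]
        show "(\<lambda>\<xi>. hk t \<xi> * h (hv t \<xi>)) \<in> borel_measurable lborel" by measurable
        show "integrable lborel (\<lambda>\<xi>::'v. (C * exp m * (1 + L) ^ j) * ((1 + norm \<xi>) ^ j * exp (- (2 * m) * norm \<xi>)))"
          using m by (intro integrable_mult_right integrable_power_exp_norm) auto
        show "AE \<xi> in lborel. norm (hk t \<xi> * h (hv t \<xi>)) \<le> norm ((C * exp m * (1 + L) ^ j) * ((1 + norm \<xi>) ^ j * exp (- (2 * m) * norm \<xi>)))"
        proof (rule AE_I2)
          fix \<xi>
          have "1 + norm (hv t \<xi>) \<le> (1 + L) * (1 + norm \<xi>)" using hv_bound[of t L \<xi>] True L by (simp add: algebra_simps) (smt (verit) norm_ge_zero)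
          then have "norm (hk t \<xi>) * norm (h (hv t \<xi>)) \<le> (exp m * exp (- 2 * m * norm \<xi>)) * (C * ((1 + L) * (1 + norm \<xi>)) ^ j)"
            using h(2) True by (intro mult_mono hk_bound m order_trans[OF h(3)] mult_left_mono power_mono) auto
          then show "norm (hk t \<xi> * h (hv t \<xi>)) \<le> norm ((C * exp m * (1 + L) ^ j) * ((1 + norm \<xi>) ^ j * exp (- (2 * m) * norm \<xi>)))"
            using h(2) L(1) by (simp add: norm_mult abs_mult power_mult_distrib mult_ac)
        qed
      qed
      have i0: "integrable lborel (\<lambda>\<xi>. hk t \<xi> * W (hv t \<xi>) F z)" by (rule h[OF continuous_W[OF F] C0])
      have i1: "integrable lborel (\<lambda>\<xi>. hk t \<xi> * ham_W (hv t \<xi>) F z)" by (rule h[OF continuous_ham_W[OF F] C1])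
      have "(\<integral>\<xi>. k (t, \<xi>) * ham_W (v (t, \<xi>)) F z - c * (k (t, \<xi>) * W (v (t, \<xi>)) F z) \<partial>lborel)
        = (\<integral>\<xi>. exp (c * of_real t) * (hk t \<xi> * ham_W (hv t \<xi>) F z - c * (hk t \<xi> * W (hv t \<xi>) F z)) \<partial>lborel)"
        using True by (intro Bochner_Integration.integral_cong refl) (simp add: k_def v_def algebra_simps)
      also have "\<dots> = f t" unfolding f_def \<Phi>_def \<Psi>_def using i0 i1 by simp
      finally show ?thesis using True by simp
    qed (simp add: k_def)
    have "hamiltonian u z - c * u z = (\<integral>p. k p * ham_W (v p) F z - c * (k p * W (v p) F z) \<partial>M)"
      unfolding u_def hamiltonian_T(2)[OF mom F] unfolding T_def
      using hamiltonian_T(1)[OF mom F, of z] intW by simp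
    also have "\<dots> = (\<integral>t. indicator {0<..} t *\<^sub>R f t \<partial>lborel)"
      unfolding fub[symmetric] using pair_sigma_finite.integral_fst'[OF P int[unfolded M_def]] unfolding M_def by simp
    also have "\<dots> = (LBINT t=0..\<infinity>. f t)"
      unfolding interval_lebesgue_integral_def set_lebesgue_integral_def einterval_def by (simp add: greaterThan_def zero_ereal_def)
    \<comment> \<open>By the heat equation \<open>f\<close> is the derivative of
      \<open>- exp (c * t) * \<Phi> t\<close>, which tends to zero for large times because
      \<open>\<Phi>\<close> is bounded and \<open>Re c < 0\<close>.\<close>
    also have "\<dots> = 0 - (- \<Phi> 0)"
    proof (rule interval_integral_FTC_integrable[where F = "\<lambda>t. - (exp (c * of_real t) * \<Phi> t)"])
      fix t assume "0 < ereal t"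
      then have t: "t > 0" by (simp add: zero_ereal_def)
      have "((\<lambda>t. exp (c * complex_of_real t)) has_vector_derivative c * exp (c * of_real t)) (at t)"
        by (rule has_vector_derivative_real_field) (auto intro!: derivative_eq_intros simp: mult.commute)
      from has_vector_derivative_minus[OF has_vector_derivative_mult[OF this der[OF t]]]
      show "((\<lambda>t. - (exp (c * of_real t) * \<Phi> t)) has_vector_derivative f t) (at t)"
        by (simp add: f_def algebra_simps)
      have "isCont \<Phi> t" "isCont \<Psi> t" using \<Phi>(1) \<Psi> t
        by (auto intro!: continuous_on_interior[of "{0..}"] simp: interior_Ici)
      then show "isCont f t" unfolding f_def by (intro continuous_intros)
    next
      have "integrable lborel (\<lambda>t. indicator {0<..} t *\<^sub>R f t)"
        unfolding fub[symmetric] using pair_sigma_finite.integrable_fst'[OF P int[unfolded M_def]] by simp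
      then show "set_integrable lborel (einterval 0 \<infinity>) f"
        unfolding set_integrable_def einterval_def by (simp add: greaterThan_def zero_ereal_def)
      have c0: "continuous_on {0..} (\<lambda>t. - (exp (c * of_real t) * \<Phi> t))" using \<Phi>(1) by (intro continuous_intros)
      have "((\<lambda>t. - (exp (c * of_real t) * \<Phi> t)) \<longlongrightarrow> - (exp (c * of_real 0) * \<Phi> 0)) (at 0 within {0..})"
        using c0 unfolding continuous_on_def by (rule bspec) simp
      then have "((\<lambda>t. - (exp (c * of_real t) * \<Phi> t)) \<longlongrightarrow> - \<Phi> 0) (at_right 0)"
        by (rule tendsto_within_subset[THEN tendsto_eq_rhs]) auto
      then show "(((\<lambda>t. - (exp (c * of_real t) * \<Phi> t)) \<circ> real_of_ereal) \<longlongrightarrow> - \<Phi> 0) (at_right 0)"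
        by (simp add: zero_ereal_def ereal_tendsto_simps)
      obtain C where C: "\<And>t. t \<ge> 0 \<Longrightarrow> norm (\<Phi> t) \<le> C" using \<Phi>(2) by blast
      have "((\<lambda>t. - (exp (c * of_real t) * \<Phi> t)) \<longlongrightarrow> 0) at_top"
      proof (rule Lim_null_comparison)
        have "((\<lambda>t. exp (Re c * t) * C) \<longlongrightarrow> 0 * C) at_top"
          using c by (intro tendsto_intros filterlim_compose[OF exp_at_bot] filterlim_tendsto_neg_mult_at_bot[OF tendsto_const] filterlim_ident) auto
        then show "((\<lambda>t. exp (Re c * t) * C) \<longlongrightarrow> 0) at_top" by simp
        show "\<forall>\<^sub>F t in at_top. norm (- (exp (c * of_real t) * \<Phi> t)) \<le> exp (Re c * t) * C"
          using eventually_ge_at_top[of 0]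
        proof eventually_elim
          case (elim t) then show ?case using C[OF elim] by (simp add: norm_mult mult_left_mono)
        qed
      qed
      then show "(((\<lambda>t. - (exp (c * of_real t) * \<Phi> t)) \<circ> real_of_ereal) \<longlongrightarrow> 0) (at_left \<infinity>)"
        by (simp add: ereal_tendsto_simps)
    qed simp
    also have "\<dots> = \<Theta> * F z"
    proof -
      have "hs 0 b = 0" for b by (simp add: hs_def)
      then have "hk 0 \<xi> = gauss nb \<xi>" "hv 0 \<xi> = 0" for \<xi> by (simp_all add: hk_def hv_def linear_0[OF linear_Lam])
      then show ?thesis by (simp add: \<Phi>_def W_def E.zero_right \<Theta>_def)
    qed
    finally show ?thesis .
  qed
  have \<Theta>: "\<Theta> \<noteq> 0" unfolding \<Theta>_def by (rule gauss_integral_nonzero)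
  have "hamiltonian (fscale (1 / \<Theta>) u) - fscale c (fscale (1 / \<Theta>) u) = F"
    unfolding hamiltonian_scale[OF u] using main \<Theta>
    by (auto simp: fun_eq_iff fscale_def field_simps)
  then show ?thesis using u by blast
qed

end

section \<open>The quasi-periodic functions as a ladder\<close>

context magnetic_frame
begin

sublocale L: ladder S an cr \<nu> I ip
proof
  fix i j F K H and c :: complex
  show "finite I" by simp
  show "fun_space.subspace S" by (rule S_subspace)
  show "F \<in> S \<Longrightarrow> an i F \<in> S" "F \<in> S \<Longrightarrow> cr i F \<in> S" by (rule an_in cr_in, assumption)+
  show "F \<in> S \<Longrightarrow> K \<in> S \<Longrightarrow> an i (F + K) = an i F + an i K" "F \<in> S \<Longrightarrow> K \<in> S \<Longrightarrow> cr i (F + K) = cr i F + cr i K"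
    by (auto simp: fun_eq_iff an_apply cr_apply nabla_add field_simps)
  show "F \<in> S \<Longrightarrow> an i (fscale c F) = fscale c (an i F)" "F \<in> S \<Longrightarrow> cr i (fscale c F) = fscale c (cr i F)"
    by (auto simp: fun_eq_iff an_apply cr_apply nabla_scale) (auto simp: fscale_def an_apply cr_apply field_simps)
  show "an i (cr j F) = cr j (an i F) + (if i = j then fscale (of_real (\<nu> i)) F else 0)" if ij: "i \<in> I" "j \<in> I" and F: "F \<in> S"
  proof
    fix z show "an i (cr j F) z = (cr j (an i F) + (if i = j then fscale (of_real (\<nu> i)) F else 0)) z"
      unfolding an_apply cr_apply nabla_an[OF F] nabla_cr[OF F] plus_fun_apply
        comm[OF F, of "X i" "X j"] comm[OF F, of "X i" "Y j"] comm[OF F, of "Y i" "X j"] comm[OF F, of "Y i" "Y j"]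
      using ij by (auto simp: E_XX E_YY E_XY E_YX fscale_def field_simps)
  qed
  show "an i (an j F) = an j (an i F)" if ij: "i \<in> I" "j \<in> I" and F: "F \<in> S"
  proof
    fix z show "an i (an j F) z = an j (an i F) z"
      unfolding an_apply nabla_an[OF F]
        comm[OF F, of "X i" "X j"] comm[OF F, of "X i" "Y j"] comm[OF F, of "Y i" "X j"] comm[OF F, of "Y i" "Y j"]
      using ij by (auto simp: E_XX E_YY E_XY E_YX field_simps)
  qed
  show "cr i (cr j F) = cr j (cr i F)" if ij: "i \<in> I" "j \<in> I" and F: "F \<in> S"
  proof
    fix z show "cr i (cr j F) z = cr j (cr i F) z"
      unfolding cr_apply nabla_cr[OF F]
        comm[OF F, of "X i" "X j"] comm[OF F, of "X i" "Y j"] comm[OF F, of "Y i" "X j"] comm[OF F, of "Y i" "Y j"]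
      using ij by (auto simp: E_XX E_YY E_XY E_YX field_simps)
  qed
  show "i \<in> I \<Longrightarrow> \<nu> i > 0" by (rule \<nu>_pos)
  show "F \<in> S \<Longrightarrow> K \<in> S \<Longrightarrow> H \<in> S \<Longrightarrow> ip (F + K) H = ip F H + ip K H" by (rule ip_add)
  show "ip (fscale c F) K = c * ip F K" by (rule ip_scale)
  show "ip K F = cnj (ip F K)" by (rule ip_cnj)
  show "F \<in> S \<Longrightarrow> F \<noteq> 0 \<Longrightarrow> Re (ip F F) > 0" by (rule ip_pos)
  show "Re c < 0 \<Longrightarrow> F \<in> S \<Longrightarrow> \<exists>u\<in>S. (\<Sum>i\<in>I. cr i (an i u)) - fscale c u = F"
    using hamiltonian_resolvent unfolding hamiltonian_def .
  show "ip (an i F) K = ip F (cr i K)" if F: "F \<in> S" and K: "K \<in> S"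
  proof -
    have 1: "ip (an i F) K = (ip (nabla (X i) F) K + \<i> * ip (nabla (Y i) F) K) / 2"
      unfolding an_def ip_scale using F K by (simp add: ip_add nabla_in ip_scale)
    have "ip (cr i K) F = - (ip (nabla (X i) K) F - \<i> * ip (nabla (Y i) K) F) / 2"
      unfolding cr_def ip_scale ip_add[OF nabla_in[OF K] S_closed(4)[OF nabla_in[OF K]] F] by (simp add: field_simps)
    from arg_cong[OF this, of cnj] have "cnj (ip (cr i K) F) = - (cnj (ip (nabla (X i) K) F) + \<i> * cnj (ip (nabla (Y i) K) F)) / 2" by simp
    then have 2: "ip F (cr i K) = - (ip F (nabla (X i) K) + \<i> * ip F (nabla (Y i) K)) / 2"
      by (simp only: ip_cnj[symmetric])
    show ?thesis unfolding 1 2 ip_nabla[OF F K] by (simp add: field_simps)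
  qed
qed

section \<open>Existence of ground states\<close>

text \<open>Scaling by \<open>1 / sqrt (q n)\<close> fixes the Gaussian and contracts the argument
  of \<open>h\<close> to the origin, so the integrals tend to \<open>h 0\<close> times a nonzero
  mass. Continuity is asked for at the origin alone, since one of the applications has a
  discontinuous \<open>h\<close>.\<close>

lemma gauss_approximate_identity:
  fixes h :: "'v \<Rightarrow> complex"
  assumes h [measurable]: "h \<in> borel_measurable borel" and bd: "\<And>v. norm (h v) \<le> C" and cont: "isCont h 0"
    and q: "\<And>n. q n > (0::real)" "filterlim q at_top sequentially"
    and zero: "\<And>n. (\<integral>\<xi>. gauss (\<lambda>b. q n * nb b) \<xi> * h (Lam \<xi>) \<partial>lborel) = 0"
  shows "h 0 = 0"
proof -
  note [measurable] = poly_gauss_measurable[OF poly_gauss.gauss]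
  have z: "(\<integral>\<xi>. gauss nb \<xi> * h (Lam ((1 / sqrt (q n)) *\<^sub>R \<xi>)) \<partial>lborel) = 0" for n
  proof -
    have s: "sqrt (q n) > 0" using q(1) by simp
    have "(\<integral>\<xi>. gauss (\<lambda>b. q n * nb b) \<xi> * h (Lam \<xi>) \<partial>lborel) = of_real (\<Prod>b\<in>(Basis::'v set). 1 / sqrt (q n)) * (\<integral>\<xi>. gauss (\<lambda>b. q n * nb b) (\<Sum>b\<in>Basis. (1 / sqrt (q n) * (\<xi> \<bullet> b)) *\<^sub>R b) * h (Lam (\<Sum>b\<in>Basis. (1 / sqrt (q n) * (\<xi> \<bullet> b)) *\<^sub>R b)) \<partial>lborel)"
      by (rule lborel_integral_diag) (use s in auto)
    moreover have "gauss (\<lambda>b. q n * nb b) (\<Sum>b\<in>Basis. (1 / sqrt (q n) * (\<xi> \<bullet> b)) *\<^sub>R b) = gauss nb \<xi>" for \<xi>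
      unfolding gauss_def using q(1)[of n] by (simp add: power_divide)
    moreover have "(\<Sum>b\<in>Basis. (1 / sqrt (q n) * (\<xi> \<bullet> b)) *\<^sub>R b) = (1 / sqrt (q n)) *\<^sub>R \<xi>" for \<xi> :: 'v
      using euclidean_representation[of "(1 / sqrt (q n)) *\<^sub>R \<xi>"] by simp
    ultimately show ?thesis using zero[of n] s by (auto simp: less_imp_neq[symmetric])
  qed
  have "(\<lambda>n. \<integral>\<xi>. gauss nb \<xi> * h (Lam ((1 / sqrt (q n)) *\<^sub>R \<xi>)) \<partial>lborel) \<longlonglongrightarrow> (\<integral>\<xi>. gauss nb \<xi> * h 0 \<partial>lborel)"
  proof (rule integral_dominated_convergence[where w = "\<lambda>\<xi>. norm (gauss nb \<xi>) * C"])
    show "integrable lborel (\<lambda>\<xi>. norm (gauss nb \<xi>) * C)" using gauss_integrable by auto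
    show "AE \<xi> in lborel. (\<lambda>n. gauss nb \<xi> * h (Lam ((1 / sqrt (q n)) *\<^sub>R \<xi>))) \<longlonglongrightarrow> gauss nb \<xi> * h 0"
    proof (intro AE_I2 tendsto_mult tendsto_const isCont_tendsto_compose[OF cont])
      fix \<xi>
      have "(\<lambda>n. inverse (sqrt (q n))) \<longlonglongrightarrow> 0"
        by (rule tendsto_inverse_0_at_top) (rule filterlim_compose[OF sqrt_at_top q(2)])
      from tendsto_scaleR[OF this tendsto_const[of "Lam \<xi>"]]
      show "(\<lambda>n. Lam ((1 / sqrt (q n)) *\<^sub>R \<xi>)) \<longlonglongrightarrow> 0" by (simp add: linear_scale[OF linear_Lam] inverse_eq_divide)
    qed
    show "AE \<xi> in lborel. norm (gauss nb \<xi> * h (Lam ((1 / sqrt (q n)) *\<^sub>R \<xi>))) \<le> norm (gauss nb \<xi>) * C" for n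
      using bd by (intro AE_I2) (simp add: norm_mult mult_left_mono)
  qed measurable
  then have "(\<integral>\<xi>. gauss nb \<xi> * h 0 \<partial>lborel) = 0" unfolding z using LIMSEQ_unique tendsto_const by blast
  then show ?thesis using gauss_integral_nonzero by simp
qed

lemma T_linear:
  assumes "moments M v k" "moments M v k'" "F \<in> S"
  shows "T M v (\<lambda>x. k x + k' x) F z = T M v k F z + T M v k' F z" "T M v (\<lambda>x. c * k x) F z = c * T M v k F z"
proof -
  obtain C where C: "\<And>z. norm (F z) \<le> C" using S_bounded[OF assms(3)] by blast
  show "T M v (\<lambda>x. k x + k' x) F z = T M v k F z + T M v k' F z"
    unfolding T_def using moments_integrable_W[OF assms(1) S_measurable[OF assms(3)] C] moments_integrable_W[OF assms(2) S_measurable[OF assms(3)] C]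
    by (simp add: distrib_right)
  show "T M v (\<lambda>x. c * k x) F z = c * T M v k F z" unfolding T_def by (simp add: mult.assoc)
qed

text \<open>If averaging with a kernel kills every element of \<open>S\<close>, it kills
  \<open>nabla w F\<close> as well as \<open>F\<close>. Then \<open>nabla_T\<close> leaves the
  average with the kernel times \<open>E w (Lam \<xi>)\<close>, which must vanish too, and suitable
  \<open>w\<close> turn this factor into any coordinate.\<close>

lemma G_zero_poly_gauss:
  assumes a: "\<And>b. b \<in> Basis \<Longrightarrow> a b > 0" and zero: "\<And>F z. F \<in> S \<Longrightarrow> G (gauss a) F z = 0"
    and k: "\<kappa> \<in> poly_gauss a" and F: "F \<in> S"
  shows "G \<kappa> F z = 0"
  using k F
proof (induction arbitrary: F z rule: poly_gauss.induct)
  case gauss then show ?case by (rule zero)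
next
  case (coord \<kappa> b)
  have mom: "moments lborel Lam \<kappa>" by (rule poly_gauss_moments[OF coord.hyps(1) a])
  have E0: "G (\<lambda>\<xi>. (2 * pi * \<i>) * of_real (E w (Lam \<xi>)) * \<kappa> \<xi>) F z = 0" for w
  proof -
    have "G \<kappa> F = (\<lambda>z. 0)" using coord by auto
    moreover have "nabla w (\<lambda>z. 0) z = 0" by (simp add: nabla_def dird_const)
    ultimately show ?thesis using nabla_T[OF mom coord.prems, of w z] coord.IH[OF nabla_in[OF coord.prems]] by simp
  qed
  \<comment> \<open>Pairing with \<open>Y j\<close> gives the coordinate along \<open>dx j\<close>,
    pairing with \<open>X j\<close> the one along \<open>dy j\<close>.\<close>
  have "\<exists>w r. r \<noteq> 0 \<and> (\<forall>\<xi>. E w (Lam \<xi>) = r * (\<xi> \<bullet> b))"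
  proof -
    from coord.hyps(2) obtain j where j: "j \<in> I" "b = dx j \<or> b = dy j" unfolding Basis_eq[symmetric] by auto
    have nz: "\<nu> j / pi \<noteq> 0" "- \<nu> j / pi \<noteq> 0" using \<nu>_pos[OF j(1)] by auto
    from j(2) show ?thesis
    proof
      assume "b = dx j" then show ?thesis using nz(1) E_Lam(2)[OF j(1)] by (intro exI[of _ "Y j"] exI[of _ "\<nu> j / pi"]) simp
    next
      assume "b = dy j" then show ?thesis using nz(2) E_Lam(1)[OF j(1)] by (intro exI[of _ "X j"] exI[of _ "- \<nu> j / pi"]) simp
    qed
  qed
  then obtain w r where wr: "r \<noteq> 0" "\<And>\<xi>. E w (Lam \<xi>) = r * (\<xi> \<bullet> b)" by auto
  have "(\<lambda>\<xi>. (2 * pi * \<i>) * of_real (E w (Lam \<xi>)) * \<kappa> \<xi>) = (\<lambda>\<xi>. (2 * pi * \<i> * of_real r) * (of_real (\<xi> \<bullet> b) * \<kappa> \<xi>))"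
    unfolding wr by (simp add: mult_ac)
  then have "G (\<lambda>\<xi>. (2 * pi * \<i> * of_real r) * (of_real (\<xi> \<bullet> b) * \<kappa> \<xi>)) F z = 0"
    using E0[of w] by (simp only:)
  then have "(2 * pi * \<i> * of_real r) * G (\<lambda>\<xi>. of_real (\<xi> \<bullet> b) * \<kappa> \<xi>) F z = 0"
    unfolding T_def by (simp only: mult.assoc integral_mult_right_zero)
  then show ?case using wr(1) by simp
next
  case (add \<kappa> \<kappa>')
  have "G (\<lambda>\<xi>. \<kappa> \<xi> + \<kappa>' \<xi>) F z = G \<kappa> F z + G \<kappa>' F z"
    by (rule T_linear(1)[OF poly_gauss_moments[OF add.hyps(1) a] poly_gauss_moments[OF add.hyps(2) a] add.prems])
  then show ?case using add.IH add.prems by simp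
next
  case (scale \<kappa> c)
  have "G (\<lambda>\<xi>. c * \<kappa> \<xi>) F z = c * G \<kappa> F z"
    by (rule T_linear(2)[OF poly_gauss_moments[OF scale.hyps a] poly_gauss_moments[OF scale.hyps a] scale.prems])
  then show ?case using scale by simp
qed

definition quad :: "'v \<Rightarrow> real" where "quad \<xi> = (\<Sum>b\<in>Basis. nb b * (\<xi> \<bullet> b)\<^sup>2)"

lemma gauss_quad: "gauss (\<lambda>b. q * nb b) \<xi> = of_real (exp (- (q * quad \<xi>)))"
  by (simp add: gauss_def quad_def sum_distrib_left mult.assoc)

lemma quad_nonneg: "quad \<xi> \<ge> 0" unfolding quad_def using nb_pos by (intro sum_nonneg mult_nonneg_nonneg) (auto simp: less_imp_le)

lemma quad_poly_gauss: "\<kappa> \<in> poly_gauss a \<Longrightarrow> (\<lambda>\<xi>. of_real (quad \<xi> ^ k) * \<kappa> \<xi>) \<in> poly_gauss a"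
proof (induction k)
  case (Suc k)
  have "(\<lambda>\<xi>. of_real (quad \<xi> ^ Suc k) * \<kappa> \<xi>) = (\<lambda>\<xi>. \<Sum>b\<in>Basis. of_real (nb b) * (of_real (\<xi> \<bullet> b) * (of_real (\<xi> \<bullet> b) * (of_real (quad \<xi> ^ k) * \<kappa> \<xi>))))"
    by (simp add: quad_def[of "_::'v"] sum_distrib_left sum_distrib_right power2_eq_square mult_ac)
  then show ?case using Suc by (simp only:) (intro poly_gauss_sum poly_gauss.scale poly_gauss.coord finite_Basis; simp)
qed simp

text \<open>Enlarging the weight by half multiplies the kernel by
  \<open>exp (- (q / 2) * quad \<xi>)\<close>, whose Taylor polynomials give kernels in
  \<open>poly_gauss\<close>. They are bounded by \<open>exp (q / 2 * quad \<xi>)\<close>, and the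
  original Gaussian absorbs this with weight \<open>q / 2\<close> to spare; a step by a factor of
  \<open>2\<close> or more would leave nothing integrable.\<close>

lemma gauss_widen:
  assumes q: "q > 0" and zero: "\<And>F z. F \<in> S \<Longrightarrow> G (gauss (\<lambda>b. q * nb b)) F z = 0" and F: "F \<in> S"
  shows "G (gauss (\<lambda>b. (3/2 * q) * nb b)) F z = 0"
proof -
  let ?a = "\<lambda>b. q * nb b"
  have a: "?a b > 0" if "b \<in> Basis" for b using q nb_pos[OF that] by simp
  have pg: "gauss ?a \<in> poly_gauss ?a" by (rule poly_gauss.gauss)
  obtain C where C: "C \<ge> 0" "\<And>v. norm (W v F z) \<le> C" using norm_W_bound[OF F] by blast
  note [measurable] = borel_measurable_continuous_onI[OF continuous_W[OF F]] poly_gauss_measurable[OF poly_gauss.gauss] poly_gauss_measurable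
  define s where "s N \<xi> = (\<Sum>k<N. of_real ((- (q / 2)) ^ k / fact k) * (of_real (quad \<xi> ^ k) * gauss ?a \<xi>))" for N \<xi>
  have s: "s N \<in> poly_gauss ?a" for N unfolding s_def[abs_def]
    by (intro poly_gauss_sum poly_gauss.scale quad_poly_gauss pg) auto
  have sz: "(\<integral>\<xi>. s N \<xi> * W (Lam \<xi>) F z \<partial>lborel) = 0" for N
    using G_zero_poly_gauss[OF a zero s F] unfolding T_def .
  have se: "s N \<xi> = of_real ((\<Sum>k<N. (- (q / 2) * quad \<xi>) ^ k / fact k) * exp (- (q * quad \<xi>)))" for N \<xi>
    unfolding s_def gauss_quad sum_distrib_right of_real_sum
    by (simp only: of_real_mult[symmetric] power_mult_distrib times_divide_eq_left times_divide_eq_right mult.assoc)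
  have "(\<lambda>N. \<integral>\<xi>. s N \<xi> * W (Lam \<xi>) F z \<partial>lborel) \<longlonglongrightarrow> (\<integral>\<xi>. gauss (\<lambda>b. (3/2 * q) * nb b) \<xi> * W (Lam \<xi>) F z \<partial>lborel)"
  proof (rule integral_dominated_convergence[where w = "\<lambda>\<xi>. norm (gauss (\<lambda>b. (q/2) * nb b) \<xi>) * C"])
    have "moments lborel Lam (gauss (\<lambda>b. (q/2) * nb b))" by (rule poly_gauss_moments[OF poly_gauss.gauss]) (use q nb_pos in auto)
    then have "integrable lborel (\<lambda>\<xi>. (1 + norm (Lam \<xi>)) ^ 0 * norm (gauss (\<lambda>b. (q/2) * nb b) \<xi>))" unfolding moments_def by blast
    then show "integrable lborel (\<lambda>\<xi>. norm (gauss (\<lambda>b. (q/2) * nb b) \<xi>) * C)"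
      unfolding power_0 mult_1 by (rule integrable_mult_left)
    show "AE \<xi> in lborel. (\<lambda>N. s N \<xi> * W (Lam \<xi>) F z) \<longlonglongrightarrow> gauss (\<lambda>b. (3/2 * q) * nb b) \<xi> * W (Lam \<xi>) F z"
    proof (intro AE_I2 tendsto_mult tendsto_const)
      fix \<xi>
      have "(\<lambda>N. \<Sum>k<N. (- (q / 2) * quad \<xi>) ^ k / fact k) \<longlonglongrightarrow> exp (- (q / 2) * quad \<xi>)"
        using exp_converges[of "- (q / 2) * quad \<xi>"] unfolding sums_def by (simp only: real_scaleR_def divide_inverse_commute[symmetric])
      then have "(\<lambda>N. s N \<xi>) \<longlonglongrightarrow> of_real (exp (- (q / 2) * quad \<xi>) * exp (- (q * quad \<xi>)))"
        unfolding se by (intro tendsto_of_real tendsto_mult tendsto_const)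
      then show "(\<lambda>N. s N \<xi>) \<longlonglongrightarrow> gauss (\<lambda>b. (3/2 * q) * nb b) \<xi>"
        unfolding gauss_quad exp_add[symmetric] by (simp add: algebra_simps)
    qed
    show "AE \<xi> in lborel. norm (s N \<xi> * W (Lam \<xi>) F z) \<le> norm (gauss (\<lambda>b. (q/2) * nb b) \<xi>) * C" for N
    proof (rule AE_I2)
      fix \<xi>
      have "\<bar>\<Sum>k<N. (- (q / 2) * quad \<xi>) ^ k / fact k\<bar> \<le> (\<Sum>k<N. \<bar>(- (q / 2) * quad \<xi>) ^ k / fact k\<bar>)" by (rule sum_abs)
      also have "\<dots> = (\<Sum>k<N. inverse (fact k) *\<^sub>R (q / 2 * quad \<xi>) ^ k)"
      proof (intro sum.cong refl)
        fix k :: nat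
        have ab: "\<bar>- (q / 2) * quad \<xi>\<bar> = q / 2 * quad \<xi>" using quad_nonneg[of \<xi>] q by (simp add: abs_mult)
        show "\<bar>(- (q / 2) * quad \<xi>) ^ k / fact k\<bar> = inverse (fact k) *\<^sub>R (q / 2 * quad \<xi>) ^ k"
          by (simp only: abs_divide power_abs ab real_scaleR_def divide_inverse_commute[symmetric] abs_of_nonneg[OF fact_ge_zero])
      qed
      also have "\<dots> \<le> exp (q / 2 * quad \<xi>)"
        unfolding exp_def using quad_nonneg[of \<xi>] q summable_exp_generic[of "q / 2 * quad \<xi>"] by (intro sum_le_suminf) auto
      finally have "\<bar>\<Sum>k<N. (- (q / 2) * quad \<xi>) ^ k / fact k\<bar> * exp (- (q * quad \<xi>)) \<le> exp (q / 2 * quad \<xi>) * exp (- (q * quad \<xi>))"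
        by (rule mult_right_mono) simp
      also have "\<dots> = exp (- (q / 2 * quad \<xi>))" unfolding exp_add[symmetric] by (simp add: algebra_simps)
      finally have "norm (s N \<xi>) \<le> norm (gauss (\<lambda>b. (q/2) * nb b) \<xi>)"
        unfolding se gauss_quad norm_of_real abs_mult by simp
      then show "norm (s N \<xi> * W (Lam \<xi>) F z) \<le> norm (gauss (\<lambda>b. (q/2) * nb b) \<xi>) * C"
        unfolding norm_mult by (intro mult_mono C) auto
    qed
    show "(\<lambda>\<xi>. s N \<xi> * W (Lam \<xi>) F z) \<in> borel_measurable lborel" for N using poly_gauss_measurable[OF s] by measurable
  qed measurable
  then show ?thesis unfolding sz T_def using LIMSEQ_unique tendsto_const by blast
qed

text \<open>\<open>nb b / 2\<close> is the stationary point of the Riccati equation and the limit of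
  \<open>ha t b\<close> for large \<open>t\<close>. At this weight the kernel satisfies the first
  order equation \<open>\<delta> (X i) + \<i> \<delta> (Y i) = 0\<close>, so every average with it
  is annihilated by all \<open>an i\<close>.\<close>

lemma ground_projection:
  assumes F: "F \<in> S" shows "G (gauss (\<lambda>b. (1/2) * nb b)) F \<in> L.Ker 0"
proof -
  let ?a = "\<lambda>b. (1/2) * nb b"
  have a: "?a b > 0" if "b \<in> Basis" for b using nb_pos[OF that] by simp
  obtain C where C: "\<And>z. norm (F z) \<le> C" using S_bounded[OF F] by blast
  have qp: "quasi_periodic F" using F by (simp add: S_def)
  note pg = poly_gauss.gauss[of ?a]
  have in_S: "G (gauss ?a) F \<in> S" by (rule G_in[OF pg a S_measurable[OF F] C qp])
  have "an i (G (gauss ?a) F) z = 0" if i: "i \<in> I" for i z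
  proof -
    have 1: "?a (dx i) = \<nu> i / 2" "?a (dy i) = \<nu> i / 2" using nb_frame[OF i] by auto
    have int: "integrable lborel (\<lambda>\<xi>. \<delta> w (gauss ?a) \<xi> * W (Lam \<xi>) F z)" for w
      by (rule moments_integrable_W[OF poly_gauss_moments[OF \<delta>_poly_gauss[OF pg] a] S_measurable[OF F] C])
    have "nabla (X i) (G (gauss ?a) F) z + \<i> * nabla (Y i) (G (gauss ?a) F) z = G (\<delta> (X i) (gauss ?a)) F z + \<i> * G (\<delta> (Y i) (gauss ?a)) F z"
      by (simp only: nabla_G[OF pg a S_measurable[OF F] C])
    also have "\<dots> = (\<integral>\<xi>. \<delta> (X i) (gauss ?a) \<xi> * W (Lam \<xi>) F z + \<i> * (\<delta> (Y i) (gauss ?a) \<xi> * W (Lam \<xi>) F z) \<partial>lborel)"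
      unfolding T_def using int by simp
    also have "\<dots> = 0"
    proof -
      have "\<delta> (X i) (gauss ?a) \<xi> * W (Lam \<xi>) F z + \<i> * (\<delta> (Y i) (gauss ?a) \<xi> * W (Lam \<xi>) F z) = 0" for \<xi>
        unfolding \<delta>_gauss[OF i 1] by (simp add: algebra_simps)
      then show ?thesis by simp
    qed
    finally show ?thesis by (simp add: an_apply)
  qed
  then show ?thesis using in_S by (auto simp: L.Ker_zero_iff)
qed

text \<open>If all averages of \<open>F\<close> against the ground state Gaussian vanish, so do those against all narrower Gaussians
  (\<open>gauss_widen\<close>), which form an approximate identity.\<close>

lemma S_trivial:
  assumes "L.Ker 0 = {0}" and F: "F \<in> S" shows "F = 0"
proof
  fix z
  \<comment> \<open>The sequence starts at the weight of the ground state, and each step is the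
    factor permitted by \<open>gauss_widen\<close>.\<close>
  define q where "q n = (1/2) * (3/2::real) ^ n" for n :: nat
  have q: "q n > 0" for n by (simp add: q_def)
  have zero: "G (gauss (\<lambda>b. q n * nb b)) F z = 0" if "F \<in> S" for n F z
    using that
  proof (induction n arbitrary: F z)
    case 0
    then show ?case using ground_projection[OF 0] assms(1) by (simp add: q_def)
  next
    case (Suc n)
    have "q (Suc n) = 3/2 * q n" by (simp add: q_def)
    then show ?case using gauss_widen[OF q[of n] Suc.IH Suc.prems, of z] by (simp only: )
  qed
  have lim: "filterlim q at_top sequentially"
  proof -
    have "filterlim (\<lambda>n. (3/2::real) ^ n) at_top sequentially"
      by (rule filterlim_at_infinity_imp_filterlim_at_top[OF filterlim_realpow_sequentially_gt1]) auto
    then show ?thesis unfolding q_def by (rule filterlim_tendsto_pos_mult_at_top[OF tendsto_const, rotated]) simp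
  qed
  obtain C where C: "\<And>v. norm (W v F z) \<le> C" using norm_W_bound[OF F] by blast
  have "W 0 F z = 0"
  proof (rule gauss_approximate_identity[where h = "\<lambda>v. W v F z", OF _ C _ q lim])
    show "(\<lambda>v. W v F z) \<in> borel_measurable borel" by (rule borel_measurable_continuous_onI[OF continuous_W[OF F]])
    show "isCont (\<lambda>v. W v F z) 0" using continuous_W[OF F] by (simp add: continuous_on_eq_continuous_at)
    show "(\<integral>\<xi>. gauss (\<lambda>b. q n * nb b) \<xi> * W (Lam \<xi>) F z \<partial>lborel) = 0" for n
      using zero[OF F] unfolding T_def .
  qed
  then show "F z = 0 z" by (simp add: W_def E.zero_right)
qed

lemma countable_U: "countable U"
proof -
  have "U = (\<Union>n::nat. {u \<in> U. norm u \<le> real n})" using real_arch_simple by auto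
  then show ?thesis
    by (rule ssubst) (intro countable_UN countable_finite finite_U_bounded countableI_type)
qed

text \<open>A discontinuous quasi-periodic function is easily written down, and averaging makes it
  smooth. If all averages with narrow Gaussians vanished, the function would vanish at its points of
  continuity.\<close>

lemma S_nonzero: "\<exists>F\<in>S. F \<noteq> 0"
proof (rule ccontr)
  assume "\<not> ?thesis"
  then have S0: "\<And>F. F \<in> S \<Longrightarrow> F = 0" by auto
  \<comment> \<open>The constant \<open>\<alpha> 0\<close> on the basic cell, continued to the other
    cells by the multipliers. It is bounded and measurable, but in general jumps between
    cells.\<close>
  define F where "F z = \<alpha> (lattice_floor z) * cis (pi * E z (lattice_floor z))" for z
  have fl [measurable]: "lattice_floor \<in> borel_measurable borel"
    unfolding lattice_floor_def[abs_def] by measurable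
  have "lattice_floor \<in> borel \<rightarrow>\<^sub>M count_space U"
    unfolding measurable_count_space_eq_countable[OF countable_U]
  proof (intro conjI ballI)
    fix u show "lattice_floor -` {u} \<inter> space borel \<in> sets borel"
      using measurable_sets[OF fl, of "{u}"] by simp
  qed (auto simp: lattice_floor_U)
  then have Fm: "F \<in> borel_measurable borel"
    unfolding F_def[abs_def]
    by (rule measurable_compose_countable'[OF _ _ countable_U, where f = "\<lambda>u z. \<alpha> u * cis (pi * E z u)", rotated]) measurable
  have Fb: "norm (F z) \<le> 1" for z by (simp add: F_def norm_mult norm_\<alpha> lattice_floor_U)
  have qp: "quasi_periodic F" unfolding quasi_periodic_def
  proof (intro ballI allI)
    fix u z assume u: "u \<in> U"
    let ?l = "lattice_floor z"
    have "F (z + u) = \<alpha> ?l * \<alpha> u * (cis (pi * E ?l u) * cis (pi * E (z + u) (?l + u)))"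
      unfolding F_def lattice_floor_add[OF u] \<alpha>_add[OF lattice_floor_U u] by simp
    also have "cis (pi * E ?l u) * cis (pi * E (z + u) (?l + u)) = cis (pi * E z u) * cis (pi * E z ?l)"
      unfolding cis_mult using skew[of u ?l] alternating[of u] by (intro arg_cong[of _ _ cis]) (simp add: E.add_left E.add_right algebra_simps)
    finally show "F (z + u) = \<alpha> u * cis (pi * E z u) * F z" by (simp add: F_def)
  qed
  \<comment> \<open>A point in the interior of the basic cell, around which \<open>F\<close> is
    constant; this gives the continuity at zero demanded by the approximate identity.\<close>
  obtain z0 r where r: "r > 0" "ball z0 r \<subseteq> cell 0"
    using interior_cell[of "(1/2) *\<^sub>R (\<Sum>b\<in>B. b)"] by auto
  have fl0: "lattice_floor z = 0" if "z \<in> ball z0 r" for z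
  proof (rule crd_eqI)
    fix b assume b: "b \<in> B"
    then have "0 \<le> crd b z" "crd b z < 1" using r(2) that by (auto simp: cell_def subset_iff)
    then have "\<lfloor>crd b z\<rfloor> = 0" by linarith
    then show "crd b (lattice_floor z) = crd b 0" using b by (simp add: crd_lattice_floor)
  qed
  have z0: "z0 \<in> ball z0 r" using r by simp
  have "\<alpha> 0 \<noteq> 0" using norm_\<alpha>[OF U_group(1)] by auto
  define h where "h v = W v F z0" for v
  have "h 0 = 0"
  proof (rule gauss_approximate_identity[where q = "\<lambda>n. real (Suc n)" and C = 1])
    show "h \<in> borel_measurable borel" unfolding h_def[abs_def] using Fm by measurable
    show "norm (h v) \<le> 1" for v unfolding h_def norm_W by (rule Fb)
    have "eventually (\<lambda>v. z0 + v \<in> ball z0 r) (nhds 0)"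
      using r(1) unfolding eventually_nhds_metric by (auto simp: dist_norm intro!: exI[of _ r])
    then have ev: "eventually (\<lambda>v. h v = cis (pi * E z0 v) * \<alpha> 0) (nhds 0)"
      by eventually_elim (simp add: h_def W_def F_def fl0 E.zero_right)
    have "isCont (\<lambda>v. cis (pi * E z0 v) * \<alpha> 0) 0"
    proof -
      have "continuous_on UNIV (\<lambda>v. cis (pi * E z0 v) * \<alpha> 0)"
        by (intro continuous_intros E.continuous_on continuous_on_compose2[OF continuous_on_cis[OF continuous_on_id], of UNIV]) auto
      then show ?thesis by (simp add: continuous_on_eq_continuous_at)
    qed
    then show "isCont h 0" using isCont_cong[OF ev] by simp
    show "filterlim (\<lambda>n. real (Suc n)) at_top sequentially"
      by (rule filterlim_compose[OF filterlim_real_sequentially filterlim_Suc])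
    fix n
    have a: "real (Suc n) * nb b > 0" if "b \<in> Basis" for b using nb_pos[OF that] by simp
    have "G (gauss (\<lambda>b. real (Suc n) * nb b)) F \<in> S"
      by (rule G_in[OF poly_gauss.gauss a Fm Fb qp])
    from S0[OF this] have "G (gauss (\<lambda>b. real (Suc n) * nb b)) F z0 = 0" by simp
    then show "(\<integral>\<xi>. gauss (\<lambda>b. real (Suc n) * nb b) \<xi> * h (Lam \<xi>) \<partial>lborel) = 0" unfolding T_def h_def .
  qed simp
  then show False using \<open>\<alpha> 0 \<noteq> 0\<close> fl0[OF z0] by (simp add: h_def W_def F_def E.zero_right)
qed

theorem ground_state_exists: "\<exists>F\<in>L.Ker 0. F \<noteq> 0"
proof (rule ccontr)
  assume "\<not> ?thesis"
  moreover have "0 \<in> L.Ker 0" by (rule fun_space.subspace_0[OF L.Ker_subspace])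
  ultimately have "L.Ker 0 = {0}" by blast
  then show False using S_trivial S_nonzero by blast
qed

end

section \<open>Finite dimensionality of the space of ground states\<close>

text \<open>Bases as indexed families: a basis can be transported along a linear map or assembled
  over a product index set, and counting reduces to the index set. Distinctness of the vectors
  follows from independence.\<close>

definition fam_basis :: "('a::field \<Rightarrow> 'b::ab_group_add \<Rightarrow> 'b) \<Rightarrow> 'i set \<Rightarrow> ('i \<Rightarrow> 'b) \<Rightarrow> 'b set \<Rightarrow> bool" where
  "fam_basis sc J v V \<longleftrightarrow> finite J \<and> V = {\<Sum>j\<in>J. sc (c j) (v j) | c. True} \<and>
     (\<forall>c. (\<Sum>j\<in>J. sc (c j) (v j)) = 0 \<longrightarrow> (\<forall>j\<in>J. c j = 0))"

context vector_space
begin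

lemma fam_basis_inj: assumes "fam_basis scale J v V" shows "inj_on v J"
proof (rule inj_onI, rule ccontr)
  fix i j assume ij: "i \<in> J" "j \<in> J" "v i = v j" "i \<noteq> j"
  define c where "c = (\<lambda>k. if k = i then 1 else if k = j then -1 else 0 :: 'a)"
  have fin: "finite J" using assms by (simp add: fam_basis_def)
  have "(\<Sum>k\<in>J. scale (c k) (v k)) = (\<Sum>k\<in>J. (if k = i then v i else 0) - (if k = j then v j else 0))"
    using ij by (intro sum.cong) (auto simp: c_def)
  also have "\<dots> = 0" using fin ij by (simp add: sum_subtractf)
  finally have "c i = 0" using assms ij unfolding fam_basis_def by blast
  then show False by (simp add: c_def)
qed

lemma fam_basis_image:
  assumes "fam_basis scale J v V"
  shows "finite (v ` J)" "card (v ` J) = card J" "\<not> module.dependent scale (v ` J)" "module.span scale (v ` J) = V"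
proof -
  have fin: "finite J" and ind: "\<And>c j. (\<Sum>j\<in>J. scale (c j) (v j)) = 0 \<Longrightarrow> j \<in> J \<Longrightarrow> c j = 0"
    and V: "V = {\<Sum>j\<in>J. scale (c j) (v j) | c. True}" using assms unfolding fam_basis_def by blast+
  note inj = fam_basis_inj[OF assms]
  show finv: "finite (v ` J)" and "card (v ` J) = card J" using fin inj by (auto intro: card_image)
  have sum: "(\<Sum>x\<in>v ` J. scale (u x) x) = (\<Sum>j\<in>J. scale (u (v j)) (v j))" for u
    by (simp add: sum.reindex[OF inj])
  show "\<not> module.dependent scale (v ` J)"
  proof
    assume "module.dependent scale (v ` J)"
    then obtain u x where u: "x \<in> v ` J" "u x \<noteq> 0" "(\<Sum>x\<in>v ` J. scale (u x) x) = 0"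
      unfolding dependent_finite[OF finv] by blast
    then obtain j where "j \<in> J" "x = v j" by blast
    then show False using ind[of "\<lambda>j. u (v j)" j] u sum by simp
  qed
  show "module.span scale (v ` J) = V"
  proof
    show "module.span scale (v ` J) \<subseteq> V" unfolding span_finite[OF finv] V sum by auto
    show "V \<subseteq> module.span scale (v ` J)" unfolding V by (clarify, intro span_sum span_scale span_base imageI)
  qed
qed

lemma fam_basis_unique:
  assumes "fam_basis scale J v V" "fam_basis scale K w V" shows "card J = card K"
  using fam_basis_image[OF assms(1)] fam_basis_image[OF assms(2)] dim_span_eq_card_independent by metis

lemma fam_basis_of_independent:
  assumes "finite Bs" "\<not> module.dependent scale Bs" "module.span scale Bs = V"
  shows "fam_basis scale Bs (\<lambda>x. x) V"
  using assms(2) unfolding fam_basis_def assms(3)[symmetric] span_finite[OF assms(1)] dependent_finite[OF assms(1)]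
  using assms(1) by auto

lemma fam_basis_reindex:
  assumes "fam_basis scale J v V" "bij_betw f K J"
  shows "fam_basis scale K (\<lambda>k. v (f k)) V"
proof -
  have inj: "inj_on f K" and im: "f ` K = J" using assms(2) by (auto simp: bij_betw_def)
  have fin: "finite K" using assms bij_betw_finite unfolding fam_basis_def by blast
  have sum: "(\<Sum>k\<in>K. scale (c (f k)) (v (f k))) = (\<Sum>j\<in>J. scale (c j) (v j))" for c
    using sum.reindex[OF inj, of "\<lambda>j. scale (c j) (v j)"] im by simp
  define g where "g = the_inv_into K f"
  have g: "g (f k) = k" if "k \<in> K" for k using the_inv_into_f_f[OF inj that] by (simp add: g_def)
  have sum': "(\<Sum>k\<in>K. scale (c k) (v (f k))) = (\<Sum>j\<in>J. scale (c (g j)) (v j))" for c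
    using sum[of "\<lambda>j. c (g j)"] g by (simp cong: sum.cong)
  have V: "V = {\<Sum>j\<in>J. scale (c j) (v j) | c. True}" and ind: "\<And>c. (\<Sum>j\<in>J. scale (c j) (v j)) = 0 \<Longrightarrow> \<forall>j\<in>J. c j = 0"
    using assms(1) unfolding fam_basis_def by blast+
  show ?thesis unfolding fam_basis_def
  proof (intro conjI fin allI impI)
    show "V = {\<Sum>k\<in>K. scale (c k) (v (f k)) |c. True}"
    proof safe
      fix x assume "x \<in> V"
      then obtain c where "x = (\<Sum>j\<in>J. scale (c j) (v j))" using V by blast
      then show "\<exists>c. x = (\<Sum>k\<in>K. scale (c k) (v (f k))) \<and> True" using sum[of c] by (intro exI[of _ "\<lambda>k. c (f k)"]) simp
    next
      fix c show "(\<Sum>k\<in>K. scale (c k) (v (f k))) \<in> V" unfolding sum' V by (intro CollectI exI[of _ "\<lambda>j. c (g j)"] conjI refl TrueI)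
    qed
    fix c assume "(\<Sum>k\<in>K. scale (c k) (v (f k))) = 0"
    then have "\<forall>j\<in>J. c (g j) = 0" using ind[of "\<lambda>j. c (g j)"] unfolding sum' by blast
    then show "\<forall>k\<in>K. c k = 0" using g im by force
  qed
qed

end

text \<open>Restriction to \<open>P\<close> is injective on \<open>V\<close> and maps into the
  functions supported on \<open>P\<close>, which finitely many indicator functions span.\<close>

lemma separating_points_fam_basis:
  fixes V :: "('x \<Rightarrow> complex) set"
  assumes V: "fun_space.subspace V" and P: "finite P" "\<And>f. f \<in> V \<Longrightarrow> (\<And>p. p \<in> P \<Longrightarrow> f p = 0) \<Longrightarrow> f = 0"
  shows "\<exists>d v. fam_basis fscale {..<d::nat} v V"
proof -
  interpret fs: vector_space_pair "fscale :: complex \<Rightarrow> ('x \<Rightarrow> complex) \<Rightarrow> _" "fscale :: complex \<Rightarrow> ('x \<Rightarrow> complex) \<Rightarrow> _" ..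
  obtain Bs where Bs: "Bs \<subseteq> V" "fun_space.independent Bs" "V \<subseteq> fun_space.span Bs"
    using fun_space.maximal_independent_subset by blast
  have span: "fun_space.span Bs = V" using Bs V by (metis fun_space.span_minimal subset_antisym)
  define r :: "('x \<Rightarrow> complex) \<Rightarrow> 'x \<Rightarrow> complex" where "r f = (\<lambda>x. if x \<in> P then f x else 0)" for f
  have lin: "Vector_Spaces.linear fscale fscale r"
    by unfold_locales (auto simp: r_def fscale_def fun_eq_iff)
  have "inj_on r (fun_space.span Bs)"
    unfolding span
  proof (rule inj_onI)
    fix f g assume fg: "f \<in> V" "g \<in> V" "r f = r g"
    have "f - g = 0"
    proof (rule P(2))
      show "f - g \<in> V" using fun_space.subspace_diff[OF V] fg by blast
      fix p assume "p \<in> P" then show "(f - g) p = 0" using fun_cong[OF fg(3), of p] by (simp add: r_def)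
    qed
    then show "f = g" by simp
  qed
  then have ind: "fun_space.independent (r ` Bs)" and inj: "inj_on r Bs"
    using fs.linear_independent_injective_image[OF lin Bs(2)] inj_on_subset[OF _ fun_space.span_superset] by auto
  define T where "T = (\<lambda>p x. if x = p then 1 else 0 :: complex) ` P"
  have "r f \<in> fun_space.span T" for f
  proof -
    have "r f = (\<Sum>p\<in>P. fscale (f p) (\<lambda>x. if x = p then 1 else 0))"
      using P(1) by (auto simp: fun_eq_iff r_def fscale_def sum_fun_apply if_distrib cong: if_cong)
    then show ?thesis by (simp only:) (intro fun_space.span_sum fun_space.span_scale fun_space.span_base, simp add: T_def)
  qed
  then have "finite (r ` Bs)"
    using fun_space.independent_span_bound[of T "r ` Bs"] ind P(1) by (auto simp: T_def)
  then have fin: "finite Bs" using inj finite_imageD by blast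
  obtain f where "bij_betw f {..<card Bs} Bs" using ex_bij_betw_nat_finite[OF fin] by (auto simp: atLeast0LessThan)
  then show ?thesis
    using fun_space.fam_basis_reindex[OF fun_space.fam_basis_of_independent[OF fin Bs(2) span]] by blast
qed

context magnetic_frame
begin

lemma W_has_derivative_translation:
  assumes "F \<in> S"
  shows "((\<lambda>v. W v F z) has_derivative (\<lambda>w. W v (nabla w F) z - \<i> * of_real (pi * E v w) * W v F z)) (at v)"
proof -
  have "((\<lambda>v. z + v) has_derivative (\<lambda>w. w)) (at v)" by (auto intro!: derivative_eq_intros)
  then have F: "((\<lambda>v. F (z + v)) has_derivative (\<lambda>w. dird w F (z + v))) (at v)"
    using has_derivative_compose[of "\<lambda>v. z + v" "\<lambda>w. w" v UNIV F, OF _ differentiable_has_derivative_dird[OF S_differentiable[OF assms]]] by blast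
  have "((\<lambda>v. \<i> * complex_of_real (pi * E z v)) has_derivative (\<lambda>w. \<i> * complex_of_real (pi * E z w))) (at v)"
    by (intro bounded_linear_imp_has_derivative bounded_linear_compose[OF bounded_linear_mult_right] bounded_linear_compose[OF bounded_linear_of_real] bounded_linear_const_mult E.bounded_linear_right)
  from has_derivative_compose[OF this DERIV_exp[unfolded has_field_derivative_def]]
  have c: "((\<lambda>v. cis (pi * E z v)) has_derivative (\<lambda>w. cis (pi * E z v) * (\<i> * of_real (pi * E z w)))) (at v)"
    by (simp add: cis_conv_exp)
  show ?thesis unfolding W_def
    by (rule has_derivative_eq_rhs[OF has_derivative_mult[OF c F]])
       (simp add: fun_eq_iff nabla_def E.add_left algebra_simps)
qed

text \<open>A ground state is, up to a Gaussian factor, holomorphic on the complex line spanned by \<open>X i\<close> and \<open>Y i\<close>,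
  so Cauchy's estimate applies.\<close>

lemma ground_state_derivative_bound:
  assumes F: "F \<in> L.Ker 0" and i: "i \<in> I" and M: "\<And>z. norm (F z) \<le> M"
  shows "norm (nabla (X i) F z) \<le> exp (\<nu> i / 2) * M" "norm (nabla (Y i) F z) \<le> exp (\<nu> i / 2) * M"
proof -
  have FS: "F \<in> S" and an0: "an i F = 0" using F i by (auto simp: L.Ker_zero_iff)
  have Y: "nabla (Y i) F z = \<i> * nabla (X i) F z" for z
  proof -
    have "nabla (X i) F z + \<i> * nabla (Y i) F z = 0" using fun_cong[OF an0, of z] by (simp add: an_apply)
    then have "\<i> * (nabla (X i) F z + \<i> * nabla (Y i) F z) = 0" by simp
    then show ?thesis by (simp add: algebra_simps)
  qed
  define v where "v \<zeta> = Re \<zeta> *\<^sub>R X i + Im \<zeta> *\<^sub>R Y i" for \<zeta>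
  \<comment> \<open>This Gaussian contributes the real part of
    \<open>\<nu> i * cnj \<zeta> * s\<close> to the derivative along \<open>s\<close>, the magnetic
    phase the imaginary part. Their sum is complex linear in \<open>s\<close>, which makes the
    product holomorphic.\<close>
  define e where "e \<zeta> = complex_of_real (exp (\<nu> i / 2 * ((Re \<zeta>)\<^sup>2 + (Im \<zeta>)\<^sup>2)))" for \<zeta>
  define \<phi> where "\<phi> \<zeta> = e \<zeta> * W (v \<zeta>) F z" for \<zeta>
  have der: "(\<phi> has_field_derivative e \<zeta> * (W (v \<zeta>) (nabla (X i) F) z + of_real (\<nu> i) * cnj \<zeta> * W (v \<zeta>) F z)) (at \<zeta>)" for \<zeta>
  proof -
    have dv: "(v has_derivative v) (at \<zeta>)" unfolding v_def
      by (auto intro!: derivative_eq_intros)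
    have "((\<lambda>\<zeta>. exp (\<nu> i / 2 * ((Re \<zeta>)\<^sup>2 + (Im \<zeta>)\<^sup>2))) has_derivative (\<lambda>s. exp (\<nu> i / 2 * ((Re \<zeta>)\<^sup>2 + (Im \<zeta>)\<^sup>2)) * (\<nu> i * (Re \<zeta> * Re s + Im \<zeta> * Im s)))) (at \<zeta>)"
      by (auto intro!: derivative_eq_intros simp: algebra_simps)
    from bounded_linear.has_derivative[OF bounded_linear_of_real[where 'a=complex] this]
    have de: "(e has_derivative (\<lambda>s. e \<zeta> * of_real (\<nu> i * (Re \<zeta> * Re s + Im \<zeta> * Im s)))) (at \<zeta>)" unfolding e_def by simp
    have "W (v \<zeta>) (nabla (v s) F) z = s * W (v \<zeta>) (nabla (X i) F) z" for s
    proof -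
      have "nabla (v s) F y = s * nabla (X i) F y" for y
        unfolding v_def nabla_linear[OF FS] Y by (subst (3) complex_eq[of s]) (simp add: scaleR_conv_of_real algebra_simps)
      then show ?thesis by (simp add: W_def)
    qed
    moreover have "E (v \<zeta>) (v s) = - \<nu> i / pi * (Re \<zeta> * Im s - Im \<zeta> * Re s)" for s
      unfolding v_def by (simp add: E.add_left E.add_right E.scaleR_left E.scaleR_right E_XX E_YY E_XY E_YX i field_simps)
    ultimately have dW: "((\<lambda>\<zeta>. W (v \<zeta>) F z) has_derivative (\<lambda>s. s * W (v \<zeta>) (nabla (X i) F) z + \<i> * of_real (\<nu> i * (Re \<zeta> * Im s - Im \<zeta> * Re s)) * W (v \<zeta>) F z)) (at \<zeta>)"
      using has_derivative_compose[OF dv W_has_derivative_translation[OF FS, of z "v \<zeta>"]] by simp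
    have cz: "of_real (\<nu> i * (Re \<zeta> * Re s + Im \<zeta> * Im s)) + \<i> * of_real (\<nu> i * (Re \<zeta> * Im s - Im \<zeta> * Re s)) = of_real (\<nu> i) * cnj \<zeta> * s" for s
      by (simp add: complex_eq_iff algebra_simps)
    show ?thesis unfolding has_field_derivative_def \<phi>_def
    proof (rule has_derivative_eq_rhs[OF has_derivative_mult[OF de dW]], rule ext)
      fix s
      have "e \<zeta> * (s * W (v \<zeta>) (nabla (X i) F) z + \<i> * of_real (\<nu> i * (Re \<zeta> * Im s - Im \<zeta> * Re s)) * W (v \<zeta>) F z) + e \<zeta> * of_real (\<nu> i * (Re \<zeta> * Re s + Im \<zeta> * Im s)) * W (v \<zeta>) F z
        = e \<zeta> * (s * W (v \<zeta>) (nabla (X i) F) z + (of_real (\<nu> i * (Re \<zeta> * Re s + Im \<zeta> * Im s)) + \<i> * of_real (\<nu> i * (Re \<zeta> * Im s - Im \<zeta> * Re s))) * W (v \<zeta>) F z)"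
        by (simp only: distrib_left distrib_right mult_ac add_ac)
      also have "\<dots> = e \<zeta> * (W (v \<zeta>) (nabla (X i) F) z + of_real (\<nu> i) * cnj \<zeta> * W (v \<zeta>) F z) * s"
        unfolding cz by (simp add: algebra_simps)
      finally show "e \<zeta> * (s * W (v \<zeta>) (nabla (X i) F) z + \<i> * of_real (\<nu> i * (Re \<zeta> * Im s - Im \<zeta> * Re s)) * W (v \<zeta>) F z) + e \<zeta> * of_real (\<nu> i * (Re \<zeta> * Re s + Im \<zeta> * Im s)) * W (v \<zeta>) F z
        = e \<zeta> * (W (v \<zeta>) (nabla (X i) F) z + of_real (\<nu> i) * cnj \<zeta> * W (v \<zeta>) F z) * s" .
    qed
  qed
  have hol: "\<phi> holomorphic_on A" for A unfolding holomorphic_on_def field_differentiable_def using has_field_derivative_at_within[OF der] by blast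
  \<comment> \<open>Cauchy's estimate on the unit circle, where the Gaussian factor is constantly
    \<open>exp (\<nu> i / 2)\<close>.\<close>
  have "norm ((deriv ^^ 1) \<phi> 0) \<le> fact 1 * (exp (\<nu> i / 2) * M) / 1 ^ 1"
  proof (rule Cauchy_inequality[OF hol holomorphic_on_imp_continuous_on[OF hol]])
    fix \<zeta> :: complex assume "norm (0 - \<zeta>) = 1"
    then have "(Re \<zeta>)\<^sup>2 + (Im \<zeta>)\<^sup>2 = 1" using cmod_power2[of \<zeta>] by simp
    then show "norm (\<phi> \<zeta>) \<le> exp (\<nu> i / 2) * M" unfolding \<phi>_def e_def using M by (simp add: norm_mult norm_W)
  qed simp
  moreover have "deriv \<phi> 0 = nabla (X i) F z"
    using DERIV_imp_deriv[OF der[of 0]] by (simp add: e_def v_def W_def E.zero_right)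
  ultimately show "norm (nabla (X i) F z) \<le> exp (\<nu> i / 2) * M" by simp
  then show "norm (nabla (Y i) F z) \<le> exp (\<nu> i / 2) * M" unfolding Y by (simp add: norm_mult)
qed

text \<open>The constant is the same for all ground states, so that a single net of points can serve
  for the whole space.\<close>

lemma ground_state_nabla_bound:
  "\<exists>C\<ge>0. \<forall>F\<in>L.Ker 0. \<forall>M. (\<forall>z. norm (F z) \<le> M) \<longrightarrow> (\<forall>w z. norm (nabla w F z) \<le> C * M * norm w)"
proof -
  obtain L' where L': "L' > 0" "\<And>\<xi>. norm (Lam' \<xi>) \<le> L' * norm \<xi>" using Lam'_bound by blast
  define C where "C = (\<Sum>i\<in>I. 2 * exp (\<nu> i / 2)) * L'"
  have "norm (nabla w F z) \<le> C * M * norm w" if F: "F \<in> L.Ker 0" and M: "\<forall>z. norm (F z) \<le> M" for F M w z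
  proof -
    have FS: "F \<in> S" using F by (simp add: L.Ker_def)
    have M0: "M \<ge> 0" using M norm_ge_zero order_trans by blast
    let ?x = "Lam' w"
    have "nabla w F z = nabla (Lam ?x) F z" by (simp add: Lam_Lam')
    also have "\<dots> = (\<Sum>i\<in>I. (?x \<bullet> dx i) *\<^sub>R nabla (X i) F z + (?x \<bullet> dy i) *\<^sub>R nabla (Y i) F z)"
      unfolding Lam_def nabla_sum[OF FS finite_I] nabla_linear[OF FS] ..
    finally have "norm (nabla w F z) \<le> (\<Sum>i\<in>I. norm ((?x \<bullet> dx i) *\<^sub>R nabla (X i) F z + (?x \<bullet> dy i) *\<^sub>R nabla (Y i) F z))"
      by (simp only: norm_sum)
    also have "\<dots> \<le> (\<Sum>i\<in>I. norm ?x * (exp (\<nu> i / 2) * M) + norm ?x * (exp (\<nu> i / 2) * M))"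
    proof (intro sum_mono order_trans[OF norm_triangle_ineq] add_mono)
      fix i assume i: "i \<in> I"
      show "norm ((?x \<bullet> dx i) *\<^sub>R nabla (X i) F z) \<le> norm ?x * (exp (\<nu> i / 2) * M)" "norm ((?x \<bullet> dy i) *\<^sub>R nabla (Y i) F z) \<le> norm ?x * (exp (\<nu> i / 2) * M)"
        unfolding norm_scaleR using Basis_le_norm[OF Basis_frame(1)[OF i], of ?x] Basis_le_norm[OF Basis_frame(2)[OF i], of ?x] ground_state_derivative_bound[OF F i, of M z] M
        by (intro mult_mono; simp)+
    qed
    also have "\<dots> = (\<Sum>i\<in>I. 2 * exp (\<nu> i / 2)) * M * norm ?x" unfolding sum_distrib_right by (intro sum.cong refl) (simp add: algebra_simps)
    also have "\<dots> \<le> (\<Sum>i\<in>I. 2 * exp (\<nu> i / 2)) * M * (L' * norm w)" using M0 by (intro mult_left_mono L') (auto intro!: mult_nonneg_nonneg sum_nonneg)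
    finally show ?thesis by (simp add: C_def mult_ac)
  qed
  moreover have "C \<ge> 0" unfolding C_def using L'(1) by (auto intro!: mult_nonneg_nonneg sum_nonneg)
  ultimately show ?thesis by blast
qed

text \<open>By the derivative bound, a ground state that vanishes on a sufficiently fine net of the fundamental cell
  has sup norm at most half its sup norm.\<close>

lemma ground_state_separating_points:
  "\<exists>P. finite P \<and> (\<forall>F\<in>L.Ker 0. (\<forall>p\<in>P. F p = 0) \<longrightarrow> F = 0)"
proof -
  obtain C where C: "C \<ge> 0" "\<And>F M w z. F \<in> L.Ker 0 \<Longrightarrow> (\<And>z. norm (F z) \<le> M) \<Longrightarrow> norm (nabla w F z) \<le> C * M * norm w"
    using ground_state_nabla_bound by blast
  obtain K where K: "K \<ge> 0" "\<And>v w. \<bar>E v w\<bar> \<le> K * norm v * norm w" using E_bound by blast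
  have "bounded (closure (cell 0))" using bounded_cell by (rule bounded_closure)
  \<comment> \<open>A ball around the cell, because the mean value inequality needs a convex
    set.\<close>
  then obtain R where R: "R > 0" "closure (cell 0) \<subseteq> ball 0 R" using bounded_subset_ballD by blast
  \<comment> \<open>Bounds the ordinary derivative on that ball: the covariant bound plus the
    connection term.\<close>
  define C' where "C' = C + pi * K * R"
  have C': "C' \<ge> 0" using C(1) K(1) R(1) by (simp add: C'_def)
  have cpt: "compact (closure (cell 0))" using bounded_cell by simp
  \<comment> \<open>The mesh is chosen such that \<open>C' * eps \<le> 1/2\<close>; adding
    \<open>1\<close> covers \<open>C' = 0\<close>.\<close>
  define eps where "eps = 1 / (2 * (C' + 1))"
  have "eps > 0" unfolding eps_def using C' by (intro divide_pos_pos) auto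
  then have "closure (cell 0) \<subseteq> (\<Union>p\<in>closure (cell 0). ball p eps)" by auto
  from compactE_image[OF cpt open_ball this]
  obtain P where P0: "P \<subseteq> closure (cell 0)" "finite P" "closure (cell 0) \<subseteq> (\<Union>p\<in>P. ball p eps)" .
  note P = P0(2,1) P0(3)[unfolded eps_def]
  have "F = 0" if F: "F \<in> L.Ker 0" and F0: "\<And>p. p \<in> P \<Longrightarrow> F p = 0" for F
  proof -
    have FS: "F \<in> S" using F by (simp add: L.Ker_def)
    have step: "norm (F z) \<le> M / 2" if M: "\<And>z. norm (F z) \<le> M" for M z
    proof -
      have M0: "M \<ge> 0" using M norm_ge_zero order_trans by blast
      obtain u where u: "u \<in> U" "z - u \<in> cell 0" using fundamental_domain_cell[of 0] unfolding fundamental_domain_def by blast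
      let ?z = "z - u"
      have nz: "norm (F z) = norm (F ?z)"
      proof -
        have "F (?z + u) = \<alpha> u * cis (pi * E ?z u) * F ?z" using FS u(1) unfolding S_def quasi_periodic_def by blast
        then show ?thesis by (simp add: norm_mult norm_\<alpha>[OF u(1)])
      qed
      have zc: "?z \<in> closure (cell 0)" using u(2) closure_subset by blast
      then obtain p where p: "p \<in> P" "?z \<in> ball p (1 / (2 * (C' + 1)))" using P(3) by blast
      have "norm (F ?z - F p) \<le> (C' * M) * norm (?z - p)"
      proof (rule differentiable_bound[where S = "ball 0 R" and f' = "\<lambda>z w. dird w F z"])
        show "?z \<in> ball 0 R" "p \<in> ball 0 R" using zc R P(2) p(1) by blast+
        fix y assume y: "y \<in> ball (0::'v) R"
        show "(F has_derivative (\<lambda>w. dird w F y)) (at y within ball 0 R)"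
          by (rule has_derivative_at_withinI[OF differentiable_has_derivative_dird[OF S_differentiable[OF FS]]])
        show "onorm (\<lambda>w. dird w F y) \<le> C' * M"
        proof (rule onorm_le)
          fix w
          have "dird w F y = nabla w F y - \<i> * of_real (pi * E y w) * F y" by (simp add: nabla_def)
          then have "norm (dird w F y) \<le> norm (nabla w F y) + pi * \<bar>E y w\<bar> * norm (F y)"
            using norm_triangle_ineq4[of "nabla w F y" "\<i> * of_real (pi * E y w) * F y"] by (simp add: norm_mult abs_mult)
          also have "\<dots> \<le> C * M * norm w + pi * (K * R * norm w) * M"
          proof (intro add_mono mult_mono C(2)[OF F M] M order_refl)
            have "K * norm y * norm w \<le> K * R * norm w" using y K(1) R(1) by (intro mult_mono) auto
            then show "\<bar>E y w\<bar> \<le> K * R * norm w" using K(2)[of y w] by linarith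
          qed (use K(1) R(1) in auto)
          finally show "norm (dird w F y) \<le> C' * M * norm w" by (simp add: C'_def algebra_simps)
        qed
      qed auto
      also have "\<dots> \<le> (C' * M) * (1 / (2 * (C' + 1)))"
        using p(2) C' M0 by (intro mult_left_mono) (auto simp: dist_norm norm_minus_commute less_imp_le)
      also have "\<dots> = (C' / (C' + 1)) * (M / 2)" using C' by (simp add: field_simps)
      also have "\<dots> \<le> 1 * (M / 2)" using C' M0 by (intro mult_right_mono) (auto simp: field_simps)
      finally show ?thesis using F0[OF p(1)] nz by simp
    qed
    obtain M where M: "\<And>z. norm (F z) \<le> M" using S_bounded[OF FS] by blast
    have pow: "norm (F z) \<le> M * (1/2) ^ n" for n z
    proof (induction n arbitrary: z)
      case (Suc n)
      from step[OF Suc.IH, of z] show ?case by simp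
    qed (simp add: M)
    have "norm (F z) \<le> 0" for z
    proof (rule tendsto_lowerbound[of "\<lambda>n. M * (1/2) ^ n" "0::real" sequentially])
      have "(\<lambda>n. M * (1/2) ^ n) \<longlonglongrightarrow> M * 0" by (intro tendsto_mult tendsto_const LIMSEQ_realpow_zero) auto
      then show "(\<lambda>n. M * (1/2) ^ n) \<longlonglongrightarrow> 0" by simp
    qed (auto simp: pow)
    then show ?thesis by (auto simp: fun_eq_iff)
  qed
  then show ?thesis using P(1) by blast
qed

theorem ground_states_fam_basis: "\<exists>d v. d > 0 \<and> fam_basis fscale {..<d::nat} v (L.Ker 0)"
proof -
  obtain P where P: "finite P" "\<And>F. F \<in> L.Ker 0 \<Longrightarrow> (\<And>p. p \<in> P \<Longrightarrow> F p = 0) \<Longrightarrow> F = 0"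
    using ground_state_separating_points by blast
  from separating_points_fam_basis[OF L.Ker_subspace P] obtain d v where dv: "fam_basis fscale {..<d::nat} v (L.Ker 0)" by blast
  obtain F where "F \<in> L.Ker 0" "F \<noteq> 0" using ground_state_exists by blast
  then have "d \<noteq> 0" using dv unfolding fam_basis_def by auto
  then show ?thesis using dv by blast
qed

end

section \<open>The Dolbeault complex over a family of ladder operators\<close>

definition cp :: "'x form \<Rightarrow> nat set \<Rightarrow> 'x \<Rightarrow> complex" where "cp \<psi> J = (\<lambda>x. \<psi> x J)"
definition single :: "nat set \<Rightarrow> ('x \<Rightarrow> complex) \<Rightarrow> 'x form" where "single J f = (\<lambda>x K. if K = J then f x else 0)"
definition sgn_at :: "nat \<Rightarrow> nat set \<Rightarrow> complex" where "sgn_at i J = (-1) ^ card {j\<in>J. j < i}"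

lemma cp_simps [simp]: "cp (\<phi> + \<psi>) J = cp \<phi> J + cp \<psi> J" "cp (\<phi> - \<psi>) J = cp \<phi> J - cp \<psi> J" "cp 0 J = 0"
  "cp (form_scale c \<psi>) J = fscale c (cp \<psi> J)"
  by (simp_all add: cp_def fun_eq_iff form_scale_def fscale_def)

lemma cp_sum: "cp (\<Sum>i\<in>K. \<psi> i) J = (\<Sum>i\<in>K. cp (\<psi> i) J)"
  by (induction K rule: infinite_finite_induct) (simp_all only: sum.infinite sum.empty sum.insert cp_simps not_False_eq_True)

lemma cp_single: "cp (single J f) K = (if K = J then f else 0)"
  by (auto simp: cp_def single_def fun_eq_iff)

lemma form_eqI: "(\<And>J. cp \<phi> J = cp \<psi> J) \<Longrightarrow> \<phi> = \<psi>"
  by (auto simp: cp_def fun_eq_iff)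

lemma sgn_at_square [simp]: "sgn_at i J * sgn_at i J = 1"
  by (simp add: sgn_at_def power_add[symmetric] mult_2[symmetric])

lemma sgn_at_self: "sgn_at i (J - {i}) = sgn_at i J" "sgn_at i (insert i J) = sgn_at i J"
proof -
  have "{j \<in> J - {i}. j < i} = {j \<in> J. j < i}" "{j \<in> insert i J. j < i} = {j \<in> J. j < i}" by auto
  then show "sgn_at i (J - {i}) = sgn_at i J" "sgn_at i (insert i J) = sgn_at i J" by (simp_all add: sgn_at_def)
qed

lemma sgn_at_insert:
  assumes "finite J" "j \<notin> J" shows "sgn_at i (insert j J) = (if j < i then - sgn_at i J else sgn_at i J)"
proof -
  have "{l \<in> insert j J. l < i} = (if j < i then insert j {l \<in> J. l < i} else {l \<in> J. l < i})" by auto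
  then show ?thesis using assms by (simp add: sgn_at_def)
qed

lemma sgn_at_remove:
  assumes "finite J" "j \<in> J" shows "sgn_at i (J - {j}) = (if j < i then - sgn_at i J else sgn_at i J)"
  using sgn_at_insert[of "J - {j}" j i] assms by (auto simp: insert_absorb)

text \<open>\<open>Hm\<close> is a space of representatives of \<open>W / W'\<close>. An arbitrary
  quotient basis need not lie in \<open>Hm\<close>, but each of its members can be moved there along
  \<open>W'\<close>; the result is a basis of \<open>Hm\<close>, which fixes the
  cardinality.\<close>

lemma quotient_dimension:
  assumes W: "form.subspace W" "form.subspace W'" and H: "Hm \<subseteq> W" and dec: "\<And>w. w \<in> W \<Longrightarrow> \<exists>h\<in>Hm. w - h \<in> W'"
    and int: "\<And>h. h \<in> Hm \<Longrightarrow> h \<in> W' \<Longrightarrow> h = 0" and fb: "fam_basis form_scale K v Hm"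
  shows "(THE d. \<exists>B. finite B \<and> card B = d \<and> quotient_basis W W' B) = card K"
proof (rule the_equality)
  note im = form.fam_basis_image[OF fb]
  have subH: "form.subspace Hm" using im(4) form.subspace_span by metis
  have uniq: "c = c'" if "finite B" "\<And>b. b \<notin> B \<Longrightarrow> c b = 0" "\<And>b. b \<notin> B \<Longrightarrow> c' b = 0"
     "\<not> form.dependent B" "(\<Sum>b\<in>B. form_scale (c b) b) = (\<Sum>b\<in>B. form_scale (c' b) b)" for B :: "'a form set" and c c'
  proof
    fix b
    have z: "(\<Sum>b\<in>B. form_scale (c b - c' b) b) = 0" using that(5) by (simp add: form.scale_left_diff_distrib sum_subtractf)
    have "form.dependent B" if "\<exists>v\<in>B. c v - c' v \<noteq> 0"
      unfolding form.dependent_finite[OF \<open>finite B\<close>] by (rule exI[of _ "\<lambda>b. c b - c' b"]) (intro conjI that z)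
    then have "\<forall>v\<in>B. c v - c' v = 0" using that(4) by blast
    then show "c b = c' b" using that(2,3) by (cases "b \<in> B") auto
  qed
  show "\<exists>B. finite B \<and> card B = card K \<and> quotient_basis W W' B"
  proof (rule exI[of _ "v ` K"], intro conjI im(1) im(2))
    show "quotient_basis W W' (v ` K)" unfolding quotient_basis_def
    proof (intro conjI ballI)
      show "v ` K \<subseteq> W" using H im(4) form.span_superset[of "v ` K"] by auto
      fix w assume "w \<in> W"
      then obtain h where h: "h \<in> Hm" "w - h \<in> W'" using dec by blast
      then have "h \<in> form.span (v ` K)" using im(4) by simp
      then obtain u where u: "h = (\<Sum>b\<in>v ` K. form_scale (u b) b)" unfolding form.span_finite[OF im(1)] by auto
      define c where "c = (\<lambda>b. if b \<in> v ` K then u b else 0)"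
      have hc: "h = (\<Sum>b\<in>v ` K. form_scale (c b) b)" unfolding u by (intro sum.cong) (auto simp: c_def)
      show "\<exists>!c. (\<forall>b. b \<notin> v ` K \<longrightarrow> c b = 0) \<and> w - (\<Sum>b\<in>v ` K. form_scale (c b) b) \<in> W'"
      proof (rule ex1I[of _ c])
        show "(\<forall>b. b \<notin> v ` K \<longrightarrow> c b = 0) \<and> w - (\<Sum>b\<in>v ` K. form_scale (c b) b) \<in> W'" using h hc by (auto simp: c_def)
        fix c' assume c': "(\<forall>b. b \<notin> v ` K \<longrightarrow> c' b = 0) \<and> w - (\<Sum>b\<in>v ` K. form_scale (c' b) b) \<in> W'"
        let ?h' = "\<Sum>b\<in>v ` K. form_scale (c' b) b"
        have h': "?h' \<in> Hm" unfolding im(4)[symmetric] by (intro form.span_sum form.span_scale form.span_base)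
        have "(w - h) - (w - ?h') \<in> W'" using c' h form.subspace_diff[OF W(2)] by blast
        then have "?h' - h \<in> W'" by simp
        then have "?h' - h = 0" using int form.subspace_diff[OF subH h' h(1)] by blast
        then have "?h' = h" by simp
        then show "c' = c" using hc uniq[OF im(1), of c' c] c' im(3) by (auto simp: c_def)
      qed
    qed
  qed
  fix d assume "\<exists>B. finite B \<and> card B = d \<and> quotient_basis W W' B"
  then obtain B where B0: "finite B" "card B = d" "quotient_basis W W' B" by blast
  have B: "finite B" "card B = d" "B \<subseteq> W"
    "\<And>w. w \<in> W \<Longrightarrow> \<exists>!c. (\<forall>b. b \<notin> B \<longrightarrow> c b = 0) \<and> w - (\<Sum>b\<in>B. form_scale (c b) b) \<in> W'"
    using B0 unfolding quotient_basis_def by simp_all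
  have "\<forall>b\<in>B. \<exists>h. h \<in> Hm \<and> b - h \<in> W'" using dec B(3) by blast
  then obtain hp where hp: "\<And>b. b \<in> B \<Longrightarrow> hp b \<in> Hm" "\<And>b. b \<in> B \<Longrightarrow> b - hp b \<in> W'" by metis
  have diff: "(\<Sum>b\<in>B. form_scale (c b) b) - (\<Sum>b\<in>B. form_scale (c b) (hp b)) \<in> W'" for c
    unfolding sum_subtractf[symmetric] form.scale_right_diff_distrib[symmetric]
    by (intro form.subspace_sum[OF W(2)] form.subspace_scale[OF W(2)] hp)
  have "fam_basis form_scale B hp Hm" unfolding fam_basis_def
  proof (intro conjI B(1) allI impI)
    show "Hm = {\<Sum>b\<in>B. form_scale (c b) (hp b) |c. True}"
    proof safe
      fix h assume h: "h \<in> Hm"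
      then obtain c where c: "h - (\<Sum>b\<in>B. form_scale (c b) b) \<in> W'" using B(4)[of h] H by blast
      have "(h - (\<Sum>b\<in>B. form_scale (c b) b)) + ((\<Sum>b\<in>B. form_scale (c b) b) - (\<Sum>b\<in>B. form_scale (c b) (hp b))) \<in> W'"
        by (rule form.subspace_add[OF W(2) c diff])
      then have "h - (\<Sum>b\<in>B. form_scale (c b) (hp b)) \<in> W'" by simp
      moreover have "h - (\<Sum>b\<in>B. form_scale (c b) (hp b)) \<in> Hm"
        by (intro form.subspace_diff[OF subH h] form.subspace_sum[OF subH] form.subspace_scale[OF subH] hp)
      ultimately have "h - (\<Sum>b\<in>B. form_scale (c b) (hp b)) = 0" by (rule int[rotated])
      then show "\<exists>c. h = (\<Sum>b\<in>B. form_scale (c b) (hp b)) \<and> True" by (intro exI[of _ c]) simp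
    next
      fix c show "(\<Sum>b\<in>B. form_scale (c b) (hp b)) \<in> Hm"
        by (intro form.subspace_sum[OF subH] form.subspace_scale[OF subH] hp)
    qed
    fix c assume c: "(\<Sum>b\<in>B. form_scale (c b) (hp b)) = 0"
    \<comment> \<open>Uniqueness in \<open>quotient_basis\<close> concerns coefficient functions
      vanishing outside \<open>B\<close>, so the given one is cut off first.\<close>
    define c' where "c' = (\<lambda>b. if b \<in> B then c b else 0)"
    have cc: "(\<Sum>b\<in>B. form_scale (c' b) b) = (\<Sum>b\<in>B. form_scale (c b) b)" by (intro sum.cong) (auto simp: c'_def)
    have "(\<Sum>b\<in>B. form_scale (c b) b) \<in> W'" using diff[of c] c by simp
    then have "0 - (\<Sum>b\<in>B. form_scale (c' b) b) \<in> W'" unfolding cc by (rule form.subspace_diff[OF W(2) form.subspace_0[OF W(2)]])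
    then have p1: "(\<forall>b. b \<notin> B \<longrightarrow> c' b = 0) \<and> 0 - (\<Sum>b\<in>B. form_scale (c' b) b) \<in> W'" by (simp add: c'_def)
    have p2: "(\<forall>b. b \<notin> B \<longrightarrow> (\<lambda>b. 0::complex) b = 0) \<and> 0 - (\<Sum>b\<in>B. form_scale ((\<lambda>b. 0) b) b) \<in> W'"
      using form.subspace_0[OF W(2)] by simp
    from B(4)[OF form.subspace_0[OF W(1)]] have "c' = (\<lambda>b. 0)"
    proof (rule ex1E)
      fix c0 assume "\<forall>c. (\<forall>b. b \<notin> B \<longrightarrow> c b = 0) \<and> 0 - (\<Sum>b\<in>B. form_scale (c b) b) \<in> W' \<longrightarrow> c = c0"
      from this[rule_format, OF p1] this[rule_format, OF p2] show "c' = (\<lambda>b. 0)" by simp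
    qed
    then show "\<forall>b\<in>B. c b = 0" by (metis c'_def)
  qed
  from form.fam_basis_unique[OF this fb] B(2) show "d = card K" by simp
qed

text \<open>\<open>N\<close> stands for the directions of negative curvature, where the
  antiholomorphic derivative is a creation operator up to sign. Of the ground states only a basis of
  positive finite size \<open>d\<close> is assumed.\<close>

locale koszul = independent_ladder S b bs \<nu> I ip
  for S :: "('x \<Rightarrow> complex) set" and b bs \<nu> and I :: "nat set" and ip +
  fixes N :: "nat set" and d :: nat and kv :: "nat \<Rightarrow> 'x \<Rightarrow> complex"
  assumes N: "N \<subseteq> I" and d_pos: "d > 0" and ker_basis: "fam_basis fscale {..<d} kv (Ker 0)"
begin

definition Fo :: "'x form set" where
  "Fo = {\<psi>. (\<forall>J. cp \<psi> J \<in> S) \<and> (\<forall>J. \<not> J \<subseteq> I \<longrightarrow> cp \<psi> J = 0)}"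
definition Fk :: "nat \<Rightarrow> 'x form set" where "Fk k = {\<psi> \<in> Fo. \<forall>J. card J \<noteq> k \<longrightarrow> cp \<psi> J = 0}"

text \<open>The antiholomorphic derivative in direction \<open>i\<close>; \<open>Ds i\<close> is its
  adjoint for the product on functions, whence the exchange of \<open>b\<close> and
  \<open>bs\<close> under the same sign.\<close>

definition Dz :: "nat \<Rightarrow> ('x \<Rightarrow> complex) \<Rightarrow> 'x \<Rightarrow> complex" where
  "Dz i f = (if i \<in> N then fscale (-1) (bs i f) else b i f)"
definition Ds :: "nat \<Rightarrow> ('x \<Rightarrow> complex) \<Rightarrow> 'x \<Rightarrow> complex" where
  "Ds i f = (if i \<in> N then fscale (-1) (b i f) else bs i f)"

definition dK :: "'x form \<Rightarrow> 'x form" where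
  "dK \<psi> = (\<lambda>x J. if J \<subseteq> I then \<Sum>i\<in>J. sgn_at i J * Dz i (cp \<psi> (J - {i})) x else 0)"
text \<open>The factor \<open>2\<close> is the ratio of the squared norms of \<open>dzbar\<close>
  for \<open>insert i J\<close> and for \<open>J\<close>.\<close>

definition dKs :: "'x form \<Rightarrow> 'x form" where
  "dKs \<psi> = (\<lambda>x J. if J \<subseteq> I then \<Sum>i\<in>I - J. (2 * sgn_at i J) * Ds i (cp \<psi> (insert i J)) x else 0)"
definition box :: "'x form \<Rightarrow> 'x form" where "box \<psi> = dK (dKs \<psi>) + dKs (dK \<psi>)"

lemma cp_dK: "cp (dK \<psi>) J = (if J \<subseteq> I then \<Sum>i\<in>J. fscale (sgn_at i J) (Dz i (cp \<psi> (J - {i}))) else 0)"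
  by (auto simp: cp_def dK_def fun_eq_iff sum_fun_apply fscale_def)
lemma cp_dKs: "cp (dKs \<psi>) J = (if J \<subseteq> I then \<Sum>i\<in>I - J. fscale (2 * sgn_at i J) (Ds i (cp \<psi> (insert i J))) else 0)"
  by (auto simp: cp_def dKs_def fun_eq_iff sum_fun_apply fscale_def)

lemma uminus_simps [simp]: "f \<in> S \<Longrightarrow> - f \<in> S" "i \<in> I \<Longrightarrow> f \<in> S \<Longrightarrow> b i (- f) = - b i f" "i \<in> I \<Longrightarrow> f \<in> S \<Longrightarrow> bs i (- f) = - bs i f"
  using S_closed(4)[of f "-1"] b_scale[of i f "-1"] bs_scale[of i f "-1"] by auto

lemma Dz_in: "i \<in> I \<Longrightarrow> f \<in> S \<Longrightarrow> Dz i f \<in> S" and Ds_in: "i \<in> I \<Longrightarrow> f \<in> S \<Longrightarrow> Ds i f \<in> S"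
  by (auto simp: Dz_def Ds_def b_in bs_in)
lemma Dz_add: "i \<in> I \<Longrightarrow> f \<in> S \<Longrightarrow> g \<in> S \<Longrightarrow> Dz i (f + g) = Dz i f + Dz i g"
  and Ds_add: "i \<in> I \<Longrightarrow> f \<in> S \<Longrightarrow> g \<in> S \<Longrightarrow> Ds i (f + g) = Ds i f + Ds i g"
  by (auto simp: Dz_def Ds_def b_add bs_add fun_space.scale_right_distrib)
lemma Dz_scale: "i \<in> I \<Longrightarrow> f \<in> S \<Longrightarrow> Dz i (fscale c f) = fscale c (Dz i f)"
  and Ds_scale: "i \<in> I \<Longrightarrow> f \<in> S \<Longrightarrow> Ds i (fscale c f) = fscale c (Ds i f)"
  by (auto simp: Dz_def Ds_def b_scale bs_scale mult.commute)
lemma Dz_zero: "i \<in> I \<Longrightarrow> Dz i 0 = 0" and Ds_zero: "i \<in> I \<Longrightarrow> Ds i 0 = 0"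
  by (auto simp: Dz_def Ds_def)
lemma Dz_sum: "i \<in> I \<Longrightarrow> (\<And>j. j \<in> J \<Longrightarrow> F j \<in> S) \<Longrightarrow> Dz i (\<Sum>j\<in>J. F j) = (\<Sum>j\<in>J. Dz i (F j))"
  by (induction J rule: infinite_finite_induct) (auto simp: Dz_add Dz_zero)
lemma Ds_sum: "i \<in> I \<Longrightarrow> (\<And>j. j \<in> J \<Longrightarrow> F j \<in> S) \<Longrightarrow> Ds i (\<Sum>j\<in>J. F j) = (\<Sum>j\<in>J. Ds i (F j))"
  by (induction J rule: infinite_finite_induct) (auto simp: Ds_add Ds_zero)

lemma Dz_Dz: "i \<in> I \<Longrightarrow> j \<in> I \<Longrightarrow> f \<in> S \<Longrightarrow> Dz i (Dz j f) = Dz j (Dz i f)"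
  by (auto simp: Dz_def b_b[of i j] bs_bs[of i j] b_bs b_scale bs_scale b_in bs_in)
lemma Dz_Ds: "i \<in> I \<Longrightarrow> j \<in> I \<Longrightarrow> i \<noteq> j \<Longrightarrow> f \<in> S \<Longrightarrow> Dz i (Ds j f) = Ds j (Dz i f)"
  by (auto simp: Dz_def Ds_def b_b[of i j] bs_bs[of i j] b_bs b_scale bs_scale b_in bs_in)

text \<open>When the first operator lowers, the product is the number operator itself; when it
  raises, the commutator leaves \<open>\<nu> i\<close>. All the constants in \<open>shift\<close>
  arise in this way.\<close>

lemma Ds_Dz_self: "i \<in> I \<Longrightarrow> f \<in> S \<Longrightarrow> Ds i (Dz i f) = bs i (b i f) + (if i \<in> N then fscale (of_real (\<nu> i)) f else 0)"
  and Dz_Ds_self: "i \<in> I \<Longrightarrow> f \<in> S \<Longrightarrow> Dz i (Ds i f) = bs i (b i f) + (if i \<in> N then 0 else fscale (of_real (\<nu> i)) f)"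
  by (auto simp: Dz_def Ds_def b_bs b_scale bs_scale b_in bs_in)

lemma ip_scale_right: "f \<in> S \<Longrightarrow> g \<in> S \<Longrightarrow> ip f (fscale c g) = cnj c * ip f g"
  using ip_cnj[of "fscale c g" f] ip_cnj[of g f] by (simp add: ip_scale)

lemma ip_uminus: "f \<in> S \<Longrightarrow> g \<in> S \<Longrightarrow> ip (- f) g = - ip f g" "f \<in> S \<Longrightarrow> g \<in> S \<Longrightarrow> ip f (- g) = - ip f g"
  using ip_scale[of f g "-1"] ip_scale_right[of f g "-1"] by auto

lemma ip_Dz: "i \<in> I \<Longrightarrow> f \<in> S \<Longrightarrow> g \<in> S \<Longrightarrow> ip (Dz i f) g = ip f (Ds i g)"
  by (auto simp: Dz_def Ds_def ip_scale ip_scale_right ip_uminus ip_b ip_bs b_in bs_in)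

lemma Fo_S: "\<psi> \<in> Fo \<Longrightarrow> cp \<psi> J \<in> S" and Fo_outside: "\<psi> \<in> Fo \<Longrightarrow> \<not> J \<subseteq> I \<Longrightarrow> cp \<psi> J = 0"
  by (auto simp: Fo_def)

lemma Fo_subspace: "form.subspace Fo" and Fk_subspace: "form.subspace (Fk k)"
  unfolding form.subspace_def Fo_def Fk_def by auto

lemma finite_sub: "J \<subseteq> I \<Longrightarrow> finite J" using fin finite_subset by blast

lemma dK_in: "\<psi> \<in> Fo \<Longrightarrow> dK \<psi> \<in> Fo" and dKs_in: "\<psi> \<in> Fo \<Longrightarrow> dKs \<psi> \<in> Fo"
  unfolding Fo_def mem_Collect_eq cp_dK cp_dKs by (auto intro!: S_closed Dz_in Ds_in)

lemma cp_dKs_degree: "\<psi> \<in> Fk k \<Longrightarrow> Suc (card J) \<noteq> k \<Longrightarrow> cp (dKs \<psi>) J = 0"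
proof (cases "J \<subseteq> I")
  case True
  assume \<psi>: "\<psi> \<in> Fk k" and J: "Suc (card J) \<noteq> k"
  have "cp \<psi> (insert i J) = 0" if "i \<in> I - J" for i
    using \<psi> J that finite_sub[OF True] by (simp add: Fk_def)
  then show ?thesis unfolding cp_dKs using True by (auto simp: Ds_zero intro!: sum.neutral)
qed (simp add: cp_dKs)

lemma dKs_Fk: "\<psi> \<in> Fk (Suc k) \<Longrightarrow> dKs \<psi> \<in> Fk k"
  using cp_dKs_degree[of \<psi> "Suc k"] dKs_in by (auto simp: Fk_def)
lemma dKs_F0: "\<psi> \<in> Fk 0 \<Longrightarrow> dKs \<psi> = 0"
  by (rule form_eqI) (simp add: cp_dKs_degree)

lemma dK_add: "\<phi> \<in> Fo \<Longrightarrow> \<psi> \<in> Fo \<Longrightarrow> dK (\<phi> + \<psi>) = dK \<phi> + dK \<psi>"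
  and dKs_add: "\<phi> \<in> Fo \<Longrightarrow> \<psi> \<in> Fo \<Longrightarrow> dKs (\<phi> + \<psi>) = dKs \<phi> + dKs \<psi>"
  by (rule form_eqI, auto simp: cp_dK cp_dKs Dz_add Ds_add Fo_S subset_iff fun_space.scale_right_distrib sum.distrib[symmetric] intro!: sum.cong)+
lemma dK_scale: "\<psi> \<in> Fo \<Longrightarrow> dK (form_scale c \<psi>) = form_scale c (dK \<psi>)"
  and dKs_scale: "\<psi> \<in> Fo \<Longrightarrow> dKs (form_scale c \<psi>) = form_scale c (dKs \<psi>)"
  by (rule form_eqI, auto simp: cp_dK cp_dKs Dz_scale Ds_scale Fo_S subset_iff fun_space.scale_sum_right mult.commute intro!: sum.cong)+

text \<open>Interchanging the two removed indices reverses the sign while the derivatives commute,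
  so the double sum equals its own negative.\<close>

lemma dK_dK:
  assumes "\<psi> \<in> Fo" shows "dK (dK \<psi>) = 0"
proof (rule form_eqI)
  fix J
  show "cp (dK (dK \<psi>)) J = cp 0 J"
  proof (cases "J \<subseteq> I")
    case True
    note fJ = finite_sub[OF True]
    define t where "t i j = fscale (sgn_at i J * sgn_at j (J - {i})) (Dz i (Dz j (cp \<psi> (J - {i} - {j}))))" for i j
    have "cp (dK (dK \<psi>)) J = (\<Sum>i\<in>J. \<Sum>j\<in>J - {i}. t i j)"
    proof -
      have "fscale (sgn_at i J) (Dz i (cp (dK \<psi>) (J - {i}))) = (\<Sum>j\<in>J - {i}. t i j)" if i: "i \<in> J" for i
      proof -
        have "J - {i} \<subseteq> I" using True by auto
        then have "cp (dK \<psi>) (J - {i}) = (\<Sum>j\<in>J - {i}. fscale (sgn_at j (J - {i})) (Dz j (cp \<psi> (J - {i} - {j}))))" by (simp add: cp_dK)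
        moreover have "Dz i (\<Sum>j\<in>J - {i}. fscale (sgn_at j (J - {i})) (Dz j (cp \<psi> (J - {i} - {j})))) = (\<Sum>j\<in>J - {i}. Dz i (fscale (sgn_at j (J - {i})) (Dz j (cp \<psi> (J - {i} - {j})))))"
          using i True by (intro Dz_sum) (auto intro!: S_closed Dz_in Fo_S[OF assms])
        moreover have "Dz i (fscale (sgn_at j (J - {i})) (Dz j (cp \<psi> (J - {i} - {j})))) = fscale (sgn_at j (J - {i})) (Dz i (Dz j (cp \<psi> (J - {i} - {j}))))" if "j \<in> J - {i}" for j
          using i that True by (intro Dz_scale) (auto intro!: Dz_in Fo_S[OF assms])
        ultimately show ?thesis by (simp add: t_def fun_space.scale_sum_right)
      qed
      then show ?thesis using True by (simp add: cp_dK[of "dK \<psi>"])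
    qed
    also have "\<dots> = (\<Sum>p\<in>(SIGMA i:J. J - {i}). t (fst p) (snd p))"
      using fJ by (simp add: sum.Sigma case_prod_unfold)
    finally have 1: "cp (dK (dK \<psi>)) J = (\<Sum>p\<in>(SIGMA i:J. J - {i}). t (fst p) (snd p))" .
    also have "\<dots> = (\<Sum>p\<in>(SIGMA i:J. J - {i}). t (snd p) (fst p))"
      by (rule sum.reindex_bij_witness[of _ prod.swap prod.swap]) auto
    also have "\<dots> = (\<Sum>p\<in>(SIGMA i:J. J - {i}). - t (fst p) (snd p))"
    proof (rule sum.cong[OF refl])
      fix p assume "p \<in> (SIGMA i:J. J - {i})"
      then obtain i j where p: "p = (i, j)" "i \<in> J" "j \<in> J" "i \<noteq> j" by auto
      have "J - {j} - {i} = J - {i} - {j}" by auto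
      moreover have "sgn_at j J * sgn_at i (J - {j}) = - (sgn_at i J * sgn_at j (J - {i}))"
        using p sgn_at_remove[OF fJ p(2), of j] sgn_at_remove[OF fJ p(3), of i] by auto
      moreover have "Dz j (Dz i (cp \<psi> (J - {i} - {j}))) = Dz i (Dz j (cp \<psi> (J - {i} - {j})))"
        using p True by (intro Dz_Dz Fo_S[OF assms]) auto
      ultimately show "t (snd p) (fst p) = - t (fst p) (snd p)" by (simp add: t_def p(1))
    qed
    also have "\<dots> = - cp (dK (dK \<psi>)) J" unfolding 1 by (rule sum_negf)
    finally have "cp (dK (dK \<psi>)) J x = - cp (dK (dK \<psi>)) J x" for x by (metis uminus_apply)
    then show ?thesis by (simp add: fun_eq_iff eq_neg_iff_add_eq_0)
  qed (simp add: cp_dK)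
qed

text \<open>A sum over the symmetric difference of \<open>J\<close> and \<open>N\<close>. For
  \<open>J \<subseteq> I\<close> it vanishes only at \<open>J = N\<close>, which is why harmonic
  forms have this single multi-index.\<close>

definition shift :: "nat set \<Rightarrow> real" where "shift J = (\<Sum>i\<in>(J - N) \<union> (N - J). \<nu> i)"

text \<open>Terms exchanging an index of \<open>J\<close> for one outside occur in both halves of
  \<open>box\<close> with opposite signs and cancel, since operators in different directions
  commute. So \<open>box\<close> is diagonal in the multi-indices, and each direction contributes a
  number operator plus \<open>\<nu> i\<close> precisely where \<open>J\<close> and \<open>N\<close>
  differ.\<close>

lemma box_formula:
  assumes \<psi>: "\<psi> \<in> Fo" and J: "J \<subseteq> I"
  shows "cp (box \<psi>) J = fscale 2 (A (cp \<psi> J) + fscale (of_real (shift J)) (cp \<psi> J))"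
proof -
  note fJ = finite_sub[OF J]
  note S = Fo_S[OF \<psi>]
  \<comment> \<open>The term of \<open>box\<close> in which \<open>i\<close> is replaced by
    \<open>j\<close>; the diagonal terms are split off before the cancellation.\<close>
  define t where "t i j = fscale (2 * (sgn_at i J * sgn_at j (J - {i}))) (Dz i (Ds j (cp \<psi> (insert j (J - {i})))))" for i j
  have a: "cp (dK (dKs \<psi>)) J = (\<Sum>i\<in>J. fscale 2 (Dz i (Ds i (cp \<psi> J))) + (\<Sum>j\<in>I - J. t i j))"
  proof -
    have "fscale (sgn_at i J) (Dz i (cp (dKs \<psi>) (J - {i}))) = fscale 2 (Dz i (Ds i (cp \<psi> J))) + (\<Sum>j\<in>I - J. t i j)" if i: "i \<in> J" for i
    proof -
      have sub: "J - {i} \<subseteq> I" using J by auto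
      have set: "I - (J - {i}) = insert i (I - J)" using i J by auto
      have "cp (dKs \<psi>) (J - {i}) = (\<Sum>j\<in>I - (J - {i}). fscale (2 * sgn_at j (J - {i})) (Ds j (cp \<psi> (insert j (J - {i})))))"
        using sub by (simp add: cp_dKs)
      moreover have "Dz i (\<Sum>j\<in>I - (J - {i}). fscale (2 * sgn_at j (J - {i})) (Ds j (cp \<psi> (insert j (J - {i}))))) = (\<Sum>j\<in>I - (J - {i}). Dz i (fscale (2 * sgn_at j (J - {i})) (Ds j (cp \<psi> (insert j (J - {i}))))))"
        using i J by (intro Dz_sum) (auto intro!: S_closed Ds_in S)
      moreover have "Dz i (fscale (2 * sgn_at j (J - {i})) (Ds j (cp \<psi> (insert j (J - {i}))))) = fscale (2 * sgn_at j (J - {i})) (Dz i (Ds j (cp \<psi> (insert j (J - {i})))))" if "j \<in> I" for j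
        using i that J by (intro Dz_scale) (auto intro!: Ds_in S)
      ultimately have "fscale (sgn_at i J) (Dz i (cp (dKs \<psi>) (J - {i}))) = (\<Sum>j\<in>I - (J - {i}). t i j)"
        by (simp add: t_def fun_space.scale_sum_right mult_ac)
      also have "\<dots> = t i i + (\<Sum>j\<in>I - J. t i j)" unfolding set using i by (subst sum.insert) auto
      also have "t i i = fscale 2 (Dz i (Ds i (cp \<psi> J)))" using i by (simp add: t_def sgn_at_self insert_absorb)
      finally show ?thesis .
    qed
    then show ?thesis using J by (simp add: cp_dK[of "dKs \<psi>"])
  qed
  have b: "cp (dKs (dK \<psi>)) J = (\<Sum>j\<in>I - J. fscale 2 (Ds j (Dz j (cp \<psi> J))) - (\<Sum>i\<in>J. t i j))"
  proof -
    have "fscale (2 * sgn_at j J) (Ds j (cp (dK \<psi>) (insert j J))) = fscale 2 (Ds j (Dz j (cp \<psi> J))) - (\<Sum>i\<in>J. t i j)" if j: "j \<in> I - J" for j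
    proof -
      have sub: "insert j J \<subseteq> I" using J j by auto
      let ?t = "\<lambda>i. fscale (2 * (sgn_at j J * sgn_at i (insert j J))) (Ds j (Dz i (cp \<psi> (insert j J - {i}))))"
      have e1: "cp (dK \<psi>) (insert j J) = (\<Sum>i\<in>insert j J. fscale (sgn_at i (insert j J)) (Dz i (cp \<psi> (insert j J - {i}))))"
        using sub by (simp add: cp_dK)
      have e2: "Ds j (\<Sum>i\<in>insert j J. fscale (sgn_at i (insert j J)) (Dz i (cp \<psi> (insert j J - {i})))) = (\<Sum>i\<in>insert j J. Ds j (fscale (sgn_at i (insert j J)) (Dz i (cp \<psi> (insert j J - {i})))))"
        using j J by (intro Ds_sum) (auto intro!: S_closed Dz_in S)
      have e3: "Ds j (fscale (sgn_at i (insert j J)) (Dz i (cp \<psi> (insert j J - {i})))) = fscale (sgn_at i (insert j J)) (Ds j (Dz i (cp \<psi> (insert j J - {i}))))" if "i \<in> I" for i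
        using j that J by (intro Ds_scale) (auto intro!: Dz_in S)
      have "fscale (2 * sgn_at j J) (Ds j (cp (dK \<psi>) (insert j J))) = (\<Sum>i\<in>insert j J. ?t i)"
        unfolding e1 e2 fun_space.scale_sum_right
      proof (rule sum.cong[OF refl])
        fix i assume "i \<in> insert j J"
        then have "i \<in> I" using sub by blast
        from e3[OF this] show "fscale (2 * sgn_at j J) (Ds j (fscale (sgn_at i (insert j J)) (Dz i (cp \<psi> (insert j J - {i}))))) = ?t i"
          by (simp add: mult.assoc)
      qed
      also have "\<dots> = ?t j + (\<Sum>i\<in>J. ?t i)" using j fJ by (subst sum.insert) auto
      also have "?t j = fscale 2 (Ds j (Dz j (cp \<psi> J)))" using j by (simp add: sgn_at_self)
      also have "(\<Sum>i\<in>J. ?t i) = (\<Sum>i\<in>J. - t i j)"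
      proof (rule sum.cong[OF refl])
        fix i assume i: "i \<in> J"
        then have ij: "i \<noteq> j" using j by auto
        have "insert j J - {i} = insert j (J - {i})" using ij by auto
        moreover have "sgn_at j J * sgn_at i (insert j J) = - (sgn_at i J * sgn_at j (J - {i}))"
          using ij j sgn_at_insert[OF fJ, of j i] sgn_at_remove[OF fJ i, of j] by auto
        moreover have "Ds j (Dz i (cp \<psi> (insert j (J - {i})))) = Dz i (Ds j (cp \<psi> (insert j (J - {i}))))"
          using i j ij J by (intro Dz_Ds[symmetric] S) auto
        ultimately show "?t i = - t i j" by (simp add: t_def)
      qed
      finally show ?thesis by (simp only: sum_negf add_uminus_conv_diff)
    qed
    then show ?thesis using J by (simp add: cp_dKs[of "dK \<psi>"])
  qed
  have "cp (box \<psi>) J = (\<Sum>i\<in>J. fscale 2 (Dz i (Ds i (cp \<psi> J)))) + (\<Sum>j\<in>I - J. fscale 2 (Ds j (Dz j (cp \<psi> J)))) + ((\<Sum>i\<in>J. \<Sum>j\<in>I - J. t i j) - (\<Sum>j\<in>I - J. \<Sum>i\<in>J. t i j))"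
    unfolding box_def cp_simps a b sum.distrib sum_subtractf by simp
  also have "(\<Sum>i\<in>J. \<Sum>j\<in>I - J. t i j) = (\<Sum>j\<in>I - J. \<Sum>i\<in>J. t i j)" by (rule sum.swap)
  finally have "cp (box \<psi>) J = fscale 2 ((\<Sum>i\<in>J. Dz i (Ds i (cp \<psi> J))) + (\<Sum>j\<in>I - J. Ds j (Dz j (cp \<psi> J))))"
    by (simp only: diff_self add_0_right fun_space.scale_sum_right fun_space.scale_right_distrib)
  also have "(\<Sum>i\<in>J. Dz i (Ds i (cp \<psi> J))) = (\<Sum>i\<in>J. bs i (b i (cp \<psi> J))) + (\<Sum>i\<in>J. if i \<in> N then 0 else fscale (of_real (\<nu> i)) (cp \<psi> J))"
    unfolding sum.distrib[symmetric] using J S by (intro sum.cong refl Dz_Ds_self) auto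
  also have "(\<Sum>j\<in>I - J. Ds j (Dz j (cp \<psi> J))) = (\<Sum>i\<in>I - J. bs i (b i (cp \<psi> J))) + (\<Sum>i\<in>I - J. if i \<in> N then fscale (of_real (\<nu> i)) (cp \<psi> J) else 0)"
    unfolding sum.distrib[symmetric] using S by (intro sum.cong refl Ds_Dz_self) auto
  also have "(\<Sum>i\<in>J. if i \<in> N then 0 else fscale (of_real (\<nu> i)) (cp \<psi> J)) = (\<Sum>i\<in>J - N. fscale (of_real (\<nu> i)) (cp \<psi> J))"
    using fJ by (intro sum.mono_neutral_cong_right) auto
  also have "(\<Sum>i\<in>I - J. if i \<in> N then fscale (of_real (\<nu> i)) (cp \<psi> J) else 0) = (\<Sum>i\<in>N - J. fscale (of_real (\<nu> i)) (cp \<psi> J))"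
    using N by (intro sum.mono_neutral_cong_right) auto
  also have "(\<Sum>i\<in>J. bs i (b i (cp \<psi> J))) + (\<Sum>i\<in>J - N. fscale (of_real (\<nu> i)) (cp \<psi> J)) + ((\<Sum>i\<in>I - J. bs i (b i (cp \<psi> J))) + (\<Sum>i\<in>N - J. fscale (of_real (\<nu> i)) (cp \<psi> J)))
     = ((\<Sum>i\<in>J. bs i (b i (cp \<psi> J))) + (\<Sum>i\<in>I - J. bs i (b i (cp \<psi> J)))) + ((\<Sum>i\<in>J - N. fscale (of_real (\<nu> i)) (cp \<psi> J)) + (\<Sum>i\<in>N - J. fscale (of_real (\<nu> i)) (cp \<psi> J)))" by simp
  also have "(\<Sum>i\<in>J. bs i (b i (cp \<psi> J))) + (\<Sum>i\<in>I - J. bs i (b i (cp \<psi> J))) = A (cp \<psi> J)"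
    unfolding A_def using sum.subset_diff[OF J fin, of "\<lambda>i. bs i (b i (cp \<psi> J))"] by (simp add: add.commute)
  also have "(\<Sum>i\<in>J - N. fscale (of_real (\<nu> i)) (cp \<psi> J)) + (\<Sum>i\<in>N - J. fscale (of_real (\<nu> i)) (cp \<psi> J)) = fscale (of_real (shift J)) (cp \<psi> J)"
  proof -
    have "finite (J - N)" "finite (N - J)" using fJ finite_sub[OF N] by auto
    then show ?thesis unfolding shift_def by (subst sum.union_disjoint) (auto simp: fun_space.scale_left_distrib fun_space.scale_sum_left)
  qed
  finally show ?thesis .
qed

lemma box_in: "\<psi> \<in> Fo \<Longrightarrow> box \<psi> \<in> Fo"
  unfolding box_def by (intro form.subspace_add[OF Fo_subspace] dK_in dKs_in)

text \<open>As \<open>box\<close> is diagonal, being an eigenform is a condition on each coefficient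
  separately; the spectral parameter is halved and then lowered by the constant of the
  multi-index.\<close>

lemma box_eigen_iff:
  assumes "\<psi> \<in> Fo"
  shows "box \<psi> = form_scale ev \<psi> \<longleftrightarrow> (\<forall>J. J \<subseteq> I \<longrightarrow> cp \<psi> J \<in> Ker (ev / 2 - of_real (shift J)))"
proof -
  have eq: "cp (box \<psi>) J = cp (form_scale ev \<psi>) J \<longleftrightarrow> cp \<psi> J \<in> Ker (ev / 2 - of_real (shift J))" if J: "J \<subseteq> I" for J
  proof -
    have "fscale 2 (A f + fscale s f) = fscale ev f \<longleftrightarrow> A f = fscale (ev / 2 - s) f" for f s
      by (auto simp: fscale_def fun_eq_iff field_simps)
    then show ?thesis unfolding box_formula[OF assms J] using Fo_S[OF assms] by (simp add: Ker_def)
  qed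
  have "box \<psi> = form_scale ev \<psi> \<longleftrightarrow> (\<forall>J. cp (box \<psi>) J = cp (form_scale ev \<psi>) J)" using form_eqI by metis
  also have "\<dots> \<longleftrightarrow> (\<forall>J. J \<subseteq> I \<longrightarrow> cp (box \<psi>) J = cp (form_scale ev \<psi>) J)"
    using Fo_outside[OF assms] Fo_outside[OF box_in[OF assms]] by (metis cp_simps(4) fun_space.scale_zero_right)
  finally show ?thesis using eq by blast
qed

end

section \<open>The product on forms, adjointness, and the spectrum\<close>

context koszul
begin

text \<open>The weight is the squared norm of \<open>dzbar\<close> with multi-index
  \<open>J\<close>, each factor contributing \<open>2\<close>.\<close>

definition IP :: "'x form \<Rightarrow> 'x form \<Rightarrow> complex" where
  "IP \<phi> \<psi> = (\<Sum>J\<in>Pow I. 2 ^ card J * ip (cp \<phi> J) (cp \<psi> J))"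

lemma ip_sum_right: "f \<in> S \<Longrightarrow> (\<And>j. j \<in> J \<Longrightarrow> F j \<in> S) \<Longrightarrow> ip f (\<Sum>j\<in>J. F j) = (\<Sum>j\<in>J. ip f (F j))"
proof -
  assume f: "f \<in> S" and F: "\<And>j. j \<in> J \<Longrightarrow> F j \<in> S"
  then have "ip f (\<Sum>j\<in>J. F j) = cnj (\<Sum>j\<in>J. ip (F j) f)" using ip_cnj[of "\<Sum>j\<in>J. F j" f] by (simp add: ip_sum S_closed)
  also have "\<dots> = (\<Sum>j\<in>J. ip f (F j))" unfolding cnj_sum using f F ip_cnj[of _ f] by (intro sum.cong refl) simp
  finally show ?thesis .
qed

text \<open>Both sides are sums over a multi-index and an index, one inside and the other outside of
  it. Removing the index is a bijection between these pairs, and the power of \<open>2\<close> it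
  loses is the factor in \<open>dKs\<close>.\<close>

lemma IP_dK:
  assumes \<phi>: "\<phi> \<in> Fo" and \<psi>: "\<psi> \<in> Fo"
  shows "IP (dK \<phi>) \<psi> = IP \<phi> (dKs \<psi>)"
proof -
  define t where "t J i = 2 ^ card J * sgn_at i J * ip (cp \<phi> (J - {i})) (Ds i (cp \<psi> J))" for J i
  have cnj_sgn: "cnj (sgn_at i J) = sgn_at i J" for i J by (simp add: sgn_at_def)
  have "IP (dK \<phi>) \<psi> = (\<Sum>J\<in>Pow I. \<Sum>i\<in>J. t J i)"
    unfolding IP_def
  proof (rule sum.cong[OF refl])
    fix J assume "J \<in> Pow I"
    then have J: "J \<subseteq> I" by simp
    have "ip (cp (dK \<phi>) J) (cp \<psi> J) = (\<Sum>i\<in>J. ip (fscale (sgn_at i J) (Dz i (cp \<phi> (J - {i})))) (cp \<psi> J))"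
      using J by (simp add: cp_dK ip_sum Fo_S[OF \<psi>] Fo_S[OF \<phi>] S_closed Dz_in subset_iff)
    also have "\<dots> = (\<Sum>i\<in>J. sgn_at i J * ip (cp \<phi> (J - {i})) (Ds i (cp \<psi> J)))"
      using J by (intro sum.cong refl) (auto simp: ip_scale ip_Dz Fo_S[OF \<psi>] Fo_S[OF \<phi>] Dz_in)
    finally show "2 ^ card J * ip (cp (dK \<phi>) J) (cp \<psi> J) = (\<Sum>i\<in>J. t J i)"
      by (simp add: t_def sum_distrib_left mult.assoc)
  qed
  also have "\<dots> = (\<Sum>p\<in>(SIGMA J:Pow I. J). t (fst p) (snd p))"
    using fin finite_sub by (subst sum.Sigma) (auto simp: case_prod_unfold)
  also have "\<dots> = (\<Sum>p\<in>(SIGMA J:Pow I. I - J). t (insert (snd p) (fst p)) (snd p))"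
    by (rule sum.reindex_bij_witness[of _ "\<lambda>p. (insert (snd p) (fst p), snd p)" "\<lambda>p. (fst p - {snd p}, snd p)"])
       (auto simp: insert_absorb)
  also have "\<dots> = (\<Sum>J\<in>Pow I. \<Sum>i\<in>I - J. t (insert i J) i)"
    using fin finite_sub by (subst sum.Sigma) (auto simp: case_prod_unfold)
  also have "\<dots> = IP \<phi> (dKs \<psi>)"
    unfolding IP_def
  proof (rule sum.cong[OF refl])
    fix J assume "J \<in> Pow I"
    then have J: "J \<subseteq> I" by simp
    have "ip (cp \<phi> J) (cp (dKs \<psi>) J) = (\<Sum>i\<in>I - J. ip (cp \<phi> J) (fscale (2 * sgn_at i J) (Ds i (cp \<psi> (insert i J)))))"
      unfolding cp_dKs if_P[OF J] by (rule ip_sum_right) (auto intro!: Fo_S \<phi> \<psi> S_closed Ds_in)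
    also have "\<dots> = (\<Sum>i\<in>I - J. 2 * sgn_at i J * ip (cp \<phi> J) (Ds i (cp \<psi> (insert i J))))"
      by (intro sum.cong refl) (simp add: ip_scale_right Fo_S[OF \<psi>] Fo_S[OF \<phi>] Ds_in cnj_sgn)
    finally have "2 ^ card J * ip (cp \<phi> J) (cp (dKs \<psi>) J) = (\<Sum>i\<in>I - J. 2 ^ card J * (2 * sgn_at i J * ip (cp \<phi> J) (Ds i (cp \<psi> (insert i J)))))"
      by (simp add: sum_distrib_left)
    also have "\<dots> = (\<Sum>i\<in>I - J. t (insert i J) i)"
      using finite_sub[OF J] by (intro sum.cong refl) (auto simp: t_def sgn_at_self)
    finally show "(\<Sum>i\<in>I - J. t (insert i J) i) = 2 ^ card J * ip (cp \<phi> J) (cp (dKs \<psi>) J)" by simp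
  qed
  finally show ?thesis .
qed

lemma IP_cnj: "\<phi> \<in> Fo \<Longrightarrow> \<psi> \<in> Fo \<Longrightarrow> IP \<psi> \<phi> = cnj (IP \<phi> \<psi>)"
  unfolding IP_def cnj_sum by (intro sum.cong refl) (simp add: ip_cnj[OF Fo_S Fo_S, of \<phi> \<psi>])

lemma IP_dKs: "\<phi> \<in> Fo \<Longrightarrow> \<psi> \<in> Fo \<Longrightarrow> IP (dKs \<phi>) \<psi> = IP \<phi> (dK \<psi>)"
  using IP_dK[of \<psi> \<phi>] IP_cnj[of \<psi> "dKs \<phi>"] IP_cnj[of "dK \<psi>" \<phi>] dK_in dKs_in by auto

lemma Re_two_power: "Re (2 ^ k * z) = 2 ^ k * Re z"
proof -
  have "(2::complex) ^ k = of_real (2 ^ k)" by simp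
  then show ?thesis by (simp only: Re_complex_of_real mult.commute[of "of_real _"] times_complex.sel(1)) simp
qed

lemma IP_nonneg: "\<psi> \<in> Fo \<Longrightarrow> Re (IP \<psi> \<psi>) \<ge> 0"
  unfolding IP_def Re_sum Re_two_power by (intro sum_nonneg mult_nonneg_nonneg ip_nonneg Fo_S) auto

lemma IP_eq_0:
  assumes "\<psi> \<in> Fo" "Re (IP \<psi> \<psi>) = 0" shows "\<psi> = 0"
proof (rule form_eqI)
  fix J
  show "cp \<psi> J = cp 0 J"
  proof (cases "J \<subseteq> I")
    case True
    have "(\<Sum>J\<in>Pow I. 2 ^ card J * Re (ip (cp \<psi> J) (cp \<psi> J))) = 0" using assms(2) unfolding IP_def Re_sum Re_two_power .
    then have "2 ^ card J * Re (ip (cp \<psi> J) (cp \<psi> J)) = 0"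
      using True fin by (subst (asm) sum_nonneg_eq_0_iff) (auto intro!: mult_nonneg_nonneg ip_nonneg Fo_S[OF assms(1)])
    then show ?thesis using ip_pos[OF Fo_S[OF assms(1), of J]] by fastforce
  qed (simp add: Fo_outside[OF assms(1)])
qed

lemma IP_zero: "\<psi> \<in> Fo \<Longrightarrow> IP 0 \<psi> = 0" "\<psi> \<in> Fo \<Longrightarrow> IP \<psi> 0 = 0"
proof -
  assume \<psi>: "\<psi> \<in> Fo"
  have z: "0 \<in> Fo" by (rule form.subspace_0[OF Fo_subspace])
  show 1: "IP 0 \<psi> = 0" unfolding IP_def using ip_scale[OF S_closed(1) Fo_S[OF \<psi>], of 0] by (intro sum.neutral) simp
  show "IP \<psi> 0 = 0" using IP_cnj[OF z \<psi>] 1 by simp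
qed

lemma IP_add: "\<phi> \<in> Fo \<Longrightarrow> \<psi> \<in> Fo \<Longrightarrow> \<eta> \<in> Fo \<Longrightarrow> IP (\<phi> + \<psi>) \<eta> = IP \<phi> \<eta> + IP \<psi> \<eta>"
  unfolding IP_def sum.distrib[symmetric] by (intro sum.cong refl) (simp add: ip_add Fo_S distrib_left)

lemma IP_diff_right: "\<phi> \<in> Fo \<Longrightarrow> \<psi> \<in> Fo \<Longrightarrow> \<eta> \<in> Fo \<Longrightarrow> IP \<eta> (\<phi> - \<psi>) = IP \<eta> \<phi> - IP \<eta> \<psi>"
proof -
  assume a: "\<phi> \<in> Fo" "\<psi> \<in> Fo" "\<eta> \<in> Fo"
  have d: "\<phi> - \<psi> \<in> Fo" by (rule form.subspace_diff[OF Fo_subspace a(1,2)])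
  have "IP ((\<phi> - \<psi>) + \<psi>) \<eta> = IP (\<phi> - \<psi>) \<eta> + IP \<psi> \<eta>" by (rule IP_add[OF d a(2,3)])
  then have "cnj (IP (\<phi> - \<psi>) \<eta>) = cnj (IP \<phi> \<eta>) - cnj (IP \<psi> \<eta>)" by simp
  then show ?thesis by (simp add: IP_cnj[OF d a(3), symmetric] IP_cnj[OF a(1,3), symmetric] IP_cnj[OF a(2,3), symmetric])
qed

lemma adjoint_unique:
  assumes "\<eta> \<in> Fo" "\<eta>' \<in> Fo" "\<And>\<phi>. \<phi> \<in> Fo \<Longrightarrow> IP \<phi> \<eta> = IP \<phi> \<eta>'" shows "\<eta> = \<eta>'"
proof -
  have d: "\<eta> - \<eta>' \<in> Fo" by (rule form.subspace_diff[OF Fo_subspace assms(1,2)])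
  have "IP (\<eta> - \<eta>') (\<eta> - \<eta>') = 0" unfolding IP_diff_right[OF assms(1,2) d] assms(3)[OF d] by simp
  then have "\<eta> - \<eta>' = 0" by (intro IP_eq_0[OF d]) simp
  then show ?thesis by simp
qed

lemma single_in: "f \<in> S \<Longrightarrow> J \<subseteq> I \<Longrightarrow> single J f \<in> Fo"
  unfolding Fo_def by (auto simp: cp_single)

lemma kv_in: "j < d \<Longrightarrow> kv j \<in> Ker 0"
proof -
  assume j: "j < d"
  have "kv j = (\<Sum>i\<in>{..<d}. fscale (if i = j then 1 else 0) (kv i))"
    using j by (simp add: if_distrib[of "\<lambda>c. fscale c _"] sum.delta cong: if_cong)
  moreover have "Ker 0 = {\<Sum>j\<in>{..<d}. fscale (c j) (kv j) | c. True}"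
    using ker_basis unfolding fam_basis_def by (elim conjE)
  ultimately show "kv j \<in> Ker 0" by (simp only:) (rule CollectI, rule exI[of _ "\<lambda>i. if i = j then 1 else 0"], simp only: simp_thms)
qed

lemma Ker_nontrivial: "\<exists>f\<in>Ker (of_real (level m)). f \<noteq> 0"
proof -
  from Ker_iso[of m] obtain T where T: "bij_betw T (Ker 0) (Ker (of_real (level m)))" "\<And>c f. f \<in> Ker 0 \<Longrightarrow> T (fscale c f) = fscale c (T f)" by blast
  have ind: "\<And>c. (\<Sum>j\<in>{..<d}. fscale (c j) (kv j)) = 0 \<Longrightarrow> \<forall>j\<in>{..<d}. c j = 0"
    using ker_basis unfolding fam_basis_def by blast
  have kv: "kv 0 \<in> Ker 0" by (rule kv_in[OF d_pos])
  have z0: "0 \<in> Ker 0" by (rule fun_space.subspace_0[OF Ker_subspace])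
  have "kv 0 \<noteq> 0"
  proof
    assume z: "kv 0 = 0"
    have "(\<Sum>j\<in>{..<d}. fscale ((\<lambda>j. if j = 0 then 1 else 0) j) (kv j)) = 0"
      using z by (intro sum.neutral) auto
    from bspec[OF ind[OF this], of 0] show False using d_pos by simp
  qed
  moreover have "T 0 = 0" using T(2)[OF z0, of 0] by simp
  ultimately have "T (kv 0) \<noteq> 0" using T(1) kv z0 by (metis bij_betw_def inj_onD)
  then show ?thesis using T(1) kv by (auto simp: bij_betw_def)
qed

text \<open>One more quantum at every index where \<open>J\<close> and \<open>N\<close> differ
  accounts for \<open>shift J\<close>, so the constants of the Laplacian lead to no values other
  than levels.\<close>

lemma level_shift:
  assumes J: "J \<subseteq> I" and ev: "ev / 2 - of_real (shift J) = complex_of_real (level m)"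
  shows "ev = of_real (2 * level (\<lambda>i. m i + (if i \<in> (J - N) \<union> (N - J) then 1 else 0)))"
proof -
  have "level (\<lambda>i. m i + (if i \<in> (J - N) \<union> (N - J) then 1 else 0)) = level m + (\<Sum>i\<in>I. if i \<in> (J - N) \<union> (N - J) then \<nu> i else 0)"
    unfolding level_def sum.distrib[symmetric] by (intro sum.cong refl) (auto simp: algebra_simps)
  also have "(\<Sum>i\<in>I. if i \<in> (J - N) \<union> (N - J) then \<nu> i else 0) = shift J"
    unfolding shift_def using J N fin by (intro sum.mono_neutral_cong_right) auto
  finally show ?thesis using ev by (simp add: field_simps)
qed

text \<open>Off the levels all kernels of the coefficient equations are trivial, so these equations
  are uniquely solvable by \<open>Ker_range_decomposition\<close>. At a level an eigenform is
  exhibited.\<close>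

theorem box_spectrum:
  "{ev. \<not> bij_betw (\<lambda>\<psi>. box \<psi> - form_scale ev \<psi>) Fo Fo} = {of_real (2 * level m) | m. True}"
proof (intro set_eqI iffI)
  fix ev assume "ev \<in> {ev. \<not> bij_betw (\<lambda>\<psi>. box \<psi> - form_scale ev \<psi>) Fo Fo}"
  then have nb: "\<not> bij_betw (\<lambda>\<psi>. box \<psi> - form_scale ev \<psi>) Fo Fo" by simp
  show "ev \<in> {of_real (2 * level m) | m. True}"
  proof (rule ccontr)
    assume no: "ev \<notin> {of_real (2 * level m) | m. True}"
    have K0: "f = 0" if J: "J \<subseteq> I" and f: "f \<in> Ker (ev / 2 - of_real (shift J))" for J f
    proof (rule ccontr)
      assume "f \<noteq> 0"
      from Ker_eigen_exists[OF f this] obtain m where "ev / 2 - of_real (shift J) = complex_of_real (level m)" by blast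
      from level_shift[OF J this] show False using no by blast
    qed
    have "bij_betw (\<lambda>\<psi>. box \<psi> - form_scale ev \<psi>) Fo Fo"
      unfolding bij_betw_def
    proof
      show "inj_on (\<lambda>\<psi>. box \<psi> - form_scale ev \<psi>) Fo"
      proof (rule inj_onI)
        fix \<phi> \<psi> assume a: "\<phi> \<in> Fo" "\<psi> \<in> Fo" "box \<phi> - form_scale ev \<phi> = box \<psi> - form_scale ev \<psi>"
        have d: "\<phi> - \<psi> \<in> Fo" by (rule form.subspace_diff[OF Fo_subspace a(1,2)])
        have "box ((\<phi> - \<psi>) + \<psi>) = box (\<phi> - \<psi>) + box \<psi>"
          unfolding box_def dK_add[OF d a(2)] dKs_add[OF d a(2)] dK_add[OF dKs_in[OF d] dKs_in[OF a(2)]] dKs_add[OF dK_in[OF d] dK_in[OF a(2)]]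
          by (simp only: add_ac)
        then have "box (\<phi> - \<psi>) = box \<phi> - box \<psi>" by (simp only: diff_add_cancel eq_diff_eq)
        also have "\<dots> = form_scale ev \<phi> - form_scale ev \<psi>" using a(3) by (simp only: diff_eq_eq add_diff_eq) (metis add.commute add_diff_cancel_right' diff_add_eq)
        also have "\<dots> = form_scale ev (\<phi> - \<psi>)" by (rule form.scale_right_diff_distrib[symmetric])
        finally have "\<forall>J. J \<subseteq> I \<longrightarrow> cp (\<phi> - \<psi>) J \<in> Ker (ev / 2 - of_real (shift J))" using box_eigen_iff[OF d] by blast
        then have "\<phi> - \<psi> = 0" using K0 Fo_outside[OF d] by (intro form_eqI) (metis cp_simps(3))
        then show "\<phi> = \<psi>" by simp
      qed
      show "(\<lambda>\<psi>. box \<psi> - form_scale ev \<psi>) ` Fo = Fo"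
      proof safe
        fix \<psi> assume "\<psi> \<in> Fo"
        then show "box \<psi> - form_scale ev \<psi> \<in> Fo" by (intro form.subspace_diff[OF Fo_subspace] form.subspace_scale[OF Fo_subspace] box_in)
      next
        fix \<phi> assume \<phi>: "\<phi> \<in> Fo"
        have "\<exists>u. u \<in> S \<and> (J \<subseteq> I \<longrightarrow> A u - fscale (ev / 2 - of_real (shift J)) u = fscale (1/2) (cp \<phi> J)) \<and> (\<not> J \<subseteq> I \<longrightarrow> u = 0)" for J
        proof (cases "J \<subseteq> I")
          case True
          obtain k u where "k \<in> Ker (ev / 2 - of_real (shift J))" "u \<in> S" "fscale (1/2) (cp \<phi> J) = k + (A u - fscale (ev / 2 - of_real (shift J)) u)"
            using Ker_range_decomposition[where f = "fscale (1/2) (cp \<phi> J)" and c = "ev / 2 - of_real (shift J)"] S_closed(4)[OF Fo_S[OF \<phi>]] by blast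
          then show ?thesis using K0[OF True] True by (intro exI[of _ u]) auto
        qed (auto intro: exI[of _ 0])
        then obtain u where u: "\<And>J. u J \<in> S" "\<And>J. J \<subseteq> I \<Longrightarrow> A (u J) - fscale (ev / 2 - of_real (shift J)) (u J) = fscale (1/2) (cp \<phi> J)" "\<And>J. \<not> J \<subseteq> I \<Longrightarrow> u J = 0"
          by metis
        define \<psi> where "\<psi> = (\<lambda>x J. u J x)"
        have cp: "cp \<psi> J = u J" for J by (simp add: cp_def \<psi>_def)
        have \<psi>: "\<psi> \<in> Fo" using u by (simp add: Fo_def cp)
        have "box \<psi> - form_scale ev \<psi> = \<phi>"
        proof (rule form_eqI)
          fix J show "cp (box \<psi> - form_scale ev \<psi>) J = cp \<phi> J"
          proof (cases "J \<subseteq> I")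
            case True
            have "fscale 2 (A (u J) - fscale (ev / 2 - of_real (shift J)) (u J)) = cp \<phi> J" unfolding u(2)[OF True] by simp
            then show ?thesis unfolding cp_simps box_formula[OF \<psi> True] cp
              by (simp add: fscale_def fun_eq_iff) (simp add: algebra_simps)
          next
            case False
            then show ?thesis using Fo_outside[OF box_in[OF \<psi>] False] Fo_outside[OF \<psi> False] Fo_outside[OF \<phi> False] by simp
          qed
        qed
        then show "\<phi> \<in> (\<lambda>\<psi>. box \<psi> - form_scale ev \<psi>) ` Fo" using \<psi> by blast
      qed
    qed
    then show False using nb by simp
  qed
next
  fix ev :: complex assume "ev \<in> {of_real (2 * level m) | m. True}"
  then obtain m where ev: "ev = of_real (2 * level m)" by blast
  obtain f where f: "f \<in> Ker (of_real (level m))" "f \<noteq> 0" using Ker_nontrivial by blast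
  have fS: "f \<in> S" using f by (simp add: Ker_def)
  \<comment> \<open>An eigenfunction of any level placed in the multi-index \<open>N\<close>, where
    the shift is zero.\<close>
  have \<psi>: "single N f \<in> Fo" by (rule single_in[OF fS N])
  have "shift N = 0" by (simp add: shift_def)
  then have "\<forall>J. J \<subseteq> I \<longrightarrow> cp (single N f) J \<in> Ker (ev / 2 - of_real (shift J))"
    using f(1) fun_space.subspace_0[OF Ker_subspace] by (simp add: cp_single ev)
  then have e: "box (single N f) = form_scale ev (single N f)" using box_eigen_iff[OF \<psi>] by blast
  have z: "0 \<in> Fo" by (rule form.subspace_0[OF Fo_subspace])
  have e0: "box 0 = form_scale ev 0" using box_eigen_iff[OF z] fun_space.subspace_0[OF Ker_subspace] by simp
  have "single N f \<noteq> 0"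
  proof
    assume "single N f = 0"
    then have "cp (single N f) N = 0" by simp
    then show False using f(2) by (simp add: cp_single)
  qed
  then have "\<not> inj_on (\<lambda>\<psi>. box \<psi> - form_scale ev \<psi>) Fo"
    using inj_onD[of "\<lambda>\<psi>. box \<psi> - form_scale ev \<psi>" Fo "single N f" 0] \<psi> z e e0 by auto
  then show "ev \<in> {ev. \<not> bij_betw (\<lambda>\<psi>. box \<psi> - form_scale ev \<psi>) Fo Fo}" by (simp add: bij_betw_def)
qed

lemma Ker_fam_basis: "\<exists>w. fam_basis fscale {..<d} w (Ker (of_real (level m)))"
proof -
  from Ker_iso[of m] obtain T where T: "bij_betw T (Ker 0) (Ker (of_real (level m)))"
    "\<And>f g. f \<in> Ker 0 \<Longrightarrow> g \<in> Ker 0 \<Longrightarrow> T (f + g) = T f + T g" "\<And>c f. f \<in> Ker 0 \<Longrightarrow> T (fscale c f) = fscale c (T f)" by blast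
  note sub = Ker_subspace[of 0]
  have K: "Ker 0 = {\<Sum>j\<in>{..<d}. fscale (c j) (kv j) | c. True}" and ind: "\<And>c. (\<Sum>j\<in>{..<d}. fscale (c j) (kv j)) = 0 \<Longrightarrow> \<forall>j\<in>{..<d}. c j = 0"
    using ker_basis unfolding fam_basis_def by blast+
  note kv = kv_in
  have z0: "0 \<in> Ker 0" by (rule fun_space.subspace_0[OF sub])
  have T0: "T 0 = 0" using T(3)[OF z0, of 0] by simp
  have Tsum: "T (\<Sum>j\<in>J. fscale (c j) (kv j)) = (\<Sum>j\<in>J. fscale (c j) (T (kv j)))" if "finite J" "J \<subseteq> {..<d}" for J c
    using that
  proof (induction J rule: finite_induct)
    case (insert j J)
    have "fscale (c j) (kv j) \<in> Ker 0" "(\<Sum>j\<in>J. fscale (c j) (kv j)) \<in> Ker 0" "kv j \<in> Ker 0"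
      using insert kv by (auto intro!: fun_space.subspace_sum[OF sub] fun_space.subspace_scale[OF sub])
    then show ?case using insert T(2)[of "fscale (c j) (kv j)" "\<Sum>j\<in>J. fscale (c j) (kv j)"] T(3)[of "kv j" "c j"]
      by (simp only: sum.insert[OF insert(1,2)]) simp
  qed (simp only: sum.empty T0)
  have "fam_basis fscale {..<d} (\<lambda>j. T (kv j)) (Ker (of_real (level m)))"
    unfolding fam_basis_def
  proof (intro conjI allI impI)
    show "finite {..<d}" by simp
    show "Ker (of_real (level m)) = {\<Sum>j<d. fscale (c j) (T (kv j)) |c. True}"
    proof safe
      fix f assume "f \<in> Ker (of_real (level m))"
      then obtain g where "g \<in> Ker 0" "f = T g" using T(1) by (auto simp: bij_betw_def)
      then show "\<exists>c. f = (\<Sum>j<d. fscale (c j) (T (kv j))) \<and> True" using K Tsum[of "{..<d}"] by auto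
    next
      fix c
      have "(\<Sum>j<d. fscale (c j) (kv j)) \<in> Ker 0" using K by blast
      then show "(\<Sum>j<d. fscale (c j) (T (kv j))) \<in> Ker (of_real (level m))"
        using Tsum[of "{..<d}" c] T(1) bij_betwE by fastforce
    qed
    fix c assume "(\<Sum>j<d. fscale (c j) (T (kv j))) = 0"
    then have "T (\<Sum>j<d. fscale (c j) (kv j)) = T 0" using Tsum[of "{..<d}" c] T0 by simp
    moreover have "(\<Sum>j<d. fscale (c j) (kv j)) \<in> Ker 0" using K by blast
    ultimately have "(\<Sum>j<d. fscale (c j) (kv j)) = 0" using T(1) z0 by (meson bij_betw_def inj_onD)
    then show "\<forall>j\<in>{..<d}. c j = 0" by (rule ind)
  qed
  then show ?thesis by blast
qed

section \<open>Dimensions of the eigenspaces\<close>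

definition eigenspace :: "(nat \<Rightarrow> nat) \<Rightarrow> nat \<Rightarrow> 'x form set" where
  "eigenspace m k = {\<psi> \<in> Fk k. box \<psi> = form_scale (of_real (2 * level m)) \<psi>}"

text \<open>The multi-indices for which one quantum can be taken from \<open>m\<close> at every
  index where \<open>J\<close> and \<open>N\<close> differ.\<close>

definition admissible :: "(nat \<Rightarrow> nat) \<Rightarrow> nat \<Rightarrow> nat set set" where
  "admissible m k = {J. J \<subseteq> I \<and> card J = k \<and> (J - N) \<union> (N - J) \<subseteq> {i. m i \<noteq> 0}}"

lemma finite_admissible: "finite (admissible m k)"
  by (rule finite_subset[of _ "Pow I"]) (auto simp: admissible_def)

text \<open>The coefficient at \<open>J\<close> is an eigenfunction of \<open>A\<close> for
  \<open>level m - shift J\<close>. If \<open>J\<close> is admissible this is the level of the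
  reduced occupation numbers, with a \<open>d\<close>-dimensional kernel; otherwise rational
  independence shows that it is no level at all and the coefficient vanishes.\<close>

theorem eigenspace_basis:
  "\<exists>v. fam_basis form_scale (admissible m k \<times> {..<d}) v (eigenspace m k)"
proof -
  \<comment> \<open>The subtraction of natural numbers is exact for admissible \<open>J\<close>,
    since there \<open>m i\<close> is at least one wherever a quantum is removed.\<close>
  define lo where "lo J = (\<lambda>i. m i - (if i \<in> (J - N) \<union> (N - J) then 1 else 0))" for J
  have lo: "of_real (2 * level m) / 2 - of_real (shift J) = complex_of_real (level (lo J))" if J: "J \<in> admissible m k" for J
  proof -
    have "level m = level (lo J) + (\<Sum>i\<in>I. if i \<in> (J - N) \<union> (N - J) then \<nu> i else 0)"
      unfolding level_def sum.distrib[symmetric]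
    proof (intro sum.cong refl)
      fix i
      have "i \<in> (J - N) \<union> (N - J) \<Longrightarrow> m i \<ge> 1" using J by (force simp: admissible_def)
      then show "real (m i) * \<nu> i = real (lo J i) * \<nu> i + (if i \<in> (J - N) \<union> (N - J) then \<nu> i else 0)"
        by (auto simp: lo_def of_nat_diff algebra_simps)
    qed
    also have "(\<Sum>i\<in>I. if i \<in> (J - N) \<union> (N - J) then \<nu> i else 0) = shift J"
      unfolding shift_def using J N fin by (intro sum.mono_neutral_cong_right) (auto simp: admissible_def)
    finally show ?thesis by (simp add: field_simps)
  qed
  have zero: "f = 0" if J: "J \<subseteq> I" "card J = k" "J \<notin> admissible m k" and f: "f \<in> Ker (of_real (2 * level m) / 2 - of_real (shift J))" for J f
  proof (rule ccontr)
    assume "f \<noteq> 0"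
    from Ker_eigen_exists[OF f this] obtain m' where "of_real (2 * level m) / 2 - of_real (shift J) = complex_of_real (level m')" by blast
    from level_shift[OF J(1) this] have eq: "level m = level (\<lambda>i. m' i + (if i \<in> (J - N) \<union> (N - J) then 1 else 0))" by (simp only: of_real_eq_iff mult_cancel_left) simp
    have "(J - N) \<union> (N - J) \<subseteq> {i. m i \<noteq> 0}"
    proof
      fix i assume i: "i \<in> (J - N) \<union> (N - J)"
      then have "i \<in> I" using J(1) N by auto
      from level_inj[OF eq this] i show "i \<in> {i. m i \<noteq> 0}" by auto
    qed
    then show False using J by (simp add: admissible_def)
  qed
  have "\<forall>J. \<exists>w. J \<in> admissible m k \<longrightarrow> fam_basis fscale {..<d} w (Ker (of_real (2 * level m) / 2 - of_real (shift J)))"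
    using Ker_fam_basis lo by metis
  then obtain w where w: "\<And>J. J \<in> admissible m k \<Longrightarrow> fam_basis fscale {..<d} (w J) (Ker (of_real (2 * level m) / 2 - of_real (shift J)))"
    by metis
  have Kw: "Ker (of_real (2 * level m) / 2 - of_real (shift J)) = {\<Sum>j<d. fscale (c j) (w J j) | c. True}" if "J \<in> admissible m k" for J
    using w[OF that] unfolding fam_basis_def by (elim conjE)
  define v where "v p = single (fst p) (w (fst p) (snd p))" for p
  have cpsum: "cp (\<Sum>p\<in>admissible m k \<times> {..<d}. form_scale (c p) (v p)) J = (if J \<in> admissible m k then \<Sum>j<d. fscale (c (J, j)) (w J j) else 0)" for c J
  proof -
    have "cp (\<Sum>p\<in>admissible m k \<times> {..<d}. form_scale (c p) (v p)) J = (\<Sum>p\<in>admissible m k \<times> {..<d}. if fst p = J then fscale (c p) (w J (snd p)) else 0)"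
      unfolding cp_sum by (intro sum.cong refl) (auto simp: v_def cp_single)
    also have "\<dots> = (\<Sum>K\<in>admissible m k. \<Sum>j<d. if K = J then fscale (c (K, j)) (w J j) else 0)"
      unfolding sum.cartesian_product by (intro sum.cong refl) (auto split: prod.splits)
    also have "\<dots> = (\<Sum>K\<in>admissible m k. if K = J then (\<Sum>j<d. fscale (c (J, j)) (w J j)) else 0)"
      by (intro sum.cong refl) auto
    also have "\<dots> = (if J \<in> admissible m k then \<Sum>j<d. fscale (c (J, j)) (w J j) else 0)"
      using finite_admissible by simp
    finally show ?thesis .
  qed
  have "fam_basis form_scale (admissible m k \<times> {..<d}) v (eigenspace m k)"
    unfolding fam_basis_def
  proof (intro conjI allI impI)
    show "finite (admissible m k \<times> {..<d})" using finite_admissible by simp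
    show "eigenspace m k = {\<Sum>p\<in>admissible m k \<times> {..<d}. form_scale (c p) (v p) |c. True}"
    proof (intro set_eqI iffI)
      fix \<psi> assume "\<psi> \<in> eigenspace m k"
      then have \<psi>: "\<psi> \<in> Fk k" "\<psi> \<in> Fo" "box \<psi> = form_scale (of_real (2 * level m)) \<psi>" by (auto simp: eigenspace_def Fk_def)
      have ker: "cp \<psi> J \<in> Ker (of_real (2 * level m) / 2 - of_real (shift J))" if "J \<subseteq> I" for J
        using box_eigen_iff[OF \<psi>(2)] \<psi>(3) that by blast
      have "\<exists>c. J \<in> admissible m k \<longrightarrow> cp \<psi> J = (\<Sum>j<d. fscale (c j) (w J j))" for J
      proof (cases "J \<in> admissible m k")
        case True
        then have "cp \<psi> J \<in> {\<Sum>j<d. fscale (c j) (w J j) | c. True}"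
          unfolding Kw[OF True, symmetric] by (intro ker) (simp add: admissible_def)
        then show ?thesis by blast
      qed simp
      then obtain c where c: "\<And>J. J \<in> admissible m k \<Longrightarrow> cp \<psi> J = (\<Sum>j<d. fscale (c J j) (w J j))" by metis
      have "\<psi> = (\<Sum>p\<in>admissible m k \<times> {..<d}. form_scale (c (fst p) (snd p)) (v p))"
      proof (rule form_eqI)
        fix J
        have "cp \<psi> J = 0" if "J \<notin> admissible m k"
        proof (cases "J \<subseteq> I \<and> card J = k")
          case True then show ?thesis using zero[OF _ _ that ker] by blast
        next
          case False then show ?thesis using \<psi>(1) Fo_outside[OF \<psi>(2)] by (auto simp: Fk_def)
        qed
        then show "cp \<psi> J = cp (\<Sum>p\<in>admissible m k \<times> {..<d}. form_scale (c (fst p) (snd p)) (v p)) J"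
          unfolding cpsum using c by simp
      qed
      then show "\<psi> \<in> {\<Sum>p\<in>admissible m k \<times> {..<d}. form_scale (c p) (v p) |c. True}"
        by (intro CollectI exI[of _ "\<lambda>p. c (fst p) (snd p)"] conjI TrueI)
    next
      fix \<psi> assume "\<psi> \<in> {\<Sum>p\<in>admissible m k \<times> {..<d}. form_scale (c p) (v p) |c. True}"
      then obtain c where \<psi>: "\<psi> = (\<Sum>p\<in>admissible m k \<times> {..<d}. form_scale (c p) (v p))" by blast
      have in1: "(\<Sum>j<d. fscale (c (J, j)) (w J j)) \<in> Ker (of_real (2 * level m) / 2 - of_real (shift J))" if "J \<in> admissible m k" for J
        unfolding Kw[OF that] by (intro CollectI exI[of _ "\<lambda>j. c (J, j)"] conjI refl TrueI)
      have kerJ: "cp \<psi> J \<in> Ker (of_real (2 * level m) / 2 - of_real (shift J))" for J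
        unfolding \<psi> cpsum using in1 fun_space.subspace_0[OF Ker_subspace] by auto
      have Fo: "\<psi> \<in> Fo" unfolding Fo_def
      proof (intro CollectI conjI allI impI)
        show "cp \<psi> J \<in> S" for J using kerJ by (simp add: Ker_def)
        show "cp \<psi> J = 0" if "\<not> J \<subseteq> I" for J using that unfolding \<psi> cpsum by (auto simp: admissible_def)
      qed
      moreover have "cp \<psi> J = 0" if "card J \<noteq> k" for J using that unfolding \<psi> cpsum by (auto simp: admissible_def)
      ultimately show "\<psi> \<in> eigenspace m k" using box_eigen_iff[OF Fo] kerJ by (simp add: eigenspace_def Fk_def)
    qed
    fix c assume z: "(\<Sum>p\<in>admissible m k \<times> {..<d}. form_scale (c p) (v p)) = 0"
    show "\<forall>p\<in>admissible m k \<times> {..<d}. c p = 0"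
    proof
      fix p assume p: "p \<in> admissible m k \<times> {..<d}"
      obtain J j where pj: "p = (J, j)" by force
      have z1: "(\<Sum>j<d. fscale (c (J, j)) (w J j)) = 0" using cpsum[of c J] z p pj by simp
      have "\<And>c. (\<Sum>j<d. fscale (c j) (w J j)) = 0 \<Longrightarrow> \<forall>j\<in>{..<d}. c j = 0"
        using w[of J] p pj unfolding fam_basis_def by simp
      from this[of "\<lambda>j. c (J, j)", OF z1] have "\<forall>j\<in>{..<d}. c (J, j) = 0" .
      then show "c p = 0" using p pj by auto
    qed
  qed
  then show ?thesis by blast
qed

text \<open>Where \<open>m i = 0\<close> the membership of \<open>i\<close> in \<open>J\<close> must
  agree with that in \<open>N\<close>; elsewhere it is free. So \<open>J\<close> is the forced part
  \<open>Z\<close> together with an arbitrary subset of \<open>M\<close> of the remaining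
  size.\<close>

lemma card_admissible:
  "card (admissible m k) = (let a = card {i\<in>I. m i \<noteq> 0}; b = card {i\<in>N. m i = 0} in if b \<le> k then a choose (k - b) else 0)"
proof -
  define M where "M = {i\<in>I. m i \<noteq> 0}"
  define Z where "Z = {i\<in>N. m i = 0}"
  have finM: "finite M" and finZ: "finite Z" and disj: "M \<inter> Z = {}" unfolding M_def Z_def using finite_sub[OF N] by auto
  have char: "J \<in> admissible m k \<longleftrightarrow> (\<exists>T. T \<subseteq> M \<and> J = Z \<union> T \<and> card T + card Z = k)" for J
  proof
    assume J: "J \<in> admissible m k"
    have JI: "J \<subseteq> I" using J by (simp add: admissible_def)
    have "J = Z \<union> (J \<inter> M)" using J N by (auto simp: admissible_def M_def Z_def)
    moreover have "card J = card (J \<inter> M) + card Z"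
      by (subst \<open>J = Z \<union> (J \<inter> M)\<close>, subst card_Un_disjoint) (use finM finZ disj in auto)
    ultimately show "\<exists>T. T \<subseteq> M \<and> J = Z \<union> T \<and> card T + card Z = k"
      using J by (intro exI[of _ "J \<inter> M"]) (auto simp: admissible_def)
  next
    assume "\<exists>T. T \<subseteq> M \<and> J = Z \<union> T \<and> card T + card Z = k"
    then obtain T where T: "T \<subseteq> M" "J = Z \<union> T" "card T + card Z = k" by blast
    have "card J = k" unfolding T(2) using T finM finZ disj by (subst card_Un_disjoint) (auto intro: finite_subset)
    then show "J \<in> admissible m k" using T N by (auto simp: admissible_def M_def Z_def)
  qed
  show ?thesis
  proof (cases "card Z \<le> k")
    case True
    have "admissible m k = (\<lambda>T. Z \<union> T) ` {T. T \<subseteq> M \<and> card T = k - card Z}"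
    proof (intro set_eqI iffI)
      fix J assume "J \<in> admissible m k"
      then obtain T where "T \<subseteq> M" "J = Z \<union> T" "card T + card Z = k" using char by blast
      then show "J \<in> (\<lambda>T. Z \<union> T) ` {T. T \<subseteq> M \<and> card T = k - card Z}" by auto
    next
      fix J assume "J \<in> (\<lambda>T. Z \<union> T) ` {T. T \<subseteq> M \<and> card T = k - card Z}"
      then obtain T where "T \<subseteq> M" "card T = k - card Z" "J = Z \<union> T" by blast
      then have "T \<subseteq> M \<and> J = Z \<union> T \<and> card T + card Z = k" using True by simp
      then show "J \<in> admissible m k" using char by (intro iffD2[OF char] exI[of _ T])
    qed
    moreover have "inj_on (\<lambda>T. Z \<union> T) {T. T \<subseteq> M \<and> card T = k - card Z}" using disj by (intro inj_onI) blast
    ultimately have "card (admissible m k) = card M choose (k - card Z)" by (simp add: card_image n_subsets[OF finM])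
    then show ?thesis using True by (simp add: M_def Z_def Let_def)
  next
    case False
    then have "admissible m k = {}" using char by fastforce
    then show ?thesis using False by (simp add: Z_def Let_def)
  qed
qed

section \<open>Hodge theory and cohomology\<close>

definition cocycles :: "nat \<Rightarrow> 'x form set" where "cocycles k = {\<psi> \<in> Fk k. dK \<psi> = 0}"
definition coboundaries :: "nat \<Rightarrow> 'x form set" where "coboundaries k = (if k = 0 then {0} else dK ` Fk (k - 1))"

text \<open>Pairing \<open>box \<psi>\<close> with \<open>\<psi>\<close> gives the sum of the
  squared norms of \<open>dKs \<psi>\<close> and \<open>dK \<psi>\<close>.\<close>

lemma harmonic:
  assumes "\<psi> \<in> Fo" "box \<psi> = 0" shows "dK \<psi> = 0" "dKs \<psi> = 0"
proof -
  have "IP (dK (dKs \<psi>)) \<psi> + IP (dKs (dK \<psi>)) \<psi> = IP (box \<psi>) \<psi>"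
    unfolding box_def by (rule IP_add[symmetric]) (intro dK_in dKs_in assms)+
  also have "\<dots> = 0" using assms IP_zero by simp
  finally have "IP (dKs \<psi>) (dKs \<psi>) + IP (dK \<psi>) (dK \<psi>) = 0"
    unfolding IP_dK[OF dKs_in[OF assms(1)] assms(1)] IP_dKs[OF dK_in[OF assms(1)] assms(1)] .
  then have "Re (IP (dKs \<psi>) (dKs \<psi>)) + Re (IP (dK \<psi>) (dK \<psi>)) = 0" by (metis plus_complex.sel(1) zero_complex.sel(1))
  then show "dK \<psi> = 0" "dKs \<psi> = 0"
    using IP_nonneg[OF dK_in[OF assms(1)]] IP_nonneg[OF dKs_in[OF assms(1)]]
    by (auto intro!: IP_eq_0 dK_in dKs_in assms)
qed

text \<open>The diagonal form of \<open>box\<close> reduces this to one equation per multi-index,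
  solved by \<open>Ker_range_decomposition\<close> at the parameter \<open>- shift J\<close>.
  Multi-indices of the wrong size receive zero, which preserves the degree.\<close>

lemma harmonic_decomposition:
  assumes \<psi>: "\<psi> \<in> Fk k" shows "\<exists>h\<in>Fk k. \<exists>\<eta>\<in>Fk k. box h = 0 \<and> \<psi> = h + box \<eta>"
proof -
  have Fo: "\<psi> \<in> Fo" using \<psi> by (simp add: Fk_def)
  have "\<exists>f u. f \<in> S \<and> u \<in> S \<and> (J \<subseteq> I \<longrightarrow> f \<in> Ker (0 / 2 - of_real (shift J)) \<and> cp \<psi> J = f + fscale 2 (A u + fscale (of_real (shift J)) u)) \<and> (\<not> (J \<subseteq> I \<and> card J = k) \<longrightarrow> f = 0 \<and> u = 0)" for J
  proof (cases "J \<subseteq> I \<and> card J = k")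
    case True
    obtain f u where fu: "f \<in> Ker (0 / 2 - of_real (shift J))" "u \<in> S" "cp \<psi> J = f + (A u - fscale (0 / 2 - of_real (shift J)) u)"
      using Ker_range_decomposition[where f = "cp \<psi> J" and c = "0 / 2 - of_real (shift J)"] Fo_S[OF Fo] by blast
    have "A u - fscale (0 / 2 - of_real (shift J)) u = fscale 2 (A (fscale (1/2) u) + fscale (of_real (shift J)) (fscale (1/2) u))"
      unfolding A_scale[OF fu(2)] by (simp add: fscale_def fun_eq_iff)
    then show ?thesis using fu True by (intro exI[of _ f] exI[of _ "fscale (1/2) u"]) (auto simp: Ker_def)
  next
    case False
    then have "cp \<psi> J = 0" using \<psi> Fo_outside[OF Fo] by (auto simp: Fk_def)
    then show ?thesis using False fun_space.subspace_0[OF Ker_subspace] by (intro exI[of _ 0]) auto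
  qed
  then obtain f u where fu: "\<And>J. f J \<in> S" "\<And>J. u J \<in> S" "\<And>J. J \<subseteq> I \<Longrightarrow> f J \<in> Ker (0 / 2 - of_real (shift J))"
    "\<And>J. J \<subseteq> I \<Longrightarrow> cp \<psi> J = f J + fscale 2 (A (u J) + fscale (of_real (shift J)) (u J))" "\<And>J. \<not> (J \<subseteq> I \<and> card J = k) \<Longrightarrow> f J = 0 \<and> u J = 0"
    by metis
  define h where "h = (\<lambda>x J. f J x)"
  define \<eta> where "\<eta> = (\<lambda>x J. u J x)"
  have cp: "cp h J = f J" "cp \<eta> J = u J" for J by (simp_all add: cp_def h_def \<eta>_def)
  have hF: "h \<in> Fk k" "\<eta> \<in> Fk k" using fu(1,2,5) by (auto simp: Fk_def Fo_def cp)
  then have hFo: "h \<in> Fo" "\<eta> \<in> Fo" by (auto simp: Fk_def)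
  have "box h = form_scale 0 h" using box_eigen_iff[OF hFo(1), of 0] fu(3) cp by simp
  then have "box h = 0" by simp
  moreover have "\<psi> = h + box \<eta>"
  proof (rule form_eqI)
    fix J show "cp \<psi> J = cp (h + box \<eta>) J"
    proof (cases "J \<subseteq> I")
      case True then show ?thesis using fu(4) by (simp add: box_formula[OF hFo(2) True] cp)
    next
      case False then show ?thesis using Fo_outside[OF Fo] Fo_outside[OF hFo(1)] Fo_outside[OF box_in[OF hFo(2)]] by simp
    qed
  qed
  ultimately show ?thesis using hF by blast
qed

text \<open>Each class has exactly one harmonic representative, and harmonic forms are the
  eigenspace with no quanta.\<close>

theorem cohomology:
  "(THE D. \<exists>B. finite B \<and> card B = D \<and> quotient_basis (cocycles k) (coboundaries k) B) = card (admissible (\<lambda>_. 0) k) * d"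
proof -
  obtain v where v: "fam_basis form_scale (admissible (\<lambda>_. 0) k \<times> {..<d}) v (eigenspace (\<lambda>_. 0) k)" using eigenspace_basis by blast
  have H: "eigenspace (\<lambda>_. 0) k = {\<psi> \<in> Fk k. box \<psi> = 0}" by (simp add: eigenspace_def level_def)
  have FkFo: "\<psi> \<in> Fk k \<Longrightarrow> \<psi> \<in> Fo" for \<psi> k by (simp add: Fk_def)
  have "(THE D. \<exists>B. finite B \<and> card B = D \<and> quotient_basis (cocycles k) (coboundaries k) B) = card (admissible (\<lambda>_. 0) k \<times> {..<d})"
  proof (rule quotient_dimension[OF _ _ _ _ _ v])
    have dK0: "dK 0 = 0" using dK_scale[OF form.subspace_0[OF Fo_subspace], of 0] by simp
    show "form.subspace (cocycles k)"
      unfolding form.subspace_def cocycles_def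
      using form.subspace_0[OF Fk_subspace] form.subspace_add[OF Fk_subspace] form.subspace_scale[OF Fk_subspace] dK0
      by (auto simp: dK_add dK_scale FkFo)
    show "form.subspace (coboundaries k)"
    proof (cases "k = 0")
      case False
      show ?thesis unfolding form.subspace_def
      proof (intro conjI ballI allI)
        have "dK 0 \<in> dK ` Fk (k - 1)" by (intro imageI form.subspace_0[OF Fk_subspace])
        then show "0 \<in> coboundaries k" using dK0 False by (simp add: coboundaries_def)
        fix x assume "x \<in> coboundaries k"
        then obtain x' where x': "x' \<in> Fk (k - 1)" "x = dK x'" using False by (auto simp: coboundaries_def)
        show "form_scale c x \<in> coboundaries k" for c
          using False x' imageI[OF form.subspace_scale[OF Fk_subspace x'(1), of c], of dK] dK_scale[OF FkFo[OF x'(1)], of c] by (simp add: coboundaries_def)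
        fix y assume "y \<in> coboundaries k"
        then obtain y' where y': "y' \<in> Fk (k - 1)" "y = dK y'" using False by (auto simp: coboundaries_def)
        have "x + y = dK (x' + y')" using x' y' by (simp only: dK_add[OF FkFo FkFo])
        then show "x + y \<in> coboundaries k"
          using False form.subspace_add[OF Fk_subspace x'(1) y'(1)] by (simp add: coboundaries_def)
      qed
    qed (simp add: coboundaries_def)
    show "eigenspace (\<lambda>_. 0) k \<subseteq> cocycles k" unfolding H cocycles_def using harmonic(1) FkFo by auto
    show "h = 0" if h: "h \<in> eigenspace (\<lambda>_. 0) k" "h \<in> coboundaries k" for h
    proof (cases "k = 0")
      case True then show ?thesis using h(2) by (simp add: coboundaries_def)
    next
      case False
      then obtain y where y: "y \<in> Fk (k - 1)" "h = dK y" using h(2) by (auto simp: coboundaries_def)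
      have hF: "h \<in> Fo" "box h = 0" using h(1) FkFo unfolding H by auto
      have "IP h h = IP y (dKs h)" using IP_dK[OF FkFo[OF y(1)] hF(1)] y(2) by simp
      also have "\<dots> = 0" using harmonic(2)[OF hF] IP_zero(2)[OF FkFo[OF y(1)]] by simp
      finally show ?thesis by (intro IP_eq_0[OF hF(1)]) simp
    qed
    show "\<exists>h\<in>eigenspace (\<lambda>_. 0) k. w - h \<in> coboundaries k" if w: "w \<in> cocycles k" for w
    proof -
      have wk: "w \<in> Fk k" "dK w = 0" using w by (auto simp: cocycles_def)
      from harmonic_decomposition[OF wk(1)] obtain h \<eta> where h: "h \<in> Fk k" "\<eta> \<in> Fk k" "box h = 0" "w = h + box \<eta>" by blast
      note Fo = FkFo[OF h(1)] FkFo[OF h(2)]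
      \<comment> \<open>The coexact part of \<open>w\<close>. It is closed because \<open>w\<close>,
        \<open>h\<close> and the exact part are closed, and a closed form in the image of
        \<open>dKs\<close> is orthogonal to itself.\<close>
      let ?x = "dKs (dK \<eta>)"
      have xF: "?x \<in> Fo" by (intro dKs_in dK_in Fo)
      have "0 = dK h + (dK (dK (dKs \<eta>)) + dK ?x)"
        using wk(2) unfolding h(4) box_def
        by (simp only: dK_add[OF Fo(1) form.subspace_add[OF Fo_subspace dK_in[OF dKs_in[OF Fo(2)]] xF]] dK_add[OF dK_in[OF dKs_in[OF Fo(2)]] xF])
      then have dx: "dK ?x = 0" using harmonic(1)[OF Fo(1) h(3)] dK_dK[OF dKs_in[OF Fo(2)]] by simp
      have "IP ?x ?x = IP (dK \<eta>) (dK ?x)" by (rule IP_dKs[OF dK_in[OF Fo(2)] xF])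
      also have "\<dots> = 0" unfolding dx by (rule IP_zero(2)[OF dK_in[OF Fo(2)]])
      finally have "?x = 0" by (intro IP_eq_0[OF xF]) simp
      then have wh: "w - h = dK (dKs \<eta>)" unfolding h(4) box_def by simp
      have "w - h \<in> coboundaries k"
      proof (cases k)
        case 0
        then have "dKs \<eta> = 0" using h(2) dKs_F0 by simp
        then show ?thesis unfolding wh using 0 dK0 by (simp add: coboundaries_def)
      next
        case (Suc k')
        then show ?thesis unfolding wh using dKs_Fk[of \<eta> k'] h(2) by (simp add: coboundaries_def)
      qed
      then show ?thesis using h unfolding H by blast
    qed
  qed
  then show ?thesis by (simp add: card_cartesian_product)
qed

end

section \<open>Lattices and hermitian forms\<close>

interpretation int_module: module "int_scale :: int \<Rightarrow> 'v::real_vector \<Rightarrow> 'v"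
  by unfold_locales (simp_all add: scaleR_add_right scaleR_add_left)

lemma discrete_subgroup_uniform_discrete:
  fixes U :: "'v::real_normed_vector set"
  assumes "discrete U" "0 \<in> U" "\<And>u v. u \<in> U \<Longrightarrow> v \<in> U \<Longrightarrow> u - v \<in> U"
  shows "uniform_discrete U"
proof -
  obtain r where r: "r > 0" "\<And>u. u \<in> U \<Longrightarrow> dist 0 u < r \<Longrightarrow> u = 0"
    using discreteD[OF assms(1,2)] unfolding isolated_in_dist_Ex_iff by blast
  have "u = v" if "u \<in> U" "v \<in> U" "dist u v < r" for u v
    using r(2)[OF assms(3)[OF that(1,2)]] that(3) by (simp add: dist_norm norm_minus_commute)
  then show ?thesis unfolding uniform_discrete_def using r(1) by blast
qed

text \<open>If \<open>b\<close> were a real combination of the other generators, rounding down the coefficients of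
  the multiples \<open>k b\<close> would give infinitely many elements of \<open>U\<close> in a bounded set.\<close>

lemma discrete_independent:
  fixes B :: "'v::euclidean_space set"
  assumes d: "discrete (int_module.span B)" and fin: "finite B" and ind: "int_module.independent B"
  shows "independent B"
proof -
  \<comment> \<open>A maximal part of \<open>B\<close> that is independent over the reals; the aim
    is that nothing of \<open>B\<close> is left over.\<close>
  obtain C where C: "C \<subseteq> B" "independent C" "B \<subseteq> span C"
    using real_vector.maximal_independent_subset by blast
  have finC: "finite C" using C(1) fin finite_subset by blast
  have "B \<subseteq> C"
  proof (rule ccontr)
    assume "\<not> B \<subseteq> C"
    then obtain b where b: "b \<in> B" "b \<notin> C" by blast
    then obtain r where r: "b = (\<Sum>c\<in>C. r c *\<^sub>R c)" using C(3) unfolding real_vector.span_finite[OF finC] by blast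
    define w where "w k = of_int k *\<^sub>R b - (\<Sum>c\<in>C. of_int \<lfloor>of_int k * r c\<rfloor> *\<^sub>R c)" for k :: int
    have wU: "w k \<in> int_module.span B" for k
      unfolding w_def using C(1) b(1)
      by (intro int_module.span_diff int_module.span_sum int_module.span_scale int_module.span_base) auto
    have wb: "norm (w k) \<le> (\<Sum>c\<in>C. norm c)" for k
    proof -
      have "w k = (\<Sum>c\<in>C. (of_int k * r c - of_int \<lfloor>of_int k * r c\<rfloor>) *\<^sub>R c)"
        unfolding w_def by (subst r) (simp add: scaleR_sum_right sum_subtractf scaleR_diff_left)
      also have "norm \<dots> \<le> (\<Sum>c\<in>C. norm ((of_int k * r c - of_int \<lfloor>of_int k * r c\<rfloor>) *\<^sub>R c))" by (rule norm_sum)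
      also have "\<dots> \<le> (\<Sum>c\<in>C. norm c)"
      proof (rule sum_mono)
        fix c
        have "\<bar>of_int k * r c - of_int \<lfloor>of_int k * r c\<rfloor>\<bar> \<le> 1" by linarith
        then show "norm ((of_int k * r c - of_int \<lfloor>of_int k * r c\<rfloor>) *\<^sub>R c) \<le> norm c"
          by (simp add: mult_left_le_one_le)
      qed
      finally show ?thesis .
    qed
    have "uniform_discrete (int_module.span B)"
      by (rule discrete_subgroup_uniform_discrete[OF d int_module.span_zero int_module.span_diff])
    then have ud: "uniform_discrete (range w)" by (rule uniform_discrete_subset) (use wU in blast)
    have "bounded (range w)" unfolding bounded_iff using wb by blast
    then have "finite (range w)" using ud uniform_discrete_finite_iff by blast
    then have "\<not> inj w" using finite_imageD[of w UNIV] by (auto simp: infinite_UNIV_int)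
    then obtain k l where kl: "w k = w l" "k \<noteq> l" by (auto simp: inj_def)
    \<comment> \<open>The integer relation expressed by \<open>w k = w l\<close>; it is nontrivial
      because its coefficient at \<open>b\<close> is \<open>k - l\<close>.\<close>
    define u where "u = (\<lambda>c. if c = b then k - l else \<lfloor>of_int l * r c\<rfloor> - \<lfloor>of_int k * r c\<rfloor>)"
    have "(\<Sum>c\<in>insert b C. int_scale (u c) c) = w k - w l"
    proof -
      have "(\<Sum>c\<in>C. int_scale (u c) c) = (\<Sum>c\<in>C. of_int \<lfloor>of_int l * r c\<rfloor> *\<^sub>R c - of_int \<lfloor>of_int k * r c\<rfloor> *\<^sub>R c)"
        using b(2) by (intro sum.cong refl) (auto simp: u_def scaleR_diff_left)
      moreover have "int_scale (u b) b = of_int k *\<^sub>R b - of_int l *\<^sub>R b" by (simp add: u_def scaleR_diff_left)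
      ultimately show ?thesis using b(2) finC by (simp add: w_def sum_subtractf)
    qed
    also have "\<dots> = 0" using kl by simp
    finally have "int_module.dependent (insert b C)"
      using kl(2) finC by (subst int_module.dependent_finite) (auto simp: u_def intro!: exI[of _ u])
    then show False using ind int_module.dependent_mono[of "insert b C" B] C(1) b(1) by blast
  qed
  then show ?thesis using C by (metis subset_antisym)
qed

text \<open>The \<open>2 * n\<close> generators are independent over the reals, so together with the
  assumed bound the dimension is exactly \<open>2 * n\<close> and the generators span.\<close>

lemma is_lattice_obtain:
  fixes U :: "'v::complex_euclidean_space set"
  assumes "is_lattice n U" "DIM('v) \<le> 2 * n"
  obtains B where "lattice B U" "DIM('v) = 2 * n"
proof -
  obtain B where B: "discrete U" "finite B" "card B = 2 * n" "int_module.independent B" "int_module.span B = U"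
    using assms(1) unfolding is_lattice_def by blast
  have ind: "independent B" using discrete_independent B by blast
  have "2 * n \<le> DIM('v)" using independent_bound[OF ind] B(3) by simp
  then have eq: "DIM('v) = 2 * n" using assms(2) by simp
  have "(UNIV :: 'v set) \<subseteq> span B" using ind B(3) eq by (intro card_ge_dim_independent) auto
  then have "lattice B U"
    using ind B(5) by unfold_locales (auto simp: int_module.span_finite[OF B(2)])
  then show ?thesis using that eq by blast
qed

text \<open>Finite complex dimension is derived from the real one: the real span of a set is
  contained in its complex span, so \<open>Basis\<close> spans. Then counting applies.\<close>

lemma complex_independent_spans:
  fixes B :: "'v::complex_euclidean_space set"
  assumes "complex_space.independent B" "finite B" "card B = complex_space.dim (UNIV :: 'v set)"
  shows "complex_space.span B = UNIV"
proof -
  have sub: "span X \<subseteq> complex_space.span X" for X :: "'v set"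
    by (rule real_vector.span_minimal)
       (auto simp: real_vector.subspace_def scaleC_of_real[symmetric]
        intro: complex_space.span_base complex_space.span_zero complex_space.span_add complex_space.span_scale)
  obtain C :: "'v set" where C: "complex_space.independent C" "UNIV \<subseteq> complex_space.span C"
    using complex_space.maximal_independent_subset by blast
  have "finite C"
    using complex_space.independent_span_bound[of "Basis :: 'v set" C] C(1) sub[of Basis] by auto
  interpret finite_dimensional_vector_space "scaleC :: complex \<Rightarrow> 'v \<Rightarrow> 'v" C
    using \<open>finite C\<close> C by unfold_locales auto
  show ?thesis using card_ge_dim_independent[of B UNIV] assms by auto
qed

locale hermitian =
  fixes H :: "'v::complex_euclidean_space \<Rightarrow> 'v \<Rightarrow> complex"
  assumes hermitian: "hermitian_form H"
begin

lemma add_left: "H (x + y) z = H x z + H y z" and scaleC_left: "H (c *\<^sub>C x) z = c * H x z" and sym: "H y x = cnj (H x y)"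
  using hermitian unfolding hermitian_form_def by blast+

lemma add_right: "H x (y + z) = H x y + H x z"
  using sym[of x "y + z"] sym[of x y] sym[of x z] by (simp add: add_left)
lemma scaleC_right: "H x (c *\<^sub>C y) = cnj c * H x y"
  using sym[of x "c *\<^sub>C y"] sym[of x y] by (simp add: scaleC_left)
lemma scaleR: "H (r *\<^sub>R x) z = of_real r * H x z" "H x (r *\<^sub>R z) = of_real r * H x z"
  by (simp_all add: scaleC_of_real[symmetric] scaleC_left scaleC_right)
lemma zero [simp]: "H 0 z = 0" "H z 0 = 0"
  using scaleR(1)[of 0 0 z] scaleR(2)[of z 0 0] by simp_all
lemma diff_left: "H (x - y) z = H x z - H y z"
  using add_left[of "x - y" y z] by simp
lemma sum_left: "H (\<Sum>i\<in>J. f i) z = (\<Sum>i\<in>J. H (f i) z)"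
  by (induction J rule: infinite_finite_induct) (simp_all add: add_left)
lemma sum_right: "H z (\<Sum>i\<in>J. f i) = (\<Sum>i\<in>J. H z (f i))"
  by (induction J rule: infinite_finite_induct) (simp_all add: add_right)
lemma real_diagonal: "H z z = of_real (Re (H z z))"
  using sym[of z z] by (simp add: complex_eq_iff)

lemma bounded_bilinear: "bounded_bilinear H"
  unfolding bilinear_conv_bounded_bilinear[symmetric] bilinear_def
  by (auto intro!: linearI simp: add_left add_right scaleR scaleR_conv_of_real)

lemma bounded_bilinear_Im: "bounded_bilinear (\<lambda>x y. Im (H x y))"
  unfolding bilinear_conv_bounded_bilinear[symmetric] bilinear_def
  by (auto intro!: linearI simp: add_left add_right scaleR)

end

section \<open>Gauge transformation\<close>

definition gauge :: "('x \<Rightarrow> complex) \<Rightarrow> ('x \<Rightarrow> complex) \<Rightarrow> 'x \<Rightarrow> complex" where "gauge \<gamma> f = (\<lambda>x. \<gamma> x * f x)"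

lemma gauge_simps:
  "gauge \<gamma> (f + k) = gauge \<gamma> f + gauge \<gamma> k" "gauge \<gamma> (fscale c f) = fscale c (gauge \<gamma> f)" "gauge \<gamma> 0 = 0"
  "gauge \<gamma> (f - k) = gauge \<gamma> f - gauge \<gamma> k"
  by (auto simp: gauge_def fun_eq_iff fscale_def algebra_simps)

lemma gauge_sum: "gauge \<gamma> (\<Sum>i\<in>J. f i) = (\<Sum>i\<in>J. gauge \<gamma> (f i))"
  by (auto simp: gauge_def fun_eq_iff sum_fun_apply sum_distrib_left)

lemma gauge_inverse:
  assumes "\<And>x. \<gamma> x \<noteq> 0"
  shows "gauge \<gamma> (gauge (\<lambda>x. 1 / \<gamma> x) f) = f" "gauge (\<lambda>x. 1 / \<gamma> x) (gauge \<gamma> f) = f"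
  using assms by (auto simp: gauge_def fun_eq_iff)

context ladder
begin

text \<open>Conjugation by a nowhere vanishing function preserves all identities. The product is
  pulled back along with the operators, so adjointness and positivity are carried over as
  well.\<close>

lemma ladder_gauge:
  assumes \<gamma>: "\<And>x. \<gamma> x \<noteq> 0"
  defines "\<gamma>' \<equiv> \<lambda>x. 1 / \<gamma> x"
  shows "ladder {f. gauge \<gamma> f \<in> S} (\<lambda>i f. gauge \<gamma>' (b i (gauge \<gamma> f))) (\<lambda>i f. gauge \<gamma>' (bs i (gauge \<gamma> f))) \<nu> I
    (\<lambda>f g. ip (gauge \<gamma> f) (gauge \<gamma> g))"
proof -
  note inv = gauge_inverse[of \<gamma>, OF \<gamma>, folded \<gamma>'_def]
  show ?thesis
  proof
    fix i j f f' h and c :: complex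
    show "finite I" by (rule fin)
    show "fun_space.subspace {f. gauge \<gamma> f \<in> S}"
      unfolding fun_space.subspace_def mem_Collect_eq gauge_simps by (intro conjI ballI allI S_closed; simp)
    assume i: "i \<in> I"
    show "\<nu> i > 0" by (rule \<nu>_pos[OF i])
    assume "f \<in> {f. gauge \<gamma> f \<in> S}"
    then have f: "gauge \<gamma> f \<in> S" by simp
    show "gauge \<gamma>' (b i (gauge \<gamma> f)) \<in> {f. gauge \<gamma> f \<in> S}" using b_in[OF i f] by (simp add: inv)
    show "gauge \<gamma>' (bs i (gauge \<gamma> f)) \<in> {f. gauge \<gamma> f \<in> S}" using bs_in[OF i f] by (simp add: inv)
    show "gauge \<gamma>' (b i (gauge \<gamma> (fscale c f))) = fscale c (gauge \<gamma>' (b i (gauge \<gamma> f)))"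
      "gauge \<gamma>' (bs i (gauge \<gamma> (fscale c f))) = fscale c (gauge \<gamma>' (bs i (gauge \<gamma> f)))"
      by (simp_all only: gauge_simps b_scale[OF i f] bs_scale[OF i f])
    { assume "f' \<in> {f. gauge \<gamma> f \<in> S}"
      then have f': "gauge \<gamma> f' \<in> S" by simp
      show "gauge \<gamma>' (b i (gauge \<gamma> (f + f'))) = gauge \<gamma>' (b i (gauge \<gamma> f)) + gauge \<gamma>' (b i (gauge \<gamma> f'))"
        "gauge \<gamma>' (bs i (gauge \<gamma> (f + f'))) = gauge \<gamma>' (bs i (gauge \<gamma> f)) + gauge \<gamma>' (bs i (gauge \<gamma> f'))"
        by (simp_all only: gauge_simps b_add[OF i f f'] bs_add[OF i f f'])
      show "ip (gauge \<gamma> (gauge \<gamma>' (b i (gauge \<gamma> f)))) (gauge \<gamma> f') = ip (gauge \<gamma> f) (gauge \<gamma> (gauge \<gamma>' (bs i (gauge \<gamma> f'))))"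
        by (simp only: inv ip_b[OF i f f']) }
    { assume j: "j \<in> I"
      show "gauge \<gamma>' (b i (gauge \<gamma> (gauge \<gamma>' (bs j (gauge \<gamma> f))))) =
          gauge \<gamma>' (bs j (gauge \<gamma> (gauge \<gamma>' (b i (gauge \<gamma> f))))) + (if i = j then fscale (of_real (\<nu> i)) f else 0)"
        by (simp only: inv b_bs[OF i j f] gauge_simps if_distrib[of "gauge \<gamma>'"])
      show "gauge \<gamma>' (b i (gauge \<gamma> (gauge \<gamma>' (b j (gauge \<gamma> f))))) = gauge \<gamma>' (b j (gauge \<gamma> (gauge \<gamma>' (b i (gauge \<gamma> f)))))"
        "gauge \<gamma>' (bs i (gauge \<gamma> (gauge \<gamma>' (bs j (gauge \<gamma> f))))) = gauge \<gamma>' (bs j (gauge \<gamma> (gauge \<gamma>' (bs i (gauge \<gamma> f)))))"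
        by (simp_all only: inv b_b[OF i j f] bs_bs[OF i j f]) }
  next
    fix f f' h and c :: complex
    assume "f \<in> {f. gauge \<gamma> f \<in> S}"
    then have f: "gauge \<gamma> f \<in> S" by simp
    { assume "f' \<in> {f. gauge \<gamma> f \<in> S}"
      then have f': "gauge \<gamma> f' \<in> S" by simp
      show "ip (gauge \<gamma> (fscale c f)) (gauge \<gamma> f') = c * ip (gauge \<gamma> f) (gauge \<gamma> f')"
        unfolding gauge_simps by (rule ip_scale[OF f f'])
      show "ip (gauge \<gamma> f') (gauge \<gamma> f) = cnj (ip (gauge \<gamma> f) (gauge \<gamma> f'))" by (rule ip_cnj[OF f f'])
      assume "h \<in> {f. gauge \<gamma> f \<in> S}"
      then show "ip (gauge \<gamma> (f + f')) (gauge \<gamma> h) = ip (gauge \<gamma> f) (gauge \<gamma> h) + ip (gauge \<gamma> f') (gauge \<gamma> h)"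
        unfolding gauge_simps by (intro ip_add[OF f f']) simp }
    show "Re (ip (gauge \<gamma> f) (gauge \<gamma> f)) > 0" if "f \<noteq> 0"
    proof (rule ip_pos[OF f])
      show "gauge \<gamma> f \<noteq> 0" using that inv(2)[of f] by (metis gauge_simps(3))
    qed
    assume c: "Re c < 0"
    from resolvent[OF c f] obtain u where u: "u \<in> S" "(\<Sum>i\<in>I. bs i (b i u)) - fscale c u = gauge \<gamma> f" by blast
    show "\<exists>u\<in>{f. gauge \<gamma> f \<in> S}. (\<Sum>i\<in>I. gauge \<gamma>' (bs i (gauge \<gamma> (gauge \<gamma>' (b i (gauge \<gamma> u)))))) - fscale c u = f"
    proof (rule bexI[of _ "gauge \<gamma>' u"])
      show "gauge \<gamma>' u \<in> {f. gauge \<gamma> f \<in> S}" using u(1) by (simp add: inv)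
      show "(\<Sum>i\<in>I. gauge \<gamma>' (bs i (gauge \<gamma> (gauge \<gamma>' (b i (gauge \<gamma> (gauge \<gamma>' u))))))) - fscale c (gauge \<gamma>' u) = f"
        using arg_cong[OF u(2), of "gauge \<gamma>'"] by (simp only: inv gauge_simps gauge_sum)
    qed
  qed
qed

lemma Ker_gauge:
  assumes \<gamma>: "\<And>x. \<gamma> x \<noteq> 0"
  defines "\<gamma>' \<equiv> \<lambda>x. 1 / \<gamma> x"
  assumes f: "fam_basis fscale K v (Ker c)"
  shows "fam_basis fscale K (\<lambda>j. gauge \<gamma>' (v j))
    (ladder.Ker {f. gauge \<gamma> f \<in> S} (\<lambda>i f. gauge \<gamma>' (b i (gauge \<gamma> f))) (\<lambda>i f. gauge \<gamma>' (bs i (gauge \<gamma> f))) I c)"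
proof -
  note inv = gauge_inverse[of \<gamma>, OF \<gamma>, folded \<gamma>'_def]
  interpret G: ladder "{f. gauge \<gamma> f \<in> S}" "\<lambda>i f. gauge \<gamma>' (b i (gauge \<gamma> f))" "\<lambda>i f. gauge \<gamma>' (bs i (gauge \<gamma> f))" \<nu> I
    "\<lambda>f g. ip (gauge \<gamma> f) (gauge \<gamma> g)"
    unfolding \<gamma>'_def by (rule ladder_gauge[OF \<gamma>])
  have A: "G.A f = gauge \<gamma>' (A (gauge \<gamma> f))" for f
    unfolding G.A_def A_def by (simp only: inv gauge_sum)
  have mem: "f \<in> G.Ker c \<longleftrightarrow> gauge \<gamma> f \<in> Ker c" for f
  proof -
    have "gauge \<gamma>' (A (gauge \<gamma> f)) = fscale c f \<longleftrightarrow> A (gauge \<gamma> f) = fscale c (gauge \<gamma> f)"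
      by (metis gauge_simps(2) inv)
    then show ?thesis by (simp add: G.Ker_def Ker_def A)
  qed
  have sum: "(\<Sum>j\<in>K. fscale (a j) (gauge \<gamma>' (v j))) = gauge \<gamma>' (\<Sum>j\<in>K. fscale (a j) (v j))" for a
    by (simp only: gauge_sum gauge_simps)
  have fin: "finite K" and K: "Ker c = {\<Sum>j\<in>K. fscale (a j) (v j) | a. True}"
    and ind: "\<And>a. (\<Sum>j\<in>K. fscale (a j) (v j)) = 0 \<Longrightarrow> \<forall>j\<in>K. a j = 0"
    using f unfolding fam_basis_def by blast+
  show ?thesis unfolding fam_basis_def sum
  proof (intro conjI allI impI fin)
    show "G.Ker c = {gauge \<gamma>' (\<Sum>j\<in>K. fscale (a j) (v j)) | a. True}"
    proof (intro set_eqI iffI)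
      fix f assume "f \<in> G.Ker c"
      then have "gauge \<gamma> f \<in> {\<Sum>j\<in>K. fscale (a j) (v j) | a. True}" unfolding mem K .
      then obtain a where "gauge \<gamma> f = (\<Sum>j\<in>K. fscale (a j) (v j))" by blast
      then have "f = gauge \<gamma>' (\<Sum>j\<in>K. fscale (a j) (v j))" by (metis inv(2))
      then show "f \<in> {gauge \<gamma>' (\<Sum>j\<in>K. fscale (a j) (v j)) | a. True}" by blast
    next
      fix f assume "f \<in> {gauge \<gamma>' (\<Sum>j\<in>K. fscale (a j) (v j)) | a. True}"
      then obtain a where a: "f = gauge \<gamma>' (\<Sum>j\<in>K. fscale (a j) (v j))" by blast
      show "f \<in> G.Ker c" unfolding mem a inv K by blast
    qed
    show "\<forall>j\<in>K. a j = 0" if "gauge \<gamma>' (\<Sum>j\<in>K. fscale (a j) (v j)) = 0" for a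
      by (rule ind) (metis that inv(1) gauge_simps(3))
  qed
qed

end

section \<open>The orthonormal eigenbasis and the frame that it defines\<close>

locale torus_bundle = g: hermitian g + h: hermitian H
  for g H :: "'v::complex_euclidean_space \<Rightarrow> 'v \<Rightarrow> complex" +
  fixes n p :: nat and U :: "'v set" and \<alpha> :: "'v \<Rightarrow> complex" and e :: "nat \<Rightarrow> 'v" and \<mu> :: "nat \<Rightarrow> real"
  assumes dim: "n = complex_space.dim (UNIV :: 'v set)" and pos: "positive_definite g" and lat: "is_lattice n U"
    and semichar: "semicharacter U H \<alpha>" and orth: "orthonormal_system g n e"
    and eigen: "\<And>i. i \<in> {1..n} \<Longrightarrow> g_inv_H g H (e i) = of_real (\<mu> i) *\<^sub>C e i"
    and mono: "mono_on {1..n} \<mu>"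
    and indep: "\<And>c :: nat \<Rightarrow> rat. (\<Sum>i=1..n. of_rat (c i) * \<mu> i) = 0 \<Longrightarrow> (\<forall>i\<in>{1..n}. c i = 0)"
    and p_def: "p = card {i\<in>{1..n}. \<mu> i < 0}"
begin

lemma g_e: "i \<in> {1..n} \<Longrightarrow> j \<in> {1..n} \<Longrightarrow> g (e i) (e j) = (if i = j then 1 else 0)"
  using orth unfolding orthonormal_system_def by blast

lemma g_sum_e: "i \<in> {1..n} \<Longrightarrow> g (\<Sum>j\<in>{1..n}. c j *\<^sub>C e j) (e i) = c i"
proof -
  assume i: "i \<in> {1..n}"
  have "g (\<Sum>j\<in>{1..n}. c j *\<^sub>C e j) (e i) = (\<Sum>j\<in>{1..n}. if j = i then c i else 0)"
    unfolding g.sum_left using i by (intro sum.cong refl) (simp only: g.scaleC_left g_e; simp)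
  then show ?thesis using i by simp
qed

lemma expansion: "z = (\<Sum>i\<in>{1..n}. g z (e i) *\<^sub>C e i)"
proof -
  have inj: "inj_on e {1..n}"
    by (rule inj_onI) (metis g_e zero_neq_one)
  have fin: "finite (e ` {1..n})" by simp
  have ind: "complex_space.independent (e ` {1..n})"
  proof
    assume "complex_space.dependent (e ` {1..n})"
    then obtain u where u: "\<exists>v\<in>e ` {1..n}. u v \<noteq> 0" "(\<Sum>v\<in>e ` {1..n}. u v *\<^sub>C v) = 0"
      unfolding complex_space.dependent_finite[OF fin] by blast
    then have "(\<Sum>i\<in>{1..n}. u (e i) *\<^sub>C e i) = 0" by (simp only: sum.reindex[OF inj] o_def)
    then have "u (e i) = 0" if "i \<in> {1..n}" for i using g_sum_e[OF that, of "\<lambda>i. u (e i)"] by simp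
    then show False using u(1) by blast
  qed
  have "complex_space.span (e ` {1..n}) = UNIV"
    by (rule complex_independent_spans[OF ind fin]) (simp only: card_image[OF inj] card_atLeastAtMost dim[symmetric])
  then have "z \<in> complex_space.span (e ` {1..n})" by (rule ssubst) (rule UNIV_I)
  then obtain u where "z = (\<Sum>v\<in>e ` {1..n}. u v *\<^sub>C v)" unfolding complex_space.span_finite[OF fin] by blast
  then have z: "z = (\<Sum>i\<in>{1..n}. u (e i) *\<^sub>C e i)" by (simp only: sum.reindex[OF inj] o_def)
  have "g z (e i) = u (e i)" if "i \<in> {1..n}" for i unfolding z by (rule g_sum_e[OF that])
  then show ?thesis using z by (metis (no_types, lifting) sum.cong)
qed

text \<open>The vectors \<open>e i\<close> and their multiples by \<open>\<i>\<close> span over the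
  reals; this is the bound that the passage from \<open>is_lattice\<close> to a real basis asks
  for.\<close>

lemma DIM_le: "DIM('v) \<le> 2 * n"
proof -
  let ?B = "e ` {1..n} \<union> (\<lambda>i. \<i> *\<^sub>C e i) ` {1..n}"
  have "z \<in> span ?B" for z
  proof -
    have split: "c *\<^sub>C e i = Re c *\<^sub>R e i + Im c *\<^sub>R (\<i> *\<^sub>C e i)" for c i
    proof -
      have "c *\<^sub>C e i = (of_real (Re c) + of_real (Im c) * \<i>) *\<^sub>C e i" by (simp add: complex_eq[symmetric] mult.commute)
      then show ?thesis by (simp only: scaleC_add_left scaleC_scaleC[symmetric] scaleC_of_real)
    qed
    have "c *\<^sub>C e i \<in> span ?B" if i: "i \<in> {1..n}" for c i
    proof -
      have "e i \<in> ?B" "\<i> *\<^sub>C e i \<in> ?B" using i by blast+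
      then show ?thesis by (subst split) (intro real_vector.span_add real_vector.span_scale real_vector.span_base)
    qed
    then have "(\<Sum>i\<in>{1..n}. g z (e i) *\<^sub>C e i) \<in> span ?B" by (intro real_vector.span_sum)
    then show ?thesis by (simp only: expansion[symmetric])
  qed
  then have "dim (UNIV :: 'v set) \<le> card ?B" by (intro dim_le_card) auto
  also have "\<dots> \<le> card (e ` {1..n}) + card ((\<lambda>i. \<i> *\<^sub>C e i) ` {1..n})" by (rule card_Un_le)
  also have "\<dots> \<le> n + n" by (intro add_mono order_trans[OF card_image_le]) auto
  finally show ?thesis by simp
qed

text \<open>\<open>g_inv_H\<close> is a definite description, so the vector representing
  \<open>H (e i)\<close> with respect to \<open>g\<close> is first built from the orthonormal basis
  and shown to be unique; only then does the eigenvalue equation give information.\<close>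

lemma H_e: assumes i: "i \<in> {1..n}" shows "H (e i) z = of_real (\<mu> i) * g (e i) z"
proof -
  define w where "w = (\<Sum>j\<in>{1..n}. H (e i) (e j) *\<^sub>C e j)"
  have w: "H (e i) z = g w z" for z
  proof -
    have "H (e i) z = (\<Sum>j\<in>{1..n}. cnj (g z (e j)) * H (e i) (e j))"
      by (subst expansion[of z]) (simp only: h.sum_right h.scaleC_right)
    also have "\<dots> = g w z"
      unfolding w_def g.sum_left g.scaleC_left using g.sym by (intro sum.cong refl) (metis mult.commute)
    finally show ?thesis .
  qed
  have "g_inv_H g H (e i) = w" unfolding g_inv_H_def
  proof (rule the_equality)
    show "\<forall>z. H (e i) z = g w z" using w by blast
    fix w' assume w': "\<forall>z. H (e i) z = g w' z"
    have "g (w' - w) (w' - w) = 0" using w w' by (simp add: g.diff_left)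
    then show "w' = w" using pos unfolding positive_definite_def by (metis eq_iff_diff_eq_0 less_irrefl zero_complex.sel(1))
  qed
  then have "w = of_real (\<mu> i) *\<^sub>C e i" using eigen[OF i] by simp
  then show ?thesis using w[of z] by (simp only: g.scaleC_left)
qed

lemma H_e_e: "i \<in> {1..n} \<Longrightarrow> j \<in> {1..n} \<Longrightarrow> H (e i) (e j) = (if i = j then of_real (\<mu> i) else 0)"
  unfolding H_e using g_e by simp

lemma \<mu>_nonzero: assumes i: "i \<in> {1..n}" shows "\<mu> i \<noteq> 0"
proof
  assume z: "\<mu> i = 0"
  have "(\<Sum>j=1..n. of_rat (if j = i then 1 else 0) * \<mu> j) = 0" using z by (intro sum.neutral) auto
  from bspec[OF indep[OF this] i] show False by simp
qed

text \<open>The differences of the occupation numbers are the coefficients of a rational relation. A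
  sign for each negative eigenvalue turns the absolute values back into the eigenvalues.\<close>

lemma level_inj:
  assumes "(\<Sum>i\<in>{1..n}. real (m i) * (pi * \<bar>\<mu> i\<bar>)) = (\<Sum>i\<in>{1..n}. real (m' i) * (pi * \<bar>\<mu> i\<bar>))" and i: "i \<in> {1..n}"
  shows "m i = m' i"
proof -
  define c :: "nat \<Rightarrow> rat" where "c i = of_int ((int (m i) - int (m' i)) * (if \<mu> i < 0 then -1 else 1))" for i
  have "(\<Sum>i=1..n. of_rat (c i) * \<mu> i) = (\<Sum>i\<in>{1..n}. (real (m i) * (pi * \<bar>\<mu> i\<bar>) - real (m' i) * (pi * \<bar>\<mu> i\<bar>)) / pi)"
    by (intro sum.cong refl) (simp add: c_def of_rat_mult of_rat_diff diff_divide_distrib left_diff_distrib)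
  also have "\<dots> = 0" using assms(1) by (simp only: sum_divide_distrib[symmetric] sum_subtractf) simp
  finally have "\<forall>i\<in>{1..n}. c i = 0" by (rule indep)
  from bspec[OF this i] show ?thesis by (simp add: c_def split: if_splits)
qed

text \<open>The eigenvalues increase, so the negative ones occupy an initial segment of the indices,
  and its length is \<open>p\<close>.\<close>

lemma negative_iff: assumes i: "i \<in> {1..n}" shows "\<mu> i < 0 \<longleftrightarrow> i \<le> p"
proof -
  let ?N = "{i\<in>{1..n}. \<mu> i < 0}"
  have down: "j \<in> ?N" if "i \<in> ?N" "j \<in> {1..i}" for i j
    using mono_onD[OF mono, of j i] that by auto
  have N: "?N = {1..p}"
  proof (cases "?N = {}")
    case True then show ?thesis unfolding p_def by simp
  next
    case False
    define k where "k = Max ?N"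
    have fin: "finite ?N" by simp
    have k: "k \<in> ?N" unfolding k_def by (rule Max_in[OF fin False])
    have "?N \<subseteq> {1..k}" unfolding k_def using Max_ge[OF fin] by auto
    then have "?N = {1..k}" using down[OF k] by blast
    then show ?thesis unfolding p_def by simp
  qed
  have "\<mu> i < 0 \<longleftrightarrow> i \<in> ?N" using i by blast
  then show ?thesis using i unfolding N by simp
qed

text \<open>The form takes the value \<open>- \<mu> i\<close> on \<open>e i\<close> and
  \<open>\<i> *\<^sub>C e i\<close>. The factor \<open>sgn (\<mu> i)\<close> turns this into
  \<open>- \<bar>\<mu> i\<bar>\<close>, so all planes get the orientation that the frame requires.
  The \<open>2 * n\<close> elements of \<open>Basis\<close> are listed and split into two halves as
  coordinates.\<close>

lemma frame_exists:
  "\<exists>B dx dy. magnetic_frame B U (\<lambda>x y. Im (H x y)) \<alpha> (SOME F. fundamental_domain U F) {1..n} e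
     (\<lambda>i. sgn (\<mu> i) *\<^sub>R (\<i> *\<^sub>C e i)) dx dy (\<lambda>i. pi * \<bar>\<mu> i\<bar>)"
proof -
  obtain B where lB: "lattice B U" and D: "DIM('v) = 2 * n" using is_lattice_obtain[OF lat DIM_le] by blast
  obtain f where f: "bij_betw f {1..2 * n} (Basis :: 'v set)"
    using ex_bij_betw_nat_finite_1[OF finite_Basis] D by metis
  interpret lattice B U by (rule lB)
  interpret bounded_bilinear "\<lambda>x y. Im (H x y)" by (rule h.bounded_bilinear_Im)
  have f1: "f ` {1..n} \<union> (\<lambda>i. f (i + n)) ` {1..n} = Basis"
  proof -
    have "(\<lambda>i. i + n) ` {1..n} = {n+1..2*n}" using image_add_atLeastAtMost'[of n 1 n] by (simp add: mult_2)
    then have "f ` {1..n} \<union> (\<lambda>i. f (i + n)) ` {1..n} = f ` ({1..n} \<union> {n+1..2*n})" by (metis image_Un image_image)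
    also have "{1..n} \<union> {n+1..2*n} = {1..2*n}" by auto
    finally show ?thesis using f by (simp add: bij_betw_def)
  qed
  have inj: "f i = f j \<Longrightarrow> i = j" if "i \<in> {1..2*n}" "j \<in> {1..2*n}" for i j
    using f that unfolding bij_betw_def inj_on_def by blast
  show ?thesis
  proof (rule exI[of _ B], rule exI[of _ f], rule exI[of _ "\<lambda>i. f (i + n)"], unfold_locales)
    show "Im (H v v) = 0" for v using h.real_diagonal[of v] by (metis Im_complex_of_real)
    show "fundamental_domain U (SOME F. fundamental_domain U F)"
      by (rule someI[of _ "cell 0"]) (rule fundamental_domain_cell)
    show "u \<in> U \<Longrightarrow> norm (\<alpha> u) = 1" for u using semichar unfolding semicharacter_def by blast
    show "u \<in> U \<Longrightarrow> v \<in> U \<Longrightarrow> \<alpha> (u + v) = \<alpha> u * \<alpha> v * cis (pi * Im (H u v))" for u v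
      using semichar unfolding semicharacter_def by (simp add: cis_conv_exp mult.assoc)
    show "finite {1..n}" by simp
    show "inj_on f {1..n}" "inj_on (\<lambda>i. f (i + n)) {1..n}" "f ` {1..n} \<inter> (\<lambda>i. f (i + n)) ` {1..n} = {}"
      by (auto simp: inj_on_def dest!: inj[rotated 2])
    show "f ` {1..n} \<union> (\<lambda>i. f (i + n)) ` {1..n} = Basis" by (rule f1)
    fix i j assume i: "i \<in> {1..n}"
    show "pi * \<bar>\<mu> i\<bar> > 0" using \<mu>_nonzero[OF i] by simp
    assume j: "j \<in> {1..n}"
    show "Im (H (e i) (e j)) = 0"
      "Im (H (sgn (\<mu> i) *\<^sub>R (\<i> *\<^sub>C e i)) (sgn (\<mu> j) *\<^sub>R (\<i> *\<^sub>C e j))) = 0"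
      "Im (H (e i) (sgn (\<mu> j) *\<^sub>R (\<i> *\<^sub>C e j))) = (if i = j then - (pi * \<bar>\<mu> i\<bar>) / pi else 0)"
      by (simp_all add: h.scaleR h.scaleC_left h.scaleC_right H_e_e[OF i j] abs_sgn mult.commute)
  qed
qed

end

section \<open>The Dolbeault Laplacian on the torus\<close>

locale framed_bundle = torus_bundle g H n p U \<alpha> e \<mu> +
  F: magnetic_frame B U "\<lambda>x y. Im (H x y)" \<alpha> "SOME F. fundamental_domain U F" "{1..n}" e
    "\<lambda>i. sgn (\<mu> i) *\<^sub>R (\<i> *\<^sub>C e i)" dx dy "\<lambda>i. pi * \<bar>\<mu> i\<bar>"
  for g H :: "'v::complex_euclidean_space \<Rightarrow> 'v \<Rightarrow> complex" and n p U \<alpha> e \<mu> B dx dy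
begin

definition q :: "'v \<Rightarrow> complex" where "q z = - (of_real pi / 2) * H z z"
text \<open>The square root of the weight in the hermitian metric of the bundle, so that
  multiplication by it is isometric onto functions with the unweighted product.\<close>

definition \<gamma> :: "'v \<Rightarrow> complex" where "\<gamma> z = exp (q z)"

lemma \<gamma>_nonzero: "\<gamma> z \<noteq> 0" by (simp add: \<gamma>_def)

lemma smooth_q: "smooth_function q"
proof -
  have lin: "smooth_function (\<lambda>z. g z w)" for w
    by (rule smooth_function_bounded_linear[OF bounded_bilinear.bounded_linear_left[OF g.bounded_bilinear]])
  have "H z z = (\<Sum>i\<in>{1..n}. of_real (\<mu> i) * (g z (e i) * cnj (g z (e i))))" for z
  proof -
    have "H z z = (\<Sum>i\<in>{1..n}. g z (e i) * H (e i) z)"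
      by (subst (1) expansion[of z]) (simp only: h.sum_left h.scaleC_left)
    also have "\<dots> = (\<Sum>i\<in>{1..n}. of_real (\<mu> i) * (g z (e i) * cnj (g z (e i))))"
      by (intro sum.cong refl) (simp only: H_e g.sym[of "e _" z] mult.left_commute complex_cnj_cnj)
    finally show ?thesis .
  qed
  then have "q = (\<lambda>z. - (of_real pi / 2) * (\<Sum>i\<in>{1..n}. of_real (\<mu> i) * (g z (e i) * cnj (g z (e i)))))"
    unfolding q_def fun_eq_iff by simp
  then show ?thesis
    by (simp only:) (intro smooth_function_cmult smooth_function_sum smooth_function_mult smooth_function_cnj lin)
qed

lemma smooth_\<gamma>: "smooth_function \<gamma>" unfolding \<gamma>_def[abs_def] by (rule smooth_function_exp[OF smooth_q])

lemma smooth_gauge: "smooth_function (gauge \<gamma> f) \<longleftrightarrow> smooth_function f"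
proof
  assume "smooth_function (gauge \<gamma> f)"
  moreover have "smooth_function (\<lambda>z. exp (- 1 * q z))" by (intro smooth_function_exp smooth_function_cmult smooth_q)
  ultimately have "smooth_function (\<lambda>z. exp (- 1 * q z) * gauge \<gamma> f z)" by (intro smooth_function_mult)
  moreover have "(\<lambda>z. exp (- 1 * q z) * gauge \<gamma> f z) = f"
    by (simp add: gauge_def \<gamma>_def mult.assoc[symmetric] exp_add[symmetric])
  ultimately show "smooth_function f" by simp
qed (auto simp: gauge_def intro: smooth_function_mult smooth_\<gamma>)

lemma dird_q: "dird v q z = - (of_real pi / 2) * (H z v + H v z)"
  unfolding q_def
  by (rule dird_eqI[OF has_derivative_mult_right[OF bounded_bilinear.FDERIV[OF h.bounded_bilinear has_derivative_ident has_derivative_ident]]])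

lemma dird_\<gamma>: "dird v \<gamma> z = dird v q z * \<gamma> z"
proof -
  have "((\<lambda>z. exp (q z)) has_derivative (\<lambda>v. dird v q z * exp (q z))) (at z)"
    using has_derivative_compose[OF differentiable_has_derivative_dird[OF smooth_function_differentiable[OF smooth_q]] DERIV_exp[unfolded has_field_derivative_def], of z]
    by (simp add: mult.commute)
  then show ?thesis unfolding \<gamma>_def[abs_def] by (rule dird_eqI)
qed

text \<open>The derivative of the weight contributes the real part and the magnetic connection the
  imaginary part of one term, \<open>- \<pi> H w z\<close>, complex linear in the direction
  \<open>w\<close>.\<close>

lemma nabla_gauge:
  assumes f: "smooth_function f"
  shows "F.nabla w (gauge \<gamma> f) z = \<gamma> z * (dird w f z - of_real pi * H w z * f z)"
proof -
  have d: "dird w (gauge \<gamma> f) z = \<gamma> z * dird w f z + dird w \<gamma> z * f z"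
    unfolding gauge_def
    by (subst dird_mult) (intro smooth_function_differentiable smooth_\<gamma> f refl)+
  have "- (of_real pi / 2) * (H z w + H w z) + \<i> * of_real (pi * Im (H z w)) = - (of_real pi * H w z)"
    using h.sym[of z w] by (simp add: complex_eq_iff field_simps)
  then show ?thesis unfolding F.nabla_def d dird_\<gamma> dird_q by (simp add: gauge_def) algebra
qed

text \<open>Being complex linear in \<open>w\<close>, the zeroth order term of
  \<open>nabla_gauge\<close> cancels in the combination with \<open>\<i>\<close>. This reflects that
  the trivialization is holomorphic.\<close>

lemma gauge_deriv_zbar:
  assumes f: "smooth_function f"
  shows "\<gamma> z * deriv_zbar w f z = (F.nabla w (gauge \<gamma> f) z + \<i> * F.nabla (\<i> *\<^sub>C w) (gauge \<gamma> f) z) / 2"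
proof -
  have ii: "\<i> * (\<i> * x) = - x" for x :: complex by (simp add: mult.assoc[symmetric])
  show ?thesis
    unfolding nabla_gauge[OF f] deriv_zbar_def dird_def[symmetric] h.scaleC_left by (simp add: algebra_simps ii)
qed

text \<open>The real part of the exponent of the automorphy factor is exactly the change of the
  weight under translation by \<open>u\<close>; what remains is a phase.\<close>

lemma \<gamma>_automorphy: "\<gamma> (z + u) * automorphy_factor H \<alpha> u z = \<alpha> u * cis (pi * Im (H z u)) * \<gamma> z"
proof -
  have "q (z + u) + (of_real pi * H z u + of_real pi / 2 * H u u) = \<i> * of_real (pi * Im (H z u)) + q z"
    using h.sym[of u z] by (simp add: q_def h.add_left h.add_right complex_eq_iff field_simps)
  then have "exp (q (z + u)) * exp (of_real pi * H z u + of_real pi / 2 * H u u) = exp (\<i> * of_real (pi * Im (H z u))) * exp (q z)"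
    by (simp only: exp_add[symmetric])
  then show ?thesis unfolding \<gamma>_def automorphy_factor_def cis_conv_exp by (simp only: mult.assoc mult.left_commute[of _ "\<alpha> u"])
qed

abbreviation sections :: "('v \<Rightarrow> complex) set" where "sections \<equiv> {f. gauge \<gamma> f \<in> F.S}"
abbreviation lower where "lower i f \<equiv> gauge (\<lambda>z. 1 / \<gamma> z) (F.an i (gauge \<gamma> f))"
abbreviation raise where "raise i f \<equiv> gauge (\<lambda>z. 1 / \<gamma> z) (F.cr i (gauge \<gamma> f))"
abbreviation product where "product f k \<equiv> F.ip (gauge \<gamma> f) (gauge \<gamma> k)"

lemma sections_iff:
  "gauge \<gamma> f \<in> F.S \<longleftrightarrow> smooth_function f \<and> (\<forall>u\<in>U. \<forall>z. f (z + u) = automorphy_factor H \<alpha> u z * f z)"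
proof -
  have "gauge \<gamma> f (z + u) = \<alpha> u * cis (pi * Im (H z u)) * gauge \<gamma> f z \<longleftrightarrow> f (z + u) = automorphy_factor H \<alpha> u z * f z" for u z
  proof -
    have "\<alpha> u * cis (pi * Im (H z u)) * gauge \<gamma> f z = (\<alpha> u * cis (pi * Im (H z u)) * \<gamma> z) * f z"
      by (simp only: gauge_def mult.assoc)
    also have "\<dots> = \<gamma> (z + u) * (automorphy_factor H \<alpha> u z * f z)" unfolding \<gamma>_automorphy[symmetric] by (rule mult.assoc)
    finally have eq: "\<alpha> u * cis (pi * Im (H z u)) * gauge \<gamma> f z = \<gamma> (z + u) * (automorphy_factor H \<alpha> u z * f z)" .
    show ?thesis unfolding eq unfolding gauge_def mult_cancel_left using \<gamma>_nonzero[of "z + u"] by simp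
  qed
  then show ?thesis by (simp add: F.S_def F.quasi_periodic_def smooth_gauge)
qed

lemma koszul_exists:
  "\<exists>d kv. koszul sections lower raise (\<lambda>i. pi * \<bar>\<mu> i\<bar>) {1..n} product {i\<in>{1..n}. \<mu> i < 0} d kv"
proof -
  obtain d v where dv: "d > 0" "fam_basis fscale {..<d::nat} v (F.L.Ker 0)" using F.ground_states_fam_basis by blast
  interpret G: ladder sections lower raise "\<lambda>i. pi * \<bar>\<mu> i\<bar>" "{1..n}" product
    by (rule F.L.ladder_gauge[OF \<gamma>_nonzero])
  interpret G: independent_ladder sections lower raise "\<lambda>i. pi * \<bar>\<mu> i\<bar>" "{1..n}" product
    by unfold_locales (rule level_inj, simp only: G.level_def)
  have "koszul sections lower raise (\<lambda>i. pi * \<bar>\<mu> i\<bar>) {1..n} product {i\<in>{1..n}. \<mu> i < 0} d (\<lambda>j. gauge (\<lambda>z. 1 / \<gamma> z) (v j))"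
    using dv(1) F.L.Ker_gauge[OF \<gamma>_nonzero dv(2)] by unfold_locales blast+
  then show ?thesis by blast
qed

lemma mem_unit_cube:
  "z \<in> unit_cube n e \<longleftrightarrow> (\<forall>i\<in>{1..n}. 0 \<le> Re (g z (e i)) \<and> Re (g z (e i)) \<le> 1 \<and> 0 \<le> Im (g z (e i)) \<and> Im (g z (e i)) \<le> 1)"
proof
  assume "z \<in> unit_cube n e"
  then obtain s t where z: "z = (\<Sum>i\<in>{1..n}. Complex (s i) (t i) *\<^sub>C e i)" and
    st: "\<forall>i\<in>{1..n}. 0 \<le> s i \<and> s i \<le> 1 \<and> 0 \<le> t i \<and> t i \<le> 1" unfolding unit_cube_def by blast
  have "g z (e i) = Complex (s i) (t i)" if "i \<in> {1..n}" for i unfolding z by (rule g_sum_e[OF that])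
  then show "\<forall>i\<in>{1..n}. 0 \<le> Re (g z (e i)) \<and> Re (g z (e i)) \<le> 1 \<and> 0 \<le> Im (g z (e i)) \<and> Im (g z (e i)) \<le> 1"
    using st by simp
next
  assume a: "\<forall>i\<in>{1..n}. 0 \<le> Re (g z (e i)) \<and> Re (g z (e i)) \<le> 1 \<and> 0 \<le> Im (g z (e i)) \<and> Im (g z (e i)) \<le> 1"
  show "z \<in> unit_cube n e" unfolding unit_cube_def mem_Collect_eq
    by (rule exI[of _ "\<lambda>i. Re (g z (e i))"], rule exI[of _ "\<lambda>i. Im (g z (e i))"], intro conjI)
       (use a expansion[of z] in \<open>simp_all only: complex.collapse\<close>)
qed

lemma continuous_g: "continuous_on A (\<lambda>z. g z w)"
  by (rule linear_continuous_on[OF bounded_bilinear.bounded_linear_left[OF g.bounded_bilinear]])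

text \<open>The volume is a denominator in the product on forms, so it must not vanish when the
  adjoint is identified. The cube is bounded, and a ball around its centre, with all coordinates
  \<open>1/2\<close>, lies inside.\<close>

lemma measure_unit_cube: "measure lborel (unit_cube n e) > 0"
proof -
  have cl: "closed (unit_cube n e)"
  proof -
    have "unit_cube n e = (\<Inter>i\<in>{1..n}. {z. 0 \<le> Re (g z (e i)) \<and> Re (g z (e i)) \<le> 1 \<and> 0 \<le> Im (g z (e i)) \<and> Im (g z (e i)) \<le> 1})"
      using mem_unit_cube by blast
    moreover have "closed {z. 0 \<le> Re (g z (e i)) \<and> Re (g z (e i)) \<le> 1 \<and> 0 \<le> Im (g z (e i)) \<and> Im (g z (e i)) \<le> 1}" for i
      by (intro closed_Collect_conj closed_Collect_le continuous_intros continuous_g)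
    ultimately show ?thesis by (simp only:) (intro closed_INT ballI)
  qed
  have "bounded (unit_cube n e)" unfolding bounded_iff
  proof (intro exI ballI)
    fix z assume z: "z \<in> unit_cube n e"
    have "norm z = norm (\<Sum>i\<in>{1..n}. Re (g z (e i)) *\<^sub>R e i + Im (g z (e i)) *\<^sub>R (\<i> *\<^sub>C e i))"
    proof -
      have "c *\<^sub>C x = Re c *\<^sub>R x + Im c *\<^sub>R (\<i> *\<^sub>C x)" for c and x :: 'v
      proof -
        have "c *\<^sub>C x = (of_real (Re c) + of_real (Im c) * \<i>) *\<^sub>C x" by (simp add: complex_eq[symmetric] mult.commute)
        then show ?thesis by (simp only: scaleC_add_left scaleC_scaleC[symmetric] scaleC_of_real)
      qed
      then have "(\<Sum>i\<in>{1..n}. g z (e i) *\<^sub>C e i) = (\<Sum>i\<in>{1..n}. Re (g z (e i)) *\<^sub>R e i + Im (g z (e i)) *\<^sub>R (\<i> *\<^sub>C e i))"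
        by (intro sum.cong refl)
      then show ?thesis by (simp only: expansion[symmetric])
    qed
    also have "\<dots> \<le> (\<Sum>i\<in>{1..n}. norm (e i) + norm (\<i> *\<^sub>C e i))"
    proof (rule order_trans[OF norm_sum sum_mono])
      fix i assume i: "i \<in> {1..n}"
      have b: "\<bar>Re (g z (e i))\<bar> \<le> 1" "\<bar>Im (g z (e i))\<bar> \<le> 1" using z i unfolding mem_unit_cube by auto
      show "norm (Re (g z (e i)) *\<^sub>R e i + Im (g z (e i)) *\<^sub>R (\<i> *\<^sub>C e i)) \<le> norm (e i) + norm (\<i> *\<^sub>C e i)"
        using b by (intro order_trans[OF norm_triangle_ineq add_mono]) (simp_all add: mult_left_le_one_le)
    qed
    finally show "norm z \<le> (\<Sum>i\<in>{1..n}. norm (e i) + norm (\<i> *\<^sub>C e i))" .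
  qed
  then have "emeasure lborel (unit_cube n e) < \<infinity>" by (rule emeasure_bounded_finite)
  then have fm: "unit_cube n e \<in> fmeasurable lborel" using cl by (intro fmeasurableI) auto
  let ?O = "\<Inter>i\<in>{1..n}. {z. 0 < Re (g z (e i)) \<and> Re (g z (e i)) < 1 \<and> 0 < Im (g z (e i)) \<and> Im (g z (e i)) < 1}"
  have op: "open ?O"
    by (intro open_INT ballI finite_atLeastAtMost open_Collect_conj open_Collect_less continuous_intros continuous_g)
  have "(\<Sum>j\<in>{1..n}. Complex (1/2) (1/2) *\<^sub>C e j) \<in> ?O"
  proof (rule INT_I)
    fix i assume "i \<in> {1..n}"
    then have "g (\<Sum>j\<in>{1..n}. Complex (1/2) (1/2) *\<^sub>C e j) (e i) = Complex (1/2) (1/2)" by (rule g_sum_e)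
    then show "(\<Sum>j\<in>{1..n}. Complex (1/2) (1/2) *\<^sub>C e j) \<in> {z. 0 < Re (g z (e i)) \<and> Re (g z (e i)) < 1 \<and> 0 < Im (g z (e i)) \<and> Im (g z (e i)) < 1}"
      by simp
  qed
  from openE[OF op this] obtain r where r: "r > 0" "ball (\<Sum>j\<in>{1..n}. Complex (1/2) (1/2) *\<^sub>C e j) r \<subseteq> ?O" .
  have sub: "?O \<subseteq> unit_cube n e" unfolding subset_iff mem_unit_cube by (auto intro: less_imp_le)
  have "measure lborel (ball (\<Sum>j\<in>{1..n}. Complex (1/2) (1/2) *\<^sub>C e j) r) \<le> measure lborel (unit_cube n e)"
    by (intro measure_mono_fmeasurable[OF order_trans[OF r(2) sub] _ fm]) simp
  then show ?thesis using content_ball_pos[OF r(1), of "\<Sum>j\<in>{1..n}. Complex (1/2) (1/2) *\<^sub>C e j"] by linarith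
qed

end

locale dolbeault = framed_bundle g H n p U \<alpha> e \<mu> B dx dy +
  K: koszul sections lower raise "\<lambda>i. pi * \<bar>\<mu> i\<bar>" "{1..n}" product "{i\<in>{1..n}. \<mu> i < 0}" d kv
  for g H :: "'v::complex_euclidean_space \<Rightarrow> 'v \<Rightarrow> complex" and n p U \<alpha> e \<mu> B dx dy d kv
begin

lemma L_forms_eq: "L_forms n U H \<alpha> = K.Fo"
  unfolding K.Fo_def unfolding L_forms_def mem_Collect_eq sections_iff cp_def by (auto simp: fun_eq_iff)

lemma L_forms_deg_eq: "L_forms_deg n U H \<alpha> k = K.Fk k"
  unfolding K.Fk_def unfolding L_forms_deg_def L_forms_eq cp_def by (auto simp: fun_eq_iff)

lemma FkFo: "\<psi> \<in> K.Fk k \<Longrightarrow> \<psi> \<in> K.Fo"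
  unfolding K.Fk_def by blast

text \<open>For \<open>\<mu> i < 0\<close> the second frame vector is
  \<open>- \<i> *\<^sub>C e i\<close>, which turns the combination of covariant derivatives into
  minus the creation operator; for \<open>\<mu> i > 0\<close> it is the annihilation
  operator.\<close>

lemma deriv_zbar_eq:
  assumes f: "f \<in> sections" and i: "i \<in> {1..n}" shows "deriv_zbar (e i) f z = K.Dz i f z"
proof -
  have fS: "gauge \<gamma> f \<in> F.S" and sm: "smooth_function f" using f sections_iff by auto
  have "\<gamma> z * deriv_zbar (e i) f z = \<gamma> z * K.Dz i f z"
  proof (cases "\<mu> i < 0")
    case True
    then have "K.Dz i f = fscale (-1) (raise i f)" unfolding K.Dz_def using i by simp
    then have "\<gamma> z * K.Dz i f z = - F.cr i (gauge \<gamma> f) z"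
      using \<gamma>_nonzero[of z] by (simp only: fscale_def gauge_def) simp
    also have "\<dots> = (F.nabla (e i) (gauge \<gamma> f) z + \<i> * F.nabla (\<i> *\<^sub>C e i) (gauge \<gamma> f) z) / 2"
      using True by (simp add: F.cr_apply F.nabla_linear(3)[OF fS] field_simps)
    also have "\<dots> = \<gamma> z * deriv_zbar (e i) f z" by (rule gauge_deriv_zbar[OF sm, symmetric])
    finally show ?thesis by (rule sym)
  next
    case False
    then have pos: "\<mu> i > 0" using \<mu>_nonzero[OF i] by simp
    then have "K.Dz i f = lower i f" unfolding K.Dz_def by simp
    then have "\<gamma> z * K.Dz i f z = F.an i (gauge \<gamma> f) z"
      using \<gamma>_nonzero[of z] by (simp only: gauge_def) simp
    also have "\<dots> = (F.nabla (e i) (gauge \<gamma> f) z + \<i> * F.nabla (\<i> *\<^sub>C e i) (gauge \<gamma> f) z) / 2"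
      using pos by (simp add: F.an_apply)
    also have "\<dots> = \<gamma> z * deriv_zbar (e i) f z" by (rule gauge_deriv_zbar[OF sm, symmetric])
    finally show ?thesis by (rule sym)
  qed
  then show ?thesis using \<gamma>_nonzero[of z] by simp
qed

lemma dbar_eq: assumes "\<psi> \<in> K.Fo" shows "dbar n e \<psi> = K.dK \<psi>"
proof (intro ext)
  fix z J
  have "(\<Sum>i\<in>J. (-1) ^ card {j\<in>J. j < i} * deriv_zbar (e i) (\<lambda>w. \<psi> w (J - {i})) z) =
      (\<Sum>i\<in>J. sgn_at i J * K.Dz i (cp \<psi> (J - {i})) z)" if "J \<subseteq> {1..n}"
  proof (rule sum.cong[OF refl])
    fix i assume "i \<in> J"
    then have i: "i \<in> {1..n}" using that by blast
    have "deriv_zbar (e i) (cp \<psi> (J - {i})) z = K.Dz i (cp \<psi> (J - {i})) z" by (rule deriv_zbar_eq[OF K.Fo_S[OF assms] i])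
    then show "(-1) ^ card {j\<in>J. j < i} * deriv_zbar (e i) (\<lambda>w. \<psi> w (J - {i})) z = sgn_at i J * K.Dz i (cp \<psi> (J - {i})) z"
      by (simp only: sgn_at_def cp_def)
  qed
  then show "dbar n e \<psi> z J = K.dK \<psi> z J" unfolding dbar_def K.dK_def by (rule if_cong[OF refl _ refl])
qed

lemma form_inner_eq:
  "form_inner n H \<phi> \<psi> z = (\<Sum>J\<in>Pow {1..n}. 2 ^ card J * (gauge \<gamma> (cp \<phi> J) z * cnj (gauge \<gamma> (cp \<psi> J) z)))"
proof -
  have "cnj (q z) = q z" using h.real_diagonal[of z] by (simp add: q_def complex_eq_iff)
  then have "\<gamma> z * cnj (\<gamma> z) = exp (q z + q z)" by (simp add: \<gamma>_def exp_cnj exp_add[symmetric])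
  also have "q z + q z = - of_real pi * H z z" by (simp add: q_def)
  finally have e: "exp (- of_real pi * H z z) = \<gamma> z * cnj (\<gamma> z)" by simp
  show ?thesis unfolding form_inner_def e sum_distrib_right
    by (intro sum.cong refl) (simp add: gauge_def cp_def mult_ac)
qed

lemma L2_eq:
  assumes \<phi>: "\<phi> \<in> K.Fo" and \<psi>: "\<psi> \<in> K.Fo"
  shows "L2_product n e U H \<phi> \<psi> = K.IP \<phi> \<psi> / of_real (measure lborel (unit_cube n e))"
proof -
  let ?D = "SOME F. fundamental_domain U F"
  let ?f = "\<lambda>J z. gauge \<gamma> (cp \<phi> J) z * cnj (gauge \<gamma> (cp \<psi> J) z)"
  have int: "set_integrable lborel ?D (?f J)" for J
    using K.Fo_S[OF \<phi>, of J] K.Fo_S[OF \<psi>, of J] by (intro F.set_integrable_product) auto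
  have "set_lebesgue_integral lborel ?D (form_inner n H \<phi> \<psi>) =
      (\<integral>z. (\<Sum>J\<in>Pow {1..n}. 2 ^ card J * (indicator ?D z *\<^sub>R ?f J z)) \<partial>lborel)"
    unfolding set_lebesgue_integral_def form_inner_eq scaleR_sum_right mult_scaleR_right ..
  also have "\<dots> = (\<Sum>J\<in>Pow {1..n}. \<integral>z. 2 ^ card J * (indicator ?D z *\<^sub>R ?f J z) \<partial>lborel)"
    by (rule Bochner_Integration.integral_sum) (intro integrable_mult_right int[unfolded set_integrable_def])
  also have "\<dots> = K.IP \<phi> \<psi>"
    unfolding K.IP_def unfolding F.ip_def set_lebesgue_integral_def by (intro sum.cong refl integral_mult_right_zero)
  finally show ?thesis unfolding L2_product_def torus_integral_def Let_def by simp
qed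

text \<open>The definite description is discharged by \<open>IP_dK\<close>, which shows that
  \<open>K.dKs \<psi>\<close> is an adjoint, and by nondegeneracy of the product, which shows that
  there is no other.\<close>

lemma dbar_adjoint_eq: assumes \<psi>: "\<psi> \<in> K.Fo" shows "dbar_adjoint n e U H \<alpha> \<psi> = K.dKs \<psi>"
  unfolding dbar_adjoint_def L_forms_eq
proof (rule the_equality)
  have L2: "L2_product n e U H (dbar n e \<phi>) \<psi> = L2_product n e U H \<phi> (K.dKs \<psi>)" if \<phi>: "\<phi> \<in> K.Fo" for \<phi>
    unfolding dbar_eq[OF \<phi>] L2_eq[OF K.dK_in[OF \<phi>] \<psi>] L2_eq[OF \<phi> K.dKs_in[OF \<psi>]] K.IP_dK[OF \<phi> \<psi>] ..
  show "K.dKs \<psi> \<in> K.Fo \<and> (\<forall>\<phi>\<in>K.Fo. L2_product n e U H (dbar n e \<phi>) \<psi> = L2_product n e U H \<phi> (K.dKs \<psi>))"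
    using L2 K.dKs_in[OF \<psi>] by blast
  fix \<eta> assume \<eta>: "\<eta> \<in> K.Fo \<and> (\<forall>\<phi>\<in>K.Fo. L2_product n e U H (dbar n e \<phi>) \<psi> = L2_product n e U H \<phi> \<eta>)"
  show "\<eta> = K.dKs \<psi>"
  proof (rule K.adjoint_unique)
    show "\<eta> \<in> K.Fo" using \<eta> by blast
    show "K.dKs \<psi> \<in> K.Fo" by (rule K.dKs_in[OF \<psi>])
    fix \<phi> assume \<phi>: "\<phi> \<in> K.Fo"
    have "L2_product n e U H \<phi> \<eta> = L2_product n e U H \<phi> (K.dKs \<psi>)"
      by (rule trans[OF bspec[OF conjunct2[OF \<eta>] \<phi>, symmetric] L2[OF \<phi>]])
    then show "K.IP \<phi> \<eta> = K.IP \<phi> (K.dKs \<psi>)"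
      using measure_unit_cube unfolding L2_eq[OF \<phi> conjunct1[OF \<eta>]] L2_eq[OF \<phi> K.dKs_in[OF \<psi>]] by simp
  qed
qed

lemma laplacian_eq: "\<psi> \<in> K.Fo \<Longrightarrow> dolbeault_laplacian n e U H \<alpha> \<psi> = K.box \<psi>"
  unfolding dolbeault_laplacian_def K.box_def by (simp only: dbar_eq dbar_adjoint_eq K.dK_in K.dKs_in)

lemma level_eq: "2 * K.level m = 2 * pi * (\<Sum>i=1..n. real (m i) * \<bar>\<mu> i\<bar>)"
  unfolding K.level_def by (simp only: sum_distrib_left mult.assoc mult.left_commute)

lemma spectrum_eq:
  "laplacian_spectrum n e U H \<alpha> = {of_real (2 * pi * (\<Sum>i=1..n. real (m i) * \<bar>\<mu> i\<bar>)) | m :: nat \<Rightarrow> nat. True}"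
proof -
  have "bij_betw (\<lambda>\<psi>. dolbeault_laplacian n e U H \<alpha> \<psi> - form_scale ev \<psi>) K.Fo K.Fo \<longleftrightarrow>
      bij_betw (\<lambda>\<psi>. K.box \<psi> - form_scale ev \<psi>) K.Fo K.Fo" for ev
    by (rule bij_betw_cong) (simp only: laplacian_eq)
  then show ?thesis unfolding laplacian_spectrum_def L_forms_eq using K.box_spectrum unfolding level_eq by simp
qed

lemma eigenspace_eq:
  "laplacian_eigenspace n e U H \<alpha> (of_real (2 * pi * (\<Sum>i=1..n. real (m i) * \<bar>\<mu> i\<bar>))) k = K.eigenspace m k"
  unfolding laplacian_eigenspace_def L_forms_deg_eq K.eigenspace_def level_eq
  by (intro Collect_cong conj_cong refl) (simp only: laplacian_eq[OF FkFo])

text \<open>Without quanta the only admissible multi-index is the set of negative directions, which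
  has \<open>p\<close> elements.\<close>

lemma cohomology_dim_eq: "cohomology_dim n e U H \<alpha> k = (if k = p then d else 0)"
proof -
  have co: "dbar_cocycles n e U H \<alpha> k = K.cocycles k"
    unfolding dbar_cocycles_def K.cocycles_def L_forms_deg_eq using dbar_eq FkFo by auto
  have cb: "dbar_coboundaries n e U H \<alpha> k = K.coboundaries k"
    unfolding dbar_coboundaries_def K.coboundaries_def L_forms_deg_eq
    by (intro if_cong refl image_cong dbar_eq FkFo)
  have "card (K.admissible (\<lambda>_. 0) k) = (if k = p then 1 else 0)"
    unfolding K.card_admissible by (simp add: p_def binomial_eq_0_iff Let_def)
  then show ?thesis unfolding cohomology_dim_def co cb K.cohomology by simp
qed

text \<open>A single degree contributes, so the alternating sum is \<open>(-1) ^ p * d\<close>. This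
  identifies the otherwise unspecified \<open>d\<close>.\<close>

lemma euler_characteristic_eq: "nat \<bar>euler_characteristic n e U H \<alpha>\<bar> = d"
proof -
  have "card {i\<in>{1..n}. \<mu> i < 0} \<le> card {1..n}" by (rule card_mono) auto
  then have "p \<le> n" unfolding p_def by simp
  have "euler_characteristic n e U H \<alpha> = (\<Sum>k\<le>n. if k = p then (-1) ^ p * int d else 0)"
    unfolding euler_characteristic_def cohomology_dim_eq by (intro sum.cong refl) auto
  also have "\<dots> = (-1) ^ p * int d" using \<open>p \<le> n\<close> by simp
  finally show ?thesis by (simp add: abs_mult power_abs)
qed

lemma eigenspace_dimension:
  "has_dimension
     (laplacian_eigenspace n e U H \<alpha> (of_real (2 * pi * (\<Sum>i=1..n. real (m i) * \<bar>\<mu> i\<bar>))) k)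
     (let a = card {i\<in>{1..n}. m i \<noteq> 0};
          b = card {i\<in>{1..n}. i \<le> p \<and> m i = 0}
      in nat \<bar>euler_characteristic n e U H \<alpha>\<bar> * (if b \<le> k then a choose (k - b) else 0))"
proof -
  obtain v where v: "fam_basis form_scale (K.admissible m k \<times> {..<d}) v (K.eigenspace m k)" using K.eigenspace_basis by blast
  have N: "{i \<in> {i\<in>{1..n}. \<mu> i < 0}. m i = 0} = {i\<in>{1..n}. i \<le> p \<and> m i = 0}" using negative_iff by blast
  have "card (K.admissible m k \<times> {..<d}) = (let a = card {i\<in>{1..n}. m i \<noteq> 0}; b = card {i\<in>{1..n}. i \<le> p \<and> m i = 0}
      in nat \<bar>euler_characteristic n e U H \<alpha>\<bar> * (if b \<le> k then a choose (k - b) else 0))"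
    unfolding card_cartesian_product K.card_admissible N Let_def euler_characteristic_eq by simp
  then show ?thesis unfolding has_dimension_def eigenspace_eq
    using form.fam_basis_image[OF v] by (intro exI[of _ "v ` (K.admissible m k \<times> {..<d})"]) simp
qed

end

theorem mainTheorem2:
  fixes n p :: nat
    and g H :: "'v::complex_euclidean_space \<Rightarrow> 'v \<Rightarrow> complex"
    and U :: "'v set"
    and \<alpha> :: "'v \<Rightarrow> complex"
    and e :: "nat \<Rightarrow> 'v"
    and \<mu> :: "nat \<Rightarrow> real"
  assumes "n = complex_space.dim (UNIV :: 'v set)"
    and "hermitian_form g" and "positive_definite g"
    and "is_lattice n U"
    and "hermitian_form H" and "\<And>u v. u \<in> U \<Longrightarrow> v \<in> U \<Longrightarrow> Im (H u v) \<in> \<int>"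
    and "semicharacter U H \<alpha>"
    and "orthonormal_system g n e"
    and "\<And>i. i \<in> {1..n} \<Longrightarrow> g_inv_H g H (e i) = of_real (\<mu> i) *\<^sub>C e i"
    and "mono_on {1..n} \<mu>"
    and "\<And>c :: nat \<Rightarrow> rat. (\<Sum>i=1..n. of_rat (c i) * \<mu> i) = 0 \<Longrightarrow> (\<forall>i\<in>{1..n}. c i = 0)"
    and "p = card {i\<in>{1..n}. \<mu> i < 0}"
  shows "laplacian_spectrum n e U H \<alpha> =
           {of_real (2 * pi * (\<Sum>i=1..n. real (m i) * \<bar>\<mu> i\<bar>)) | m :: nat \<Rightarrow> nat. True} \<and>
         (\<forall>m :: nat \<Rightarrow> nat. \<forall>k\<le>n.
           has_dimension
             (laplacian_eigenspace n e U H \<alpha> (of_real (2 * pi * (\<Sum>i=1..n. real (m i) * \<bar>\<mu> i\<bar>))) k)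
             (let a = card {i\<in>{1..n}. m i \<noteq> 0};
                  b = card {i\<in>{1..n}. i \<le> p \<and> m i = 0}
              in nat \<bar>euler_characteristic n e U H \<alpha>\<bar> * (if b \<le> k then a choose (k - b) else 0)))"
proof -
  interpret T: torus_bundle g H n p U \<alpha> e \<mu>
    by (intro torus_bundle.intro hermitian.intro torus_bundle_axioms.intro assms)
  obtain B dx dy where F: "magnetic_frame B U (\<lambda>x y. Im (H x y)) \<alpha> (SOME F. fundamental_domain U F) {1..n} e
     (\<lambda>i. sgn (\<mu> i) *\<^sub>R (\<i> *\<^sub>C e i)) dx dy (\<lambda>i. pi * \<bar>\<mu> i\<bar>)" using T.frame_exists by blast
  interpret F: framed_bundle g H n p U \<alpha> e \<mu> B dx dy
    by (intro framed_bundle.intro T.torus_bundle_axioms F)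
  obtain d kv where K: "koszul F.sections F.lower F.raise (\<lambda>i. pi * \<bar>\<mu> i\<bar>) {1..n} F.product {i\<in>{1..n}. \<mu> i < 0} d kv"
    using F.koszul_exists by blast
  interpret D: dolbeault g H n p U \<alpha> e \<mu> B dx dy d kv
    by (intro dolbeault.intro F.framed_bundle_axioms K)
  show ?thesis using D.spectrum_eq D.eigenspace_dimension by blast
qed

end
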